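(* Fix $M>0$ and $Q\in\mathbb{R}$ with $0<|Q|<\frac{3M}{2\sqrt{2}}$. There exists $\Lambda_0>0$ such that for all $\Lambda\in(0,\Lambda_0)$ (for which the standing assumption on $\mu$ stated in the context holds) there exists a constant $c_0(\Lambda)>0$ such that the following holds. Suppose $m>0$, $q\in\mathbb{R}$ and $a\in\mathbb{R}$ satisfy $m^2\le c_0(\Lambda)q^2$ and $a^2\le c_0(\Lambda)q^2$. Then for $|q|>0$ sufficiently small there exists $\sigma\in\mathbb{C}$ with $\operatorname{Im}\sigma\ge c_1q^2>0$ such that, with $s=qQ$, $$\operatorname{Ker}\hat P(\sigma,s,m,a)\cap\operatorname{Ker}(\partial_{\phi_*})\neq\{0\}.$$ Here the smallness threshold for $|q|$ and the constant $c_1>0$ do not depend on $q$, $m$ or $a$.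
   Context: Non-rotating background. Let $M>0$, $Q\in\mathbb{R}$, $\Lambda>0$ and $$\mu(r)=1-\frac{2M}{r}+\frac{Q^2}{r^2}-\frac{\Lambda r^2}{3}.$$ Standing assumption: $|Q|<\frac{3M}{2\sqrt2}$ and $\Lambda$ is small enough that $\mu$ has four real roots $r_n<0<r_c<r_-<r_+$, $\mu>0$ on $(r_-,r_+)$, and $\mu/r^2$ has a single non-degenerate maximum on $(r_-,r_+)$. Let $\mathfrak r\in(r_-,r_+)$ be the unique non-degenerate maximum of $\mu$ in $(r_-,r_+)$, let $c>0$ with $c^2=\mu(\mathfrak r)^{-1}$, and let $\nu(r)=\mp\sqrt{1-\mu(r)c^2}$ for $\pm(r-\mathfrak r)\ge0$ (a smooth function). Here $q\in\mathbb{R}$ and $m>0$ are the charge and mass of the field and $s:=qQ$. Fix $\eta_0>0$ small so that $\mu$ has no root on $(r_--\eta_0,r_-)\cup(r_+,r_++\eta_0)$. Rotating background (De Sitter-Kerr-Newman). For $a\in\mathbb{R}$ with $|a|$ small, let $$\mu_a(r)=(r^2+a^2)\Big(1-\frac{\Lambda r^2}{3}\Big)-2Mr+\Big(1+\frac{\Lambda a^2}{3}\Big)^2Q^2,$$ $$\lambda=\frac{\Lambda a^2}{3},\qquad \kappa=1+\lambda\cos^2\theta,\qquad \rho^2=r^2+a^2\cos^2\theta,\qquad V_a=\frac{r}{\rho^2}.$$ Let $r_{-,a}<r_{+,a}$ be the two largest positive roots of $\mu_a$ (close to $r_\pm$ for $|a|$ small). On $\mathbb{R}_t\times(r_{-,a},r_{+,a})_r\times\mathbb{S}^2_{\theta,\phi}$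 the metric and electromagnetic potential are $$g_a=\frac{\mu_a}{(1+\lambda)^2\rho^2}(\mathrm{d}t-a\sin^2\theta\,\mathrm{d}\phi)^2-\frac{\kappa\sin^2\theta}{(1+\lambda)^2\rho^2}\big(a\,\mathrm{d}t-(r^2+a^2)\mathrm{d}\phi\big)^2-\rho^2\Big(\frac{\mathrm{d}r^2}{\mu_a}+\frac{\mathrm{d}\theta^2}{\kappa}\Big),$$ $$A_a=\frac{Qr}{\rho^2}(\mathrm{d}t-a\sin^2\theta\,\mathrm{d}\phi).$$ Coordinates regular across the horizons. One uses $t_*=t-T(r)$, $\phi_*=\phi-\Phi(r)$ with $T,\Phi$ smooth on $(r_{-,a},r_{+,a})$ (depending on $a$), where, near $r_{\pm,a}$, $$T'=\pm\Big(\frac{(1+\lambda)(r^2+a^2)}{\mu_a}+c_{\pm,a}\Big),\qquad \Phi'=\frac{a}{r^2+a^2}T'.$$ Here a family of functions $c_{\pm,a}(r)$ is fixed such that: $c_{+,a}$ is smooth on $(r_-+\eta_0,r_++\eta_0)$ and $c_{-,a}$ is smooth on $(r_--\eta_0,r_+-\eta_0)$; the two expressions for $T'$ agree on the overlap; $c_{\pm,a}=c_{\pm,0}+O(a^2)$ with all $r$-derivatives (in particular $\mu_ac_{\pm,a}=r^2\mu c_{\pm,0}+O(a^2)$); and $c_{\pm,0}=\frac{\mp\nu-1}{\mu}$ (so that $T'=-\nu/\mu$ when $a=0$). The coefficients of the inverse metric in the coordinates $(t_*,r,\theta,\phi_* )$ that are used are then, where the sign $\pm$ and $c_{\pm,a}$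 are those of the respective $r$-interval, $$\rho^2g_a^{t_*t_*}=-\mu_ac_{\pm,a}^2-2(1+\lambda)(r^2+a^2)c_{\pm,a}-\frac{(1+\lambda)^2a^2\sin^2\theta}{\kappa},$$ $$\rho^2g_a^{t_*r}=\pm\big(\mu_ac_{\pm,a}+(1+\lambda)(r^2+a^2)\big),\qquad g_a^{r\phi_*}=\frac{a}{r^2+a^2}g_a^{t_*r},$$ $$\rho^2g_a^{t_*\phi_*}=-\frac{a}{r^2+a^2}\big(\mu_ac_{\pm,a}^2+2(1+\lambda)(r^2+a^2)c_{\pm,a}\big)-\frac{(1+\lambda)^2a}{\kappa},$$ $$\rho^2g_a^{\phi_*\phi_*}=-\frac{a^2}{(r^2+a^2)^2}\big(\mu_ac_{\pm,a}^2+2(1+\lambda)(r^2+a^2)c_{\pm,a}\big)-\frac{(1+\lambda)^2}{\kappa\sin^2\theta};$$ they are defined on $Y=(r_--\eta_0,r_++\eta_0)_r\times\mathbb{S}^2_{\theta,\phi_*}$ and satisfy $g_a^{t_*t_*}=c^2+O(a^2)$, $g_a^{t_*r}=-\nu+O(a^2)$, $g_a^{t_*\phi_*},g_a^{r\phi_*}=O(|a|)$. The $\mathrm{d}r$-component of $A_a$ in these coordinates depends only on $r$ and is removed by a gauge transformation $e^{-iR_a(r)}$, $R_a'=A_a^r$. The operator. For $\sigma\in\mathbb{C}$, the Fourier transformed, gauge-transformed charged Klein-Gordon operator, conjugated by $\rho$, is (functions denote multiplication operators, products are compositions) $$\begin{aligned}\hat P(\sigma,s,m,a)=&-g_a^{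t_*t_*}(\sigma+sV_a)^2-\frac{i}{\rho}\Big((\sigma+sV_a)\rho^2g_a^{t_*r}\partial_r+\partial_r\,\rho^2g_a^{t_*r}(\sigma+sV_a)\Big)\frac1\rho\\&-2ig_a^{t_*\phi_*}(\sigma+sV_a)(\partial_{\phi_*}+iasV_a\sin^2\theta)-\frac1\rho\partial_r\,\mu_a\,\partial_r\frac1\rho\\&+\frac1\rho\Big(\partial_r\,\rho^2g_a^{r\phi_*}(\partial_{\phi_*}+iasV_a\sin^2\theta)+(\partial_{\phi_*}+iasV_a\sin^2\theta)\rho^2g_a^{r\phi_*}\partial_r\Big)\frac1\rho\\&-\frac{1}{\rho\sin\theta}\partial_\theta\,\kappa\sin\theta\,\partial_\theta\frac1\rho+g_a^{\phi_*\phi_*}(\partial_{\phi_*}+iasV_a\sin^2\theta)^2+m^2.\end{aligned}$$ Function spaces. $\bar H^\gamma(Y)$ is the Sobolev space of order $\gamma$ of extendible distributions on $Y$ (restrictions to $Y$ of $H^\gamma$ distributions on a larger manifold). Fix $\gamma>5/2$. The operator acts as $\hat P(\sigma,s,m,a):\mathcal{X}_a^\gamma\to\bar H^{\gamma-1}(Y)$ with $\mathcal{X}_a^\gamma=\{u\in\bar H^\gamma(Y):\hat P(\sigma,s,m,a)u\in\bar H^{\gamma-1}(Y)\}$, and its kernel is taken in this space, i.e. it consists of the $u\in\bar H^\gamma(Y)$ with $\hat P(\sigma,s,m,a)u=0$. *)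

theory Defs
  imports "HOL-Analysis.Analysis" "HOL-Library.Function_Algebras"
begin

section \<open>Smooth functions, Sobolev spaces and distributions on Y\<close>

text \<open>Meant for open sets only: on an open set, \<open>f\<close> is of class \<open>C\<^sup>k\<^sup>+\<^sup>1\<close> iff it is
  differentiable with partial derivatives of class \<open>C\<^sup>k\<close>.\<close>

primrec C_k_on :: "nat \<Rightarrow> 'a::euclidean_space set \<Rightarrow> ('a \<Rightarrow> 'b::real_normed_vector) \<Rightarrow> bool" where
  "C_k_on 0 S f \<longleftrightarrow> continuous_on S f"
| "C_k_on (Suc k) S f \<longleftrightarrow> (\<forall>x\<in>S. f differentiable (at x)) \<and>
     (\<forall>v\<in>Basis. C_k_on k S (\<lambda>x. frechet_derivative f (at x) v))"

definition smooth_on :: "'a::euclidean_space set \<Rightarrow> ('a \<Rightarrow> 'b::real_normed_vector) \<Rightarrow> bool" where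
  "smooth_on S f \<longleftrightarrow> (\<forall>k. C_k_on k S f)"

text \<open>The manifold \<open>Y\<close>, the product of an interval \<open>(lo, hi)\<close>, \<open>0 < lo\<close>, with the two-sphere, is
  identified with a spherical shell in \<open>\<real>\<^sup>3\<close> by \<open>(r, \<omega>) \<mapsto> r \<omega>\<close>. This is a diffeomorphism from
  \<open>(0, \<infinity>) \<times> S\<^sup>2\<close> onto \<open>\<real>\<^sup>3\<close> without the origin, so smoothness up to and across the poles of the
  sphere, and Sobolev regularity up to the boundary of \<open>Y\<close>, are the Cartesian ones.\<close>

definition shell :: "real \<Rightarrow> real \<Rightarrow> (real^3) set" where
  "shell lo hi = {x. lo < norm x \<and> norm x < hi}"

definition spherical :: "real \<Rightarrow> real \<Rightarrow> real \<Rightarrow> real^3" where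
  "spherical r \<theta> \<phi> = vector [r * sin \<theta> * cos \<phi>, r * sin \<theta> * sin \<phi>, r * cos \<theta>]"

text \<open>\<open>H\<^sup>\<gamma>(\<real>\<^sup>3)\<close> in the range \<open>\<gamma> > 3/2\<close>. There \<open>\<langle>\<xi>\<rangle>\<^sup>\<gamma> f \<in> L\<^sup>2\<close> implies \<open>f \<in> L\<^sup>1\<close>, so every element of
  \<open>H\<^sup>\<gamma>\<close> is a continuous function, given by the absolutely convergent Fourier integral below
  (normalisation constants are absorbed in \<open>f\<close>). For \<open>\<gamma> \<le> 3/2\<close> this is not the Sobolev space.\<close>

definition sobolev :: "real \<Rightarrow> (real^3 \<Rightarrow> complex) set" where
  "sobolev \<gamma> = {u. \<exists>f. f \<in> borel_measurable lborel \<and>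
     integrable lborel (\<lambda>\<xi>::real^3. (1 + (norm \<xi>)\<^sup>2) powr \<gamma> * (cmod (f \<xi>))\<^sup>2) \<and>
     u = (\<lambda>x. LINT \<xi>|lborel. f \<xi> * cis (x \<bullet> \<xi>))}"

text \<open>Extendible Sobolev functions: restrictions to the shell of elements of \<open>H\<^sup>\<gamma>(\<real>\<^sup>3)\<close>. Functions on
  the shell are represented by functions on \<open>\<real>\<^sup>3\<close> that vanish outside of it.\<close>

definition ext_sobolev :: "real \<Rightarrow> real \<Rightarrow> real \<Rightarrow> (real^3 \<Rightarrow> complex) set" where
  "ext_sobolev \<gamma> lo hi = {(\<lambda>x. if x \<in> shell lo hi then v x else 0) | v. v \<in> sobolev \<gamma>}"

definition test_functions :: "real \<Rightarrow> real \<Rightarrow> (real^3 \<Rightarrow> complex) set" where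
  "test_functions lo hi = {h. smooth_on UNIV h \<and>
     (\<exists>K. compact K \<and> K \<subseteq> shell lo hi \<and> (\<forall>x. x \<notin> K \<longrightarrow> h x = 0))}"

text \<open>Distributions act on densities \<open>\<psi> dr d\<theta> d\<phi>\<close>, given by their coordinate expression \<open>\<psi>\<close> in
  \<open>(r, \<theta>, \<phi>)\<close>. The densities used for testing are \<open>h sin \<theta> dr d\<theta> d\<phi>\<close> with \<open>h\<close> a test function.
  As functionals, distributions are defined on all \<open>\<psi>\<close>; this is needed because the single terms of
  the operator are singular at the poles. Operators on distributions are defined by duality (the
  pairing is bilinear, without complex conjugation), and \<open>op_comp\<close> is composition.\<close>

type_synonym coord_fun = "real \<Rightarrow> real \<Rightarrow> real \<Rightarrow> complex"
type_synonym distr = "coord_fun \<Rightarrow> complex"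

definition distr_of :: "real \<Rightarrow> real \<Rightarrow> (real^3 \<Rightarrow> complex) \<Rightarrow> distr" where
  "distr_of lo hi u = (\<lambda>\<psi>. LINT (r, \<theta>, \<phi>) : {lo<..<hi} \<times> {0<..<pi} \<times> {0<..<2*pi} | lborel.
     u (spherical r \<theta> \<phi>) * \<psi> r \<theta> \<phi>)"

definition test_density :: "(real^3 \<Rightarrow> complex) \<Rightarrow> coord_fun" where
  "test_density h = (\<lambda>r \<theta> \<phi>. h (spherical r \<theta> \<phi>) * sin \<theta>)"

definition mult :: "(real \<Rightarrow> real \<Rightarrow> complex) \<Rightarrow> distr \<Rightarrow> distr" where
  "mult f T = (\<lambda>\<psi>. T (\<lambda>r \<theta> \<phi>. f r \<theta> * \<psi> r \<theta> \<phi>))"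

definition D_r :: "distr \<Rightarrow> distr" where
  "D_r T = (\<lambda>\<psi>. - T (\<lambda>r \<theta> \<phi>. vector_derivative (\<lambda>x. \<psi> x \<theta> \<phi>) (at r)))"

definition D_theta :: "distr \<Rightarrow> distr" where
  "D_theta T = (\<lambda>\<psi>. - T (\<lambda>r \<theta> \<phi>. vector_derivative (\<lambda>x. \<psi> r x \<phi>) (at \<theta>)))"

definition D_phi :: "distr \<Rightarrow> distr" where
  "D_phi T = (\<lambda>\<psi>. - T (\<lambda>r \<theta> \<phi>. vector_derivative (\<lambda>x. \<psi> r \<theta> x) (at \<phi>)))"

abbreviation op_comp :: "(distr \<Rightarrow> distr) \<Rightarrow> (distr \<Rightarrow> distr) \<Rightarrow> distr \<Rightarrow> distr"  (infixr "\<odot>" 75)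
  where "A \<odot> B \<equiv> A \<circ> B"

definition Ker :: "real \<Rightarrow> real \<Rightarrow> real \<Rightarrow> (distr \<Rightarrow> distr) \<Rightarrow> (real^3 \<Rightarrow> complex) set" where
  "Ker \<gamma> lo hi L = {u \<in> ext_sobolev \<gamma> lo hi.
     \<forall>h\<in>test_functions lo hi. L (distr_of lo hi u) (test_density h) = 0}"

section \<open>The non-rotating background\<close>

definition mu :: "real \<Rightarrow> real \<Rightarrow> real \<Rightarrow> real \<Rightarrow> real" where
  "mu M Q \<Lambda> r = 1 - 2 * M / r + Q\<^sup>2 / r\<^sup>2 - \<Lambda> * r\<^sup>2 / 3"

definition single_nondeg_max :: "(real \<Rightarrow> real) \<Rightarrow> real set \<Rightarrow> real \<Rightarrow> bool" where
  "single_nondeg_max f I x0 \<longleftrightarrow>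
     {x \<in> I. \<forall>\<^sub>F y in at x. f y \<le> f x} = {x0} \<and> deriv (deriv f) x0 < 0"

definition standing_assumption ::
  "real \<Rightarrow> real \<Rightarrow> real \<Rightarrow> real \<Rightarrow> real \<Rightarrow> real \<Rightarrow> real \<Rightarrow> bool" where
  "standing_assumption M Q \<Lambda> rn rc rm rp \<longleftrightarrow>
     rn < 0 \<and> 0 < rc \<and> rc < rm \<and> rm < rp \<and>
     {r. r \<noteq> 0 \<and> mu M Q \<Lambda> r = 0} = {rn, rc, rm, rp} \<and>
     (\<forall>r\<in>{rm<..<rp}. mu M Q \<Lambda> r > 0) \<and>
     (\<exists>x0. single_nondeg_max (\<lambda>r. mu M Q \<Lambda> r / r\<^sup>2) {rm<..<rp} x0)"

text \<open>The point \<open>\<rr>\<close>; note that it is the maximum of \<open>\<mu>\<close>, not of \<open>\<mu>/r\<^sup>2\<close>.\<close>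

definition r_max :: "real \<Rightarrow> real \<Rightarrow> real \<Rightarrow> real \<Rightarrow> real \<Rightarrow> real" where
  "r_max M Q \<Lambda> rm rp = (THE x0. single_nondeg_max (mu M Q \<Lambda>) {rm<..<rp} x0)"

definition nu :: "real \<Rightarrow> real \<Rightarrow> real \<Rightarrow> real \<Rightarrow> real \<Rightarrow> real \<Rightarrow> real" where
  "nu M Q \<Lambda> rm rp r =
     (let r0 = r_max M Q \<Lambda> rm rp; c = 1 / sqrt (mu M Q \<Lambda> r0) in
      if r \<ge> r0 then - sqrt (1 - mu M Q \<Lambda> r * c\<^sup>2) else sqrt (1 - mu M Q \<Lambda> r * c\<^sup>2))"

text \<open>Smallness of \<open>\<eta>\<^sub>0\<close>: the outer end points are included in the root-free sets, which keeps the
  closure of \<open>Y\<close> away from \<open>r\<^sub>c\<close>, and \<open>2 \<eta>\<^sub>0 < r\<^sub>+ - r\<^sub>-\<close> makes the intervals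
  \<open>(r\<^sub>- + \<eta>\<^sub>0, r\<^sub>+ + \<eta>\<^sub>0)\<close> and \<open>(r\<^sub>- - \<eta>\<^sub>0, r\<^sub>+ - \<eta>\<^sub>0)\<close> overlap and cover \<open>(r\<^sub>- - \<eta>\<^sub>0, r\<^sub>+ + \<eta>\<^sub>0)\<close>.\<close>

definition eta_admissible :: "real \<Rightarrow> real \<Rightarrow> real \<Rightarrow> real \<Rightarrow> real \<Rightarrow> real \<Rightarrow> bool" where
  "eta_admissible M Q \<Lambda> rm rp \<eta> \<longleftrightarrow> 0 < \<eta> \<and> 2 * \<eta> < rp - rm \<and>
     (\<forall>r\<in>{rm - \<eta>..<rm} \<union> {rp<..rp + \<eta>}. mu M Q \<Lambda> r \<noteq> 0)"

section \<open>The rotating background\<close>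

definition mu_a :: "real \<Rightarrow> real \<Rightarrow> real \<Rightarrow> real \<Rightarrow> real \<Rightarrow> real" where
  "mu_a M Q \<Lambda> a r = (r\<^sup>2 + a\<^sup>2) * (1 - \<Lambda> * r\<^sup>2 / 3) - 2 * M * r + (1 + \<Lambda> * a\<^sup>2 / 3)\<^sup>2 * Q\<^sup>2"

definition lam :: "real \<Rightarrow> real \<Rightarrow> real" where
  "lam \<Lambda> a = \<Lambda> * a\<^sup>2 / 3"

definition kappa :: "real \<Rightarrow> real \<Rightarrow> real \<Rightarrow> real" where
  "kappa \<Lambda> a \<theta> = 1 + lam \<Lambda> a * (cos \<theta>)\<^sup>2"

definition rho :: "real \<Rightarrow> real \<Rightarrow> real \<Rightarrow> real" where
  "rho a r \<theta> = sqrt (r\<^sup>2 + a\<^sup>2 * (cos \<theta>)\<^sup>2)"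

definition V_pot :: "real \<Rightarrow> real \<Rightarrow> real \<Rightarrow> real" where
  "V_pot a r \<theta> = r / (rho a r \<theta>)\<^sup>2"

text \<open>\<open>c\<^sub>+\<close> and \<open>c\<^sub>-\<close> take \<open>a\<close> and then \<open>r\<close>; the family is given for \<open>|a| < a\<^sub>0\<close>. The formula for
  \<open>c\<^sub>\<plusminus>\<close> at \<open>a = 0\<close> has a removable singularity at the root \<open>r\<^sub>\<plusminus>\<close> of \<open>\<mu>\<close>, where the value is determined
  by continuity. The last but one conjunct says that the two expressions for \<open>T'\<close> agree.\<close>

definition admissible_family ::
  "real \<Rightarrow> real \<Rightarrow> real \<Rightarrow> real \<Rightarrow> real \<Rightarrow> real \<Rightarrow> real \<Rightarrow>
   (real \<Rightarrow> real \<Rightarrow> real) \<Rightarrow> (real \<Rightarrow> real \<Rightarrow> real) \<Rightarrow> bool" where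
  "admissible_family M Q \<Lambda> rm rp \<eta> a0 cp cm \<longleftrightarrow>
     (let Iplus = {rm + \<eta><..<rp + \<eta>}; Iminus = {rm - \<eta><..<rp - \<eta>} in
      0 < a0 \<and>
      (\<forall>a\<in>{-a0<..<a0}. smooth_on Iplus (cp a) \<and> smooth_on Iminus (cm a)) \<and>
      (\<forall>r\<in>Iplus. mu M Q \<Lambda> r \<noteq> 0 \<longrightarrow> cp 0 r = (- nu M Q \<Lambda> rm rp r - 1) / mu M Q \<Lambda> r) \<and>
      (\<forall>r\<in>Iminus. mu M Q \<Lambda> r \<noteq> 0 \<longrightarrow> cm 0 r = (nu M Q \<Lambda> rm rp r - 1) / mu M Q \<Lambda> r) \<and>
      (\<forall>a\<in>{-a0<..<a0}. \<forall>r\<in>Iplus \<inter> Iminus.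
         (1 + lam \<Lambda> a) * (r\<^sup>2 + a\<^sup>2) / mu_a M Q \<Lambda> a r + cp a r
         = - ((1 + lam \<Lambda> a) * (r\<^sup>2 + a\<^sup>2) / mu_a M Q \<Lambda> a r + cm a r)) \<and>
      (\<forall>k. \<exists>C. \<forall>a\<in>{-a0<..<a0}.
         (\<forall>r\<in>Iplus. \<bar>(deriv ^^ k) (cp a) r - (deriv ^^ k) (cp 0) r\<bar> \<le> C * a\<^sup>2) \<and>
         (\<forall>r\<in>Iminus. \<bar>(deriv ^^ k) (cm a) r - (deriv ^^ k) (cm 0) r\<bar> \<le> C * a\<^sup>2)))"

context
  fixes M Q \<Lambda> rm \<eta> :: real
    and cp cm :: "real \<Rightarrow> real \<Rightarrow> real"
    and a :: real
begin

text \<open>The sign and the function \<open>c\<^sub>\<plusminus>\<close> belonging to \<open>r\<close>: the plus version on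
  \<open>(r\<^sub>- + \<eta>\<^sub>0, r\<^sub>+ + \<eta>\<^sub>0)\<close>, and the minus version on the rest of \<open>(r\<^sub>- - \<eta>\<^sub>0, r\<^sub>+ + \<eta>\<^sub>0)\<close>. On the overlap
  of the two intervals both choices yield the same metric coefficients.\<close>

definition sgn_sel :: "real \<Rightarrow> real" where
  "sgn_sel r = (if rm + \<eta> < r then 1 else - 1)"

definition c_sel :: "real \<Rightarrow> real" where
  "c_sel r = (if rm + \<eta> < r then cp a r else cm a r)"

definition q_sel :: "real \<Rightarrow> real" where
  "q_sel r = mu_a M Q \<Lambda> a r * (c_sel r)\<^sup>2 + 2 * (1 + lam \<Lambda> a) * (r\<^sup>2 + a\<^sup>2) * c_sel r"

text \<open>Inverse metric coefficients. A prefix \<open>R\<close> stands for multiplication by \<open>\<rho>\<^sup>2\<close>.\<close>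

definition Rg_tr :: "real \<Rightarrow> real" where
  "Rg_tr r = sgn_sel r * (mu_a M Q \<Lambda> a r * c_sel r + (1 + lam \<Lambda> a) * (r\<^sup>2 + a\<^sup>2))"

definition Rg_rphi :: "real \<Rightarrow> real" where
  "Rg_rphi r = a / (r\<^sup>2 + a\<^sup>2) * Rg_tr r"

definition g_tt :: "real \<Rightarrow> real \<Rightarrow> real" where
  "g_tt r \<theta> = (- q_sel r - (1 + lam \<Lambda> a)\<^sup>2 * a\<^sup>2 * (sin \<theta>)\<^sup>2 / kappa \<Lambda> a \<theta>) / (rho a r \<theta>)\<^sup>2"

definition g_tphi :: "real \<Rightarrow> real \<Rightarrow> real" where
  "g_tphi r \<theta> = (- (a / (r\<^sup>2 + a\<^sup>2)) * q_sel r - (1 + lam \<Lambda> a)\<^sup>2 * a / kappa \<Lambda> a \<theta>) / (rho a r \<theta>)\<^sup>2"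

definition g_phiphi :: "real \<Rightarrow> real \<Rightarrow> real" where
  "g_phiphi r \<theta> = (- (a\<^sup>2 / (r\<^sup>2 + a\<^sup>2)\<^sup>2) * q_sel r
     - (1 + lam \<Lambda> a)\<^sup>2 / (kappa \<Lambda> a \<theta> * (sin \<theta>)\<^sup>2)) / (rho a r \<theta>)\<^sup>2"

definition hatP :: "complex \<Rightarrow> real \<Rightarrow> real \<Rightarrow> distr \<Rightarrow> distr" where
  "hatP \<sigma> s m =
    (let X = mult (\<lambda>r \<theta>. \<sigma> + of_real (s * V_pot a r \<theta>));
         rinv = mult (\<lambda>r \<theta>. of_real (1 / rho a r \<theta>));
         b_tr = mult (\<lambda>r \<theta>. of_real (Rg_tr r));
         b_rphi = mult (\<lambda>r \<theta>. of_real (Rg_rphi r));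
         Dphi = D_phi + mult (\<lambda>r \<theta>. \<i> * of_real (a * s * V_pot a r \<theta> * (sin \<theta>)\<^sup>2))
     in
       - (mult (\<lambda>r \<theta>. of_real (g_tt r \<theta>)) \<odot> X \<odot> X)
       - (mult (\<lambda>r \<theta>. \<i> / of_real (rho a r \<theta>)) \<odot>
            ((X \<odot> b_tr \<odot> D_r) + (D_r \<odot> b_tr \<odot> X)) \<odot> rinv)
       - (mult (\<lambda>r \<theta>. 2 * \<i> * of_real (g_tphi r \<theta>)) \<odot> X \<odot> Dphi)
       - (rinv \<odot> D_r \<odot> mult (\<lambda>r \<theta>. of_real (mu_a M Q \<Lambda> a r)) \<odot> D_r \<odot> rinv)
       + (rinv \<odot> ((D_r \<odot> b_rphi \<odot> Dphi) + (Dphi \<odot> b_rphi \<odot> D_r)) \<odot> rinv)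
       - (mult (\<lambda>r \<theta>. of_real (1 / (rho a r \<theta> * sin \<theta>))) \<odot> D_theta \<odot>
            mult (\<lambda>r \<theta>. of_real (kappa \<Lambda> a \<theta> * sin \<theta>)) \<odot> D_theta \<odot> rinv)
       + (mult (\<lambda>r \<theta>. of_real (g_phiphi r \<theta>)) \<odot> Dphi \<odot> Dphi)
       + mult (\<lambda>r \<theta>. of_real (m\<^sup>2)))"

end

end

theory Submission
  imports Defs "HOL-Complex_Analysis.Complex_Analysis" "HOL-Probability.Probability"
begin

text \<open>The mode is found by separation of variables, \<open>u = \<rho> exp (i G(r)) R(r) S(cos \<theta>)\<close>. Let
  \<open>K = \<sigma> (r\<^sup>2 + a\<^sup>2) + s r\<close> and let \<open>e1\<close>, \<open>e2\<close> be the horizons. The gauge function \<open>G\<close> is chosen such that the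
  first order coefficient of the radial equation becomes the linear function \<open>N\<close> that equals
  \<open>\<plusminus>(1 + \<lambda>) K\<close> at \<open>e2\<close>, \<open>e1\<close>. The functions \<open>c\<^sub>\<plusminus>\<close> then disappear from the radial equation, which has
  regular singular points at the horizons, and outgoing solutions are those holomorphic there.

  For small \<open>s\<close> write \<open>\<sigma> = - s (e1 + e2) / (e1\<^sup>2 + e2\<^sup>2 + 2 a\<^sup>2) + s\<^sup>2 \<tau>\<close> and perturb \<open>R = S = 1\<close>. The
  solvability conditions of the two equations determine \<open>\<tau>\<close> and the separation constant, and \<open>\<tau>\<close>, the
  separation constant, \<open>R\<close> and \<open>S\<close> together are the fixed point of a contraction on holomorphic functions.
  To leading order \<open>Im \<tau>\<close> is a negative multiple of the integral over \<open>[e1, e2]\<close> of \<open>(N\<^sup>2 - (1 + \<lambda>)\<^sup>2 K\<^sup>2) / \<mu> + m\<^sup>2 r\<^sup>2\<close> at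
  \<open>\<tau> = 0\<close>, scaled by \<open>s\<^sup>-\<^sup>2\<close>. By Chebyshev's inequality the first term is negative when the ratio
  \<open>e2 / e1\<close> is large, i.e. for small \<open>\<Lambda>\<close>, and \<open>m\<^sup>2 \<le> c0 q\<^sup>2\<close>, \<open>a\<^sup>2 \<le> c0 q\<^sup>2\<close> keep the rest smaller.\<close>

section \<open>Calculus of k times differentiable functions\<close>

text \<open>Integrating the radial equation from horizon to horizon with \<open>R = 1\<close> leaves
  \<open>(1 + \<lambda>) (\<sigma> (e1^2 + e2^2 + 2 a^2) + s (e1 + e2))\<close>, up to a factor
  \<open>- i\<close>, against terms of order \<open>s^2\<close>. Its part of order \<open>s\<close>
  must therefore vanish, which gives the real first order value of \<open>\<sigma>\<close>; growth
  is decided only at order \<open>s^2\<close>, where \<open>m^2\<close> competes.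

  The obstacle is regularity: the coefficients of the operator are merely smooth, and the horizons
  move with \<open>a\<close>. The gauge change makes the radial equation rational, so it can be
  solved in holomorphic functions on one fixed complex neighbourhood of both horizons. There,
  regularity at the horizons means that a primitive is divisible by both linear factors of
  \<open>\<mu>\<close>; this division costs no derivatives, and all bounds are uniform in
  \<open>q\<close>, \<open>m\<close>, \<open>a\<close>. The functions \<open>cp\<close>,
  \<open>cm\<close> return only through the gauge factor, which must be continued across the ends of
  \<open>Y\<close> because \<open>ext_sobolev\<close> asks for restrictions of functions on the
  whole space.\<close>

lemma C_k_on_cong:
  assumes "open S" "\<And>x. x \<in> S \<Longrightarrow> f x = g x" "C_k_on k S f"
  shows "C_k_on k S g"
  using assms(2,3)
proof (induction k arbitrary: f g)
  case 0
  then show ?case by (auto intro: continuous_on_eq)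
next
  case (Suc k)
  have d: "(g has_derivative frechet_derivative f (at x)) (at x)" if "x \<in> S" for x
    using has_derivative_transform_within_open[OF _ assms(1) that] Suc.prems that
    by (force simp: frechet_derivative_works)
  then have e: "frechet_derivative g (at x) = frechet_derivative f (at x)" if "x \<in> S" for x
    using that frechet_derivative_at by metis
  show ?case
    using d e Suc by (auto simp: differentiable_def)
qed

text \<open>Admits any known derivative in place of the choice \<open>frechet_derivative\<close>, so
  that the rules below can be proved by ordinary differentiation.\<close>

lemma C_k_on_SucI:
  assumes "open S" "\<And>x. x \<in> S \<Longrightarrow> (f has_derivative f' x) (at x)"
    and "\<And>v. v \<in> Basis \<Longrightarrow> C_k_on k S (\<lambda>x. f' x v)"
  shows "C_k_on (Suc k) S f"
proof -
  have "C_k_on k S (\<lambda>x. frechet_derivative f (at x) v)" if "v \<in> Basis" for v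
    by (rule C_k_on_cong[OF assms(1) _ assms(3)[OF that]]) (metis assms(2) frechet_derivative_at)
  then show ?thesis using assms(2) by (auto simp: differentiable_def)
qed

lemma C_k_on_has_derivative:
  assumes "C_k_on (Suc k) S f" "x \<in> S"
  shows "(f has_derivative frechet_derivative f (at x)) (at x)"
  using assms by (auto simp: frechet_derivative_works)

lemma C_k_on_continuous_on: "C_k_on k S f \<Longrightarrow> continuous_on S f"
  by (cases k) (auto intro!: continuous_at_imp_continuous_on differentiable_imp_continuous_within)

lemma C_k_on_lower: "C_k_on (Suc k) S f \<Longrightarrow> C_k_on k S f"
proof (induction k arbitrary: f)
  case 0
  then show ?case using C_k_on_continuous_on by fastforce
next
  case (Suc k)
  then show ?case by (subst C_k_on.simps) auto
qed

lemma C_k_on_mono: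
  assumes "C_k_on k S f" "j \<le> k" shows "C_k_on j S f"
  using assms(2,1) by (induction rule: inc_induct) (auto simp del: C_k_on.simps dest: C_k_on_lower)

lemma C_k_on_subset: "C_k_on k S f \<Longrightarrow> T \<subseteq> S \<Longrightarrow> C_k_on k T f"
  by (induction k arbitrary: f) (auto intro: continuous_on_subset)

text \<open>Used to glue functions that are given by different formulas on overlapping open
  sets.\<close>

lemma C_k_on_open_cover:
  assumes "open S" "\<And>x. x \<in> S \<Longrightarrow> \<exists>T. open T \<and> x \<in> T \<and> C_k_on k T f"
  shows "C_k_on k S f"
  using assms(2)
proof (induction k arbitrary: f)
  case 0
  have "isCont f x" if "x \<in> S" for x
    using 0[OF that] by (auto simp: continuous_on_eq_continuous_at)
  then show ?case by (simp add: continuous_at_imp_continuous_on)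
next
  case (Suc k)
  show ?case
    using Suc.prems by (auto intro!: Suc.IH) blast+
qed

lemma C_k_on_const [simp]: "C_k_on k S (\<lambda>x. c)"
  by (induction k arbitrary: c) (auto simp: frechet_derivative_const)

lemma C_k_on_bounded_linear_comp:
  assumes "bounded_linear L" "open S" "C_k_on k S f"
  shows "C_k_on k S (\<lambda>x. L (f x))"
  using assms(3)
proof (induction k arbitrary: f)
  case 0
  then show ?case using assms(1) by (auto intro: bounded_linear.continuous_on)
next
  case (Suc k)
  show ?case
    by (rule C_k_on_SucI[OF assms(2), where f'="\<lambda>x v. L (frechet_derivative f (at x) v)"])
       (use Suc in \<open>auto intro!: bounded_linear.has_derivative[OF assms(1)] C_k_on_has_derivative\<close>)
qed

lemma C_k_on_linear:
  assumes "bounded_linear L" "open S" shows "C_k_on k S L"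
proof (cases k)
  case (Suc j)
  have "C_k_on (Suc j) S L"
    by (rule C_k_on_SucI[OF assms(2) bounded_linear_imp_has_derivative[OF assms(1)]]) auto
  then show ?thesis using Suc by simp
qed (use assms in \<open>simp add: linear_continuous_on\<close>)

lemmas C_k_on_id = C_k_on_linear[OF bounded_linear_ident]

lemma C_k_on_add:
  assumes "open S" "C_k_on k S f" "C_k_on k S g"
  shows "C_k_on k S (\<lambda>x. f x + g x)"
  using assms(2,3)
proof (induction k arbitrary: f g)
  case (Suc k)
  show ?case
    by (rule C_k_on_SucI[OF assms(1), where f'="\<lambda>x v. frechet_derivative f (at x) v + frechet_derivative g (at x) v"])
       (use Suc in \<open>auto intro!: derivative_intros C_k_on_has_derivative\<close>)
qed (auto intro: continuous_intros)

lemma C_k_on_bilinear: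
  assumes "bounded_bilinear pr" "open S" "C_k_on k S f" "C_k_on k S g"
  shows "C_k_on k S (\<lambda>x. pr (f x) (g x))"
  using assms(3,4)
proof (induction k arbitrary: f g)
  case 0
  then show ?case using assms(1) by (auto intro: bounded_bilinear.continuous_on)
next
  case (Suc k)
  have fg: "C_k_on k S f" "C_k_on k S g" using Suc.prems by (blast intro: C_k_on_lower)+
  show ?case
    by (rule C_k_on_SucI[OF assms(2), where
        f'="\<lambda>x v. pr (f x) (frechet_derivative g (at x) v) + pr (frechet_derivative f (at x) v) (g x)"])
       (use Suc fg in \<open>auto intro!: C_k_on_add assms bounded_bilinear.FDERIV[OF assms(1)] C_k_on_has_derivative\<close>)
qed

lemmas C_k_on_mult = C_k_on_bilinear[OF bounded_bilinear_mult]
lemmas C_k_on_scaleR = C_k_on_bilinear[OF bounded_bilinear_scaleR]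
lemmas C_k_on_minus = C_k_on_bounded_linear_comp[OF bounded_linear_minus[OF bounded_linear_ident]]
lemmas C_k_on_of_real = C_k_on_bounded_linear_comp[OF bounded_linear_of_real]
lemmas C_k_on_inner_left = C_k_on_bounded_linear_comp[OF bounded_linear_inner_left]

lemma C_k_on_diff:
  assumes "open S" "C_k_on k S f" "C_k_on k S g"
  shows "C_k_on k S (\<lambda>x. f x - g x)"
  using C_k_on_add[OF assms(1,2) C_k_on_minus[OF assms(1,3)]] by simp

lemma C_k_on_sum:
  assumes "open S" "\<And>i. i \<in> I \<Longrightarrow> C_k_on k S (f i)"
  shows "C_k_on k S (\<lambda>x. \<Sum>i\<in>I. f i x)"
  using assms(2) by (induction I rule: infinite_finite_induct) (auto intro: C_k_on_add assms(1))

lemma C_k_on_power: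
  fixes f :: "'a::euclidean_space \<Rightarrow> 'b::real_normed_field"
  assumes "open S" "C_k_on k S f"
  shows "C_k_on k S (\<lambda>x. f x ^ n)"
  by (induction n) (auto intro!: C_k_on_mult assms)

text \<open>Induction on the order works because the derivative is a product of \<open>f'\<close>
  with two copies of the inverse itself, which the induction hypothesis covers at order
  \<open>k\<close>. The square root and the exponential below follow the same pattern.\<close>

lemma C_k_on_inverse:
  fixes f :: "'a::euclidean_space \<Rightarrow> 'b::real_normed_field"
  assumes "open S" "C_k_on k S f" "\<And>x. x \<in> S \<Longrightarrow> f x \<noteq> 0"
  shows "C_k_on k S (\<lambda>x. inverse (f x))"
  using assms(2)
proof (induction k)
  case (Suc k)
  have "C_k_on k S f" using Suc.prems by (rule C_k_on_lower)
  then have i: "C_k_on k S (\<lambda>x. inverse (f x))" by (rule Suc.IH)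
  have d: "((\<lambda>x. inverse (f x)) has_derivative (\<lambda>v. - (inverse (f x) * frechet_derivative f (at x) v * inverse (f x)))) (at x)"
    if "x \<in> S" for x
    by (rule Deriv.has_derivative_inverse[OF assms(3)[OF that] C_k_on_has_derivative[OF Suc.prems that]])
  have f': "C_k_on k S (\<lambda>x. frechet_derivative f (at x) v)" if "v \<in> Basis" for v
    using Suc.prems that by simp
  show ?case
    by (intro C_k_on_SucI[OF assms(1) d] C_k_on_minus C_k_on_mult i f' assms)
qed (use assms in \<open>auto intro!: continuous_intros\<close>)

lemma C_k_on_divide:
  fixes f :: "'a::euclidean_space \<Rightarrow> 'b::real_normed_field"
  assumes "open S" "C_k_on k S f" "C_k_on k S g" "\<And>x. x \<in> S \<Longrightarrow> g x \<noteq> 0"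
  shows "C_k_on k S (\<lambda>x. f x / g x)"
  unfolding divide_inverse by (intro C_k_on_mult C_k_on_inverse assms)

lemma C_k_on_sqrt:
  assumes "open S" "C_k_on k S f" "\<And>x. x \<in> S \<Longrightarrow> f x > 0"
  shows "C_k_on k S (\<lambda>x. sqrt (f x))"
  using assms(2)
proof (induction k)
  case (Suc k)
  have d: "((\<lambda>x. sqrt (f x)) has_derivative (\<lambda>v. frechet_derivative f (at x) v * (inverse (sqrt (f x)) / 2))) (at x)"
    if "x \<in> S" for x
    using has_derivative_compose[OF C_k_on_has_derivative[OF Suc.prems that]
      DERIV_real_sqrt[OF assms(3)[OF that], unfolded has_field_derivative_def]] by (simp add: mult.commute)
  have "C_k_on k S (\<lambda>x. sqrt (f x))" by (rule Suc.IH[OF C_k_on_lower[OF Suc.prems]])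
  then have "C_k_on k S (\<lambda>x. inverse (sqrt (f x)) / 2)"
    by (intro C_k_on_divide C_k_on_inverse assms(1) C_k_on_const) (use assms(3) in force)+
  then show ?case
    using Suc.prems by (intro C_k_on_SucI[OF assms(1) d] C_k_on_mult[OF assms(1)]) simp_all
qed (use assms in \<open>auto intro!: continuous_intros\<close>)

lemma C_k_on_exp:
  fixes f :: "'a::euclidean_space \<Rightarrow> complex"
  assumes "open S" "C_k_on k S f"
  shows "C_k_on k S (\<lambda>x. exp (f x))"
  using assms(2)
proof (induction k)
  case (Suc k)
  have d: "((\<lambda>x. exp (f x)) has_derivative (\<lambda>v. frechet_derivative f (at x) v * exp (f x))) (at x)"
    if "x \<in> S" for x
    using has_derivative_compose[OF C_k_on_has_derivative[OF Suc.prems that], where g=exp]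
      DERIV_exp[of "f x"] by (simp add: has_field_derivative_def mult.commute)
  have fk: "C_k_on k S f" using Suc.prems by (rule C_k_on_lower)
  show ?case
    by (intro C_k_on_SucI[OF assms(1) d]) (use Suc assms fk in \<open>auto intro!: C_k_on_mult\<close>)
qed (use assms in \<open>auto intro!: continuous_intros\<close>)

lemma C_k_on_compose:
  fixes f :: "'a::euclidean_space \<Rightarrow> 'b::euclidean_space" and g :: "'b \<Rightarrow> 'c::real_normed_vector"
  assumes "open S" "open T" "C_k_on k S f" "C_k_on k T g" "f ` S \<subseteq> T"
  shows "C_k_on k S (\<lambda>x. g (f x))"
  using assms(3,4)
proof (induction k arbitrary: g)
  case 0
  then show ?case using assms(5) by (auto intro: continuous_on_compose2)
next
  case (Suc k)
  have fk: "C_k_on k S f" using Suc.prems(1) by (rule C_k_on_lower)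
  \<comment> \<open>The chain rule expanded in basis vectors: only derivatives of \<open>g\<close>
    along fixed vectors occur. These are of class \<open>k\<close>, so the induction hypothesis
    applies to each of them in place of \<open>g\<close>.\<close>
  have d: "((\<lambda>x. g (f x)) has_derivative (\<lambda>v. \<Sum>b\<in>Basis. (frechet_derivative f (at x) v \<bullet> b) *\<^sub>R frechet_derivative g (at (f x)) b)) (at x)"
    if "x \<in> S" for x
  proof -
    have g: "(g has_derivative frechet_derivative g (at (f x))) (at (f x))"
      using C_k_on_has_derivative Suc.prems(2) assms(5) that by blast
    have eq: "frechet_derivative g (at (f x)) w = (\<Sum>b\<in>Basis. (w \<bullet> b) *\<^sub>R frechet_derivative g (at (f x)) b)" for w
    proof -
      interpret bounded_linear "frechet_derivative g (at (f x))" using g has_derivative_bounded_linear by blast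
      show ?thesis by (subst (1) euclidean_representation[of w, symmetric]) (simp add: sum scale)
    qed
    have "(\<lambda>v. \<Sum>b\<in>Basis. (frechet_derivative f (at x) v \<bullet> b) *\<^sub>R frechet_derivative g (at (f x)) b)
      = (\<lambda>v. frechet_derivative g (at (f x)) (frechet_derivative f (at x) v))"
      using eq by (intro ext) (rule sym)
    then show ?thesis
      using has_derivative_compose[OF C_k_on_has_derivative[OF Suc.prems(1) that] g] by (simp only:)
  qed
  show ?case
    by (rule C_k_on_SucI[OF assms(1) d])
       (use Suc.prems in \<open>auto intro!: C_k_on_sum C_k_on_scaleR C_k_on_inner_left Suc.IH[OF fk, of "\<lambda>y. frechet_derivative g (at y) _"] assms\<close>)
qed

lemma C_k_on_real_SucI:
  fixes f :: "real \<Rightarrow> 'b::real_normed_vector"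
  assumes "open S" "\<And>x. x \<in> S \<Longrightarrow> (f has_vector_derivative f' x) (at x)" "C_k_on k S f'"
  shows "C_k_on (Suc k) S f"
  by (rule C_k_on_SucI[OF assms(1) assms(2)[unfolded has_vector_derivative_def]]) (use assms in auto)

lemma C_k_on_real_Suc:
  fixes f :: "real \<Rightarrow> 'b::real_normed_vector"
  assumes "open S"
  shows "C_k_on (Suc k) S f \<longleftrightarrow>
    (\<forall>x\<in>S. (f has_vector_derivative vector_derivative f (at x)) (at x)) \<and> C_k_on k S (\<lambda>x. vector_derivative f (at x))"
    (is "?l \<longleftrightarrow> ?r")
proof
  assume ?r then show ?l by (intro C_k_on_real_SucI[OF assms]) auto
next
  assume l: ?l
  have v: "\<forall>x\<in>S. (f has_vector_derivative vector_derivative f (at x)) (at x)"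
    using l by (simp add: vector_derivative_works[symmetric])
  moreover have "C_k_on k S (\<lambda>x. vector_derivative f (at x))"
    by (rule C_k_on_cong[OF assms, of "\<lambda>x. frechet_derivative f (at x) 1"])
      (use l v frechet_derivative_at[symmetric] in \<open>force simp: has_vector_derivative_def\<close>)+
  ultimately show ?r by simp
qed

lemma C_k_on_of_real_holomorphic:
  assumes "open \<Omega>" "f holomorphic_on \<Omega>" "open S" "complex_of_real ` S \<subseteq> \<Omega>"
  shows "C_k_on k S (\<lambda>x. f (complex_of_real x))"
  using assms(2)
proof (induction k arbitrary: f)
  case 0
  then show ?case
    using assms by (auto intro!: continuous_on_compose2[OF holomorphic_on_imp_continuous_on[OF 0]] continuous_intros)
next
  case (Suc k)
  have "((\<lambda>x. f (complex_of_real x)) has_vector_derivative deriv f (complex_of_real x)) (at x)" if "x \<in> S" for x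
  proof -
    have "(f has_field_derivative deriv f (complex_of_real x)) (at (complex_of_real x))"
      using Suc.prems assms that by (intro holomorphic_derivI) auto
    then show ?thesis by (rule has_vector_derivative_real_field)
  qed
  then show ?case
    by (rule C_k_on_real_SucI[OF assms(3)]) (use Suc assms in \<open>auto intro!: holomorphic_deriv\<close>)
qed

text \<open>Proved together, since each is the derivative of the other up to sign.\<close>

lemma C_k_on_sin: "C_k_on k S (sin :: real \<Rightarrow> real)" and C_k_on_cos: "C_k_on k S (cos :: real \<Rightarrow> real)"
proof -
  have "C_k_on k UNIV (sin :: real \<Rightarrow> real) \<and> C_k_on k UNIV (cos :: real \<Rightarrow> real)"
  proof (induction k)
    case (Suc k)
    have "C_k_on (Suc k) UNIV (sin :: real \<Rightarrow> real)"
      by (rule C_k_on_real_SucI[where f'=cos]) (use Suc in \<open>auto simp flip: has_real_derivative_iff_has_vector_derivative\<close>)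
    moreover have "C_k_on (Suc k) UNIV (cos :: real \<Rightarrow> real)"
      by (rule C_k_on_real_SucI[where f'="\<lambda>x. - sin x"]) (use Suc in \<open>auto intro!: C_k_on_minus simp flip: has_real_derivative_iff_has_vector_derivative\<close>)
    ultimately show ?case by blast
  qed (auto intro: continuous_intros)
  then show "C_k_on k S (sin :: real \<Rightarrow> real)" "C_k_on k S (cos :: real \<Rightarrow> real)" by (auto intro: C_k_on_subset)
qed

section \<open>Compactly supported functions are in Sobolev spaces\<close>

text \<open>Fubini, through the identification of \<open>lborel\<close> with the product measure
  over \<open>Basis\<close>.\<close>

lemma lborel_integral_prod_Basis:
  fixes g :: "'a::euclidean_space \<Rightarrow> real \<Rightarrow> complex"
  assumes "\<And>b. b \<in> Basis \<Longrightarrow> integrable lborel (g b)"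
  shows "integrable lborel (\<lambda>x::'a. \<Prod>b\<in>Basis. g b (x \<bullet> b))"
    and "(LINT x|lborel. (\<Prod>b\<in>Basis. g b (x \<bullet> b))) = (\<Prod>b\<in>Basis. LINT t|lborel. g b t)"
proof -
  interpret product_sigma_finite "\<lambda>_::'a. lborel :: real measure" by standard
  have m: "(\<lambda>f. \<Sum>b\<in>Basis. f b *\<^sub>R b) \<in> measurable (\<Pi>\<^sub>M b\<in>Basis. lborel) (borel :: 'a measure)"
    by measurable
  have [measurable]: "\<And>b. b \<in> Basis \<Longrightarrow> g b \<in> borel_measurable borel"
    using assms borel_measurable_integrable by fastforce
  have m2: "(\<lambda>x::'a. \<Prod>b\<in>Basis. g b (x \<bullet> b)) \<in> borel_measurable borel"
    by measurable
  have e: "(\<Prod>b\<in>Basis. g b ((\<Sum>b\<in>Basis. f b *\<^sub>R b) \<bullet> b)) = (\<Prod>b\<in>Basis. g b (f b))" for f :: "'a \<Rightarrow> real"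
    by (intro prod.cong) auto
  show "integrable lborel (\<lambda>x::'a. \<Prod>b\<in>Basis. g b (x \<bullet> b))"
    by (subst lborel_eq, subst integrable_distr_eq[OF m m2], unfold e)
       (intro product_integrable_prod assms, auto)
  show "(LINT x|lborel. (\<Prod>b\<in>Basis. g b (x \<bullet> b))) = (\<Prod>b\<in>Basis. LINT t|lborel. g b t)"
    by (subst lborel_eq, subst integral_distr[OF m m2], unfold e)
       (intro product_integral_prod assms, auto)
qed

lemma cis_measurable [measurable]: "cis \<in> borel_measurable borel"
  by (intro borel_measurable_continuous_onI continuous_intros)

text \<open>This is the characteristic function of the standard normal distribution, rescaled by the
  factor \<open>sqrt (2 * pi)\<close> of its density.\<close>

lemma gaussian_fourier_real:
  "integrable lborel (\<lambda>t. complex_of_real (exp (- t\<^sup>2 / 2)) * cis (t * u))"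
  "(LINT t|lborel. complex_of_real (exp (- t\<^sup>2 / 2)) * cis (t * u)) = sqrt (2 * pi) * exp (- u\<^sup>2 / 2)"
proof -
  have i: "integrable lborel (\<lambda>t. exp (- t\<^sup>2 / 2) :: real)"
    using integrable_mult_right[OF integrable_normal_density[of 1 0], of "sqrt (2 * pi)"]
    by (simp add: std_normal_density_def field_simps)
  then show "integrable lborel (\<lambda>t. complex_of_real (exp (- t\<^sup>2 / 2)) * cis (t * u))"
    by (rule Bochner_Integration.integrable_bound) (auto simp: norm_mult)
  have "complex_of_real (exp (- (u\<^sup>2) / 2)) = (LINT t|std_normal_distribution. cis (u * t))"
    using fun_cong[OF char_std_normal_distribution, of u] by (simp add: char_def cis_conv_exp mult.commute)
  also have "\<dots> = (LINT t|lborel. std_normal_density t *\<^sub>R cis (u * t))"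
    by (subst integral_density) (auto simp: cis_conv_exp)
  also have "\<dots> = (LINT t|lborel. (1 / sqrt (2 * pi)) *\<^sub>R (complex_of_real (exp (- t\<^sup>2 / 2)) * cis (t * u)))"
    by (intro Bochner_Integration.integral_cong) (auto simp: std_normal_density_def scaleR_conv_of_real mult.commute)
  also have "\<dots> = (1 / sqrt (2 * pi)) *\<^sub>R (LINT t|lborel. complex_of_real (exp (- t\<^sup>2 / 2)) * cis (t * u))"
    by simp
  finally show "(LINT t|lborel. complex_of_real (exp (- t\<^sup>2 / 2)) * cis (t * u)) = sqrt (2 * pi) * exp (- u\<^sup>2 / 2)"
    by (simp add: scaleR_conv_of_real field_simps)
qed

lemma norm_square_Basis: "(norm x)\<^sup>2 = (\<Sum>b\<in>Basis. (x \<bullet> b)\<^sup>2)" for x :: "'a::euclidean_space"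
  unfolding power2_norm_eq_inner euclidean_inner[of x x] by (simp add: power2_eq_square)

lemma cis_sum: "finite I \<Longrightarrow> cis (\<Sum>i\<in>I. f i) = (\<Prod>i\<in>I. cis (f i))"
  by (induction I rule: finite_induct) (auto simp: cis_mult[symmetric])

lemma gaussian_fourier:
  fixes y :: "'a::euclidean_space"
  shows "integrable lborel (\<lambda>x::'a. complex_of_real (exp (- (norm x)\<^sup>2 / 2)) * cis (x \<bullet> y))"
    and "(LINT x|lborel. complex_of_real (exp (- (norm x)\<^sup>2 / 2)) * cis (x \<bullet> y)) =
      sqrt (2 * pi) ^ DIM('a) * exp (- (norm y)\<^sup>2 / 2)"
proof -
  have e: "complex_of_real (exp (- (norm x)\<^sup>2 / 2)) * cis (x \<bullet> y) =
     (\<Prod>b\<in>Basis. complex_of_real (exp (- (x \<bullet> b)\<^sup>2 / 2)) * cis ((x \<bullet> b) * (y \<bullet> b)))" for x :: 'a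
    unfolding prod.distrib euclidean_inner[of x y]
    by (simp add: cis_sum norm_square_Basis sum_negf[symmetric] sum_divide_distrib exp_sum)
  show "integrable lborel (\<lambda>x::'a. complex_of_real (exp (- (norm x)\<^sup>2 / 2)) * cis (x \<bullet> y))"
    unfolding e by (intro lborel_integral_prod_Basis gaussian_fourier_real)
  show "(LINT x|lborel. complex_of_real (exp (- (norm x)\<^sup>2 / 2)) * cis (x \<bullet> y)) =
      sqrt (2 * pi) ^ DIM('a) * exp (- (norm y)\<^sup>2 / 2)"
    unfolding e
    by (subst lborel_integral_prod_Basis, rule gaussian_fourier_real, unfold gaussian_fourier_real(2))
       (simp add: prod.distrib norm_square_Basis[of y] sum_negf[symmetric] sum_divide_distrib exp_sum)
qed

lemma lborel_integral_affine:
  fixes f :: "'a::euclidean_space \<Rightarrow> complex"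
  assumes [measurable]: "f \<in> borel_measurable borel" and "c \<noteq> 0"
  shows "(LINT x|lborel. f x) = complex_of_real (\<bar>c\<bar> ^ DIM('a)) * (LINT x|lborel. f (t + c *\<^sub>R x))"
proof -
  have "(LINT x|lborel. f x) = (LINT x|density (distr lborel borel (\<lambda>x. t + c *\<^sub>R x)) (\<lambda>_. \<bar>c\<bar>^DIM('a)). f x)"
    using lborel_affine[OF assms(2), of t] by simp
  also have "\<dots> = (LINT x|distr lborel borel (\<lambda>x. t + c *\<^sub>R x). (\<bar>c\<bar>^DIM('a)) *\<^sub>R f x)"
    by (subst integral_density) auto
  also have "\<dots> = complex_of_real (\<bar>c\<bar> ^ DIM('a)) * (LINT x|lborel. f (t + c *\<^sub>R x))"
    by (subst integral_distr) (auto simp: scaleR_conv_of_real)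
  finally show ?thesis .
qed

section \<open>Fourier inversion and decay of the Fourier transform\<close>

definition fourier :: "('a::euclidean_space \<Rightarrow> complex) \<Rightarrow> 'a \<Rightarrow> complex" where
  "fourier v \<xi> = (LINT x|lborel. v x * cis (- (x \<bullet> \<xi>)))"

lemma fourier_measurable [measurable]:
  assumes [measurable]: "v \<in> borel_measurable borel"
  shows "fourier v \<in> borel_measurable borel"
  unfolding fourier_def by measurable

text \<open>A Gaussian factor of width \<open>1 / e n\<close> is inserted into the inversion
  integral. Exchanging the integrals turns the damped integral into an average of \<open>v\<close>
  over Gaussian displacements of size \<open>e n\<close> around \<open>x\<close>; the limit
  \<open>e n \<longlonglongrightarrow> 0\<close> on both sides gives the claim.\<close>

lemma fourier_inversion:
  fixes v :: "'a::euclidean_space \<Rightarrow> complex"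
  assumes cont: "continuous_on UNIV v" and bd: "\<And>x. norm (v x) \<le> C"
    and iv: "integrable lborel v" and iF: "integrable lborel (fourier v)"
  shows "(LINT \<xi>|lborel. fourier v \<xi> * cis (x \<bullet> \<xi>)) = (2 * pi) ^ DIM('a) * v x"
proof -
  have mv [measurable]: "v \<in> borel_measurable borel"
    using cont by (rule borel_measurable_continuous_onI)
  define e where "e n = 1 / real (Suc n)" for n
  have e0: "e n > 0" for n by (simp add: e_def)
  have elim: "e \<longlonglongrightarrow> 0" unfolding e_def by (rule LIMSEQ_Suc[OF lim_1_over_n])
  define g where "g z = complex_of_real (exp (- (norm z)\<^sup>2 / 2))" for z :: 'a
  have mg [measurable]: "g \<in> borel_measurable borel" unfolding g_def by measurable
  have ig: "integrable lborel g" using gaussian_fourier(1)[of "0::'a"] by (simp add: g_def[abs_def])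
  have "complex_integrable lborel (\<lambda>\<xi>. complex_of_real (norm (g \<xi>)))" using integrable_norm[OF ig] by simp
  define I where "I n = (LINT \<xi>|lborel. fourier v \<xi> * cis (x \<bullet> \<xi>) * g (e n *\<^sub>R \<xi>))" for n
  have ig': "integrable lborel (\<lambda>\<xi>. g (e n *\<^sub>R \<xi>))" for n
  proof -
    have "integrable (density (distr lborel borel (\<lambda>x. 0 + e n *\<^sub>R x)) (\<lambda>_. ennreal (\<bar>e n\<bar>^DIM('a)))) g"
      using ig lborel_affine[of "e n" "0::'a"] e0[of n] by simp
    then have "integrable (distr lborel borel (\<lambda>x. 0 + e n *\<^sub>R x)) (\<lambda>x. (\<bar>e n\<bar>^DIM('a)) *\<^sub>R g x)"
      by (subst (asm) integrable_density) auto
    then have "integrable lborel (\<lambda>x. (\<bar>e n\<bar>^DIM('a)) *\<^sub>R g (e n *\<^sub>R x))"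
      by (subst (asm) integrable_distr_eq) auto
    then have "integrable lborel (\<lambda>x. (1 / \<bar>e n\<bar>^DIM('a)) *\<^sub>R ((\<bar>e n\<bar>^DIM('a)) *\<^sub>R g (e n *\<^sub>R x)))"
      by (rule integrable_scaleR_right)
    then show ?thesis using e0[of n] by simp
  qed
  \<comment> \<open>Undoes the damping; \<open>norm (fourier v \<xi>)\<close> dominates.\<close>
  have I1: "I \<longlonglongrightarrow> (LINT \<xi>|lborel. fourier v \<xi> * cis (x \<bullet> \<xi>))"
    unfolding I_def
  proof (rule integral_dominated_convergence[where w="\<lambda>\<xi>. norm (fourier v \<xi>)"])
    show "AE \<xi> in lborel. (\<lambda>n. fourier v \<xi> * cis (x \<bullet> \<xi>) * g (e n *\<^sub>R \<xi>)) \<longlonglongrightarrow> fourier v \<xi> * cis (x \<bullet> \<xi>)"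
    proof (rule AE_I2)
      fix \<xi> :: 'a
      have "(\<lambda>n. g (e n *\<^sub>R \<xi>)) \<longlonglongrightarrow> g (0 *\<^sub>R \<xi>)"
        unfolding g_def by (intro tendsto_intros elim) auto
      then show "(\<lambda>n. fourier v \<xi> * cis (x \<bullet> \<xi>) * g (e n *\<^sub>R \<xi>)) \<longlonglongrightarrow> fourier v \<xi> * cis (x \<bullet> \<xi>)"
        using tendsto_mult[OF tendsto_const[of "fourier v \<xi> * cis (x \<bullet> \<xi>)"]] by (fastforce simp: g_def)
    qed
    show "AE \<xi> in lborel. norm (fourier v \<xi> * cis (x \<bullet> \<xi>) * g (e n *\<^sub>R \<xi>)) \<le> norm (fourier v \<xi>)" for n
      by (auto simp: norm_mult g_def intro!: mult_left_le)
  qed (use iF in \<open>auto intro: integrable_norm\<close>)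
  \<comment> \<open>Fubini, then the substitutions \<open>y = x - e n * z\<close> and
    \<open>\<xi>\<close> scaled by \<open>e n\<close>. Their Jacobians cancel, and the inner
    integral becomes the transform of the Gaussian.\<close>
  have I2: "I n = sqrt (2 * pi) ^ DIM('a) * (LINT z|lborel. v (x + (- e n) *\<^sub>R z) * g z)" for n
  proof -
    have int2: "integrable (lborel \<Otimes>\<^sub>M lborel) (\<lambda>(\<xi>, y). v y * cis (- (y \<bullet> \<xi>)) * cis (x \<bullet> \<xi>) * g (e n *\<^sub>R \<xi>))"
    proof (rule lborel_pair.Fubini_integrable)
      have "(\<lambda>\<xi>. LINT y|lborel. norm (case (\<xi>, y) of (\<xi>, y) \<Rightarrow> v y * cis (- (y \<bullet> \<xi>)) * cis (x \<bullet> \<xi>) * g (e n *\<^sub>R \<xi>)))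
        = (\<lambda>\<xi>. (LINT y|lborel. norm (v y)) * norm (g (e n *\<^sub>R \<xi>)))"
        by (simp add: norm_mult)
      then show "integrable lborel (\<lambda>\<xi>. LINT y|lborel. norm (case (\<xi>, y) of (\<xi>, y) \<Rightarrow> v y * cis (- (y \<bullet> \<xi>)) * cis (x \<bullet> \<xi>) * g (e n *\<^sub>R \<xi>)))"
        using integrable_norm[OF ig'[of n]] by simp
      have "integrable lborel (\<lambda>y. v y * cis (- (y \<bullet> \<xi>)))" for \<xi>
        by (rule Bochner_Integration.integrable_bound[OF iv]) (auto simp: norm_mult)
      then show "AE \<xi> in lborel. integrable lborel (\<lambda>y. case (\<xi>, y) of (\<xi>, y) \<Rightarrow> v y * cis (- (y \<bullet> \<xi>)) * cis (x \<bullet> \<xi>) * g (e n *\<^sub>R \<xi>))"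
        by auto
    qed simp
    have "I n = (LINT \<xi>|lborel. LINT y|lborel. v y * cis (- (y \<bullet> \<xi>)) * cis (x \<bullet> \<xi>) * g (e n *\<^sub>R \<xi>))"
      unfolding I_def fourier_def by simp
    also have "\<dots> = (LINT y|lborel. LINT \<xi>|lborel. v y * cis (- (y \<bullet> \<xi>)) * cis (x \<bullet> \<xi>) * g (e n *\<^sub>R \<xi>))"
      using lborel_pair.Fubini_integral[of "\<lambda>\<xi> y. v y * cis (- (y \<bullet> \<xi>)) * cis (x \<bullet> \<xi>) * g (e n *\<^sub>R \<xi>)"] int2 by simp
    also have "\<dots> = (LINT y|lborel. v y * (LINT \<xi>|lborel. g (e n *\<^sub>R \<xi>) * cis ((x - y) \<bullet> \<xi>)))"
    proof (intro Bochner_Integration.integral_cong refl)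
      fix y
      have "(LINT \<xi>|lborel. v y * cis (- (y \<bullet> \<xi>)) * cis (x \<bullet> \<xi>) * g (e n *\<^sub>R \<xi>))
        = (LINT \<xi>|lborel. v y * (g (e n *\<^sub>R \<xi>) * cis ((x - y) \<bullet> \<xi>)))"
        by (intro Bochner_Integration.integral_cong refl) (simp add: inner_diff_left cis_mult mult_ac)
      then show "(LINT \<xi>|lborel. v y * cis (- (y \<bullet> \<xi>)) * cis (x \<bullet> \<xi>) * g (e n *\<^sub>R \<xi>))
        = v y * (LINT \<xi>|lborel. g (e n *\<^sub>R \<xi>) * cis ((x - y) \<bullet> \<xi>))" by simp
    qed
    also have "\<dots> = complex_of_real (\<bar>- e n\<bar> ^ DIM('a)) * (LINT z|lborel. v (x + (- e n) *\<^sub>R z) *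
        (LINT \<xi>|lborel. g (e n *\<^sub>R \<xi>) * cis ((x - (x + (- e n) *\<^sub>R z)) \<bullet> \<xi>)))"
      by (rule lborel_integral_affine[where t=x and c="- e n"]) (use e0[of n] in \<open>auto simp del: inner_diff_left\<close>)
    also have "\<dots> = (LINT z|lborel. v (x + (- e n) *\<^sub>R z) *
        (complex_of_real (\<bar>e n\<bar> ^ DIM('a)) * (LINT \<xi>|lborel. g (0 + e n *\<^sub>R \<xi>) * cis (z \<bullet> (0 + e n *\<^sub>R \<xi>)))))"
      unfolding Bochner_Integration.integral_mult_right_zero[symmetric]
      by (intro Bochner_Integration.integral_cong refl) (simp add: mult_ac)
    also have "\<dots> = (LINT z|lborel. v (x + (- e n) *\<^sub>R z) * (LINT \<xi>|lborel. g \<xi> * cis (z \<bullet> \<xi>)))"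
      by (subst lborel_integral_affine[where t=0 and c="e n", symmetric, of "\<lambda>\<xi>. g \<xi> * cis (_ \<bullet> \<xi>)"])
        (use e0[of n] in auto)
    also have "\<dots> = (LINT z|lborel. v (x + (- e n) *\<^sub>R z) * (sqrt (2 * pi) ^ DIM('a) * g z))"
      using gaussian_fourier(2)[where 'a='a] by (simp add: g_def inner_commute)
    also have "\<dots> = (LINT z|lborel. sqrt (2 * pi) ^ DIM('a) * (v (x + (- e n) *\<^sub>R z) * g z))"
      by (simp add: mult_ac)
    finally show ?thesis by simp
  qed
  \<comment> \<open>The averages converge by continuity of \<open>v\<close>; boundedness of
    \<open>v\<close> provides the domination.\<close>
  have "(\<lambda>n. LINT z|lborel. v (x + (- e n) *\<^sub>R z) * g z) \<longlonglongrightarrow> (LINT z|lborel. v x * g z)"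
  proof (rule integral_dominated_convergence[where w="\<lambda>z. C * norm (g z)"])
    show "AE z in lborel. (\<lambda>n. v (x + (- e n) *\<^sub>R z) * g z) \<longlonglongrightarrow> v x * g z"
    proof (rule AE_I2)
      fix z
      have "(\<lambda>n. x + (- e n) *\<^sub>R z) \<longlonglongrightarrow> x + (- 0) *\<^sub>R z" by (intro tendsto_intros elim)
      then have "(\<lambda>n. v (x + (- e n) *\<^sub>R z)) \<longlonglongrightarrow> v x"
        using continuous_on_tendsto_compose[OF cont, of _ x] by simp
      then show "(\<lambda>n. v (x + (- e n) *\<^sub>R z) * g z) \<longlonglongrightarrow> v x * g z" by (intro tendsto_intros)
    qed
  qed (use ig bd in \<open>auto simp: norm_mult intro!: mult_right_mono\<close>)
  also have "(LINT z|lborel. v x * g z) = v x * sqrt (2 * pi) ^ DIM('a)"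
    using gaussian_fourier(2)[of "0::'a"] by (simp add: g_def)
  finally have "I \<longlonglongrightarrow> sqrt (2 * pi) ^ DIM('a) * (v x * sqrt (2 * pi) ^ DIM('a))"
    unfolding I2 by (intro tendsto_intros)
  then have "(LINT \<xi>|lborel. fourier v \<xi> * cis (x \<bullet> \<xi>)) = sqrt (2 * pi) ^ DIM('a) * (v x * sqrt (2 * pi) ^ DIM('a))"
    using LIMSEQ_unique[OF I1] by blast
  also have "\<dots> = (complex_of_real (sqrt (2 * pi)) * complex_of_real (sqrt (2 * pi))) ^ DIM('a) * v x"
    by (simp only: power_mult_distrib mult_ac of_real_power)
  also have "\<dots> = (2 * pi) ^ DIM('a) * v x"
    by (simp only: of_real_mult[symmetric] real_sqrt_mult_self) (simp add: abs_of_pos)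
  finally show ?thesis .
qed


lemma compact_support_integrable:
  fixes h :: "'a::euclidean_space \<Rightarrow> complex"
  assumes "continuous_on UNIV h" "compact K" "\<And>x. x \<notin> K \<Longrightarrow> h x = 0"
  shows "integrable lborel h" "\<exists>C\<ge>0. \<forall>x. norm (h x) \<le> C"
proof -
  have "integrable lborel (\<lambda>x. indicator K x *\<^sub>R h x)"
    by (intro borel_integrable_compact assms continuous_on_subset[OF assms(1)]) auto
  moreover have "(\<lambda>x. indicator K x *\<^sub>R h x) = h" using assms(3) by (auto simp: indicator_def)
  ultimately show "integrable lborel h" by simp
  have "bounded (h ` K)"
    by (intro compact_imp_bounded compact_continuous_image continuous_on_subset[OF assms(1)] assms) auto
  then obtain C where "\<And>x. x \<in> K \<Longrightarrow> norm (h x) \<le> C" by (auto simp: bounded_iff)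
  then have "norm (h x) \<le> max C 0" for x using assms(3)[of x] by (cases "x \<in> K") force+
  then show "\<exists>C\<ge>0. \<forall>x. norm (h x) \<le> C" by (intro exI[of _ "max C 0"]) auto
qed

lemma frechet_derivative_zero_outside:
  assumes "compact K" "\<And>x. x \<notin> K \<Longrightarrow> h x = 0" "x \<notin> K"
  shows "frechet_derivative h (at x) v = 0"
proof -
  have "(h has_derivative (\<lambda>_. 0)) (at x)"
    by (rule has_derivative_transform_within_open[of "\<lambda>_. 0" _ x UNIV "- K"])
       (use assms compact_imp_closed in auto)
  then show ?thesis by (simp add: frechet_derivative_at[symmetric])
qed

text \<open>The integral of a difference quotient vanishes by translation invariance.\<close>

lemma integral_frechet_derivative_eq_0:
  fixes h :: "'a::euclidean_space \<Rightarrow> complex"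
  assumes C1: "C_k_on (Suc 0) UNIV h" and K: "compact K" "\<And>x. x \<notin> K \<Longrightarrow> h x = 0" and b: "b \<in> Basis"
  shows "(LINT x|lborel. frechet_derivative h (at x) b) = 0"
proof -
  define h' where "h' x = frechet_derivative h (at x) b" for x
  have d: "(h has_derivative frechet_derivative h (at x)) (at x)" for x
    using C_k_on_has_derivative[OF C1] by simp
  have ch: "continuous_on UNIV h" "continuous_on UNIV h'"
    using C_k_on_continuous_on[OF C1] C1 b by (auto simp: h'_def)
  have h'0: "h' x = 0" if "x \<notin> K" for x
    unfolding h'_def by (rule frechet_derivative_zero_outside[OF K that])
  obtain C where C: "C \<ge> 0" "\<And>x. norm (h' x) \<le> C"
    using compact_support_integrable(2)[OF ch(2) K(1) h'0] by blast
  obtain B where B: "\<And>x. x \<in> K \<Longrightarrow> norm x \<le> B" using compact_imp_bounded[OF K(1)] bounded_iff by metis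
  have line: "((\<lambda>t. h (x + t *\<^sub>R b)) has_vector_derivative h' (x + t *\<^sub>R b)) (at t within X)" for x t X
    unfolding h'_def has_vector_derivative_def
    by (rule has_derivative_eq_rhs[OF has_derivative_compose[OF _ d]])
       (auto intro!: derivative_eq_intros simp: linear_cmul[OF has_derivative_linear[OF d]])
  have elim: "(\<lambda>n. 1 / real (Suc n)) \<longlonglongrightarrow> 0" by (rule LIMSEQ_Suc[OF lim_1_over_n])
  define g where "g n x = real (Suc n) *\<^sub>R (h (x + (1 / real (Suc n)) *\<^sub>R b) - h x)" for n x
  have mh: "h \<in> borel_measurable borel" using ch(1) by (rule borel_measurable_continuous_onI)
  have ih: "integrable lborel h" by (rule compact_support_integrable(1)[OF ch(1) K])
  have ih2: "integrable lborel (\<lambda>x. h (x + c))" for c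
  proof (rule compact_support_integrable(1)[where K="(\<lambda>x. x - c) ` K"])
    show "continuous_on UNIV (\<lambda>x. h (x + c))" by (intro continuous_on_compose2[OF ch(1)] continuous_intros) auto
    show "compact ((\<lambda>x. x - c) ` K)" using K(1) by (intro compact_continuous_image continuous_intros)
    show "h (x + c) = 0" if "x \<notin> (\<lambda>x. x - c) ` K" for x using K(2) that by force
  qed
  have g0: "(LINT x|lborel. g n x) = 0" for n
  proof -
    have "(LINT x|lborel. h (x + c)) = (LINT x|lborel. h x)" for c
      using lborel_integral_affine[OF mh, of 1 c] by (simp add: add.commute)
    then show ?thesis unfolding g_def using ih ih2 by simp
  qed
  have "(\<lambda>n. LINT x|lborel. g n x) \<longlonglongrightarrow> (LINT x|lborel. h' x)"
  proof (rule integral_dominated_convergence[where w="\<lambda>x. C * indicator (cball 0 (B + 1)) x"])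
    show "AE x in lborel. (\<lambda>n. g n x) \<longlonglongrightarrow> h' x"
    proof (rule AE_I2)
      fix x
      have "(\<lambda>t. norm (h (x + t *\<^sub>R b) - h x - t *\<^sub>R h' x) / norm t) \<midarrow>0\<rightarrow> 0"
        using line[of x 0 UNIV] by (simp add: has_vector_derivative_def has_derivative_at)
      moreover have "\<forall>\<^sub>F t in at 0. norm (h (x + t *\<^sub>R b) - h x - t *\<^sub>R h' x) / norm t
          = norm ((h (x + t *\<^sub>R b) - h x) /\<^sub>R t - h' x)"
      proof (rule eventually_mono[OF eventually_neq_at_within[of 0]])
        fix t :: real assume t: "t \<noteq> 0"
        then have "(h (x + t *\<^sub>R b) - h x) /\<^sub>R t - h' x = (h (x + t *\<^sub>R b) - h x - t *\<^sub>R h' x) /\<^sub>R t"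
          by (simp add: scaleR_right_diff_distrib)
        then show "norm (h (x + t *\<^sub>R b) - h x - t *\<^sub>R h' x) / norm t
          = norm ((h (x + t *\<^sub>R b) - h x) /\<^sub>R t - h' x)" by (simp add: divide_inverse mult.commute)
      qed
      ultimately have "(\<lambda>t. norm ((h (x + t *\<^sub>R b) - h x) /\<^sub>R t - h' x)) \<midarrow>0\<rightarrow> 0"
        by (rule Lim_transform_eventually)
      then have "((\<lambda>t. (h (x + t *\<^sub>R b) - h x) /\<^sub>R t) \<longlongrightarrow> h' x) (at 0)"
        by (rule LIM_zero_cancel[OF tendsto_norm_zero_cancel])
      moreover have "filterlim (\<lambda>n. 1 / real (Suc n)) (at 0) sequentially"
        using elim by (simp add: filterlim_at)
      ultimately show "(\<lambda>n. g n x) \<longlonglongrightarrow> h' x"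
        unfolding g_def using filterlim_compose[where g="\<lambda>t. (h (x + t *\<^sub>R b) - h x) /\<^sub>R t"] by fastforce
    qed
    \<comment> \<open>Translations have length at most 1, so all quotients are supported in the ball
      of radius \<open>B + 1\<close>, and the mean value inequality bounds them by \<open>C\<close>
      there.\<close>
    show "AE x in lborel. norm (g n x) \<le> C * indicator (cball 0 (B + 1)) x" for n
    proof (rule AE_I2)
      fix x
      show "norm (g n x) \<le> C * indicator (cball 0 (B + 1)) x"
      proof (cases "x \<in> cball 0 (B + 1)")
        case True
        have "norm (h (x + (1 / real (Suc n)) *\<^sub>R b) - h (x + 0 *\<^sub>R b)) \<le> C * norm (1 / real (Suc n) - 0)"
          by (rule differentiable_bound[where S=UNIV, OF _ line[unfolded has_vector_derivative_def]])
             (use C in \<open>auto intro!: onorm_le mult_left_mono simp: mult.commute[of C]\<close>)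
        then have "real (Suc n) * norm (h (x + (1 / real (Suc n)) *\<^sub>R b) - h x) \<le> C"
          by (simp add: pos_le_divide_eq mult.commute)
        then show ?thesis using True by (simp only: g_def norm_scaleR) simp
      next
        case False
        have "norm ((1 / real (Suc n)) *\<^sub>R b) \<le> 1" using b by simp
        then have "norm x \<le> norm (x + (1 / real (Suc n)) *\<^sub>R b) + 1"
          using norm_triangle_ineq4[of "x + (1 / real (Suc n)) *\<^sub>R b" "(1 / real (Suc n)) *\<^sub>R b"]
          unfolding add_diff_cancel_right' by linarith
        moreover have "norm x > B + 1" using False by simp
        ultimately have "x + (1 / real (Suc n)) *\<^sub>R b \<notin> K" "x \<notin> K"
          using B[of x] B[of "x + (1 / real (Suc n)) *\<^sub>R b"] by linarith+
        then show ?thesis using K(2) C by (simp add: g_def)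
      qed
    qed
    show "integrable lborel (\<lambda>x::'a. C * indicator (cball 0 (B + 1)) x :: real)"
      by (intro integrable_mult_right integrable_real_indicator) (use emeasure_bounded_finite[OF bounded_cball[of "0::'a" "B + 1"]] in simp_all)
    show "h' \<in> borel_measurable lborel" using ch(2) by (simp add: borel_measurable_continuous_onI)
    show "g n \<in> borel_measurable lborel" for n
      unfolding g_def using mh by measurable
  qed
  then show ?thesis using g0 LIMSEQ_unique[of "\<lambda>_. 0 :: complex"] by (auto simp: h'_def)
qed

lemma C_k_on_cis_inner: "C_k_on k UNIV (\<lambda>x::'a::euclidean_space. cis (- (x \<bullet> \<xi>)))"
  unfolding cis_conv_exp
  by (intro C_k_on_exp C_k_on_mult C_k_on_const C_k_on_of_real C_k_on_minus C_k_on_linear open_UNIV bounded_linear_inner_left)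

text \<open>Integration by parts: the derivative of the compactly supported product
  \<open>v x * cis (- (x \<bullet> \<xi>))\<close> has integral 0.\<close>

lemma fourier_derivative:
  fixes v :: "'a::euclidean_space \<Rightarrow> complex"
  assumes C1: "C_k_on (Suc 0) UNIV v" and K: "compact K" "\<And>x. x \<notin> K \<Longrightarrow> v x = 0" and b: "b \<in> Basis"
  shows "fourier (\<lambda>x. frechet_derivative v (at x) b) \<xi> = \<i> * (\<xi> \<bullet> b) * fourier v \<xi>"
proof -
  define h where "h x = v x * cis (- (x \<bullet> \<xi>))" for x
  have C: "C_k_on (Suc 0) UNIV h" unfolding h_def by (intro C_k_on_mult C1 C_k_on_cis_inner open_UNIV)
  have dv: "(v has_derivative frechet_derivative v (at x)) (at x)" for x
    using C_k_on_has_derivative[OF C1] by simp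
  have dc: "((\<lambda>x. cis (- (x \<bullet> \<xi>))) has_derivative (\<lambda>w. - \<i> * (w \<bullet> \<xi>) * cis (- (x \<bullet> \<xi>)))) (at x)" for x
    unfolding cis_conv_exp
    by (rule has_derivative_eq_rhs[OF has_derivative_compose[of "\<lambda>x. \<i> * complex_of_real (- (x \<bullet> \<xi>))" _ _ _ exp, OF _ DERIV_exp[unfolded has_field_derivative_def]]])
       (auto intro!: derivative_eq_intros simp: mult_ac)
  have dh: "(h has_derivative (\<lambda>w. v x * (- \<i> * (w \<bullet> \<xi>) * cis (- (x \<bullet> \<xi>))) + frechet_derivative v (at x) w * cis (- (x \<bullet> \<xi>)))) (at x)" for x
    unfolding h_def by (rule has_derivative_mult[OF dv dc])
  then have e: "frechet_derivative h (at x) b = frechet_derivative v (at x) b * cis (- (x \<bullet> \<xi>)) - \<i> * (\<xi> \<bullet> b) * h x" for x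
    by (subst frechet_derivative_at[OF dh, symmetric]) (simp add: h_def inner_commute mult_ac)
  have i1: "integrable lborel h"
    by (rule compact_support_integrable(1)[OF C_k_on_continuous_on[OF C] K(1)]) (simp add: h_def K)
  have i2: "integrable lborel (\<lambda>x. frechet_derivative v (at x) b * cis (- (x \<bullet> \<xi>)))"
    by (rule compact_support_integrable(1)[OF _ K(1)])
       (use C1 b C_k_on_continuous_on[OF C_k_on_cis_inner] frechet_derivative_zero_outside[OF K] in \<open>auto intro!: continuous_intros\<close>)
  have "0 = (LINT x|lborel. frechet_derivative h (at x) b)"
    by (rule integral_frechet_derivative_eq_0[OF C K(1) _ b, symmetric]) (simp add: h_def K)
  also have "\<dots> = fourier (\<lambda>x. frechet_derivative v (at x) b) \<xi> - \<i> * (\<xi> \<bullet> b) * fourier v \<xi>"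
    unfolding e fourier_def h_def[symmetric]
    by (subst Bochner_Integration.integral_diff) (use i1 i2 in auto)
  finally show ?thesis by simp
qed

text \<open>Each induction step applies \<open>1 - Laplacian\<close>, here called \<open>T\<close>,
  which multiplies the transform by \<open>1 + (norm \<xi>)\<^sup>2\<close> and uses up two
  derivatives.\<close>

lemma fourier_decay:
  fixes v :: "'a::euclidean_space \<Rightarrow> complex"
  assumes "C_k_on (2 * k) UNIV v" "compact K" "\<And>x. x \<notin> K \<Longrightarrow> v x = 0"
  shows "\<exists>C. \<forall>\<xi>. (1 + (norm \<xi>)\<^sup>2) ^ k * norm (fourier v \<xi>) \<le> C"
  using assms(1,3)
proof (induction k arbitrary: v)
  case 0
  have i: "integrable lborel v"
    by (rule compact_support_integrable(1)[OF _ assms(2) 0(2)]) (use 0 in auto)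
  have "norm (fourier v \<xi>) \<le> (LINT x|lborel. norm (v x * cis (- (x \<bullet> \<xi>))))" for \<xi>
    unfolding fourier_def by (rule integral_norm_bound)
  then show ?case by (auto simp: norm_mult)
next
  case (Suc k)
  define D where "D b w = (\<lambda>x. frechet_derivative w (at x) b)" for b and w :: "'a \<Rightarrow> complex"
  have C2: "C_k_on (Suc (Suc (2 * k))) UNIV v" using Suc.prems(1) by simp
  have C1: "C_k_on (Suc (2 * k)) UNIV (D b v)" "C_k_on (2 * k) UNIV (D b (D b v))" if "b \<in> Basis" for b
    using C2 that by (simp_all add: D_def)
  have D0: "D b v x = 0" "D b (D b v) x = 0" if "x \<notin> K" for b x
    unfolding D_def by (rule frechet_derivative_zero_outside[OF assms(2) _ that],
      simp add: Suc.prems(2) frechet_derivative_zero_outside[OF assms(2) Suc.prems(2)])+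
  define T where "T x = v x - (\<Sum>b\<in>Basis. D b (D b v) x)" for x
  have CT: "C_k_on (2 * k) UNIV T" unfolding T_def
    by (intro C_k_on_diff C_k_on_sum C1 open_UNIV C_k_on_mono[OF C2]) auto
  have T0: "T x = 0" if "x \<notin> K" for x using that D0 Suc.prems(2) by (simp add: T_def)
  from Suc.IH[OF CT T0] obtain C where C: "\<And>\<xi>. (1 + (norm \<xi>)\<^sup>2) ^ k * norm (fourier T \<xi>) \<le> C" by blast
  have *: "fourier T \<xi> = complex_of_real (1 + (norm \<xi>)\<^sup>2) * fourier v \<xi>" for \<xi>
  proof -
    have i: "integrable lborel (\<lambda>x. w x * cis (- (x \<bullet> \<xi>)))" if "C_k_on 0 UNIV w" "\<And>x. x \<notin> K \<Longrightarrow> w x = 0" for w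
      by (rule compact_support_integrable(1)[OF _ assms(2)])
         (use that C_k_on_continuous_on[OF C_k_on_cis_inner] in \<open>auto intro!: continuous_intros\<close>)
    have "fourier T \<xi> = fourier v \<xi> - (\<Sum>b\<in>Basis. fourier (D b (D b v)) \<xi>)"
    proof -
      have iv: "integrable lborel (\<lambda>x. v x * cis (- (x \<bullet> \<xi>)))"
        by (intro i Suc.prems C_k_on_mono[OF C2]) auto
      have id: "integrable lborel (\<lambda>x. D b (D b v) x * cis (- (x \<bullet> \<xi>)))" if "b \<in> Basis" for b
        by (intro i D0 C_k_on_mono[OF C1(2)[OF that]]) auto
      show ?thesis
        unfolding fourier_def T_def left_diff_distrib sum_distrib_right
        by (subst Bochner_Integration.integral_diff, rule iv, intro Bochner_Integration.integrable_sum id, assumption,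
          subst Bochner_Integration.integral_sum, rule id, auto)
    qed
    also have "fourier (D b (D b v)) \<xi> = - (\<xi> \<bullet> b)\<^sup>2 * fourier v \<xi>" if b: "b \<in> Basis" for b
    proof -
      have "fourier (D b (D b v)) \<xi> = \<i> * (\<xi> \<bullet> b) * fourier (D b v) \<xi>"
        unfolding D_def[of b "D b v"]
        by (rule fourier_derivative[OF C_k_on_mono[OF C1(1)[OF b]] assms(2) D0(1) b]) auto
      also have "fourier (D b v) \<xi> = \<i> * (\<xi> \<bullet> b) * fourier v \<xi>"
        unfolding D_def by (rule fourier_derivative[OF C_k_on_mono[OF C2] assms(2) Suc.prems(2) b]) auto
      finally have "fourier (D b (D b v)) \<xi> = (\<i> * \<i>) * (complex_of_real (\<xi> \<bullet> b) * complex_of_real (\<xi> \<bullet> b) * fourier v \<xi>)"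
        by (simp only: mult_ac)
      then show ?thesis by (simp add: power2_eq_square)
    qed
    then have "(\<Sum>b\<in>Basis. fourier (D b (D b v)) \<xi>) = - (norm \<xi>)\<^sup>2 * fourier v \<xi>"
      by (simp add: norm_square_Basis[of \<xi>] sum_negf sum_distrib_right)
    finally show ?thesis by (simp add: ring_distribs)
  qed
  have "norm (fourier T \<xi>) = (1 + (norm \<xi>)\<^sup>2) * norm (fourier v \<xi>)" for \<xi>
  proof -
    have "norm (complex_of_real (1 + (norm \<xi>)\<^sup>2)) = 1 + (norm \<xi>)\<^sup>2"
      by (simp only: norm_of_real) (simp add: abs_of_nonneg)
    then show ?thesis by (simp only: * norm_mult)
  qed
  then have "(1 + (norm \<xi>)\<^sup>2) ^ Suc k * norm (fourier v \<xi>) \<le> C" for \<xi>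
    using C[of \<xi>] by (simp only: power_Suc mult_ac)
  then show ?case by blast
qed


text \<open>For every \<open>b\<close> in \<open>Basis\<close> one factor is at most
  \<open>1 / (1 + (\<xi> \<bullet> b)\<^sup>2)\<close>, so one factor per dimension reduces the
  claim to the line.\<close>

lemma inverse_square_integrable:
  "integrable lborel (\<lambda>\<xi>::'a::euclidean_space. (1 / (1 + (norm \<xi>)\<^sup>2)) ^ DIM('a))"
proof -
  have "set_integrable lborel (einterval (-\<infinity>) \<infinity>) (\<lambda>x. inverse (1 + x^2) :: real)"
    using integrable_inverse_1_plus_square by simp
  then have "integrable lborel (\<lambda>t. complex_of_real (1 / (1 + t\<^sup>2)))"
    by (simp add: set_integrable_def einterval_def divide_inverse flip: complex_of_real_integrable_eq)
  then have "integrable lborel (\<lambda>x::'a. \<Prod>b\<in>Basis. complex_of_real (1 / (1 + (x \<bullet> b)\<^sup>2)))"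
    by (rule lborel_integral_prod_Basis)
  then show ?thesis
  proof (rule Bochner_Integration.integrable_bound, safe intro!: AE_I2)
    fix x :: 'a
    have "(1 / (1 + (norm x)\<^sup>2)) ^ DIM('a) = (\<Prod>b\<in>(Basis::'a set). 1 / (1 + (norm x)\<^sup>2))" by simp
    also have "\<dots> \<le> (\<Prod>b\<in>Basis. 1 / (1 + (x \<bullet> b)\<^sup>2))"
      by (intro prod_mono conjI divide_left_mono)
         (auto intro!: Basis_le_norm power_mono mult_pos_pos add_pos_nonneg simp: abs_le_square_iff[symmetric])
    finally show "norm ((1 / (1 + (norm x)\<^sup>2)) ^ DIM('a)) \<le> norm (\<Prod>b\<in>Basis. complex_of_real (1 / (1 + (x \<bullet> b)\<^sup>2)))"
      by (simp del: of_real_divide of_real_add of_real_power flip: of_real_prod)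
  qed simp
qed

text \<open>\<open>k \<ge> 3\<close> makes the transform integrable in dimension 3, as inversion
  requires; \<open>2 * k \<ge> \<gamma> + 3\<close> leaves the power \<open>- 3\<close> of
  \<open>1 + (norm \<xi>)\<^sup>2\<close> after the weight in \<open>sobolev\<close> has been
  absorbed.\<close>

lemma compact_support_in_sobolev:
  assumes "2 * real k \<ge> \<gamma> + 3" "k \<ge> 3" "C_k_on (2 * k) UNIV v" "compact K" "\<And>x. x \<notin> K \<Longrightarrow> v x = 0"
  shows "v \<in> sobolev \<gamma>"
proof -
  have cv: "continuous_on UNIV v" using C_k_on_continuous_on assms(3) by blast
  have mv [measurable]: "v \<in> borel_measurable borel" using cv by (rule borel_measurable_continuous_onI)
  obtain C where C: "\<And>\<xi>. (1 + (norm \<xi>)\<^sup>2) ^ k * norm (fourier v \<xi>) \<le> C"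
    using fourier_decay[OF assms(3-5)] by blast
  have C0: "C \<ge> 0" using C[of 0] by (simp add: order_trans[OF norm_ge_zero])
  have dec: "norm (fourier v \<xi>) \<le> C * (1 / (1 + (norm \<xi>)\<^sup>2)) ^ k" for \<xi>
  proof -
    have "(1 + (norm \<xi>)\<^sup>2) ^ k > 0" by (intro zero_less_power add_pos_nonneg) auto
    then show ?thesis using C[of \<xi>] by (simp add: power_divide pos_le_divide_eq mult.commute)
  qed
  have le1: "0 < 1 / (1 + (norm \<xi>)\<^sup>2)" "1 / (1 + (norm \<xi>)\<^sup>2) \<le> 1" for \<xi> :: "real^3"
    by (auto simp: add_pos_nonneg divide_le_eq)
  have i3: "integrable lborel (\<lambda>\<xi>::real^3. B * (1 / (1 + (norm \<xi>)\<^sup>2)) ^ 3)" for B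
    using inverse_square_integrable[where 'a="real^3"] by simp
  have iF: "integrable lborel (fourier v)"
  proof (rule Bochner_Integration.integrable_bound[OF i3[of C]], safe intro!: AE_I2)
    fix \<xi> :: "real^3"
    have "norm (fourier v \<xi>) \<le> C * (1 / (1 + (norm \<xi>)\<^sup>2)) ^ k" by (rule dec)
    also have "\<dots> \<le> C * (1 / (1 + (norm \<xi>)\<^sup>2)) ^ 3"
      using le1[of \<xi>] assms(2) C0 by (intro mult_left_mono power_decreasing) auto
    finally show "norm (fourier v \<xi>) \<le> norm (C * (1 / (1 + (norm \<xi>)\<^sup>2)) ^ 3)" using C0 by simp
  qed simp
  \<comment> \<open>The integral in \<open>sobolev\<close> has the opposite sign in the exponent, so
    it inverts \<open>fourier\<close> up to this constant.\<close>
  define f where "f \<xi> = fourier v \<xi> / (2 * pi) ^ 3" for \<xi>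
  have mf: "f \<in> borel_measurable borel" unfolding f_def by measurable
  obtain Cv where Cv: "\<And>x. norm (v x) \<le> Cv" using compact_support_integrable(2)[OF cv assms(4,5)] by blast
  have "v x = (LINT \<xi>|lborel. f \<xi> * cis (x \<bullet> \<xi>))" for x
    using fourier_inversion[OF cv Cv compact_support_integrable(1)[OF cv assms(4,5)] iF, of x]
    by (simp add: f_def)
  moreover have "integrable lborel (\<lambda>\<xi>::real^3. (1 + (norm \<xi>)\<^sup>2) powr \<gamma> * (cmod (f \<xi>))\<^sup>2)"
  proof (rule Bochner_Integration.integrable_bound[OF i3[of "(C / (2 * pi) ^ 3)\<^sup>2"]], safe intro!: AE_I2)
    fix \<xi> :: "real^3"
    let ?t = "1 + (norm \<xi>)\<^sup>2"
    have t: "?t \<ge> 1" "?t > 0" by (auto intro: add_pos_nonneg)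
    have "cmod (f \<xi>) \<le> C / (2 * pi) ^ 3 * (1 / ?t) ^ k"
      using divide_right_mono[OF dec[of \<xi>], of "(2 * pi) ^ 3"] by (simp add: f_def norm_divide norm_power)
    then have "(cmod (f \<xi>))\<^sup>2 \<le> (C / (2 * pi) ^ 3 * (1 / ?t) ^ k)\<^sup>2" by (intro power_mono) auto
    then have "?t powr \<gamma> * (cmod (f \<xi>))\<^sup>2 \<le> ?t powr \<gamma> * ((C / (2 * pi) ^ 3)\<^sup>2 * ((1 / ?t) ^ k)\<^sup>2)"
      by (intro mult_left_mono) (simp_all only: power_mult_distrib powr_ge_zero)
    also have "((1 / ?t) ^ k)\<^sup>2 = ?t powr (- 2 * real k)"
    proof -
      have "?t powr (- 2 * real k) = inverse (?t powr real (2 * k))" by (simp add: powr_minus)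
      also have "\<dots> = inverse (?t ^ (2 * k))" using t(2) by (simp only: powr_realpow)
      also have "\<dots> = ((1 / ?t) ^ k)\<^sup>2" by (simp add: power_mult[symmetric] inverse_eq_divide power_one_over mult.commute)
      finally show ?thesis ..
    qed
    also have "?t powr \<gamma> * ((C / (2 * pi) ^ 3)\<^sup>2 * ?t powr (- 2 * real k)) = (C / (2 * pi) ^ 3)\<^sup>2 * ?t powr (\<gamma> - 2 * real k)"
      by (simp only: mult.left_commute[of "?t powr \<gamma>"] powr_add[symmetric]) simp
    also have "\<dots> \<le> (C / (2 * pi) ^ 3)\<^sup>2 * ?t powr (- 3)"
      using t assms(1) by (intro mult_left_mono powr_mono) auto
    also have "?t powr (- 3) = (1 / ?t) ^ 3"
    proof -
      have "?t powr (- 3) = inverse (?t powr real 3)" by (simp add: powr_minus)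
      also have "\<dots> = inverse (?t ^ 3)" using t(2) by (simp only: powr_realpow)
      also have "\<dots> = (1 / ?t) ^ 3" by (simp add: inverse_eq_divide power_one_over)
      finally show ?thesis .
    qed
    finally show "norm (?t powr \<gamma> * (cmod (f \<xi>))\<^sup>2) \<le> norm ((C / (2 * pi) ^ 3)\<^sup>2 * (1 / ?t) ^ 3)"
      by simp
  qed (auto simp: f_def)
  ultimately show ?thesis
    unfolding sobolev_def using mf by (intro CollectI exI[of _ f]) auto
qed

section \<open>Smooth extension and cutoff functions on the line\<close>

lemma C_k_on_real_deriv:
  fixes f :: "real \<Rightarrow> real"
  assumes "open S" "C_k_on (Suc k) S f"
  shows "x \<in> S \<Longrightarrow> (f has_field_derivative deriv f x) (at x)" "C_k_on k S (deriv f)"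
proof -
  have d: "(f has_field_derivative deriv f x) (at x)" if "x \<in> S" for x
    using assms that by (auto simp: DERIV_deriv_iff_real_differentiable)
  then show "x \<in> S \<Longrightarrow> (f has_field_derivative deriv f x) (at x)" .
  have c: "C_k_on k S (\<lambda>x. vector_derivative f (at x))" using C_k_on_real_Suc[OF assms(1), of k f] assms(2) by simp
  have "vector_derivative f (at x) = deriv f x" if "x \<in> S" for x
    using d[OF that] by (simp add: has_real_derivative_iff_has_vector_derivative vector_derivative_at)
  then show "C_k_on k S (deriv f)" by (rule C_k_on_cong[OF assms(1) _ c])
qed

text \<open>For order 0, a bounded derivative makes \<open>f\<close> uniformly continuous, hence
  continuous up to the end points. For higher order the derivative is extended first and then
  integrated; on the interval the result differs from \<open>f\<close> by a constant.\<close>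

lemma extend_C_k:
  fixes f :: "real \<Rightarrow> real"
  assumes "\<alpha> < \<beta>" "\<And>j. C_k_on j {\<alpha><..<\<beta>} f" "\<And>k. \<exists>C. \<forall>x\<in>{\<alpha><..<\<beta>}. \<bar>(deriv ^^ k) f x\<bar> \<le> C"
  shows "\<exists>F. C_k_on N UNIV F \<and> (\<forall>x\<in>{\<alpha><..<\<beta>}. F x = f x)"
  using assms(2,3)
proof (induction N arbitrary: f)
  case 0
  let ?S = "{\<alpha><..<\<beta>}"
  obtain C where C: "\<And>x. x \<in> ?S \<Longrightarrow> \<bar>deriv f x\<bar> \<le> C" using 0(2)[of "Suc 0"] by (auto simp: Ball_def)
  have d: "(f has_field_derivative deriv f x) (at x)" if "x \<in> ?S" for x
    using C_k_on_real_deriv(1)[OF _ 0(1)[of "Suc 0"] that] by simp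
  have uc: "uniformly_continuous_on ?S f"
  proof (rule lipschitz_on_uniformly_continuous)
    show "(max C 0)-lipschitz_on ?S f"
    proof (rule bounded_derivative_imp_lipschitz[where f'="\<lambda>x. (*) (deriv f x)"])
      show "(f has_derivative (*) (deriv f x)) (at x within ?S)" if "x \<in> ?S" for x
        using has_field_derivative_at_within[OF d[OF that]] by (simp add: has_field_derivative_def)
      show "onorm ((*) (deriv f x)) \<le> max C 0" if "x \<in> ?S" for x
      proof (rule onorm_le)
        show "norm (deriv f x * y) \<le> max C 0 * norm y" for y
          using C[OF that] by (simp add: abs_mult le_max_iff_disj mult_right_mono)
      qed
    qed auto
  qed
  obtain g where g: "uniformly_continuous_on (closure ?S) g" "\<And>x. x \<in> ?S \<Longrightarrow> f x = g x"
    by (rule uniformly_continuous_on_extension_on_closure[OF uc], rule that)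
  have "continuous_on {\<alpha>..\<beta>} g" using uniformly_continuous_imp_continuous[OF g(1)] assms(1) by simp
  \<comment> \<open>Clamping the argument to \<open>[\<alpha>, \<beta>]\<close> continues the
    function by its boundary values.\<close>
  then have "continuous_on UNIV (\<lambda>x. g (max \<alpha> (min \<beta> x)))"
    by (rule continuous_on_compose2) (use assms(1) in \<open>auto intro!: continuous_intros\<close>)
  then show ?case using g(2) by (intro exI[of _ "\<lambda>x. g (max \<alpha> (min \<beta> x))"]) auto
next
  case (Suc N)
  let ?S = "{\<alpha><..<\<beta>}"
  have "\<exists>F. C_k_on N UNIV F \<and> (\<forall>x\<in>?S. F x = deriv f x)"
  proof (rule Suc.IH)
    show "C_k_on j ?S (deriv f)" for j using C_k_on_real_deriv(2)[OF _ Suc.prems(1)] by simp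
    show "\<exists>C. \<forall>x\<in>?S. \<bar>(deriv ^^ k) (deriv f) x\<bar> \<le> C" for k
      using Suc.prems(2)[of "Suc k"] by (simp only: funpow_Suc_right o_def)
  qed
  then obtain F1 where F1: "C_k_on N UNIV F1" "\<And>x. x \<in> ?S \<Longrightarrow> F1 x = deriv f x" by blast
  have c1: "continuous_on UNIV F1" using C_k_on_continuous_on[OF F1(1)] .
  then have "\<exists>G. \<forall>x. (- \<infinity>::ereal) < x \<longrightarrow> x < \<infinity> \<longrightarrow> (G has_vector_derivative F1 x) (at x)"
    by (intro einterval_antiderivative) (auto simp: continuous_on_eq_continuous_at)
  then obtain G where G: "\<And>x. (G has_field_derivative F1 x) (at x)"
    by (auto simp: has_real_derivative_iff_has_vector_derivative)
  have "\<exists>c. \<forall>x\<in>?S. f x - G x = c"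
  proof (rule has_field_derivative_zero_constant)
    fix x assume x: "x \<in> ?S"
    show "((\<lambda>x. f x - G x) has_field_derivative 0) (at x within ?S)"
      using C_k_on_real_deriv(1)[OF _ Suc.prems(1)[of "Suc 0"] x] F1(2)[OF x] G[of x]
      by (intro DERIV_diff[THEN has_field_derivative_at_within, THEN DERIV_cong]) auto
  qed auto
  then obtain c where "\<forall>x\<in>?S. f x - G x = c" ..
  then have c: "f x = G x + c" if "x \<in> ?S" for x using that by (simp add: diff_eq_eq add.commute)
  have "C_k_on (Suc N) UNIV (\<lambda>x. G x + c)"
    by (rule C_k_on_real_SucI[OF open_UNIV _ F1(1)])
       (use G in \<open>auto intro!: derivative_eq_intros simp flip: has_real_derivative_iff_has_vector_derivative\<close>)
  then show ?case using c by (intro exI[of _ "\<lambda>x. G x + c"]) auto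
qed

lemma deriv_funpow_cong:
  fixes f g :: "real \<Rightarrow> real"
  assumes "open S" "\<And>x. x \<in> S \<Longrightarrow> f x = g x" "x \<in> S"
  shows "(deriv ^^ k) f x = (deriv ^^ k) g x"
  using assms(3)
proof (induction k arbitrary: x)
  case (Suc k)
  have "\<forall>\<^sub>F y in nhds x. (deriv ^^ k) f y = (deriv ^^ k) g y"
    using eventually_nhds_in_open[OF assms(1) Suc.prems] by eventually_elim (rule Suc.IH)
  then show ?case by (simp add: deriv_cong_ev)
qed (use assms in simp)

lemma deriv_funpow_smooth:
  fixes f :: "real \<Rightarrow> real"
  assumes "open S" "\<And>j. C_k_on j S f"
  shows "C_k_on j S ((deriv ^^ k) f)"
proof (induction k arbitrary: j)
  case (Suc k)
  show ?case using C_k_on_real_deriv(2)[OF assms(1) Suc.IH] by simp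
qed (use assms in simp)

lemma deriv_funpow_bounded_compact:
  fixes f :: "real \<Rightarrow> real"
  assumes "open S" "\<And>j. C_k_on j S f" "compact K" "K \<subseteq> S"
  shows "\<exists>C. \<forall>x\<in>K. \<bar>(deriv ^^ k) f x\<bar> \<le> C"
proof -
  have "continuous_on K ((deriv ^^ k) f)"
    using C_k_on_continuous_on[OF deriv_funpow_smooth[OF assms(1,2)]] assms(4) continuous_on_subset by blast
  then have "bounded ((deriv ^^ k) f ` K)" using assms(3) compact_continuous_image compact_imp_bounded by blast
  then show ?thesis by (auto simp: bounded_iff)
qed

section \<open>Cutoff functions of finite order\<close>

definition ramp :: "nat \<Rightarrow> real \<Rightarrow> real" where "ramp n x = (max 0 x) ^ n"

text \<open>Only finitely many derivatives of a cutoff are ever taken, so a power of the positive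
  part replaces the usual \<open>exp (- 1 / x)\<close>. Differentiation lowers the power by one,
  also at the corner 0, where the difference quotient is at most
  \<open>\<bar>h\<bar> ^ Suc k\<close>.\<close>

lemma C_k_on_ramp: "C_k_on k UNIV (ramp (Suc k))"
proof (induction k)
  case 0
  then show ?case by (auto simp: ramp_def[abs_def] intro!: continuous_intros)
next
  case (Suc k)
  have "(ramp (Suc (Suc k)) has_real_derivative real (Suc (Suc k)) * ramp (Suc k) x) (at x)" for x
  proof (cases x "0::real" rule: linorder_cases)
    case less
    have "((\<lambda>x. 0) has_real_derivative 0) (at x)" by simp
    then have "(ramp (Suc (Suc k)) has_real_derivative 0) (at x)"
      by (rule has_field_derivative_transform_within_open[of _ _ _ "{..<0}"]) (use less in \<open>auto simp: ramp_def\<close>)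
    then show ?thesis using less by (simp add: ramp_def)
  next
    case greater
    have "((\<lambda>x. x ^ Suc (Suc k)) has_real_derivative real (Suc (Suc k)) * x ^ Suc k) (at x)"
      using DERIV_pow[of "Suc (Suc k)" x] by simp
    then have "(ramp (Suc (Suc k)) has_real_derivative real (Suc (Suc k)) * x ^ Suc k) (at x)"
      by (rule has_field_derivative_transform_within_open[of _ _ _ "{0<..}"]) (use greater in \<open>auto simp: ramp_def\<close>)
    then show ?thesis using greater by (simp add: ramp_def)
  next
    case equal
    have "(\<lambda>h. ramp (Suc (Suc k)) h / h) \<midarrow>0\<rightarrow> 0"
    proof (rule Lim_null_comparison)
      show "\<forall>\<^sub>F h in at 0. norm (ramp (Suc (Suc k)) h / h) \<le> \<bar>h\<bar> ^ Suc k"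
      proof (rule eventually_mono[OF eventually_neq_at_within[of 0]])
        show "norm (ramp (Suc (Suc k)) h / h) \<le> \<bar>h\<bar> ^ Suc k" if "h \<noteq> 0" for h
        proof (cases "h > 0")
          case False
          then have "ramp (Suc (Suc k)) h = 0" by (simp add: ramp_def)
          then show ?thesis by (simp only: div_0 norm_zero) (rule zero_le_power[OF abs_ge_zero])
        qed (use that in \<open>simp add: ramp_def\<close>)
      qed
      show "(\<lambda>h. \<bar>h\<bar> ^ Suc k) \<midarrow>0\<rightarrow> (0::real)" by (rule tendsto_eq_intros refl | simp)+
    qed
    then show ?thesis using equal by (simp add: DERIV_def ramp_def)
  qed
  then show ?case
    by (intro C_k_on_real_SucI[OF open_UNIV, where f'="\<lambda>x. real (Suc (Suc k)) * ramp (Suc k) x"])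
       (use Suc in \<open>auto intro!: C_k_on_mult simp flip: has_real_derivative_iff_has_vector_derivative\<close>)
qed

text \<open>\<open>st u v\<close> rises from 0 to 1 between \<open>u\<close> and \<open>v\<close>;
  its denominator is positive because the two ramps overlap when \<open>u < v\<close>. The cutoff is
  a rising step times a reflected one.\<close>

lemma cutoff_exists:
  assumes "a < (b::real)" "b < c" "c < d"
  shows "\<exists>\<zeta>::real \<Rightarrow> real. C_k_on k UNIV \<zeta> \<and> (\<forall>x\<in>{b..c}. \<zeta> x = 1) \<and> (\<forall>x. x \<notin> {a..d} \<longrightarrow> \<zeta> x = 0)"
proof -
  define st where "st u v x = ramp (Suc k) (x - u) / (ramp (Suc k) (x - u) + ramp (Suc k) (v - x))" for u v x :: real
  have pos: "ramp (Suc k) (x - u) + ramp (Suc k) (v - x) > 0" if "u < v" for u v x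
    using that by (cases "x > u") (auto simp: ramp_def add_pos_nonneg add_nonneg_pos)
  have sh: "C_k_on k UNIV (\<lambda>x. ramp (Suc k) (x - u))" "C_k_on k UNIV (\<lambda>x. ramp (Suc k) (u - x))" for u
    by (rule C_k_on_compose[OF open_UNIV open_UNIV _ C_k_on_ramp], intro C_k_on_diff C_k_on_id C_k_on_const open_UNIV, simp)+
  have st: "C_k_on k UNIV (st u v)" if "u < v" for u v
    unfolding st_def by (intro C_k_on_divide C_k_on_add sh open_UNIV) (metis pos[OF that] less_irrefl)
  have st': "C_k_on k UNIV (\<lambda>x. st u v (- x))" if "u < v" for u v
    by (rule C_k_on_compose[OF open_UNIV open_UNIV _ st[OF that]], intro C_k_on_minus C_k_on_id open_UNIV, simp)
  have 0: "st u v x = 0" if "x \<le> u" for u v x using that by (simp add: st_def ramp_def)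
  have 1: "st u v x = 1" if "v \<le> x" "u < v" for u v x using that by (simp add: st_def ramp_def)
  show ?thesis
    by (rule exI[of _ "\<lambda>x. st a b x * st (- d) (- c) (- x)"])
       (use assms in \<open>auto intro!: C_k_on_mult st st' simp: 0 1\<close>)
qed

section \<open>Ordinary differential equations with regular singular points\<close>

text \<open>On a convex domain, the primitive of a holomorphic \<open>f\<close> that vanishes at
  \<open>e\<close>.\<close>

definition prim :: "complex \<Rightarrow> (complex \<Rightarrow> complex) \<Rightarrow> complex \<Rightarrow> complex" where
  "prim e f z = contour_integral (linepath e z) f"

definition mean :: "complex \<Rightarrow> complex \<Rightarrow> (complex \<Rightarrow> complex) \<Rightarrow> complex" where
  "mean e1 e2 f = prim e1 f e2 / (e2 - e1)"

context
  fixes \<Omega> :: "complex set"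
  assumes open_dom: "open \<Omega>" and convex_dom: "convex \<Omega>"
begin

lemma prim_contour:
  assumes "f holomorphic_on \<Omega>" "e \<in> \<Omega>" "z \<in> \<Omega>"
  shows "(f has_contour_integral prim e f z) (linepath e z)"
  unfolding prim_def
  using assms closed_segment_subset[OF _ _ convex_dom]
  by (intro has_contour_integral_integral contour_integrable_holomorphic_simple[OF _ open_dom]) auto

lemma prim_primitive:
  assumes "f holomorphic_on \<Omega>" "e \<in> \<Omega>"
  obtains g where "\<And>z. z \<in> \<Omega> \<Longrightarrow> (g has_field_derivative f z) (at z)"
    "\<And>z. z \<in> \<Omega> \<Longrightarrow> prim e f z = g z - g e"
proof -
  obtain g where g: "\<And>z. z \<in> \<Omega> \<Longrightarrow> (g has_field_derivative f z) (at z within \<Omega>)"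
    using holomorphic_convex_primitive'[OF convex_dom open_dom assms(1)] by blast
  then have g': "(g has_field_derivative f z) (at z)" if "z \<in> \<Omega>" for z
    using at_within_open[OF that open_dom] that by metis
  moreover have "prim e f z = g z - g e" if "z \<in> \<Omega>" for z
  proof -
    have "(f has_contour_integral (g (pathfinish (linepath e z)) - g (pathstart (linepath e z)))) (linepath e z)"
      by (rule contour_integral_primitive[OF g])
         (use closed_segment_subset[OF assms(2) that convex_dom] in auto)
    then show ?thesis by (simp add: prim_def contour_integral_unique)
  qed
  ultimately show thesis using that by blast
qed

lemma prim_deriv:
  assumes "f holomorphic_on \<Omega>" "e \<in> \<Omega>" "z \<in> \<Omega>"
  shows "(prim e f has_field_derivative f z) (at z)"
proof -
  obtain g where g: "\<And>z. z \<in> \<Omega> \<Longrightarrow> (g has_field_derivative f z) (at z)"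
    "\<And>z. z \<in> \<Omega> \<Longrightarrow> prim e f z = g z - g e" by (rule prim_primitive[OF assms(1,2)]) blast
  have "((\<lambda>z. g z - g e) has_field_derivative f z) (at z)"
    using g(1)[OF assms(3)] by (auto intro!: derivative_eq_intros)
  then show ?thesis
    by (rule has_field_derivative_transform_within_open[OF _ open_dom assms(3)]) (simp add: g(2))
qed

lemma prim_holomorphic:
  assumes "f holomorphic_on \<Omega>" "e \<in> \<Omega>" shows "prim e f holomorphic_on \<Omega>"
  using prim_deriv[OF assms] by (auto simp: holomorphic_on_open[OF open_dom])

lemma prim_bound:
  assumes "f holomorphic_on \<Omega>" "e \<in> \<Omega>" "z \<in> \<Omega>" "\<And>w. w \<in> \<Omega> \<Longrightarrow> norm (f w) \<le> C"
  shows "norm (prim e f z) \<le> C * norm (z - e)"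
proof (rule has_contour_integral_bound_linepath[OF prim_contour[OF assms(1-3)]])
  show "0 \<le> C" using assms(4)[OF assms(2)] norm_ge_zero order_trans by blast
  show "norm (f w) \<le> C" if "w \<in> closed_segment e z" for w
    using closed_segment_subset[OF assms(2,3) convex_dom] that assms(4) by blast
qed

lemma prim_diff:
  assumes "f holomorphic_on \<Omega>" "g holomorphic_on \<Omega>" "e \<in> \<Omega>" "z \<in> \<Omega>"
  shows "prim e (\<lambda>w. f w - g w) z = prim e f z - prim e g z"
  using contour_integral_unique[OF has_contour_integral_diff[OF prim_contour[OF assms(1,3,4)] prim_contour[OF assms(2,3,4)]]]
  by (simp add: prim_def)

lemma prim_const: "prim e (\<lambda>w. c) z = c * (z - e)"
  unfolding prim_def by (rule contour_integral_unique, rule has_contour_integral_const_linepath)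

lemma prim_change_base:
  assumes "f holomorphic_on \<Omega>" "e \<in> \<Omega>" "e' \<in> \<Omega>" "z \<in> \<Omega>"
  shows "prim e' f z = prim e f z - prim e f e'"
proof -
  obtain g where g: "\<And>z. z \<in> \<Omega> \<Longrightarrow> (g has_field_derivative f z) (at z)"
    "\<And>z. z \<in> \<Omega> \<Longrightarrow> prim e f z = g z - g e" by (rule prim_primitive[OF assms(1,2)]) blast
  have "(f has_contour_integral (g (pathfinish (linepath e' z)) - g (pathstart (linepath e' z)))) (linepath e' z)"
    by (rule contour_integral_primitive[OF has_field_derivative_at_within[OF g(1)]])
       (use closed_segment_subset[OF assms(3,4) convex_dom] in auto)
  then show ?thesis using g(2) assms by (simp add: prim_def contour_integral_unique)
qed

lemma mean_bound:
  assumes "f holomorphic_on \<Omega>" "e1 \<in> \<Omega>" "e2 \<in> \<Omega>" "e1 \<noteq> e2" "\<And>w. w \<in> \<Omega> \<Longrightarrow> norm (f w) \<le> C"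
  shows "norm (mean e1 e2 f) \<le> C"
  using prim_bound[OF assms(1-3,5)] assms(4) by (simp add: mean_def norm_divide divide_le_eq)

text \<open>Removable singularities, used once for each zero.\<close>

lemma divide_two_zeros:
  assumes "G holomorphic_on \<Omega>" "e1 \<in> \<Omega>" "e2 \<in> \<Omega>" "e1 \<noteq> e2" "G e1 = 0" "G e2 = 0"
  obtains H where "H holomorphic_on \<Omega>" "\<And>z. z \<in> \<Omega> \<Longrightarrow> (z - e1) * (z - e2) * H z = G z"
proof -
  define G1 where "G1 z = (if z = e1 then deriv G e1 else (G z - G e1) / (z - e1))" for z
  define H where "H z = (if z = e2 then deriv G1 e2 else (G1 z - G1 e2) / (z - e2))" for z
  have "G1 holomorphic_on \<Omega>" unfolding G1_def
    by (rule pole_lemma_open) (use assms open_dom in auto)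
  then have "H holomorphic_on \<Omega>" unfolding H_def
    by (rule pole_lemma_open) (use assms open_dom in auto)
  moreover have "(z - e1) * (z - e2) * H z = G z" if "z \<in> \<Omega>" for z
    using assms by (auto simp: H_def G1_def)
  ultimately show thesis using that by blast
qed

text \<open>Solves \<open>(p v)' = f\<close> up to a constant for \<open>p z = (z - e1) (z - e2) k z\<close>. Subtracting the mean
  of \<open>f\<close> is what makes a solution regular at both zeros of \<open>p\<close> possible.\<close>

definition sing_solve ::
  "complex \<Rightarrow> complex \<Rightarrow> (complex \<Rightarrow> complex) \<Rightarrow> (complex \<Rightarrow> complex) \<Rightarrow> complex \<Rightarrow> complex" where
  "sing_solve e1 e2 k f = (SOME v. v holomorphic_on \<Omega> \<and>
     (\<forall>z\<in>\<Omega>. (z - e1) * (z - e2) * k z * v z = prim e1 (\<lambda>w. f w - mean e1 e2 f) z))"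

lemma sing_solve:
  assumes "f holomorphic_on \<Omega>" "k holomorphic_on \<Omega>" "\<And>z. z \<in> \<Omega> \<Longrightarrow> k z \<noteq> 0"
    and "e1 \<in> \<Omega>" "e2 \<in> \<Omega>" "e1 \<noteq> e2"
  shows "sing_solve e1 e2 k f holomorphic_on \<Omega>"
    and "z \<in> \<Omega> \<Longrightarrow> (z - e1) * (z - e2) * k z * sing_solve e1 e2 k f z = prim e1 (\<lambda>w. f w - mean e1 e2 f) z"
proof -
  let ?G = "prim e1 (\<lambda>w. f w - mean e1 e2 f)"
  have h: "?G holomorphic_on \<Omega>" by (intro prim_holomorphic holomorphic_intros assms)
  have "?G e1 = 0" by (simp add: prim_def)
  moreover have "?G e2 = 0"
    using assms by (subst prim_diff) (auto intro!: holomorphic_intros simp: prim_const mean_def)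
  ultimately obtain H where H: "H holomorphic_on \<Omega>" "\<And>z. z \<in> \<Omega> \<Longrightarrow> (z - e1) * (z - e2) * H z = ?G z"
    using divide_two_zeros[OF h assms(4-6)] by blast
  have "\<exists>v. v holomorphic_on \<Omega> \<and> (\<forall>z\<in>\<Omega>. (z - e1) * (z - e2) * k z * v z = ?G z)"
    by (rule exI[of _ "\<lambda>z. H z / k z"]) (use H assms in \<open>auto intro!: holomorphic_intros simp: mult.assoc\<close>)
  from someI_ex[OF this] show "sing_solve e1 e2 k f holomorphic_on \<Omega>"
    "z \<in> \<Omega> \<Longrightarrow> (z - e1) * (z - e2) * k z * sing_solve e1 e2 k f z = ?G z"
    unfolding sing_solve_def by blast+
qed

text \<open>The primitive vanishes at \<open>e1\<close> and at \<open>e2\<close>, so it is at most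
  \<open>2 * C\<close> times the distance to either point. Each of the two estimates cancels one
  linear factor on the left; the other one is removed by adding them and using that the distances to
  \<open>e1\<close> and \<open>e2\<close> add up to at least \<open>norm (e2 - e1)\<close>. The
  bound holds for every solution \<open>v\<close>, not only for the one chosen by
  \<open>sing_solve\<close>, so it also applies to differences of solutions.\<close>

lemma sing_quotient_bound:
  assumes f: "f holomorphic_on \<Omega>" "\<And>z. z \<in> \<Omega> \<Longrightarrow> norm (f z) \<le> C"
    and k: "k0 > 0" "\<And>z. z \<in> \<Omega> \<Longrightarrow> k0 \<le> norm (k z)"
    and e: "e1 \<in> \<Omega>" "e2 \<in> \<Omega>" "e1 \<noteq> e2" and v: "v holomorphic_on \<Omega>"
    and eq: "\<And>z. z \<in> \<Omega> \<Longrightarrow> (z - e1) * (z - e2) * k z * v z = prim e1 (\<lambda>w. f w - mean e1 e2 f) z"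
    and z: "z \<in> \<Omega>"
  shows "norm (v z) \<le> 4 * C / (norm (e2 - e1) * k0)"
proof -
  let ?g = "\<lambda>w. f w - mean e1 e2 f"
  have g: "?g holomorphic_on \<Omega>" by (intro holomorphic_intros f)
  have gb: "norm (?g w) \<le> 2 * C" if "w \<in> \<Omega>" for w
    using f(2)[OF that] mean_bound[OF f(1) e f(2)] norm_triangle_ineq4[of "f w" "mean e1 e2 f"] by simp
  have z2: "prim e1 ?g e2 = 0"
    using e f by (subst prim_diff) (auto intro!: holomorphic_intros simp: prim_const mean_def)
  have C0: "C \<ge> 0" using f(2)[OF e(1)] norm_ge_zero order_trans by blast
  have b: "norm (v w) \<le> 4 * C / (norm (e2 - e1) * k0)" if w: "w \<in> \<Omega>" "w \<noteq> e1" "w \<noteq> e2" for w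
  proof -
    let ?p = "norm ((w - e1) * (w - e2) * k w * v w)"
    have "?p \<le> 2 * C * norm (w - e1)"
      unfolding eq[OF w(1)] by (rule prim_bound[OF g e(1) w(1) gb])
    then have "norm (w - e1) * (norm (w - e2) * norm (k w) * norm (v w)) \<le> norm (w - e1) * (2 * C)"
      by (simp only: norm_mult mult_ac)
    then have 1: "norm (w - e2) * norm (k w) * norm (v w) \<le> 2 * C"
      by (rule mult_left_le_imp_le) (use w in simp)
    have "?p \<le> 2 * C * norm (w - e2)"
      unfolding eq[OF w(1)] using prim_change_base[OF g e(1,2) w(1)] z2 prim_bound[OF g e(2) w(1) gb] by simp
    then have "norm (w - e2) * (norm (w - e1) * norm (k w) * norm (v w)) \<le> norm (w - e2) * (2 * C)"
      by (simp only: norm_mult mult_ac)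
    then have 2: "norm (w - e1) * norm (k w) * norm (v w) \<le> 2 * C"
      by (rule mult_left_le_imp_le) (use w in simp)
    have "norm (e2 - e1) \<le> norm (w - e1) + norm (w - e2)"
      using norm_triangle_ineq4[of "w - e1" "w - e2"] by simp
    then have "norm (e2 - e1) * (norm (k w) * norm (v w)) \<le> (norm (w - e1) + norm (w - e2)) * (norm (k w) * norm (v w))"
      by (intro mult_right_mono) auto
    then have 3: "norm (e2 - e1) * norm (k w) * norm (v w) \<le> 4 * C" using 1 2 by (simp add: algebra_simps)
    have "norm (e2 - e1) * k0 * norm (v w) \<le> norm (e2 - e1) * norm (k w) * norm (v w)"
      using k(2)[OF w(1)] by (intro mult_right_mono mult_left_mono) auto
    then show ?thesis using 3 k(1) e(3) by (simp add: pos_le_divide_eq mult.commute)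
  qed
  \<comment> \<open>At \<open>e1\<close> and \<open>e2\<close> themselves nothing can be cancelled;
    there the bound follows by continuity.\<close>
  have "continuous_on \<Omega> v" using v holomorphic_on_imp_continuous_on by blast
  then have "(v \<longlongrightarrow> v z) (at z)"
    using z open_dom by (simp add: continuous_on_eq_continuous_at isCont_def)
  moreover have "\<forall>\<^sub>F w in at z. norm (v w) \<le> 4 * C / (norm (e2 - e1) * k0)"
  proof -
    have "\<forall>\<^sub>F w in at z. w \<in> \<Omega>" using z open_dom eventually_at_in_open' by blast
    moreover have "\<forall>\<^sub>F w in at z. w \<noteq> e1" "\<forall>\<^sub>F w in at z. w \<noteq> e2"
      by (cases "z = e1"; cases "z = e2"; force intro: eventually_neq_at_within tendsto_imp_eventually_ne[OF tendsto_ident_at])+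
    ultimately show ?thesis by eventually_elim (rule b)
  qed
  ultimately show ?thesis by (intro tendsto_upperbound[OF tendsto_norm]) auto
qed

end

section \<open>A contraction principle for families of holomorphic functions\<close>

lemma geometric_uniform_limit:
  fixes f :: "nat \<Rightarrow> 'a \<Rightarrow> complex"
  assumes "\<And>n z. z \<in> S \<Longrightarrow> norm (f (Suc n) z - f n z) \<le> B / 2 ^ n"
  shows "\<exists>g. \<forall>n. \<forall>z\<in>S. norm (f n z - g z) \<le> 2 * B / 2 ^ n"
proof -
  have b: "norm (f (n + j) z - f n z) \<le> 2 * B / 2 ^ n" if "z \<in> S" for n j z
  proof -
    \<comment> \<open>The subtracted remainder of the geometric series makes the induction
      close.\<close>
    have "norm (f (n + j) z - f n z) \<le> 2 * B / 2 ^ n - 2 * B / 2 ^ (n + j)"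
    proof (induction j)
      case (Suc j)
      have "norm (f (n + Suc j) z - f n z) \<le> norm (f (Suc (n + j)) z - f (n + j) z) + norm (f (n + j) z - f n z)"
        using norm_triangle_ineq[of "f (Suc (n + j)) z - f (n + j) z" "f (n + j) z - f n z"] by simp
      also have "\<dots> \<le> B / 2 ^ (n + j) + (2 * B / 2 ^ n - 2 * B / 2 ^ (n + j))"
        using assms[OF that, of "n + j"] Suc by linarith
      also have "\<dots> = 2 * B / 2 ^ n - 2 * B / 2 ^ (n + Suc j)" by (simp add: field_simps)
      finally show ?case .
    qed simp
    moreover have "B \<ge> 0" using order_trans[OF norm_ge_zero assms[OF that, of 0]] by simp
    then have "2 * B / 2 ^ (n + j) \<ge> 0" by simp
    ultimately show ?thesis by linarith
  qed
  have "\<exists>g. \<forall>n. norm (f n z - g) \<le> 2 * B / 2 ^ n" if z: "z \<in> S" for z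
  proof -
    have lim: "(\<lambda>n. 2 * B / 2 ^ n) \<longlonglongrightarrow> 0" by (rule LIMSEQ_divide_realpow_zero) simp
    have "Cauchy (\<lambda>n. f n z)"
    proof (rule CauchyI)
      fix e :: real assume "e > 0"
      then have "\<forall>\<^sub>F n in sequentially. 2 * B / 2 ^ n < e / 2" using order_tendstoD(2)[OF lim, of "e / 2"] by simp
      then obtain N where N: "2 * B / 2 ^ N < e / 2" by (auto simp: eventually_sequentially)
      have "norm (f m z - f n z) < e" if "m \<ge> N" "n \<ge> N" for m n
      proof -
        have "norm (f m z - f N z) \<le> 2 * B / 2 ^ N" "norm (f n z - f N z) \<le> 2 * B / 2 ^ N"
          using b[OF z, of N "m - N"] b[OF z, of N "n - N"] that by auto
        then show ?thesis using N norm_triangle_ineq4[of "f m z - f N z" "f n z - f N z"] by simp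
      qed
      then show "\<exists>N. \<forall>m\<ge>N. \<forall>n\<ge>N. norm (f m z - f n z) < e" by blast
    qed
    then obtain l where l: "(\<lambda>n. f n z) \<longlonglongrightarrow> l" using Cauchy_convergent convergent_def by blast
    have "norm (f n z - l) \<le> 2 * B / 2 ^ n" for n
    proof (rule tendsto_upperbound)
      show "((\<lambda>j. norm (f n z - f (j + n) z)) \<longlongrightarrow> norm (f n z - l)) sequentially"
        by (intro tendsto_intros LIMSEQ_ignore_initial_segment l)
      show "\<forall>\<^sub>F j in sequentially. norm (f n z - f (j + n) z) \<le> 2 * B / 2 ^ n"
        using b[OF z, of n] by (simp add: norm_minus_commute add.commute)
    qed simp
    then show ?thesis by blast
  qed
  then have "\<forall>z\<in>S. \<exists>g. \<forall>n. norm (f n z - g) \<le> 2 * B / 2 ^ n" by blast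
  from bchoice[OF this] show ?thesis by blast
qed

text \<open>The unknown is a finite family of holomorphic functions, one on each bounded convex
  domain. The parameter \<open>p\<close> is explicit so that all bounds, and with them the threshold
  for \<open>s p\<close>, are uniform in \<open>p\<close>.\<close>

locale holo_family =
  fixes \<Omega> :: "'i::finite \<Rightarrow> complex set" and P :: "'p set" and s :: "'p \<Rightarrow> real"
  assumes open_dom: "open (\<Omega> i)" and convex_dom: "convex (\<Omega> i)"
    and nonempty_dom: "\<Omega> i \<noteq> {}" and bounded_dom: "bounded (\<Omega> i)"
    and s_le_1: "p \<in> P \<Longrightarrow> \<bar>s p\<bar> \<le> 1"
begin

definition Ball :: "real \<Rightarrow> ('i \<Rightarrow> complex \<Rightarrow> complex) set" where
  "Ball B = {x. \<forall>i. x i holomorphic_on \<Omega> i \<and> (\<forall>z\<in>\<Omega> i. norm (x i z) \<le> B)}"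

text \<open>Distance at most \<open>\<delta>\<close> in the sup norm, kept as a relation so that no
  supremum has to be formed.\<close>

definition near :: "real \<Rightarrow> ('i \<Rightarrow> complex \<Rightarrow> complex) \<Rightarrow> ('i \<Rightarrow> complex \<Rightarrow> complex) \<Rightarrow> bool" where
  "near \<delta> x y \<longleftrightarrow> (\<forall>i. \<forall>z\<in>\<Omega> i. norm (x i z - y i z) \<le> \<delta>)"

text \<open>\<open>BL w B j F\<close>: on \<open>\<Omega> j\<close>, the functions \<open>F p x\<close> are holomorphic and bounded, and Lipschitz in
  \<open>x\<close> with a constant \<open>O(w)\<close>, uniformly in \<open>p\<close> and \<open>x \<in> Ball B\<close>.\<close>

definition BL :: "('p \<Rightarrow> real) \<Rightarrow> real \<Rightarrow> 'i \<Rightarrow> ('p \<Rightarrow> ('i \<Rightarrow> complex \<Rightarrow> complex) \<Rightarrow> complex \<Rightarrow> complex) \<Rightarrow> bool" where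
  "BL w B j F \<longleftrightarrow> (\<exists>C\<ge>0. \<forall>p\<in>P. \<forall>x\<in>Ball B. F p x holomorphic_on \<Omega> j \<and>
     (\<forall>z\<in>\<Omega> j. norm (F p x z) \<le> C) \<and>
     (\<forall>y\<in>Ball B. \<forall>\<delta>. near \<delta> x y \<longrightarrow> (\<forall>z\<in>\<Omega> j. norm (F p x z - F p y z) \<le> C * w p * \<delta>)))"

lemma near_nonneg: assumes "near \<delta> x y" shows "\<delta> \<ge> 0"
proof -
  obtain z where "z \<in> \<Omega> undefined" using nonempty_dom by blast
  then have "norm (x undefined z - y undefined z) \<le> \<delta>" using assms by (simp add: near_def)
  then show ?thesis using norm_ge_zero order_trans by blast
qed

text \<open>Independent of \<open>x\<close>, hence Lipschitz with constant 0, which every weight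
  \<open>w\<close> allows.\<close>

lemma BL_const:
  assumes "\<And>p. p \<in> P \<Longrightarrow> c p holomorphic_on \<Omega> j" "\<And>p z. p \<in> P \<Longrightarrow> z \<in> \<Omega> j \<Longrightarrow> norm (c p z) \<le> C"
    and "\<And>p. p \<in> P \<Longrightarrow> w p \<ge> 0"
  shows "BL w B j (\<lambda>p x. c p)"
  unfolding BL_def
  by (intro exI[of _ "\<bar>C\<bar>"])
     (use assms near_nonneg in \<open>auto intro!: mult_nonneg_nonneg intro: order_trans[OF _ abs_ge_self]\<close>)

lemma BL_component:
  assumes "B \<ge> 0" shows "BL (\<lambda>p. 1) B j (\<lambda>p x. x j)"
proof -
  have "norm (x j z - y j z) \<le> max B 1 * 1 * \<delta>" if "near \<delta> x y" "z \<in> \<Omega> j" for \<delta> x y z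
    using that near_nonneg[OF that(1)] mult_right_mono[of 1 "max B 1" \<delta>] by (fastforce simp: near_def)
  then show ?thesis unfolding BL_def
    by (intro exI[of _ "max B 1"]) (auto simp: Ball_def le_max_iff_disj)
qed

lemma BL_E:
  assumes "BL w B j F"
  obtains C where "C \<ge> 0" "\<And>p x. p \<in> P \<Longrightarrow> x \<in> Ball B \<Longrightarrow> F p x holomorphic_on \<Omega> j"
    "\<And>p x z. p \<in> P \<Longrightarrow> x \<in> Ball B \<Longrightarrow> z \<in> \<Omega> j \<Longrightarrow> norm (F p x z) \<le> C"
    "\<And>p x y \<delta> z. p \<in> P \<Longrightarrow> x \<in> Ball B \<Longrightarrow> y \<in> Ball B \<Longrightarrow> near \<delta> x y \<Longrightarrow> z \<in> \<Omega> j \<Longrightarrow> norm (F p x z - F p y z) \<le> C * w p * \<delta>"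
  using assms unfolding BL_def by (elim exE conjE) (rule that; blast)

lemma BL_weaken:
  assumes "BL w B j F" "\<And>p. p \<in> P \<Longrightarrow> w p \<le> w' p"
  shows "BL w' B j F"
proof -
  obtain C where C: "C \<ge> 0" "\<And>p x. p \<in> P \<Longrightarrow> x \<in> Ball B \<Longrightarrow> F p x holomorphic_on \<Omega> j"
    "\<And>p x z. p \<in> P \<Longrightarrow> x \<in> Ball B \<Longrightarrow> z \<in> \<Omega> j \<Longrightarrow> norm (F p x z) \<le> C"
    "\<And>p x y \<delta> z. p \<in> P \<Longrightarrow> x \<in> Ball B \<Longrightarrow> y \<in> Ball B \<Longrightarrow> near \<delta> x y \<Longrightarrow> z \<in> \<Omega> j \<Longrightarrow> norm (F p x z - F p y z) \<le> C * w p * \<delta>"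
    by (rule BL_E[OF assms(1)]) blast
  have "C * w p * \<delta> \<le> C * w' p * \<delta>" if "p \<in> P" "near \<delta> x y" for p \<delta> x y
    using C(1) assms(2)[OF that(1)] near_nonneg[OF that(2)] by (intro mult_right_mono mult_left_mono)
  then have "norm (F p x z - F p y z) \<le> C * w' p * \<delta>"
    if "p \<in> P" "x \<in> Ball B" "y \<in> Ball B" "near \<delta> x y" "z \<in> \<Omega> j" for p x y \<delta> z
    using C(4)[OF that] that order_trans by blast
  then show ?thesis unfolding BL_def using C(1-3) by blast
qed

lemma BL_add:
  assumes "BL w B j F" "BL w B j G"
  shows "BL w B j (\<lambda>p x z. F p x z + G p x z)"
proof -
  obtain C where C: "C \<ge> 0" "\<And>p x. p \<in> P \<Longrightarrow> x \<in> Ball B \<Longrightarrow> F p x holomorphic_on \<Omega> j"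
    "\<And>p x z. p \<in> P \<Longrightarrow> x \<in> Ball B \<Longrightarrow> z \<in> \<Omega> j \<Longrightarrow> norm (F p x z) \<le> C"
    "\<And>p x y \<delta> z. p \<in> P \<Longrightarrow> x \<in> Ball B \<Longrightarrow> y \<in> Ball B \<Longrightarrow> near \<delta> x y \<Longrightarrow> z \<in> \<Omega> j \<Longrightarrow> norm (F p x z - F p y z) \<le> C * w p * \<delta>"
    by (rule BL_E[OF assms(1)]) blast
  obtain D where D: "D \<ge> 0" "\<And>p x. p \<in> P \<Longrightarrow> x \<in> Ball B \<Longrightarrow> G p x holomorphic_on \<Omega> j"
    "\<And>p x z. p \<in> P \<Longrightarrow> x \<in> Ball B \<Longrightarrow> z \<in> \<Omega> j \<Longrightarrow> norm (G p x z) \<le> D"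
    "\<And>p x y \<delta> z. p \<in> P \<Longrightarrow> x \<in> Ball B \<Longrightarrow> y \<in> Ball B \<Longrightarrow> near \<delta> x y \<Longrightarrow> z \<in> \<Omega> j \<Longrightarrow> norm (G p x z - G p y z) \<le> D * w p * \<delta>"
    by (rule BL_E[OF assms(2)]) blast
  have 1: "norm (F p x z + G p x z) \<le> C + D" if "p \<in> P" "x \<in> Ball B" "z \<in> \<Omega> j" for p x z
    using C(3)[OF that] D(3)[OF that] norm_triangle_mono by blast
  have 2: "norm (F p x z + G p x z - (F p y z + G p y z)) \<le> (C + D) * w p * \<delta>"
    if "p \<in> P" "x \<in> Ball B" "y \<in> Ball B" "near \<delta> x y" "z \<in> \<Omega> j" for p x y \<delta> z
    using norm_triangle_mono[OF C(4)[OF that] D(4)[OF that]] by (simp add: algebra_simps)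
  show ?thesis unfolding BL_def
    by (intro exI[of _ "C + D"]) (use C D 1 2 in \<open>auto intro!: holomorphic_intros\<close>)
qed

lemma BL_mult:
  assumes "BL w B j F" "BL w B j G"
  shows "BL w B j (\<lambda>p x z. F p x z * G p x z)"
proof -
  obtain C where C: "C \<ge> 0" "\<And>p x. p \<in> P \<Longrightarrow> x \<in> Ball B \<Longrightarrow> F p x holomorphic_on \<Omega> j"
    "\<And>p x z. p \<in> P \<Longrightarrow> x \<in> Ball B \<Longrightarrow> z \<in> \<Omega> j \<Longrightarrow> norm (F p x z) \<le> C"
    "\<And>p x y \<delta> z. p \<in> P \<Longrightarrow> x \<in> Ball B \<Longrightarrow> y \<in> Ball B \<Longrightarrow> near \<delta> x y \<Longrightarrow> z \<in> \<Omega> j \<Longrightarrow> norm (F p x z - F p y z) \<le> C * w p * \<delta>"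
    by (rule BL_E[OF assms(1)]) blast
  obtain D where D: "D \<ge> 0" "\<And>p x. p \<in> P \<Longrightarrow> x \<in> Ball B \<Longrightarrow> G p x holomorphic_on \<Omega> j"
    "\<And>p x z. p \<in> P \<Longrightarrow> x \<in> Ball B \<Longrightarrow> z \<in> \<Omega> j \<Longrightarrow> norm (G p x z) \<le> D"
    "\<And>p x y \<delta> z. p \<in> P \<Longrightarrow> x \<in> Ball B \<Longrightarrow> y \<in> Ball B \<Longrightarrow> near \<delta> x y \<Longrightarrow> z \<in> \<Omega> j \<Longrightarrow> norm (G p x z - G p y z) \<le> D * w p * \<delta>"
    by (rule BL_E[OF assms(2)]) blast
  have 1: "norm (F p x z * G p x z) \<le> C * D" if "p \<in> P" "x \<in> Ball B" "z \<in> \<Omega> j" for p x z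
    unfolding norm_mult using C(1) D(1) C(3)[OF that] D(3)[OF that] by (intro mult_mono) auto
  have 2: "norm (F p x z * G p x z - F p y z * G p y z) \<le> (2 * C * D) * w p * \<delta>"
    if "p \<in> P" "x \<in> Ball B" "y \<in> Ball B" "near \<delta> x y" "z \<in> \<Omega> j" for p x y \<delta> z
  proof -
    have "norm (F p x z * G p x z - F p y z * G p y z) =
      norm (F p x z * (G p x z - G p y z) + (F p x z - F p y z) * G p y z)" by (simp add: algebra_simps)
    also have "\<dots> \<le> C * (D * w p * \<delta>) + (C * w p * \<delta>) * D"
      by (intro norm_triangle_mono; unfold norm_mult; intro mult_mono)
         (use C D that order_trans[OF norm_ge_zero C(4)[OF that]] in auto)
    finally show ?thesis by (simp add: algebra_simps)
  qed
  have 3: "norm (F p x z * G p x z) \<le> 2 * C * D" if "p \<in> P" "x \<in> Ball B" "z \<in> \<Omega> j" for p x z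
    using 1[OF that] mult_nonneg_nonneg[OF C(1) D(1)] by linarith
  show ?thesis unfolding BL_def
    by (intro exI[of _ "2 * C * D"]) (use C D 3 2 in \<open>auto intro!: holomorphic_intros\<close>)
qed

text \<open>Source of the smallness: for terms that do depend on \<open>x\<close>, the Lipschitz
  constant becomes \<open>O(s)\<close> through an explicit factor \<open>s p\<close>.\<close>

lemma BL_s_mult:
  assumes "BL (\<lambda>p. 1) B j F"
  shows "BL (\<lambda>p. \<bar>s p\<bar>) B j (\<lambda>p x z. of_real (s p) * F p x z)"
proof -
  obtain C where C: "C \<ge> 0" "\<And>p x. p \<in> P \<Longrightarrow> x \<in> Ball B \<Longrightarrow> F p x holomorphic_on \<Omega> j"
    "\<And>p x z. p \<in> P \<Longrightarrow> x \<in> Ball B \<Longrightarrow> z \<in> \<Omega> j \<Longrightarrow> norm (F p x z) \<le> C"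
    "\<And>p x y \<delta> z. p \<in> P \<Longrightarrow> x \<in> Ball B \<Longrightarrow> y \<in> Ball B \<Longrightarrow> near \<delta> x y \<Longrightarrow> z \<in> \<Omega> j \<Longrightarrow> norm (F p x z - F p y z) \<le> C * 1 * \<delta>"
    by (rule BL_E[OF assms]) blast
  have 1: "norm (of_real (s p) * F p x z) \<le> C" if "p \<in> P" "x \<in> Ball B" "z \<in> \<Omega> j" for p x z
    using mult_mono[OF s_le_1[OF that(1)] C(3)[OF that]] by (simp add: norm_mult)
  have 2: "norm (of_real (s p) * F p x z - of_real (s p) * F p y z) \<le> C * \<bar>s p\<bar> * \<delta>"
    if "p \<in> P" "x \<in> Ball B" "y \<in> Ball B" "near \<delta> x y" "z \<in> \<Omega> j" for p x y \<delta> z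
    using mult_left_mono[OF C(4)[OF that], of "\<bar>s p\<bar>"]
    unfolding right_diff_distrib[symmetric] norm_mult by (simp add: mult_ac)
  show ?thesis unfolding BL_def
    by (intro exI[of _ C]) (use C 1 2 in \<open>auto intro!: holomorphic_intros\<close>)
qed

lemma BL_eval:
  assumes "BL w B j F" "\<And>p. p \<in> P \<Longrightarrow> e p \<in> \<Omega> j"
  shows "BL w B i (\<lambda>p x z. F p x (e p))"
proof -
  obtain C where C: "C \<ge> 0" "\<And>p x z. p \<in> P \<Longrightarrow> x \<in> Ball B \<Longrightarrow> z \<in> \<Omega> j \<Longrightarrow> norm (F p x z) \<le> C"
    "\<And>p x y \<delta> z. p \<in> P \<Longrightarrow> x \<in> Ball B \<Longrightarrow> y \<in> Ball B \<Longrightarrow> near \<delta> x y \<Longrightarrow> z \<in> \<Omega> j \<Longrightarrow> norm (F p x z - F p y z) \<le> C * w p * \<delta>"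
    by (rule BL_E[OF assms(1)]) blast
  then show ?thesis unfolding BL_def using assms(2) by (intro exI[of _ C]) auto
qed

lemma BL_prim:
  assumes "BL w B j F" "\<And>p. p \<in> P \<Longrightarrow> e p \<in> \<Omega> j"
  shows "BL w B j (\<lambda>p x. prim (e p) (F p x))"
proof -
  obtain C where C: "C \<ge> 0" "\<And>p x. p \<in> P \<Longrightarrow> x \<in> Ball B \<Longrightarrow> F p x holomorphic_on \<Omega> j"
    "\<And>p x z. p \<in> P \<Longrightarrow> x \<in> Ball B \<Longrightarrow> z \<in> \<Omega> j \<Longrightarrow> norm (F p x z) \<le> C"
    "\<And>p x y \<delta> z. p \<in> P \<Longrightarrow> x \<in> Ball B \<Longrightarrow> y \<in> Ball B \<Longrightarrow> near \<delta> x y \<Longrightarrow> z \<in> \<Omega> j \<Longrightarrow> norm (F p x z - F p y z) \<le> C * w p * \<delta>"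
    by (rule BL_E[OF assms(1)]) blast
  let ?D = "diameter (\<Omega> j)"
  have D: "norm (z - e p) \<le> ?D" if "z \<in> \<Omega> j" "p \<in> P" for z p
    using diameter_bounded_bound[OF bounded_dom that(1) assms(2)[OF that(2)]] by (simp add: dist_norm)
  note oc = open_dom[of j] convex_dom[of j]
  have 1: "norm (prim (e p) (F p x) z) \<le> C * ?D" if "p \<in> P" "x \<in> Ball B" "z \<in> \<Omega> j" for p x z
    using order_trans[OF prim_bound[OF oc C(2)[OF that(1,2)] assms(2)[OF that(1)] that(3) C(3)[OF that(1,2)]]
      mult_left_mono[OF D[OF that(3,1)] C(1)]] by simp
  have 2: "norm (prim (e p) (F p x) z - prim (e p) (F p y) z) \<le> C * ?D * w p * \<delta>"
    if "p \<in> P" "x \<in> Ball B" "y \<in> Ball B" "near \<delta> x y" "z \<in> \<Omega> j" for p x y \<delta> z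
  proof -
    have "norm (prim (e p) (\<lambda>u. F p x u - F p y u) z) \<le> (C * w p * \<delta>) * norm (z - e p)"
      by (rule prim_bound[OF oc _ assms(2)]) (use that C in \<open>auto intro!: holomorphic_intros\<close>)
    also have "\<dots> \<le> (C * w p * \<delta>) * ?D"
      by (intro mult_left_mono D that order_trans[OF norm_ge_zero C(4)[OF that]])
    finally show ?thesis using prim_diff[OF oc C(2) C(2) assms(2), of p x p y p z] that by (simp add: mult_ac)
  qed
  show ?thesis unfolding BL_def
    by (intro exI[of _ "C * ?D"])
       (use C 1 2 assms in \<open>auto intro!: prim_holomorphic[OF oc] mult_nonneg_nonneg diameter_ge_0 bounded_dom\<close>)
qed

text \<open>\<open>sing_solve\<close> is a choice and not visibly linear. But the difference of the
  solutions for \<open>x\<close> and \<open>y\<close> solves the problem whose right-hand side is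
  the difference, and \<open>sing_quotient_bound\<close> applies to it.\<close>

lemma BL_sing_solve:
  assumes "BL w B j F" "\<And>p. p \<in> P \<Longrightarrow> e1 p \<in> \<Omega> j" "\<And>p. p \<in> P \<Longrightarrow> e2 p \<in> \<Omega> j"
    and "d0 > 0" "\<And>p. p \<in> P \<Longrightarrow> d0 \<le> norm (e2 p - e1 p)"
    and "k0 > 0" "\<And>p z. p \<in> P \<Longrightarrow> z \<in> \<Omega> j \<Longrightarrow> k0 \<le> norm (k p z)" "\<And>p. p \<in> P \<Longrightarrow> k p holomorphic_on \<Omega> j"
  shows "BL w B j (\<lambda>p x. sing_solve (\<Omega> j) (e1 p) (e2 p) (k p) (F p x))"
proof -
  obtain C where C: "C \<ge> 0" "\<And>p x. p \<in> P \<Longrightarrow> x \<in> Ball B \<Longrightarrow> F p x holomorphic_on \<Omega> j"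
    "\<And>p x z. p \<in> P \<Longrightarrow> x \<in> Ball B \<Longrightarrow> z \<in> \<Omega> j \<Longrightarrow> norm (F p x z) \<le> C"
    "\<And>p x y \<delta> z. p \<in> P \<Longrightarrow> x \<in> Ball B \<Longrightarrow> y \<in> Ball B \<Longrightarrow> near \<delta> x y \<Longrightarrow> z \<in> \<Omega> j \<Longrightarrow> norm (F p x z - F p y z) \<le> C * w p * \<delta>"
    by (rule BL_E[OF assms(1)]) blast
  note oc = open_dom[of j] convex_dom[of j]
  let ?S = "\<lambda>p x. sing_solve (\<Omega> j) (e1 p) (e2 p) (k p) (F p x)"
  have ne: "e1 p \<noteq> e2 p" if "p \<in> P" for p using assms(4) assms(5)[OF that] by auto
  have kn: "k p z \<noteq> 0" if "p \<in> P" "z \<in> \<Omega> j" for p z using assms(6) assms(7)[OF that] by auto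
  have S: "?S p x holomorphic_on \<Omega> j"
    "z \<in> \<Omega> j \<Longrightarrow> (z - e1 p) * (z - e2 p) * k p z * ?S p x z = prim (e1 p) (\<lambda>u. F p x u - mean (e1 p) (e2 p) (F p x)) z"
    if "p \<in> P" "x \<in> Ball B" for p x z
    using sing_solve[OF oc C(2)[OF that] assms(8) kn assms(2,3) ne] that by blast+
  have dk: "4 * c / (norm (e2 p - e1 p) * k0) \<le> 4 * c / (d0 * k0)" if "c \<ge> 0" "p \<in> P" for c p
    using that assms(4,5,6) by (intro divide_left_mono mult_right_mono mult_pos_pos) force+
  have 1: "norm (?S p x z) \<le> 4 * C / (d0 * k0)" if "p \<in> P" "x \<in> Ball B" "z \<in> \<Omega> j" for p x z
    using order_trans[OF sing_quotient_bound[OF oc C(2,3) assms(6,7) assms(2,3) ne S that(3)] dk[OF C(1)]] that by blast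
  have 2: "norm (?S p x z - ?S p y z) \<le> 4 * C / (d0 * k0) * w p * \<delta>"
    if t: "p \<in> P" "x \<in> Ball B" "y \<in> Ball B" "near \<delta> x y" "z \<in> \<Omega> j" for p x y \<delta> z
  proof -
    let ?f = "\<lambda>u. F p x u - F p y u"
    have hf: "F p x holomorphic_on \<Omega> j" "F p y holomorphic_on \<Omega> j" using C(2) t by auto
    have m: "mean (e1 p) (e2 p) ?f = mean (e1 p) (e2 p) (F p x) - mean (e1 p) (e2 p) (F p y)"
      using prim_diff[OF oc hf] assms(2,3) t(1) by (simp add: mean_def diff_divide_distrib)
    have eq: "(u - e1 p) * (u - e2 p) * k p u * (?S p x u - ?S p y u) = prim (e1 p) (\<lambda>u. ?f u - mean (e1 p) (e2 p) ?f) u"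
      if u: "u \<in> \<Omega> j" for u
    proof -
      have "prim (e1 p) (\<lambda>u. ?f u - mean (e1 p) (e2 p) ?f) u =
        prim (e1 p) (\<lambda>u. (F p x u - mean (e1 p) (e2 p) (F p x)) - (F p y u - mean (e1 p) (e2 p) (F p y))) u"
        unfolding m by (simp add: algebra_simps)
      also have "\<dots> = prim (e1 p) (\<lambda>u. F p x u - mean (e1 p) (e2 p) (F p x)) u - prim (e1 p) (\<lambda>u. F p y u - mean (e1 p) (e2 p) (F p y)) u"
        by (rule prim_diff[OF oc]) (use hf assms(2) t u in \<open>auto intro!: holomorphic_intros\<close>)
      finally show ?thesis using S(2)[OF t(1,2) u] S(2)[OF t(1,3) u] by (simp add: algebra_simps)
    qed
    have "norm (?S p x z - ?S p y z) \<le> 4 * (C * w p * \<delta>) / (norm (e2 p - e1 p) * k0)"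
      by (rule sing_quotient_bound[OF oc _ _ assms(6,7) assms(2,3) ne _ eq])
         (use t C S in \<open>auto intro!: holomorphic_intros\<close>)
    also have "\<dots> \<le> 4 * (C * w p * \<delta>) / (d0 * k0)"
      by (intro dk order_trans[OF norm_ge_zero C(4)[OF t]] t)
    finally show ?thesis by (simp add: mult_ac)
  qed
  show ?thesis unfolding BL_def
    by (intro exI[of _ "4 * C / (d0 * k0)"]) (use C 1 2 S(1) assms(4,6) in auto)
qed

text \<open>Banach iteration started at 0. The Lipschitz constants may grow with the ball, so the
  radius \<open>B\<close> is fixed first, from a bound for \<open>F\<close> at 0, and the threshold
  for \<open>s p\<close> afterwards. The last estimate compares the fixed point with the first
  iterate.\<close>

theorem fixed_point:
  assumes "\<And>i B. B \<ge> 0 \<Longrightarrow> BL (\<lambda>p. \<bar>s p\<bar>) B i (F i)"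
  shows "\<exists>\<epsilon>>0. \<exists>C\<ge>0. \<forall>p\<in>P. \<bar>s p\<bar> < \<epsilon> \<longrightarrow> (\<exists>x\<in>Ball C. (\<forall>i. \<forall>z\<in>\<Omega> i. x i z = F i p x z) \<and>
     (\<forall>i. \<forall>z\<in>\<Omega> i. norm (x i z - F i p (\<lambda>_ _. 0) z) \<le> C * \<bar>s p\<bar>))"
proof -
  \<comment> \<open>The index type is finite, so the sum of the individual constants serves all
    components.\<close>
  have uni: "\<exists>C\<ge>0. \<forall>i. \<forall>p\<in>P. \<forall>x\<in>Ball B. F i p x holomorphic_on \<Omega> i \<and>
     (\<forall>z\<in>\<Omega> i. norm (F i p x z) \<le> C) \<and>
     (\<forall>y\<in>Ball B. \<forall>\<delta>. near \<delta> x y \<longrightarrow> (\<forall>z\<in>\<Omega> i. norm (F i p x z - F i p y z) \<le> C * \<bar>s p\<bar> * \<delta>))" if "B \<ge> 0" for B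
  proof -
    have "\<forall>i. \<exists>c. c \<ge> 0 \<and> (\<forall>p\<in>P. \<forall>x\<in>Ball B. F i p x holomorphic_on \<Omega> i \<and> (\<forall>z\<in>\<Omega> i. norm (F i p x z) \<le> c) \<and>
      (\<forall>y\<in>Ball B. \<forall>\<delta>. near \<delta> x y \<longrightarrow> (\<forall>z\<in>\<Omega> i. norm (F i p x z - F i p y z) \<le> c * \<bar>s p\<bar> * \<delta>)))"
      using assms[OF that] unfolding BL_def by blast
    from choice[OF this] obtain c where c': "\<forall>i. c i \<ge> 0 \<and> (\<forall>p\<in>P. \<forall>x\<in>Ball B. F i p x holomorphic_on \<Omega> i \<and> (\<forall>z\<in>\<Omega> i. norm (F i p x z) \<le> c i) \<and>
      (\<forall>y\<in>Ball B. \<forall>\<delta>. near \<delta> x y \<longrightarrow> (\<forall>z\<in>\<Omega> i. norm (F i p x z - F i p y z) \<le> c i * \<bar>s p\<bar> * \<delta>)))" ..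
    have c: "\<And>i. c i \<ge> 0" "\<And>i p x. p \<in> P \<Longrightarrow> x \<in> Ball B \<Longrightarrow> F i p x holomorphic_on \<Omega> i"
      "\<And>i p x z. p \<in> P \<Longrightarrow> x \<in> Ball B \<Longrightarrow> z \<in> \<Omega> i \<Longrightarrow> norm (F i p x z) \<le> c i"
      "\<And>i p x y \<delta> z. p \<in> P \<Longrightarrow> x \<in> Ball B \<Longrightarrow> y \<in> Ball B \<Longrightarrow> near \<delta> x y \<Longrightarrow> z \<in> \<Omega> i \<Longrightarrow> norm (F i p x z - F i p y z) \<le> c i * \<bar>s p\<bar> * \<delta>"
      using c' by blast+
    have le: "c i \<le> (\<Sum>i\<in>UNIV. c i)" for i by (rule member_le_sum) (use c in auto)
    show ?thesis
    proof (intro exI[of _ "\<Sum>i\<in>UNIV. c i"] conjI allI ballI impI)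
      show "0 \<le> (\<Sum>i\<in>UNIV. c i)" by (intro sum_nonneg c)
      show "norm (F i p x z - F i p y z) \<le> (\<Sum>i\<in>UNIV. c i) * \<bar>s p\<bar> * \<delta>"
        if "p \<in> P" "x \<in> Ball B" "y \<in> Ball B" "near \<delta> x y" "z \<in> \<Omega> i" for i p x y \<delta> z
        using order_trans[OF c(4)[OF that]] le[of i] near_nonneg[OF that(4)] by (simp add: mult_right_mono)
      show "norm (F i p x z) \<le> (\<Sum>i\<in>UNIV. c i)" if "p \<in> P" "x \<in> Ball B" "z \<in> \<Omega> i" for i p x z
        using c(3)[OF that] le[of i] by linarith
    qed (use c(2) in auto)
  qed
  obtain C1 where C1: "C1 \<ge> 0" "\<And>i p x z. p \<in> P \<Longrightarrow> x \<in> Ball 1 \<Longrightarrow> z \<in> \<Omega> i \<Longrightarrow> norm (F i p x z) \<le> C1"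
    using uni[of 1] by (meson zero_le_one)
  \<comment> \<open>Half of the radius is reserved for the value of \<open>F\<close> at 0, the other
    half for the contraction.\<close>
  define B where "B = 2 * C1 + 1"
  have B: "B \<ge> 0" "C1 \<le> B / 2" using C1 by (auto simp: B_def)
  obtain C where C: "C \<ge> 0" "\<And>i p x. p \<in> P \<Longrightarrow> x \<in> Ball B \<Longrightarrow> F i p x holomorphic_on \<Omega> i"
      "\<And>i p x y \<delta> z. p \<in> P \<Longrightarrow> x \<in> Ball B \<Longrightarrow> y \<in> Ball B \<Longrightarrow> near \<delta> x y \<Longrightarrow> z \<in> \<Omega> i \<Longrightarrow> norm (F i p x z - F i p y z) \<le> C * \<bar>s p\<bar> * \<delta>"
    using uni[OF B(1)] by blast
  \<comment> \<open>Makes the Lipschitz constant \<open>C * \<bar>s p\<bar>\<close> at most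
    \<open>1 / 2\<close>.\<close>
  define \<epsilon> where "\<epsilon> = 1 / (2 * C + 1)"
  \<comment> \<open>One constant serves as radius of the ball and as rate of approximation.\<close>
  define C' where "C' = max B (C * B)"
  have zB: "(\<lambda>_ _. 0) \<in> Ball b" if "b \<ge> 0" for b using that by (simp add: Ball_def)
  have main: "\<exists>x\<in>Ball B. (\<forall>i. \<forall>z\<in>\<Omega> i. x i z = F i p x z) \<and>
     (\<forall>i. \<forall>z\<in>\<Omega> i. norm (x i z - F i p (\<lambda>_ _. 0) z) \<le> C * \<bar>s p\<bar> * B)"
    if p: "p \<in> P" "\<bar>s p\<bar> < \<epsilon>" for p
  proof -
    have "C * \<bar>s p\<bar> \<le> C * \<epsilon>" using p C(1) by (intro mult_left_mono) auto
    also have "\<dots> \<le> 1 / 2" using C(1) by (simp add: \<epsilon>_def field_simps)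
    finally have half: "C * \<bar>s p\<bar> \<le> 1 / 2" .
    define \<Phi> where "\<Phi> x = (\<lambda>i. F i p x)" for x
    have near0: "near B x (\<lambda>_ _. 0)" if "x \<in> Ball B" for x using that by (auto simp: Ball_def near_def)
    have contr: "near (\<delta> / 2) (\<Phi> x) (\<Phi> y)" if "x \<in> Ball B" "y \<in> Ball B" "near \<delta> x y" for x y \<delta>
      unfolding near_def \<Phi>_def
      using C(3)[OF p(1) that] mult_right_mono[OF half near_nonneg[OF that(3)]] by fastforce
    have inv: "\<Phi> x \<in> Ball B" if x: "x \<in> Ball B" for x
      unfolding Ball_def \<Phi>_def
    proof (intro CollectI allI conjI ballI)
      fix i z assume z: "z \<in> \<Omega> i"
      have "norm (F i p x z - F i p (\<lambda>_ _. 0) z) \<le> B / 2"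
        using contr[OF x zB[OF B(1)] near0[OF x]] z by (auto simp: near_def \<Phi>_def)
      moreover have "norm (F i p (\<lambda>_ _. 0) z) \<le> B / 2" using C1(2)[OF p(1) zB z] B(2) by fastforce
      ultimately show "norm (F i p x z) \<le> B"
        using norm_triangle_sub[of "F i p x z" "F i p (\<lambda>_ _. 0) z"] by linarith
    qed (use C(2) p x in auto)
    define X where "X n = (\<Phi> ^^ n) (\<lambda>_ _. 0)" for n
    have XB: "X n \<in> Ball B" for n unfolding X_def by (induction n) (auto intro: inv zB B)
    have Xs: "near (B / 2 ^ n) (X (Suc n)) (X n)" for n
    proof (induction n)
      case 0
      then show ?case using near0[OF XB[of 1]] by (simp add: X_def)
    next
      case (Suc n)
      then show ?case using contr[OF XB XB Suc] by (simp add: X_def mult.commute)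
    qed
    have "\<exists>g. \<forall>n. \<forall>z\<in>\<Omega> i. norm (X n i z - g z) \<le> 2 * B / 2 ^ n" for i
      by (rule geometric_uniform_limit) (use Xs in \<open>auto simp: near_def\<close>)
    then obtain x where x: "\<And>i n z. z \<in> \<Omega> i \<Longrightarrow> norm (X n i z - x i z) \<le> 2 * B / 2 ^ n" by metis
    have lim0: "(\<lambda>n. 2 * B / 2 ^ n) \<longlonglongrightarrow> 0" by (rule LIMSEQ_divide_realpow_zero) simp
    have lim: "(\<lambda>n. X n i z) \<longlonglongrightarrow> x i z" if "z \<in> \<Omega> i" for i z
      by (rule LIM_zero_cancel, rule tendsto_norm_zero_cancel, rule tendsto_sandwich[OF _ _ tendsto_const lim0])
         (use x[OF that] in auto)
    have ul: "uniform_limit (\<Omega> i) (\<lambda>n. X n i) (x i) sequentially" for i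
    proof (rule uniform_limitI)
      fix e :: real assume "e > 0"
      from order_tendstoD(2)[OF lim0 this]
      show "\<forall>\<^sub>F n in sequentially. \<forall>z\<in>\<Omega> i. dist (X n i z) (x i z) < e"
        by eventually_elim (use x in \<open>auto simp: dist_norm intro: le_less_trans\<close>)
    qed
    have "x i holomorphic_on \<Omega> i" for i
    proof (rule holomorphic_uniform_sequence[OF open_dom])
      show "X n i holomorphic_on \<Omega> i" for n using XB by (auto simp: Ball_def)
      show "\<exists>d>0. cball z d \<subseteq> \<Omega> i \<and> uniform_limit (cball z d) (\<lambda>n. X n i) (x i) sequentially" if "z \<in> \<Omega> i" for z
        using open_contains_cball[of "\<Omega> i"] open_dom that uniform_limit_on_subset[OF ul] by meson
    qed
    moreover have "norm (x i z) \<le> B" if "z \<in> \<Omega> i" for i z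
      by (rule tendsto_upperbound[OF tendsto_norm[OF lim[OF that]]]) (use XB that in \<open>auto simp: Ball_def\<close>)
    ultimately have xB: "x \<in> Ball B" by (auto simp: Ball_def)
    have fx: "x i z = F i p x z" if z: "z \<in> \<Omega> i" for i z
    proof -
      have nx: "near (2 * B / 2 ^ n) (X n) x" for n using x by (auto simp: near_def)
      have "norm (X (Suc n) i z - F i p x z) \<le> 2 * B / 2 ^ n / 2" for n
        using contr[OF XB xB nx] z by (auto simp: near_def X_def \<Phi>_def)
      then have "norm (X (Suc n) i z - F i p x z) \<le> 2 * B / 2 ^ Suc n" for n by simp
      then have "(\<lambda>n. X (Suc n) i z) \<longlonglongrightarrow> F i p x z"
        by (intro LIM_zero_cancel[OF tendsto_norm_zero_cancel[OF tendsto_sandwich[OF _ _ tendsto_const LIMSEQ_Suc[OF lim0]]]]) auto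
      then show ?thesis using LIMSEQ_unique LIMSEQ_Suc[OF lim[OF z]] by blast
    qed
    moreover have "norm (x i z - F i p (\<lambda>_ _. 0) z) \<le> C * \<bar>s p\<bar> * B" if "z \<in> \<Omega> i" for i z
      using C(3)[OF p(1) xB zB[OF B(1)] near0[OF xB] that] fx[OF that] by simp
    ultimately show ?thesis using xB by blast
  qed
  have "\<epsilon> > 0" using C(1) by (simp add: \<epsilon>_def)
  moreover have "C' \<ge> 0" using B(1) by (simp add: C'_def)
  moreover have "\<exists>x\<in>Ball C'. (\<forall>i. \<forall>z\<in>\<Omega> i. x i z = F i p x z) \<and>
     (\<forall>i. \<forall>z\<in>\<Omega> i. norm (x i z - F i p (\<lambda>_ _. 0) z) \<le> C' * \<bar>s p\<bar>)" if "p \<in> P" "\<bar>s p\<bar> < \<epsilon>" for p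
  proof -
    have "Ball B \<subseteq> Ball C'" by (force simp: Ball_def C'_def le_max_iff_disj)
    moreover have "C * \<bar>s p\<bar> * B \<le> C' * \<bar>s p\<bar>"
      using mult_right_mono[of "C * B" C' "\<bar>s p\<bar>"] by (simp add: C'_def mult_ac)
    ultimately show ?thesis using main[OF that] by (meson order_trans subsetD)
  qed
  ultimately show ?thesis by blast
qed

end

section \<open>The separated equations as a fixed point problem\<close>

text \<open>The four unknowns: the correction of the frequency, the separation constant, and the
  derivatives of the radial and the angular function, both divided by \<open>s^2\<close>. The two
  numbers are carried as functions and read off at 0, so that one fixed point theorem covers
  everything.\<close>

datatype comp = Tau | Ell | Rad | Ang

instance comp :: finite
proof
  show "finite (UNIV :: comp set)"
    by (rule finite_subset[where B="{Tau, Ell, Rad, Ang}"]) (use comp.exhaust in auto)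
qed

text \<open>The constants \<open>cb\<close>, \<open>d0\<close>, \<open>k0\<close> do not depend on
  \<open>p\<close>. The bound \<open>1 / 8\<close> keeps \<open>1 + lam p * \<xi>\<^sup>2\<close>
  away from 0 on the disc of radius 2, which is the domain of the angular function.\<close>

locale mode_params =
  fixes P :: "'p set" and s M2 A2 lam a e1 e2 :: "'p \<Rightarrow> real" and k :: "'p \<Rightarrow> complex \<Rightarrow> complex"
    and \<Omega>r :: "complex set" and cb d0 k0 :: real
  assumes open_r: "open \<Omega>r" and convex_r: "convex \<Omega>r" and bounded_r: "bounded \<Omega>r" and ne_r: "\<Omega>r \<noteq> {}"
    and s_bd: "p \<in> P \<Longrightarrow> s p \<noteq> 0" "p \<in> P \<Longrightarrow> \<bar>s p\<bar> \<le> 1"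
    and M2_bd: "p \<in> P \<Longrightarrow> \<bar>M2 p\<bar> \<le> cb" and A2_bd: "p \<in> P \<Longrightarrow> \<bar>A2 p\<bar> \<le> cb" and a_bd: "p \<in> P \<Longrightarrow> \<bar>a p\<bar> \<le> cb"
    and lam_bd: "p \<in> P \<Longrightarrow> \<bar>lam p\<bar> \<le> 1 / 8"
    and e_dom: "p \<in> P \<Longrightarrow> of_real (e1 p) \<in> \<Omega>r" "p \<in> P \<Longrightarrow> of_real (e2 p) \<in> \<Omega>r"
    and d0: "d0 > 0" "p \<in> P \<Longrightarrow> d0 \<le> e2 p - e1 p"
    and k_hol: "p \<in> P \<Longrightarrow> k p holomorphic_on \<Omega>r"
    and k0: "k0 > 0" "p \<in> P \<Longrightarrow> z \<in> \<Omega>r \<Longrightarrow> k0 \<le> norm (k p z)"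
begin

text \<open>Scaled quantities: for the charge parameter \<open>s\<close> the mode has frequency \<open>\<sigma> = s Amp\<close>, radial function \<open>Rf\<close>,
  angular function \<open>Sf\<close> and separation constant \<open>s\<^sup>3 l\<close>, and \<open>M2 = m\<^sup>2 / s\<^sup>2\<close>, \<open>A2 = a\<^sup>2 / s\<^sup>2\<close>. The value \<open>sg1\<close> of
  \<open>\<sigma> / s\<close> at \<open>s = 0\<close> is the one for which constant \<open>R\<close>, \<open>S\<close> solve the equations to first order in \<open>s\<close>.\<close>

abbreviation "E1 p \<equiv> complex_of_real (e1 p)"
abbreviation "E2 p \<equiv> complex_of_real (e2 p)"

definition DD :: "'p \<Rightarrow> real" where "DD p = (e1 p)\<^sup>2 + (e2 p)\<^sup>2 + 2 * (a p)\<^sup>2"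
definition sg1 :: "'p \<Rightarrow> real" where "sg1 p = - (e1 p + e2 p) / DD p"
definition Amp :: "'p \<Rightarrow> complex \<Rightarrow> complex" where "Amp p \<tau> = of_real (sg1 p) + of_real (s p) * \<tau>"
text \<open>The slope of \<open>N\<close> divided by \<open>(1 + lam p) * s p\<close>. The choice of
  \<open>sg1\<close> cancels its part of order 0 in \<open>s\<close>, which leaves the factor
  \<open>s p * \<tau>\<close>.\<close>

definition be :: "'p \<Rightarrow> complex \<Rightarrow> complex" where
  "be p \<tau> = of_real (DD p / (e2 p - e1 p)) * (of_real (s p) * \<tau>)"
text \<open>This is \<open>N / s\<close>. It and the coefficients below are written as sums and
  products, differences included, since this is what the \<open>BL\<close> rules combine.\<close>

definition Nh :: "'p \<Rightarrow> complex \<Rightarrow> complex \<Rightarrow> complex" where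
  "Nh p \<tau> z = of_real (1 + lam p) * (Amp p \<tau> * of_real ((e2 p)\<^sup>2 + (a p)\<^sup>2) + E2 p + (z + of_real (- e2 p)) * be p \<tau>)"
text \<open>This is \<open>W / s^2\<close>. The first factor is what remains of
  \<open>N - (1 + lam p) K\<close> after its zero at \<open>e2\<close>, the second what remains of
  \<open>N + (1 + lam p) K\<close> after its zero at \<open>e1\<close>; the two zeros cancel against
  those of \<open>\<mu>\<close>.\<close>

definition Wh :: "'p \<Rightarrow> complex \<Rightarrow> complex \<Rightarrow> complex" where
  "Wh p \<tau> z = of_real ((1 + lam p)\<^sup>2) * ((be p \<tau> + (- 1) * (Amp p \<tau> * (z + E2 p)) + (- 1)) *
     (be p \<tau> + Amp p \<tau> * (z + E1 p) + 1)) * inverse (k p z)"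
definition Rf :: "'p \<Rightarrow> (complex \<Rightarrow> complex) \<Rightarrow> complex \<Rightarrow> complex" where
  "Rf p v z = 1 + of_real (s p) * (of_real (s p) * prim (E1 p) v z)"
text \<open>The angular potential divided by \<open>s^4\<close>: one \<open>s^2\<close> comes from
  \<open>a^2\<close>, the other from \<open>\<sigma>^2\<close> and \<open>m^2\<close>.\<close>

definition Uh :: "'p \<Rightarrow> complex \<Rightarrow> complex \<Rightarrow> complex" where
  "Uh p \<tau> \<xi> = of_real (A2 p) * (of_real ((1 + lam p)\<^sup>2) * (Amp p \<tau> * Amp p \<tau>) * (1 + (- 1) * (\<xi> * \<xi>)) *
     inverse (1 + of_real (lam p) * (\<xi> * \<xi>)) + of_real (M2 p) * (\<xi> * \<xi>))"
definition Sf :: "'p \<Rightarrow> (complex \<Rightarrow> complex) \<Rightarrow> complex \<Rightarrow> complex" where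
  "Sf p y \<xi> = 1 + of_real (s p) * (of_real (s p) * prim (- 1) y \<xi>)"

text \<open>Right-hand side of the radial equation divided by \<open>s^2\<close>, without the
  constant that the \<open>1\<close> in \<open>Rf\<close> contributes to the term with the slope of
  \<open>N\<close>. This constant has to be the mean of \<open>grad\<close>, which is the equation
  for \<open>\<tau>\<close>.\<close>

definition grad :: "'p \<Rightarrow> (comp \<Rightarrow> complex \<Rightarrow> complex) \<Rightarrow> complex \<Rightarrow> complex" where
  "grad p x z = (Wh p (x Tau 0) z + of_real (M2 p) * (z * z) + of_real (s p) * x Ell 0) * Rf p (x Rad) z
     + of_real (s p) * ((- 2 * \<i>) * (Nh p (x Tau 0) z * x Rad z))
     + of_real (s p) * (of_real (s p) * ((- \<i>) * (of_real ((1 + lam p) * DD p / (e2 p - e1 p)) * (x Tau 0 * prim (E1 p) (x Rad) z))))"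
text \<open>The same for the angular equation, divided by \<open>s^3\<close>; the constant left out
  is \<open>- l\<close>.\<close>

definition hang :: "'p \<Rightarrow> (comp \<Rightarrow> complex \<Rightarrow> complex) \<Rightarrow> complex \<Rightarrow> complex" where
  "hang p x \<xi> = of_real (s p) * (Uh p (x Tau 0) \<xi> * Sf p (x Ang) \<xi>)
     + of_real (s p) * (of_real (s p) * ((- 1) * (x Ell 0 * prim (- 1) (x Ang) \<xi>)))"

definition dom :: "comp \<Rightarrow> complex set" where "dom j = (if j = Rad then \<Omega>r else ball 0 2)"

text \<open>\<open>Tau\<close> and \<open>Ell\<close> are the solvability conditions, solved for the
  constants left out of \<open>grad\<close> and \<open>hang\<close>. \<open>Rad\<close> and
  \<open>Ang\<close> solve the equations after removal of the means.\<close>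

fun Fmap :: "comp \<Rightarrow> 'p \<Rightarrow> (comp \<Rightarrow> complex \<Rightarrow> complex) \<Rightarrow> complex \<Rightarrow> complex" where
  "Fmap Tau p x = (\<lambda>z. prim (E1 p) (grad p x) (E2 p) * (of_real (1 / ((1 + lam p) * DD p)) * (- \<i>)))"
| "Fmap Ell p x = (\<lambda>z. prim (- 1) (hang p x) 1 * (1 / 2))"
| "Fmap Rad p x = sing_solve \<Omega>r (E1 p) (E2 p) (k p) (grad p x)"
| "Fmap Ang p x = sing_solve (ball 0 2) (- 1) 1 (\<lambda>\<xi>. - (1 + of_real (lam p) * (\<xi> * \<xi>))) (\<lambda>\<xi>. of_real (s p) * hang p x \<xi>)"

sublocale holo_family dom P s
  by unfold_locales (use open_r convex_r bounded_r ne_r s_bd in \<open>auto simp: dom_def\<close>)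

section \<open>Uniform bounds for the parameters and coefficients\<close>

definition bdd :: "('p \<Rightarrow> real) \<Rightarrow> bool" where "bdd r \<longleftrightarrow> (\<exists>C. \<forall>p\<in>P. \<bar>r p\<bar> \<le> C)"

lemma bdd_add: "bdd f \<Longrightarrow> bdd g \<Longrightarrow> bdd (\<lambda>p. f p + g p)"
  unfolding bdd_def by (metis abs_triangle_ineq add_mono order_trans)

lemma bdd_mult: assumes "bdd f" "bdd g" shows "bdd (\<lambda>p. f p * g p)"
proof -
  obtain C D where "\<And>p. p \<in> P \<Longrightarrow> \<bar>f p\<bar> \<le> C" "\<And>p. p \<in> P \<Longrightarrow> \<bar>g p\<bar> \<le> D" using assms unfolding bdd_def by blast
  then have "\<bar>f p * g p\<bar> \<le> C * D" if "p \<in> P" for p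
    unfolding abs_mult using that by (intro mult_mono) (auto intro: order_trans[OF abs_ge_zero])
  then show ?thesis unfolding bdd_def by blast
qed

lemma bdd_const: "bdd (\<lambda>p. r)" unfolding bdd_def by blast

lemma bdd_basic: "bdd s" "bdd M2" "bdd A2" "bdd lam" "bdd a" "bdd e1" "bdd e2"
proof -
  obtain B where "\<And>z. z \<in> \<Omega>r \<Longrightarrow> norm z \<le> B" using bounded_r by (auto simp: bounded_iff)
  then show "bdd e1" "bdd e2" unfolding bdd_def using e_dom by (metis norm_of_real)+
qed (unfold bdd_def, (use s_bd M2_bd A2_bd a_bd lam_bd in blast)+)

lemma DD_lower: assumes "p \<in> P" shows "DD p \<ge> d0\<^sup>2 / 2" "DD p > 0"
proof -
  have "d0\<^sup>2 \<le> (e2 p - e1 p)\<^sup>2" using d0(2)[OF assms] d0(1) by (intro power_mono) auto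
  also have "(e2 p - e1 p)\<^sup>2 \<le> (e2 p - e1 p)\<^sup>2 + (e1 p + e2 p)\<^sup>2" by simp
  also have "\<dots> = 2 * ((e1 p)\<^sup>2 + (e2 p)\<^sup>2)" by (simp add: power2_eq_square algebra_simps)
  also have "\<dots> \<le> 2 * DD p" by (simp add: DD_def)
  finally show "DD p \<ge> d0\<^sup>2 / 2" by simp
  moreover have "d0\<^sup>2 / 2 > 0" using d0(1) by simp
  ultimately show "DD p > 0" by linarith
qed

lemma bdd_inverse: assumes "C > 0" "\<And>p. p \<in> P \<Longrightarrow> f p \<ge> C" shows "bdd (\<lambda>p. inverse (f p))"
  unfolding bdd_def
proof (intro exI ballI)
  fix p assume "p \<in> P"
  then show "\<bar>inverse (f p)\<bar> \<le> inverse C" using assms(1) assms(2)[of p] by (simp add: le_imp_inverse_le)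
qed

lemma bdd_derived: "bdd (\<lambda>p. inverse (e2 p - e1 p))" "bdd (\<lambda>p. inverse (DD p))" "bdd (\<lambda>p. inverse (1 + lam p))" "bdd DD"
  "bdd sg1"
proof -
  show 1: "bdd (\<lambda>p. inverse (e2 p - e1 p))" by (rule bdd_inverse[OF d0])
  show 2: "bdd (\<lambda>p. inverse (DD p))" by (rule bdd_inverse[OF _ DD_lower(1)]) (use d0(1) in simp)
  show "bdd (\<lambda>p. inverse (1 + lam p))" by (rule bdd_inverse[of "7 / 8"]) (use lam_bd in \<open>auto dest!: abs_le_D2 lam_bd\<close>)
  show "bdd DD" unfolding DD_def[abs_def] power2_eq_square by (intro bdd_add bdd_mult bdd_basic bdd_const)
  have "bdd (\<lambda>p. (- 1) * (e1 p + e2 p) * inverse (DD p))" by (intro bdd_add bdd_mult bdd_basic bdd_const 2)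
  then show "bdd sg1" by (simp add: sg1_def[abs_def] divide_inverse)
qed

abbreviation "SL \<equiv> BL (\<lambda>p. \<bar>s p\<bar>)"
abbreviation "B1 \<equiv> BL (\<lambda>p. 1)"

lemma SL_B1: "SL B j F \<Longrightarrow> B1 B j F" by (rule BL_weaken) (auto simp: s_bd)

lemma SL_bdd: "bdd r \<Longrightarrow> SL B j (\<lambda>p x z. complex_of_real (r p))"
  unfolding bdd_def by (elim exE) (rule BL_const, auto)

lemma SL_cconst: "SL B j (\<lambda>p x z. c)"
  by (rule BL_const[where C="norm c"]) auto

lemma SL_z: "SL B j (\<lambda>p x z. z)"
proof -
  obtain C where "\<And>z. z \<in> dom j \<Longrightarrow> norm z \<le> C" using bounded_dom[of j] by (auto simp: bounded_iff)
  then show ?thesis by (intro BL_const[where C=C]) auto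
qed

lemma B1_scalar: "B \<ge> 0 \<Longrightarrow> B1 B j (\<lambda>p x z. x Tau 0)" "B \<ge> 0 \<Longrightarrow> B1 B j (\<lambda>p x z. x Ell 0)"
  by (rule BL_eval[OF BL_component[of B Tau], of "\<lambda>_. 0"] BL_eval[OF BL_component[of B Ell], of "\<lambda>_. 0"]; simp add: dom_def)+

lemma E_dom': "p \<in> P \<Longrightarrow> E1 p \<in> dom Rad" "p \<in> P \<Longrightarrow> E2 p \<in> dom Rad" using e_dom by (auto simp: dom_def)

lemma B1_prim: "B \<ge> 0 \<Longrightarrow> B1 B Rad (\<lambda>p x. prim (E1 p) (x Rad))" "B \<ge> 0 \<Longrightarrow> B1 B Ang (\<lambda>p x. prim (- 1) (x Ang))"
  by (rule BL_prim[OF BL_component E_dom'(1)], assumption+)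
     (rule BL_prim[OF BL_component[of B Ang], of "\<lambda>_. - 1"], auto simp: dom_def)

lemma SL_Amp: "B \<ge> 0 \<Longrightarrow> SL B j (\<lambda>p x z. Amp p (x Tau 0))"
  unfolding Amp_def by (intro BL_add SL_bdd bdd_derived BL_s_mult B1_scalar)

lemma bdd_DDe: "bdd (\<lambda>p. DD p / (e2 p - e1 p))"
  unfolding divide_inverse by (intro bdd_mult bdd_derived)

lemma SL_be: "B \<ge> 0 \<Longrightarrow> SL B j (\<lambda>p x z. be p (x Tau 0))"
  unfolding be_def by (rule BL_mult[OF SL_bdd[OF bdd_DDe] BL_s_mult[OF B1_scalar(1)]])

lemma bdd_lam1: "bdd (\<lambda>p. 1 + lam p)" "bdd (\<lambda>p. (1 + lam p)\<^sup>2)" "bdd (\<lambda>p. (e2 p)\<^sup>2 + (a p)\<^sup>2)" "bdd (\<lambda>p. - e2 p)"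
  using bdd_mult[OF bdd_const[of "- 1"] bdd_basic(7)]
  unfolding power2_eq_square by (auto intro!: bdd_add bdd_mult bdd_const bdd_basic)

lemma SL_Nh: "B \<ge> 0 \<Longrightarrow> SL B j (\<lambda>p x z. Nh p (x Tau 0) z)"
  unfolding Nh_def by (intro BL_mult BL_add SL_Amp SL_be SL_z SL_bdd bdd_lam1 bdd_basic)

lemma SL_inverse_k: "SL B Rad (\<lambda>p x z. inverse (k p z))"
proof (rule BL_const[where C="inverse k0"])
  fix p assume p: "p \<in> P"
  have nz: "k p z \<noteq> 0" if "z \<in> \<Omega>r" for z using k0(2)[OF p that] k0(1) by auto
  then show "(\<lambda>z. inverse (k p z)) holomorphic_on dom Rad"
    using k_hol[OF p] by (auto simp: dom_def intro!: holomorphic_intros)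
  show "norm (inverse (k p z)) \<le> inverse k0" if "z \<in> dom Rad" for z
    using k0(2)[OF p, of z] k0(1) that by (simp add: dom_def norm_inverse le_imp_inverse_le)
qed simp

lemma SL_Wh: "B \<ge> 0 \<Longrightarrow> SL B Rad (\<lambda>p x z. Wh p (x Tau 0) z)"
  unfolding Wh_def by (intro BL_mult BL_add SL_Amp SL_be SL_z SL_cconst SL_inverse_k SL_bdd bdd_lam1 bdd_basic)

lemma SL_Rf: "B \<ge> 0 \<Longrightarrow> SL B Rad (\<lambda>p x z. Rf p (x Rad) z)"
  unfolding Rf_def by (intro BL_add SL_cconst BL_s_mult SL_B1 B1_prim)

lemma kappa_lower: "p \<in> P \<Longrightarrow> z \<in> ball 0 2 \<Longrightarrow> 1 / 2 \<le> norm (1 + complex_of_real (lam p) * (z * z))"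
proof -
  assume p: "p \<in> P" and z: "z \<in> ball (0::complex) 2"
  have "\<bar>lam p\<bar> * (norm z * norm z) \<le> 1 / 8 * (2 * 2)"
    using lam_bd[OF p] z by (intro mult_mono) auto
  then have "norm (complex_of_real (lam p) * (z * z)) \<le> 1 / 2" by (simp add: norm_mult)
  then show ?thesis using norm_diff_ineq[of 1 "complex_of_real (lam p) * (z * z)"] by simp
qed

lemma SL_inverse_kappa: "j \<noteq> Rad \<Longrightarrow> SL B j (\<lambda>p x z. inverse (1 + complex_of_real (lam p) * (z * z)))"
proof (rule BL_const[where C=2])
  fix p assume j: "j \<noteq> Rad" and p: "p \<in> P"
  have nz: "1 + complex_of_real (lam p) * (z * z) \<noteq> 0" if "z \<in> ball 0 2" for z using kappa_lower[OF p that] by auto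
  then show "(\<lambda>z. inverse (1 + complex_of_real (lam p) * (z * z))) holomorphic_on dom j"
    using j by (auto simp: dom_def intro!: holomorphic_intros)
  show "norm (inverse (1 + complex_of_real (lam p) * (z * z))) \<le> 2" if "z \<in> dom j" for z
    using le_imp_inverse_le[OF kappa_lower[OF p, of z]] that j by (simp add: dom_def norm_inverse)
qed simp

lemma SL_Uh: "B \<ge> 0 \<Longrightarrow> j \<noteq> Rad \<Longrightarrow> SL B j (\<lambda>p x z. Uh p (x Tau 0) z)"
  unfolding Uh_def by (intro BL_mult BL_add SL_Amp SL_z SL_cconst SL_inverse_kappa SL_bdd bdd_lam1 bdd_basic)

lemma SL_Sf: "B \<ge> 0 \<Longrightarrow> SL B Ang (\<lambda>p x z. Sf p (x Ang) z)"
  unfolding Sf_def by (intro BL_add SL_cconst BL_s_mult SL_B1 B1_prim)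

text \<open>Every unknown enters with an explicit factor \<open>s p\<close>, inside
  \<open>Amp\<close>, \<open>be\<close> and \<open>Rf\<close> as well; this is what makes the map a
  contraction for small \<open>s p\<close>.\<close>

lemma SL_grad: assumes "B \<ge> 0" shows "SL B Rad grad"
proof -
  have "bdd (\<lambda>p. (1 + lam p) * DD p / (e2 p - e1 p))"
    unfolding divide_inverse by (intro bdd_mult bdd_derived bdd_lam1)
  then have 3: "B1 B Rad (\<lambda>p x z. (- \<i>) * (of_real ((1 + lam p) * DD p / (e2 p - e1 p)) * (x Tau 0 * prim (E1 p) (x Rad) z)))"
    by (intro BL_mult[OF SL_B1[OF SL_cconst]] BL_mult[OF SL_B1[OF SL_bdd]] BL_mult B1_scalar B1_prim assms)
  have 2: "B1 B Rad (\<lambda>p x z. (- 2 * \<i>) * (Nh p (x Tau 0) z * x Rad z))"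
    by (intro BL_mult[OF SL_B1[OF SL_cconst]] BL_mult SL_B1[OF SL_Nh] BL_component assms)
  have 1: "SL B Rad (\<lambda>p x z. (Wh p (x Tau 0) z + of_real (M2 p) * (z * z) + of_real (s p) * x Ell 0) * Rf p (x Rad) z)"
    by (rule BL_mult[OF BL_add[OF BL_add[OF SL_Wh BL_mult[OF SL_bdd BL_mult[OF SL_z SL_z]]] BL_s_mult[OF B1_scalar(2)]] SL_Rf])
       (rule assms bdd_basic)+
  show ?thesis unfolding grad_def[abs_def]
    by (rule BL_add[OF BL_add[OF 1 BL_s_mult[OF 2]] BL_s_mult[OF SL_B1[OF BL_s_mult[OF 3]]]])
qed

lemma SL_hang: assumes "B \<ge> 0" shows "SL B Ang hang"
proof -
  have 1: "B1 B Ang (\<lambda>p x z. Uh p (x Tau 0) z * Sf p (x Ang) z)"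
    by (intro BL_mult SL_B1[OF SL_Uh] SL_B1[OF SL_Sf] assms) simp
  have 2: "B1 B Ang (\<lambda>p x z. (- 1) * (x Ell 0 * prim (- 1) (x Ang) z))"
    by (intro BL_mult[OF SL_B1[OF SL_cconst]] BL_mult B1_scalar B1_prim assms)
  show ?thesis unfolding hang_def[abs_def]
    by (rule BL_add[OF BL_s_mult[OF 1] BL_s_mult[OF SL_B1[OF BL_s_mult[OF 2]]]])
qed

lemma SL_Fmap: assumes "B \<ge> 0" shows "SL B j (Fmap j)"
proof (cases j)
  case Tau
  have "bdd (\<lambda>p. 1 / ((1 + lam p) * DD p))"
    unfolding divide_inverse inverse_mult_distrib by (intro bdd_mult bdd_const bdd_derived)
  then have "SL B j (\<lambda>p x z. prim (E1 p) (grad p x) (E2 p) * (of_real (1 / ((1 + lam p) * DD p)) * (- \<i>)))"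
    by (intro BL_mult[OF _ BL_mult[OF SL_bdd SL_cconst]] BL_eval[OF BL_prim[OF SL_grad[OF assms] E_dom'(1)] E_dom'(2)])
  then show ?thesis by (simp add: Tau Fmap.simps[abs_def])
next
  case Ell
  have "SL B j (\<lambda>p x z. prim (- 1) (hang p x) 1 * (1 / 2))"
    by (rule BL_mult[OF BL_eval[OF BL_prim[OF SL_hang[OF assms], of "\<lambda>_. - 1"], of "\<lambda>_. 1"] SL_cconst]) (auto simp: dom_def)
  then show ?thesis by (simp add: Ell Fmap.simps[abs_def])
next
  case Rad
  have "SL B Rad (\<lambda>p x. sing_solve (dom Rad) (E1 p) (E2 p) (k p) (grad p x))"
    by (rule BL_sing_solve[OF SL_grad[OF assms] E_dom' d0(1) _ k0(1), where k=k])
       (use d0 k0 k_hol in \<open>auto simp: dom_def simp flip: of_real_diff intro: order_trans[OF _ abs_ge_self]\<close>)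
  then show ?thesis by (simp add: Rad Fmap.simps[abs_def] dom_def)
next
  case Ang
  have "SL B Ang (\<lambda>p x. sing_solve (dom Ang) (- 1) 1 (\<lambda>\<xi>. - (1 + of_real (lam p) * (\<xi> * \<xi>))) (\<lambda>\<xi>. of_real (s p) * hang p x \<xi>))"
  proof (rule BL_sing_solve[where ?d0.0=2 and ?k0.0="1/2" and k="\<lambda>p \<xi>. - (1 + of_real (lam p) * (\<xi> * \<xi>))"])
    show "SL B Ang (\<lambda>p x \<xi>. of_real (s p) * hang p x \<xi>)"
      by (rule BL_s_mult[OF SL_B1[OF SL_hang[OF assms]]])
    show "1 / 2 \<le> norm (- (1 + complex_of_real (lam p) * (z * z)))" if "p \<in> P" "z \<in> dom Ang" for p z
      using kappa_lower[OF that(1), of z] that(2) unfolding norm_minus_cancel by (simp add: dom_def)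
  qed (auto simp: dom_def intro!: holomorphic_intros)
  then show ?thesis by (simp add: Ang Fmap.simps[abs_def] dom_def)
qed

lemma BL_holomorphic: "BL w B j F \<Longrightarrow> p \<in> P \<Longrightarrow> x \<in> Ball B \<Longrightarrow> F p x holomorphic_on dom j"
  unfolding BL_def by blast

section \<open>The fixed point solves the separated equations\<close>

definition tau0 :: "'p \<Rightarrow> complex" where
  "tau0 p = prim (E1 p) (\<lambda>z. Wh p 0 z + of_real (M2 p) * (z * z)) (E2 p) * (of_real (1 / ((1 + lam p) * DD p)) * (- \<i>))"

text \<open>At the fixed point the means subtracted in \<open>sing_solve\<close> are exactly the
  constants left out of \<open>grad\<close> and \<open>hang\<close>, so the derivatives of the
  primitives are the full right-hand sides.\<close>

theorem modes_exist:
  "\<exists>\<epsilon>>0. \<exists>C\<ge>0. \<forall>p\<in>P. \<bar>s p\<bar> < \<epsilon> \<longrightarrow> (\<exists>\<tau> l v y. norm (\<tau> - tau0 p) \<le> C * \<bar>s p\<bar> \<and>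
     v holomorphic_on \<Omega>r \<and> y holomorphic_on ball 0 2 \<and>
     (\<forall>z\<in>\<Omega>r. ((\<lambda>z. (z - E1 p) * (z - E2 p) * k p z * v z) has_field_derivative
        (Wh p \<tau> z + of_real (M2 p) * (z * z) + of_real (s p) * l) * Rf p v z - 2 * \<i> * of_real (s p) * Nh p \<tau> z * v z
          - \<i> * of_real ((1 + lam p) * DD p / (e2 p - e1 p)) * \<tau> * Rf p v z) (at z)) \<and>
     (\<forall>z\<in>ball 0 2. ((\<lambda>z. (z + 1) * (z - 1) * (- (1 + of_real (lam p) * (z * z))) * y z) has_field_derivative
        ((of_real (s p))\<^sup>2 * Uh p \<tau> z - of_real (s p) * l) * Sf p y z) (at z)))"
proof -
  from fixed_point[OF SL_Fmap] obtain \<epsilon> C where eC: "\<epsilon> > 0" "C \<ge> 0" and fp: "\<forall>p\<in>P. \<bar>s p\<bar> < \<epsilon> \<longrightarrow>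
     (\<exists>x\<in>Ball C. (\<forall>i. \<forall>z\<in>dom i. x i z = Fmap i p x z) \<and>
     (\<forall>i. \<forall>z\<in>dom i. norm (x i z - Fmap i p (\<lambda>_ _. 0) z) \<le> C * \<bar>s p\<bar>))"
    by blast
  have "\<exists>\<tau> l v y. norm (\<tau> - tau0 p) \<le> C * \<bar>s p\<bar> \<and>
     v holomorphic_on \<Omega>r \<and> y holomorphic_on ball 0 2 \<and>
     (\<forall>z\<in>\<Omega>r. ((\<lambda>z. (z - E1 p) * (z - E2 p) * k p z * v z) has_field_derivative
        (Wh p \<tau> z + of_real (M2 p) * (z * z) + of_real (s p) * l) * Rf p v z - 2 * \<i> * of_real (s p) * Nh p \<tau> z * v z
          - \<i> * of_real ((1 + lam p) * DD p / (e2 p - e1 p)) * \<tau> * Rf p v z) (at z)) \<and>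
     (\<forall>z\<in>ball 0 2. ((\<lambda>z. (z + 1) * (z - 1) * (- (1 + of_real (lam p) * (z * z))) * y z) has_field_derivative
        ((of_real (s p))\<^sup>2 * Uh p \<tau> z - of_real (s p) * l) * Sf p y z) (at z))"
    if p: "p \<in> P" "\<bar>s p\<bar> < \<epsilon>" for p
  proof -
    obtain x where xB: "x \<in> Ball C" and fx: "\<And>i z. z \<in> dom i \<Longrightarrow> x i z = Fmap i p x z"
      and x0: "\<And>i z. z \<in> dom i \<Longrightarrow> norm (x i z - Fmap i p (\<lambda>_ _. 0) z) \<le> C * \<bar>s p\<bar>"
      using fp p by blast
    let ?t = "x Tau 0" and ?l = "x Ell 0" and ?v = "x Rad" and ?y = "x Ang"
    have xh: "x i holomorphic_on dom i" for i using xB by (simp add: Ball_def)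
    have hv: "?v holomorphic_on \<Omega>r" "?y holomorphic_on ball 0 2"
      using xh[of Rad] xh[of Ang] by (simp_all add: dom_def)
    have hg: "grad p x holomorphic_on \<Omega>r"
      using BL_holomorphic[OF SL_grad[OF eC(2)] p(1) xB] by (simp add: dom_def)
    have hh: "hang p x holomorphic_on ball 0 2"
      using BL_holomorphic[OF SL_hang[OF eC(2)] p(1) xB] by (simp add: dom_def)
    have kn: "k p z \<noteq> 0" if "z \<in> \<Omega>r" for z using k0(1) k0(2)[OF p(1) that] by auto
    have kn2: "- (1 + complex_of_real (lam p) * (z * z)) \<noteq> 0" if "z \<in> ball 0 2" for z
    proof -
      have "1 + complex_of_real (lam p) * (z * z) \<noteq> 0" using kappa_lower[OF p(1) that] by auto
      then show ?thesis by (simp only: neg_equal_0_iff_equal not_False_eq_True)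
    qed
    have lam1: "1 + lam p \<noteq> 0" using lam_bd[OF p(1)] by auto
    have ed: "E1 p \<noteq> E2 p" "e2 p - e1 p \<noteq> 0" using d0(1) d0(2)[OF p(1)] by auto
    have z0: "(0::complex) \<in> dom Tau" "(0::complex) \<in> dom Ell" by (auto simp: dom_def)
    have t: "?t = prim (E1 p) (grad p x) (E2 p) * (of_real (1 / ((1 + lam p) * DD p)) * (- \<i>))"
      using fx[OF z0(1)] by simp
    \<comment> \<open>The fixed point equation for \<open>Tau\<close>, solved for the mean: the
      factor \<open>\<i>\<close> undoes the \<open>- \<i>\<close> in \<open>Fmap\<close>.\<close>
    have tm: "mean (E1 p) (E2 p) (grad p x) = \<i> * of_real ((1 + lam p) * DD p / (e2 p - e1 p)) * ?t"
    proof -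
      have *: "X / of_real d = \<i> * of_real (c / d) * (X * (of_real (1 / c) * (- \<i>)))" if "c \<noteq> 0" for X and c d :: real
      proof -
        have "\<i> * of_real (c / d) * (X * (of_real (1 / c) * (- \<i>))) = (\<i> * (- \<i>)) * (of_real c * of_real (1 / c)) * (X / of_real d)"
          by (simp add: divide_inverse mult_ac)
        also have "of_real c * of_real (1 / c) = (1::complex)" using that by simp
        finally show ?thesis by simp
      qed
      have "(1 + lam p) * DD p \<noteq> 0" using lam1 DD_lower(2)[OF p(1)] by auto
      from *[OF this, of "prim (E1 p) (grad p x) (E2 p)" "e2 p - e1 p"]
      show ?thesis unfolding t mean_def of_real_diff .
    qed
    have l: "2 * ?l = prim (- 1) (hang p x) 1" using fx[OF z0(2)] by (simp add: mult.commute)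
    have lm: "mean (- 1) 1 (\<lambda>\<xi>. of_real (s p) * hang p x \<xi>) = of_real (s p) * ?l"
    proof -
      have "prim (- 1) (\<lambda>\<xi>. of_real (s p) * hang p x \<xi>) 1 = of_real (s p) * prim (- 1) (hang p x) 1"
        unfolding prim_def
        by (rule contour_integral_unique, rule has_contour_integral_lmul)
           (use prim_contour[OF _ _ hh, of "- 1" 1] in \<open>auto simp: prim_def\<close>)
      then show ?thesis using l[symmetric] by (simp add: mean_def)
    qed
    have veq: "(z - E1 p) * (z - E2 p) * k p z * ?v z = prim (E1 p) (\<lambda>w. grad p x w - mean (E1 p) (E2 p) (grad p x)) z"
      if z: "z \<in> \<Omega>r" for z
      using sing_solve(2)[OF open_r convex_r hg k_hol[OF p(1)] kn e_dom[OF p(1)] ed(1) z] fx[of z Rad] z by (simp add: dom_def)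
    have yeq: "(z - (- 1)) * (z - 1) * (- (1 + complex_of_real (lam p) * (z * z))) * ?y z =
       prim (- 1) (\<lambda>w. of_real (s p) * hang p x w - of_real (s p) * ?l) z" if z: "z \<in> ball 0 2" for z
    proof -
      have hs: "(\<lambda>\<xi>. of_real (s p) * hang p x \<xi>) holomorphic_on ball 0 2" by (intro holomorphic_intros hh)
      have hk: "(\<lambda>\<xi>. - (1 + complex_of_real (lam p) * (\<xi> * \<xi>))) holomorphic_on ball 0 2" by (intro holomorphic_intros)
      have d: "(- 1 :: complex) \<in> ball 0 2" "(1 :: complex) \<in> ball 0 2" "(- 1 :: complex) \<noteq> 1" by auto
      have "?y z = sing_solve (ball 0 2) (- 1) 1 (\<lambda>\<xi>. - (1 + of_real (lam p) * (\<xi> * \<xi>))) (\<lambda>\<xi>. of_real (s p) * hang p x \<xi>) z"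
        using fx[of z Ang] z by (simp only: Fmap.simps) (simp add: dom_def)
      then show ?thesis
        using sing_solve(2)[OF open_ball convex_ball hs hk kn2 d z] unfolding lm by (simp only:)
    qed
    have dv: "((\<lambda>z. (z - E1 p) * (z - E2 p) * k p z * ?v z) has_field_derivative
        grad p x z - mean (E1 p) (E2 p) (grad p x)) (at z)" if z: "z \<in> \<Omega>r" for z
      by (rule has_field_derivative_transform_within_open[OF prim_deriv[OF open_r convex_r _ e_dom(1)[OF p(1)] z] open_r z veq[symmetric]])
         (auto intro!: holomorphic_intros hg)
    have dy: "((\<lambda>z. (z - (- 1)) * (z - 1) * (- (1 + complex_of_real (lam p) * (z * z))) * ?y z) has_field_derivative
        of_real (s p) * hang p x z - of_real (s p) * ?l) (at z)" if z: "z \<in> ball 0 2" for z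
      by (rule has_field_derivative_transform_within_open[OF prim_deriv[OF open_ball convex_ball _ _ z] open_ball z yeq[symmetric]])
         (auto intro!: holomorphic_intros hh)
    have g: "grad p x z - mean (E1 p) (E2 p) (grad p x) = (Wh p ?t z + of_real (M2 p) * (z * z) + of_real (s p) * ?l) * Rf p ?v z
        - 2 * \<i> * of_real (s p) * Nh p ?t z * ?v z - \<i> * of_real ((1 + lam p) * DD p / (e2 p - e1 p)) * ?t * Rf p ?v z" for z
    proof -
      have "W * (1 + r * (r * q)) + r * ((- 2 * \<i>) * (N * w)) + r * (r * ((- \<i>) * (b * (u * q)))) - \<i> * b * u
        = W * (1 + r * (r * q)) - 2 * \<i> * r * N * w - \<i> * b * u * (1 + r * (r * q))" for W r q N w b u :: complex
        by (simp add: algebra_simps)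
      then show ?thesis unfolding tm grad_def Rf_def .
    qed
    have h: "of_real (s p) * hang p x z - of_real (s p) * ?l = ((of_real (s p))\<^sup>2 * Uh p ?t z - of_real (s p) * ?l) * Sf p ?y z" for z
    proof -
      have "r * (r * (U * S) + r * (r * ((- 1) * (L * q)))) - r * L = (r\<^sup>2 * U - r * L) * S" if "S = 1 + r * (r * q)" for r U S L q :: complex
        unfolding that by (simp add: algebra_simps power2_eq_square)
      then show ?thesis unfolding hang_def using Sf_def by blast
    qed
    \<comment> \<open>For vanishing unknowns \<open>grad\<close> reduces to the integrand of
      \<open>tau0\<close>.\<close>
    have "norm (?t - tau0 p) \<le> C * \<bar>s p\<bar>"
    proof -
      have "grad p (\<lambda>_ _. 0) = (\<lambda>z. Wh p 0 z + of_real (M2 p) * (z * z))"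
        by (rule ext) (simp add: grad_def Rf_def prim_const[OF open_r convex_r, of _ 0, simplified])
      then show ?thesis using x0[OF z0(1)] by (simp add: tau0_def)
    qed
    then show ?thesis using hv dv dy unfolding g h
      by (intro exI[of _ ?t] exI[of _ ?l] exI[of _ ?v] exI[of _ ?y]) simp
  qed
  then show ?thesis using eC by blast
qed

end

section \<open>The horizons\<close>

lemma mu_a_0: "r \<noteq> 0 \<Longrightarrow> mu_a M Q \<Lambda> 0 r = r\<^sup>2 * mu M Q \<Lambda> r"
  by (simp add: mu_a_def mu_def field_simps power2_eq_square)

lemma cubic_four_zeros:
  fixes b0 b1 b2 b3 :: real
  assumes "finite A" "card A = 4" "\<And>x. x \<in> A \<Longrightarrow> b0 + b1 * x + b2 * x\<^sup>2 + b3 * x ^ 3 = 0"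
  shows "b0 + b1 * x + b2 * x\<^sup>2 + b3 * x ^ 3 = 0"
proof -
  let ?p = "[:b0, b1, b2, b3:]"
  have e: "poly ?p y = b0 + b1 * y + b2 * y\<^sup>2 + b3 * y ^ 3" for y
    by (simp add: algebra_simps power2_eq_square power3_eq_cube)
  have "?p = 0"
  proof (rule ccontr)
    assume nz: "?p \<noteq> 0"
    have "card A \<le> card {x. poly ?p x = 0}"
      using assms(3) by (intro card_mono poly_roots_finite nz subsetI CollectI) (simp only: e)
    also have "\<dots> \<le> degree ?p" by (rule card_poly_roots_bound[OF nz])
    also have "\<dots> \<le> 3" by simp
    finally show False using assms(2) by simp
  qed
  then show ?thesis using e by (metis poly_0)
qed

text \<open>Both sides have the same leading coefficient, so their difference is a cubic polynomial,
  and it vanishes at the four roots.\<close>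

lemma mu_a_quartic:
  assumes "\<Lambda> > 0" "standing_assumption M Q \<Lambda> rn rc rm rp"
  shows "mu_a M Q \<Lambda> 0 r = - (\<Lambda> / 3) * ((r - rn) * (r - rc) * (r - rm) * (r - rp))"
proof -
  define e1 where "e1 = rn + rc + rm + rp"
  define e2 where "e2 = rn * rc + rn * rm + rn * rp + rc * rm + rc * rp + rm * rp"
  define e3 where "e3 = rn * rc * rm + rn * rc * rp + rn * rm * rp + rc * rm * rp"
  have ex: "mu_a M Q \<Lambda> 0 x + (\<Lambda> / 3) * ((x - rn) * (x - rc) * (x - rm) * (x - rp)) =
    (Q\<^sup>2 + \<Lambda> / 3 * (rn * rc * rm * rp)) + (- 2 * M - \<Lambda> / 3 * e3) * x + (1 + \<Lambda> / 3 * e2) * x\<^sup>2 + (- \<Lambda> / 3 * e1) * x ^ 3" for x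
    by (simp add: mu_a_def e1_def e2_def e3_def algebra_simps power2_eq_square power3_eq_cube add_divide_distrib diff_divide_distrib)
  have o: "rn < 0" "0 < rc" "rc < rm" "rm < rp" and z: "{r. r \<noteq> 0 \<and> mu M Q \<Lambda> r = 0} = {rn, rc, rm, rp}"
    using assms(2) unfolding standing_assumption_def by auto
  have "(Q\<^sup>2 + \<Lambda> / 3 * (rn * rc * rm * rp)) + (- 2 * M - \<Lambda> / 3 * e3) * r + (1 + \<Lambda> / 3 * e2) * r\<^sup>2 + (- \<Lambda> / 3 * e1) * r ^ 3 = 0"
  proof (rule cubic_four_zeros[of "{rn, rc, rm, rp}"])
    show "card {rn, rc, rm, rp} = 4" using o by simp
    fix x assume x: "x \<in> {rn, rc, rm, rp}"
    then have "x \<noteq> 0" "mu M Q \<Lambda> x = 0" using z by auto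
    then have "mu_a M Q \<Lambda> 0 x = 0" by (simp add: mu_a_0)
    moreover have "(x - rn) * (x - rc) * (x - rm) * (x - rp) = 0" using x by auto
    ultimately show "(Q\<^sup>2 + \<Lambda> / 3 * (rn * rc * rm * rp)) + (- 2 * M - \<Lambda> / 3 * e3) * x + (1 + \<Lambda> / 3 * e2) * x\<^sup>2 + (- \<Lambda> / 3 * e1) * x ^ 3 = 0"
      using ex[of x] by (simp only: mult_zero_right add_0_right)
  qed simp
  then show ?thesis using ex[of r] by simp
qed

lemma mu_a_vieta:
  assumes "\<Lambda> > 0" "standing_assumption M Q \<Lambda> rn rc rm rp"
  shows "rn + rc = - (rm + rp)" "rn * rc = (rm + rp)\<^sup>2 - rm * rp - 3 / \<Lambda>"
proof -
  note q = mu_a_quartic[OF assms]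
  define f where "f = mu_a M Q \<Lambda> 0"
  \<comment> \<open>This combination isolates the cubic coefficient, which is 0 for
    \<open>mu_a\<close>.\<close>
  have "f 2 - 2 * f 1 + 2 * f (- 1) - f (- 2) = 0" by (simp add: f_def mu_a_def)
  moreover have "f 2 - 2 * f 1 + 2 * f (- 1) - f (- 2) = 4 * \<Lambda> * (rn + rc + rm + rp)"
    unfolding f_def q by (simp add: algebra_simps)
  ultimately show 1: "rn + rc = - (rm + rp)" using assms(1) by simp
  \<comment> \<open>The second difference at 0 is twice the sum of the coefficients of
    \<open>r^2\<close> and \<open>r^4\<close>.\<close>
  have "f 1 + f (- 1) - 2 * f 0 = 2 - 2 * \<Lambda> / 3" by (simp add: f_def mu_a_def)
  moreover have "f 1 + f (- 1) - 2 * f 0 = - (2 * \<Lambda> / 3) * (1 + (rn * rc + (rn + rc) * (rm + rp) + rm * rp))"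
    unfolding f_def q by (simp add: algebra_simps)
  ultimately have "2 - 2 * \<Lambda> / 3 = - (2 * \<Lambda> / 3) * (1 + (rn * rc + (rn + rc) * (rm + rp) + rm * rp))" by linarith
  then have "\<Lambda> * (rn * rc + (rn + rc) * (rm + rp) + rm * rp) = - 3" unfolding ring_distribs by linarith
  then have "rn * rc + (rn + rc) * (rm + rp) + rm * rp = - 3 / \<Lambda>" using assms(1) by (simp add: field_simps)
  then show "rn * rc = (rm + rp)\<^sup>2 - rm * rp - 3 / \<Lambda>" unfolding 1 by (simp add: power2_eq_square algebra_simps)
qed

text \<open>The factor 1000 makes \<open>mu_a\<close> positive at \<open>4 * M\<close> and at
  \<open>20 * M\<close>. To the right of \<open>rc\<close> it is positive only between
  \<open>rm\<close> and \<open>rp\<close>, so both points lie there, and \<open>rm < 4 * M\<close>,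
  \<open>20 * M < rp\<close> give the ratio 5.\<close>

lemma horizon_ratio:
  assumes M: "M > 0" and Q: "0 < \<bar>Q\<bar>" "\<bar>Q\<bar> < 3 * M / (2 * sqrt 2)"
    and L: "0 < \<Lambda>" "\<Lambda> < 1 / (1000 * M\<^sup>2)" and S: "standing_assumption M Q \<Lambda> rn rc rm rp"
  shows "5 * rm < rp"
proof -
  have o: "rn < 0" "0 < rc" "rc < rm" "rm < rp" using S unfolding standing_assumption_def by auto
  note q = mu_a_quartic[OF L(1) S]
  have Q2: "8 * Q\<^sup>2 < 9 * M\<^sup>2"
  proof -
    have "Q\<^sup>2 < (3 * M / (2 * sqrt 2))\<^sup>2"
      using Q M by (metis abs_ge_zero power2_abs power_strict_mono zero_less_numeral)
    also have "\<dots> = 9 * M\<^sup>2 / 8" by (simp add: power_divide power_mult_distrib)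
    finally show ?thesis by simp
  qed
  have LM: "\<Lambda> * M\<^sup>2 < 1 / 1000" using L M by (simp add: field_simps)
  have pos: "mu_a M Q \<Lambda> 0 (4 * M) > 0" "mu_a M Q \<Lambda> 0 (20 * M) > 0"
  proof -
    have "mu_a M Q \<Lambda> 0 (x * M) = M\<^sup>2 * (x\<^sup>2 - 2 * x - (\<Lambda> * M\<^sup>2) * x ^ 4 / 3) + Q\<^sup>2" for x
      by (simp add: mu_a_def algebra_simps power2_eq_square power4_eq_xxxx)
    moreover have "M\<^sup>2 * (4\<^sup>2 - 2 * 4 - (\<Lambda> * M\<^sup>2) * 4 ^ 4 / 3) > 0" "M\<^sup>2 * (20\<^sup>2 - 2 * 20 - (\<Lambda> * M\<^sup>2) * 20 ^ 4 / 3) > 0"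
      using LM M by (auto intro!: mult_pos_pos)
    ultimately show "mu_a M Q \<Lambda> 0 (4 * M) > 0" "mu_a M Q \<Lambda> 0 (20 * M) > 0"
      using zero_le_power2[of Q] by (metis add_pos_nonneg)+
  qed
  \<comment> \<open>The coefficients of \<open>r\<close> compared through the odd parts at 1 and
    2.\<close>
  have lin: "2 * M = \<Lambda> / 3 * (- rn * (rc * rm + rc * rp + rm * rp) - rc * rm * rp)"
  proof -
    have f: "\<Lambda> / 3 * ((r - rn) * (r - rc) * (r - rm) * (r - rp)) = - mu_a M Q \<Lambda> 0 r" for r using q[of r] by simp
    have "4 * M = mu_a M Q \<Lambda> 0 (- 1) - mu_a M Q \<Lambda> 0 1" by (simp add: mu_a_def)
    moreover have "4 * M * 2 = - (mu_a M Q \<Lambda> 0 2 - mu_a M Q \<Lambda> 0 (- 2))" by (simp add: mu_a_def)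
    ultimately show ?thesis unfolding q by (simp add: algebra_simps)
  qed
  have con: "Q\<^sup>2 = \<Lambda> / 3 * (- rn * (rc * rm * rp))" using q[of 0] by (simp add: mu_a_def)
  \<comment> \<open>If \<open>rc\<close> exceeded \<open>4 * M\<close>, so would all positive roots,
    and the sum of their reciprocals would be at most \<open>3 / (4 * M)\<close>. By Vieta this sum
    is at least \<open>2 * M / Q\<^sup>2\<close>, which forces
    \<open>8 * M\<^sup>2 \<le> 3 * Q\<^sup>2\<close> and contradicts the bound on
    \<open>Q\<close>.\<close>
  have no: "\<not> 4 * M < rc"
  proof
    assume A: "4 * M < rc"
    have "4 * M * (rc * rm + rc * rp + rm * rp) \<le> 3 * (rc * rm * rp)"
    proof -
      have "4 * M * (rc * rm) \<le> rp * (rc * rm)" "4 * M * (rc * rp) \<le> rm * (rc * rp)" "4 * M * (rm * rp) \<le> rc * (rm * rp)"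
        using A o by (intro mult_right_mono; auto)+
      then show ?thesis by (simp add: algebra_simps)
    qed
    then have "\<Lambda> / 3 * - rn * (4 * M * (rc * rm + rc * rp + rm * rp)) \<le> \<Lambda> / 3 * - rn * (3 * (rc * rm * rp))"
      using o L by (intro mult_left_mono) (auto simp: mult_nonneg_nonpos)
    then have "4 * M * (\<Lambda> / 3 * (- rn * (rc * rm + rc * rp + rm * rp))) \<le> 3 * Q\<^sup>2"
      unfolding con by (simp add: algebra_simps)
    moreover have "2 * M \<le> \<Lambda> / 3 * (- rn * (rc * rm + rc * rp + rm * rp))"
      unfolding lin using o L by (intro mult_left_mono) (auto intro: mult_nonneg_nonneg)
    then have "4 * M * (2 * M) \<le> 4 * M * (\<Lambda> / 3 * (- rn * (rc * rm + rc * rp + rm * rp)))"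
      using M by (intro mult_left_mono) auto
    ultimately have "8 * M\<^sup>2 \<le> 3 * Q\<^sup>2" by (simp add: power2_eq_square)
    then show False using Q2 M zero_less_power2[of M] by linarith
  qed
  have btw: "rm < r \<and> r < rp" if "mu_a M Q \<Lambda> 0 r > 0" "rc \<le> r" for r
  proof (rule ccontr)
    assume n: "\<not> (rm < r \<and> r < rp)"
    have "(r - rm) * (r - rp) \<ge> 0"
      using n o by (cases "r \<le> rm") (auto intro: mult_nonpos_nonpos)
    moreover have "(r - rn) * (r - rc) \<ge> 0" using that o by (intro mult_nonneg_nonneg) auto
    ultimately have "((r - rn) * (r - rc)) * ((r - rm) * (r - rp)) \<ge> 0" by (rule mult_nonneg_nonneg[rotated])
    then have "\<Lambda> / 3 * (((r - rn) * (r - rc)) * ((r - rm) * (r - rp))) \<ge> 0" using L by (intro mult_nonneg_nonneg[of "\<Lambda> / 3"]) auto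
    then show False using that(1) unfolding q by (simp add: mult.assoc)
  qed
  have "rm < 4 * M" "20 * M < rp" using btw[OF pos(1)] btw[OF pos(2)] no M by auto
  then show ?thesis by simp
qed

text \<open>Near a simple root, \<open>f 0\<close> is at least \<open>c\<close> times the distance
  to \<open>r0\<close> in modulus. At distance \<open>C / c * a\<^sup>2\<close> this outweighs the
  perturbation \<open>C * a\<^sup>2\<close>, so \<open>f a\<close> changes sign across
  \<open>r0\<close> and the intermediate value theorem applies. \<open>\<delta>\<close> keeps that
  distance within the neighbourhood in which the lower bound holds.\<close>

lemma simple_root_persists:
  fixes f :: "real \<Rightarrow> real \<Rightarrow> real" and g :: "real \<Rightarrow> real"
  assumes f0: "\<And>r. f 0 r = (r - r0) * g r" and g: "isCont g r0" "g r0 \<noteq> 0"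
    and fc: "\<And>a. continuous_on UNIV (f a)"
    and pert: "\<And>a r. \<bar>a\<bar> \<le> 1 \<Longrightarrow> \<bar>r - r0\<bar> \<le> 1 \<Longrightarrow> \<bar>f a r - f 0 r\<bar> \<le> C * a\<^sup>2"
  shows "\<exists>\<delta>>0. \<exists>C'. \<forall>a. \<bar>a\<bar> < \<delta> \<longrightarrow> (\<exists>e. \<bar>e - r0\<bar> \<le> C' * a\<^sup>2 \<and> f a e = 0)"
proof -
  define \<epsilon> where "\<epsilon> = sgn (g r0)"
  have \<epsilon>: "\<bar>\<epsilon>\<bar> = 1" "\<epsilon> * g r0 = \<bar>g r0\<bar>" using g(2) by (auto simp: \<epsilon>_def sgn_if)
  define c where "c = \<bar>g r0\<bar> / 2"
  have c: "c > 0" using g(2) by (simp add: c_def)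
  have "isCont (\<lambda>r. \<epsilon> * g r) r0" using g(1) by (intro continuous_intros)
  then have "\<forall>\<^sub>F r in nhds r0. \<epsilon> * g r > c"
    using order_tendstoD(1)[of "\<lambda>r. \<epsilon> * g r" "\<epsilon> * g r0" "nhds r0" c] c \<epsilon>
    by (simp add: c_def isCont_def tendsto_nhds_iff)
  then obtain t0 where t0: "t0 > 0" "\<And>r. \<bar>r - r0\<bar> < t0 \<Longrightarrow> \<epsilon> * g r > c"
    by (auto simp: eventually_nhds_metric dist_real_def)
  have C: "C \<ge> 0" using pert[of 1 r0] abs_ge_zero order_trans by fastforce
  define t1 where "t1 = min t0 1 / 2"
  have t1: "t1 > 0" "t1 < t0" "t1 \<le> 1" using t0 by (auto simp: t1_def)
  define \<delta> where "\<delta> = min 1 (t1 * c / (C + 1))"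
  have \<delta>: "\<delta> > 0" using t1 c C by (simp add: \<delta>_def)
  have "\<exists>e. \<bar>e - r0\<bar> \<le> (C / c) * a\<^sup>2 \<and> f a e = 0" if a: "\<bar>a\<bar> < \<delta>" for a
  proof -
    define t where "t = C / c * a\<^sup>2"
    have a1: "\<bar>a\<bar> \<le> 1" "\<bar>a\<bar> \<le> t1 * c / (C + 1)" using a by (auto simp: \<delta>_def)
    have "a\<^sup>2 \<le> \<bar>a\<bar>" using a1(1) mult_left_le[of "\<bar>a\<bar>" "\<bar>a\<bar>"] by (simp add: power2_eq_square flip: abs_mult)
    then have "a\<^sup>2 \<le> t1 * c / (C + 1)" using a1(2) by linarith
    then have "(C + 1) * a\<^sup>2 \<le> t1 * c" using C by (simp add: field_simps)
    then have "C * a\<^sup>2 + a\<^sup>2 \<le> t1 * c" by (simp only: ring_distribs mult_1_left)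
    then have "C * a\<^sup>2 \<le> t1 * c" using zero_le_power2[of a] by linarith
    then have t: "0 \<le> t" "t \<le> t1" using C c by (auto simp: t_def field_simps)
    have tc: "t * c = C * a\<^sup>2" using c by (simp add: t_def)
    have v: "\<bar>\<epsilon> * f a r - \<epsilon> * f 0 r\<bar> \<le> C * a\<^sup>2" if "\<bar>r - r0\<bar> \<le> t" for r
    proof -
      have "\<bar>\<epsilon> * f a r - \<epsilon> * f 0 r\<bar> = \<bar>\<epsilon>\<bar> * \<bar>f a r - f 0 r\<bar>" by (simp flip: abs_mult add: right_diff_distrib)
      then show ?thesis using pert[OF a1(1), of r] that t t1 \<epsilon> by simp
    qed
    have "\<epsilon> * f 0 (r0 + t) = t * (\<epsilon> * g (r0 + t))" "\<epsilon> * f 0 (r0 - t) = - (t * (\<epsilon> * g (r0 - t)))"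
      by (simp_all add: f0)
    moreover have "t * c \<le> t * (\<epsilon> * g (r0 + t))" "t * c \<le> t * (\<epsilon> * g (r0 - t))"
      using t0(2)[of "r0 + t"] t0(2)[of "r0 - t"] t t1 by (auto intro!: mult_left_mono)
    moreover have "\<bar>\<epsilon> * f a (r0 + t) - \<epsilon> * f 0 (r0 + t)\<bar> \<le> C * a\<^sup>2" "\<bar>\<epsilon> * f a (r0 - t) - \<epsilon> * f 0 (r0 - t)\<bar> \<le> C * a\<^sup>2"
      by (rule v, use t in simp)+
    ultimately have s: "\<epsilon> * f a (r0 + t) \<ge> 0" "\<epsilon> * f a (r0 - t) \<le> 0"
      using tc by linarith+
    have "\<exists>x\<ge>r0 - t. x \<le> r0 + t \<and> \<epsilon> * f a x = 0"
      by (rule IVT'[of "\<lambda>x. \<epsilon> * f a x"]) (use s t fc in \<open>auto intro!: continuous_intros continuous_on_subset[OF fc]\<close>)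
    then obtain x where "r0 - t \<le> x" "x \<le> r0 + t" "\<epsilon> * f a x = 0" by blast
    moreover have "\<epsilon> \<noteq> 0" using \<epsilon>(1) by auto
    ultimately show ?thesis by (intro exI[of _ x]) (auto simp: t_def abs_le_iff)
  qed
  then show ?thesis using \<delta> by blast
qed

lemma mu_a_perturbation:
  "\<exists>C. \<forall>a r. \<bar>a\<bar> \<le> 1 \<longrightarrow> \<bar>r - r0\<bar> \<le> 1 \<longrightarrow> \<bar>mu_a M Q \<Lambda> a r - mu_a M Q \<Lambda> 0 r\<bar> \<le> C * a\<^sup>2"
proof -
  let ?G = "\<lambda>(a, r). (1 - \<Lambda> * r\<^sup>2 / 3) + (2 * \<Lambda> / 3 + \<Lambda>\<^sup>2 * a\<^sup>2 / 9) * Q\<^sup>2"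
  have e: "mu_a M Q \<Lambda> a r - mu_a M Q \<Lambda> 0 r = ?G (a, r) * a\<^sup>2" for a r
    by (simp add: mu_a_def algebra_simps power2_eq_square)
  have "bounded (?G ` ({- 1..1} \<times> {r0 - 1..r0 + 1}))"
    by (intro compact_imp_bounded compact_continuous_image compact_Times) (auto intro!: continuous_intros simp: case_prod_beta)
  then obtain C where C: "\<And>x. x \<in> {- 1..1} \<times> {r0 - 1..r0 + 1} \<Longrightarrow> \<bar>?G x\<bar> \<le> C" by (auto simp: bounded_iff)
  show ?thesis
  proof (intro exI allI impI)
    fix a r :: real assume "\<bar>a\<bar> \<le> 1" "\<bar>r - r0\<bar> \<le> 1"
    then have "\<bar>?G (a, r)\<bar> \<le> C" by (intro C) (auto simp: abs_le_iff)
    then show "\<bar>mu_a M Q \<Lambda> a r - mu_a M Q \<Lambda> 0 r\<bar> \<le> C * a\<^sup>2"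
      unfolding e abs_mult by (intro mult_mono) auto
  qed
qed

text \<open>Only the limit at \<open>a = 0\<close> is recorded, because all later conditions on the
  horizons are strict inequalities that hold at \<open>a = 0\<close>.\<close>

lemma horizons_perturbed:
  assumes "\<Lambda> > 0" "standing_assumption M Q \<Lambda> rn rc rm rp" "r0 = rm \<or> r0 = rp"
  shows "\<exists>\<delta>>0. \<exists>e. (e \<longlongrightarrow> r0) (nhds 0) \<and> (\<forall>a. \<bar>a\<bar> < \<delta> \<longrightarrow> mu_a M Q \<Lambda> a (e a) = 0)"
proof -
  have o: "rn < 0" "0 < rc" "rc < rm" "rm < rp" using assms(2) unfolding standing_assumption_def by auto
  obtain C where C: "\<And>a r. \<bar>a\<bar> \<le> 1 \<Longrightarrow> \<bar>r - r0\<bar> \<le> 1 \<Longrightarrow> \<bar>mu_a M Q \<Lambda> a r - mu_a M Q \<Lambda> 0 r\<bar> \<le> C * a\<^sup>2"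
    using mu_a_perturbation[of r0 M Q \<Lambda>] by blast
  obtain r1 where r1: "r1 \<noteq> r0" "{r0, r1} = {rm, rp}" using assms(3) o by (metis insert_commute less_irrefl)
  have "\<exists>\<delta>>0. \<exists>C'. \<forall>a. \<bar>a\<bar> < \<delta> \<longrightarrow> (\<exists>e. \<bar>e - r0\<bar> \<le> C' * a\<^sup>2 \<and> mu_a M Q \<Lambda> a e = 0)"
  proof (rule simple_root_persists[where f="mu_a M Q \<Lambda>" and g="\<lambda>r. - (\<Lambda> / 3) * ((r - rn) * (r - rc) * (r - r1))", OF _ _ _ _ C])
    show "mu_a M Q \<Lambda> 0 r = (r - r0) * (- (\<Lambda> / 3) * ((r - rn) * (r - rc) * (r - r1)))" for r
      using mu_a_quartic[OF assms(1,2)] r1 by (auto simp: doubleton_eq_iff)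
    show "- (\<Lambda> / 3) * ((r0 - rn) * (r0 - rc) * (r0 - r1)) \<noteq> 0"
      using assms(1,3) r1 o by auto
    show "continuous_on UNIV (mu_a M Q \<Lambda> a)" for a unfolding mu_a_def by (intro continuous_intros) auto
  qed (intro continuous_intros)
  then obtain \<delta> C' where d: "\<delta> > 0" "\<And>a. \<bar>a\<bar> < \<delta> \<Longrightarrow> \<exists>e. \<bar>e - r0\<bar> \<le> C' * a\<^sup>2 \<and> mu_a M Q \<Lambda> a e = 0" by blast
  then have "\<forall>a. \<exists>e. \<bar>a\<bar> < \<delta> \<longrightarrow> \<bar>e - r0\<bar> \<le> C' * a\<^sup>2 \<and> mu_a M Q \<Lambda> a e = 0" by blast
  from choice[OF this] obtain e where e: "\<And>a. \<bar>a\<bar> < \<delta> \<Longrightarrow> \<bar>e a - r0\<bar> \<le> C' * a\<^sup>2 \<and> mu_a M Q \<Lambda> a (e a) = 0" by blast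
  have "(e \<longlongrightarrow> r0) (nhds 0)"
  proof (rule LIM_zero_cancel, rule Lim_null_comparison)
    show "\<forall>\<^sub>F a in nhds 0. norm (e a - r0) \<le> C' * a\<^sup>2"
      unfolding eventually_nhds_metric using d(1) e by (intro exI[of _ \<delta>]) (auto simp: dist_real_def)
    show "((\<lambda>a. C' * a\<^sup>2) \<longlongrightarrow> 0) (nhds 0)" by (rule tendsto_eq_intros filterlim_ident refl | simp)+
  qed
  then show ?thesis using d(1) e by blast
qed

text \<open>The leading, the cubic and the quadratic coefficient of \<open>mu_a\<close> fix the
  quadratic cofactor. The remainder \<open>A * r + B\<close> is linear and vanishes at the two
  distinct points \<open>e1\<close>, \<open>e2\<close>.\<close>

lemma mu_a_factor:
  fixes e1 e2 :: real
  assumes "\<Lambda> \<noteq> 0" "e1 \<noteq> e2" "mu_a M Q \<Lambda> a e1 = 0" "mu_a M Q \<Lambda> a e2 = 0"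
  shows "mu_a M Q \<Lambda> a r = (r - e1) * (r - e2) * (- (\<Lambda> / 3) * (r\<^sup>2 + (e1 + e2) * r + ((e1 + e2)\<^sup>2 - e1 * e2 - 3 / \<Lambda> + a\<^sup>2)))"
proof -
  define g where "g = (e1 + e2)\<^sup>2 - e1 * e2 - 3 / \<Lambda> + a\<^sup>2"
  have Lg: "\<Lambda> * g = \<Lambda> * ((e1 + e2)\<^sup>2 - e1 * e2 + a\<^sup>2) - 3" using assms(1) by (simp add: g_def field_simps)
  define A where "A = - 2 * M + (\<Lambda> / 3) * (e1 + e2) * (e1 * e2 - g)"
  define B where "B = a\<^sup>2 + (1 + \<Lambda> * a\<^sup>2 / 3)\<^sup>2 * Q\<^sup>2 + (\<Lambda> / 3) * (e1 * e2) * g"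
  have ex: "mu_a M Q \<Lambda> a r - (r - e1) * (r - e2) * (- (\<Lambda> / 3) * (r\<^sup>2 + (e1 + e2) * r + g)) = A * r + B" for r
  proof -
    have "(r - e1) * (r - e2) * (- (\<Lambda> / 3) * (r\<^sup>2 + (e1 + e2) * r + g)) =
      - (\<Lambda> / 3) * r ^ 4 - (\<Lambda> * g - \<Lambda> * ((e1 + e2)\<^sup>2 - e1 * e2)) / 3 * r\<^sup>2 - (\<Lambda> / 3) * (e1 + e2) * (e1 * e2 - g) * r - (\<Lambda> / 3) * (e1 * e2) * g"
      by (simp add: algebra_simps power2_eq_square power4_eq_xxxx add_divide_distrib diff_divide_distrib)
    then show ?thesis unfolding Lg A_def B_def mu_a_def
      by (simp add: algebra_simps power2_eq_square power4_eq_xxxx add_divide_distrib diff_divide_distrib)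
  qed
  have "A * e1 + B = 0" "A * e2 + B = 0" using ex[of e1] ex[of e2] assms by auto
  then have "A * (e1 - e2) = 0" unfolding right_diff_distrib by linarith
  then have "A = 0" "B = 0" using assms(2) \<open>A * e1 + B = 0\<close> by auto
  then show ?thesis using ex[of r] by (simp add: g_def)
qed


text \<open>Chebyshev's argument: \<open>(x - r1) / (x\<^sup>2 + h x + \<gamma>)\<close> is decreasing, so that on the left of its zero
  \<open>r2\<close> the linear factor gets the larger weights.\<close>

lemma chebyshev_lower:
  fixes h \<gamma> r1 r2 e1 e2 :: real
  assumes h: "h > 0" "\<gamma> < 0" "r1 < 0" and e: "0 < e1" "e1 < e2" and r2: "e1 \<le> r2" "r2 \<le> e2"
    and pos: "\<And>x. e1 \<le> x \<Longrightarrow> x \<le> e2 \<Longrightarrow> x\<^sup>2 + h * x + \<gamma> > 0"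
    and I: "((\<lambda>x. (r2 - x) * (x - r1) / (x\<^sup>2 + h * x + \<gamma>)) has_integral I) {e1..e2}"
  shows "I \<ge> (r2 - r1) / (r2\<^sup>2 + h * r2 + \<gamma>) * ((e2 - e1) * (r2 - (e1 + e2) / 2))"
proof -
  define q where "q x = x\<^sup>2 + h * x + \<gamma>" for x
  let ?f = "\<lambda>x. (x - r1) / q x"
  have F: "((\<lambda>x. - ((r2 - x)\<^sup>2 / 2)) has_real_derivative (r2 - x)) (at x within {e1..e2})" for x
    by (auto intro!: derivative_eq_intros simp: field_simps)
  have "((\<lambda>x. r2 - x) has_integral (- ((r2 - e2)\<^sup>2 / 2) - - ((r2 - e1)\<^sup>2 / 2))) {e1..e2}"
    using e F by (intro fundamental_theorem_of_calculus) (auto simp: has_real_derivative_iff_has_vector_derivative)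
  then have "((\<lambda>x. ?f r2 * (r2 - x)) has_integral (?f r2 * (- ((r2 - e2)\<^sup>2 / 2) - - ((r2 - e1)\<^sup>2 / 2)))) {e1..e2}"
    by (rule has_integral_mult_right)
  moreover have "- ((r2 - e2)\<^sup>2 / 2) - - ((r2 - e1)\<^sup>2 / 2) = (e2 - e1) * (r2 - (e1 + e2) / 2)"
    by (simp add: power2_eq_square field_simps)
  ultimately have J: "((\<lambda>x. ?f r2 * (r2 - x)) has_integral (?f r2 * ((e2 - e1) * (r2 - (e1 + e2) / 2)))) {e1..e2}" by metis
  show ?thesis unfolding q_def[symmetric]
  proof (rule has_integral_le[OF J I[unfolded q_def[symmetric]]])
    fix x assume "x \<in> {e1..e2}"
    then have x: "e1 \<le> x" "x \<le> e2" by auto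
    have q: "q x > 0" "q r2 > 0" using pos[OF x] pos[OF r2] by (auto simp: q_def)
    \<comment> \<open>Cross multiplication produces a second factor \<open>r2 - x\<close>, so the
      product contains a square.\<close>
    have "(r2 - x) * ((x - r1) / q x - (r2 - r1) / q r2) =
      (r2 - x)\<^sup>2 * (x * r2 - \<gamma> - r1 * (x + r2) - r1 * h) / (q x * q r2)"
    proof -
      have "(x - r1) / q x - (r2 - r1) / q r2 = ((x - r1) * q r2 - (r2 - r1) * q x) / (q x * q r2)"
        using q by (simp add: diff_frac_eq)
      also have "(x - r1) * q r2 - (r2 - r1) * q x = (r2 - x) * (x * r2 - \<gamma> - r1 * (x + r2) - r1 * h)"
        by (simp add: q_def algebra_simps power2_eq_square)
      finally show ?thesis by (simp add: power2_eq_square)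
    qed
    also have "\<dots> \<ge> 0"
    proof (intro divide_nonneg_nonneg mult_nonneg_nonneg)
      have "x * r2 > 0" using x r2 e by (intro mult_pos_pos) auto
      moreover have "r1 * (x + r2) < 0" using x r2 e h by (intro mult_neg_pos) auto
      moreover have "r1 * h < 0" using h by (intro mult_neg_pos) auto
      ultimately show "0 \<le> x * r2 - \<gamma> - r1 * (x + r2) - r1 * h" using h by linarith
    qed (use q in auto)
    finally show "(r2 - r1) / q r2 * (r2 - x) \<le> (r2 - x) * (x - r1) / q x" by (simp add: right_diff_distrib mult.commute)
  qed
qed

section \<open>Growth of the mode\<close>

text \<open>At \<open>\<tau> = 0\<close> the two linear factors of \<open>Wh\<close> have the zeros
  \<open>r1\<close> and \<open>r2\<close>. The integrand is then real, a negative multiple of the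
  one in \<open>chebyshev_lower\<close> plus the mass term, and \<open>tau0\<close> is purely
  imaginary.\<close>

lemma (in mode_params) Im_tau0:
  fixes p L \<gamma>
  defines "h \<equiv> e1 p + e2 p" and "lm \<equiv> lam p"
  defines "r1 \<equiv> ((e1 p)\<^sup>2 - e1 p * e2 p + 2 * (a p)\<^sup>2) / h" and "r2 \<equiv> ((e2 p)\<^sup>2 - e1 p * e2 p + 2 * (a p)\<^sup>2) / h"
  assumes p: "p \<in> P" and k: "\<And>z. k p z = - of_real (L / 3) * (z * z + of_real h * z + of_real \<gamma>)"
    and L: "L > 0" "\<gamma> < 0" "r1 < 0" and e: "0 < e1 p" "e1 p < e2 p" and r: "e1 p \<le> r2" "r2 \<le> e2 p"
    and pos: "\<And>x. e1 p \<le> x \<Longrightarrow> x \<le> e2 p \<Longrightarrow> x\<^sup>2 + h * x + \<gamma> > 0"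
  shows "Im (tau0 p) \<ge> ((3 / L) * (1 + lm)\<^sup>2 * (h / DD p)\<^sup>2 * ((r2 - r1) / (r2\<^sup>2 + h * r2 + \<gamma>) * ((e2 p - e1 p) * (r2 - h / 2)))
     - M2 p * (((e2 p) ^ 3 - (e1 p) ^ 3) / 3)) / ((1 + lm) * DD p)"
proof -
  have h0: "h > 0" using e by (simp add: h_def)
  have DD0: "DD p > 0" using DD_lower[OF p] by simp
  have lm: "1 + lm > 0" using lam_bd[OF p] unfolding lm_def by linarith
  define f where "f x = (r2 - x) * (x - r1) / (x\<^sup>2 + h * x + \<gamma>)" for x
  have "continuous_on {e1 p..e2 p} f"
    unfolding f_def using pos by (intro continuous_intros) force
  then obtain I where I: "(f has_integral I) {e1 p..e2 p}"
    using integrable_continuous_real[of "e1 p" "e2 p" f] unfolding integrable_on_def by blast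
  have che: "I \<ge> (r2 - r1) / (r2\<^sup>2 + h * r2 + \<gamma>) * ((e2 p - e1 p) * (r2 - h / 2))"
    using chebyshev_lower[OF h0 L(2,3) e r pos, of I] I unfolding f_def h_def by auto
  define cc where "cc = (3 / L) * (1 + lm)\<^sup>2 * (h / DD p)\<^sup>2"
  have cc: "cc \<ge> 0" using L by (simp add: cc_def)
  have "((\<lambda>x. x ^ 2) has_integral ((e2 p) ^ 3 / 3 - (e1 p) ^ 3 / 3)) {e1 p..e2 p}"
  proof (rule fundamental_theorem_of_calculus)
    show "((\<lambda>x. x ^ 3 / 3) has_vector_derivative x ^ 2) (at x within {e1 p..e2 p})" for x
      by (auto intro!: derivative_eq_intros simp flip: has_real_derivative_iff_has_vector_derivative)
  qed (use e in simp)
  then have "((\<lambda>x. - cc * f x + M2 p * x ^ 2) has_integral (- cc * I + M2 p * ((e2 p) ^ 3 / 3 - (e1 p) ^ 3 / 3))) {e1 p..e2 p}"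
    by (intro has_integral_add has_integral_mult_right I)
  from has_integral_linear[OF this bounded_linear_of_real[where 'a=complex]]
  have hi: "((\<lambda>x. complex_of_real (- cc * f x + M2 p * x ^ 2)) has_integral
     of_real (- cc * I + M2 p * ((e2 p) ^ 3 / 3 - (e1 p) ^ 3 / 3))) {e1 p..e2 p}" by (simp add: o_def)
  have s1: "sg1 p * (x + e2 p) + 1 = - (h / DD p) * (x - r1)" "sg1 p * (x + e1 p) + 1 = (h / DD p) * (r2 - x)" for x
    using DD0 h0 unfolding sg1_def r1_def r2_def h_def[symmetric]
    by (simp_all add: field_simps) (simp_all add: h_def DD_def power2_eq_square algebra_simps)
  have w: "Wh p 0 (of_real x) + of_real (M2 p) * (of_real x * of_real x) = complex_of_real (- cc * f x + M2 p * x ^ 2)"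
    if x: "x \<in> {e1 p..e2 p}" for x
  proof -
    have q: "x\<^sup>2 + h * x + \<gamma> \<noteq> 0" using pos[of x] x by force
    have "Wh p 0 (of_real x) = of_real ((1 + lm)\<^sup>2 * ((- (sg1 p * (x + e2 p) + 1)) * (sg1 p * (x + e1 p) + 1)) * inverse (- (L / 3) * (x\<^sup>2 + h * x + \<gamma>)))"
      unfolding Wh_def be_def Amp_def k lm_def by (simp add: power2_eq_square)
    also have "\<dots> = of_real (- cc * f x)"
      unfolding s1 using q L by (intro arg_cong[of _ _ of_real]) (simp add: cc_def f_def field_simps power2_eq_square)
    finally show ?thesis by (simp add: power2_eq_square)
  qed
  have "((\<lambda>z. Wh p 0 z + of_real (M2 p) * (z * z)) has_contour_integral
     of_real (- cc * I + M2 p * ((e2 p) ^ 3 / 3 - (e1 p) ^ 3 / 3))) (linepath (E1 p) (E2 p))"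
    using has_integral_eq[OF w[symmetric] hi] e
    by (subst has_contour_integral_linepath_Reals_iff) auto
  then have "tau0 p = of_real (- cc * I + M2 p * ((e2 p) ^ 3 / 3 - (e1 p) ^ 3 / 3)) * (of_real (1 / ((1 + lm) * DD p)) * (- \<i>))"
    by (simp add: tau0_def prim_def contour_integral_unique lm_def)
  moreover have "Im (of_real X * (of_real Y * (- \<i>))) = - X * Y" for X Y by simp
  ultimately have "Im (tau0 p) = - (- cc * I + M2 p * ((e2 p) ^ 3 / 3 - (e1 p) ^ 3 / 3)) * (1 / ((1 + lm) * DD p))"
    by (simp only:)
  also have "- (- cc * I + M2 p * ((e2 p) ^ 3 / 3 - (e1 p) ^ 3 / 3)) = cc * I - M2 p * (((e2 p) ^ 3 - (e1 p) ^ 3) / 3)"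
    by (simp add: diff_divide_distrib)
  finally have "Im (tau0 p) = (cc * I - M2 p * (((e2 p) ^ 3 - (e1 p) ^ 3) / 3)) / ((1 + lm) * DD p)"
    by simp
  moreover have "cc * I \<ge> cc * ((r2 - r1) / (r2\<^sup>2 + h * r2 + \<gamma>) * ((e2 p - e1 p) * (r2 - h / 2)))"
    by (rule mult_left_mono[OF che cc])
  ultimately show ?thesis
    unfolding cc_def using lm DD0 by (simp add: divide_right_mono)
qed

section \<open>The separated mode in unscaled form\<close>

definition strip :: "real \<Rightarrow> real \<Rightarrow> complex set" where
  "strip lo hi = {z. lo < Re z \<and> Re z < hi \<and> - 1 < Im z \<and> Im z < 1}"

lemma strip_box: "strip lo hi = box (Complex lo (- 1)) (Complex hi 1)"
  by (auto simp: strip_def in_box_complex_iff)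

lemma strip_props: "open (strip lo hi)" "convex (strip lo hi)" "bounded (strip lo hi)"
  unfolding strip_box by (auto intro: open_box convex_box bounded_box)

text \<open>The cofactor of the horizon factors of \<open>mu_a\<close> found in
  \<open>mu_a_factor\<close>, continued to complex arguments.\<close>

definition k_fac :: "real \<Rightarrow> real \<Rightarrow> real \<Rightarrow> real \<Rightarrow> complex \<Rightarrow> complex" where
  "k_fac \<Lambda> a e1 e2 z = - of_real (\<Lambda> / 3) * (z * z + of_real (e1 + e2) * z + of_real ((e1 + e2)\<^sup>2 - e1 * e2 - 3 / \<Lambda> + a\<^sup>2))"

text \<open>\<open>N\<close> is the linear function that equals \<open>(1 + \<lambda>) K\<close> at \<open>e2\<close> and \<open>- (1 + \<lambda>) K\<close> at \<open>e1\<close>, where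
  \<open>K z = \<sigma> (z\<^sup>2 + a\<^sup>2) + s z\<close>; its slope is \<open>(1 + \<lambda>) \<beta>\<close>. \<open>W\<close> is \<open>(N\<^sup>2 - (1 + \<lambda>)\<^sup>2 K\<^sup>2) / \<mu>\<close> after cancellation.\<close>

definition N_fun :: "real \<Rightarrow> complex \<Rightarrow> real \<Rightarrow> real \<Rightarrow> complex \<Rightarrow> real \<Rightarrow> complex \<Rightarrow> complex" where
  "N_fun lm \<sigma> s a \<beta> e2 z = of_real (1 + lm) * (\<sigma> * (z\<^sup>2 + of_real (a\<^sup>2)) + of_real s * z + (z - of_real e2) * (\<beta> - \<sigma> * (z + of_real e2) - of_real s))"

definition W_fun :: "real \<Rightarrow> real \<Rightarrow> complex \<Rightarrow> real \<Rightarrow> real \<Rightarrow> complex \<Rightarrow> real \<Rightarrow> real \<Rightarrow> complex \<Rightarrow> complex" where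
  "W_fun \<Lambda> lm \<sigma> s a \<beta> e1 e2 z = of_real ((1 + lm)\<^sup>2) * ((\<beta> - \<sigma> * (z + of_real e2) - of_real s) * (\<beta> + \<sigma> * (z + of_real e1) + of_real s)) / k_fac \<Lambda> a e1 e2 z"

text \<open>All that the construction of the kernel element needs to know about a mode.
  \<open>slope\<close> gives \<open>N_fun\<close> its prescribed values at both horizons;
  \<open>R1\<close> and \<open>S1\<close> exclude the zero function.\<close>

locale sep_mode =
  fixes M Q \<Lambda> lo hi :: real and \<sigma> :: complex and s m a :: real and \<beta> l :: complex
    and e1 e2 :: real and R S :: "complex \<Rightarrow> complex"
  assumes L: "\<Lambda> > 0"
    and e: "lo < e1" "e1 < e2" "e2 < hi"
    and roots: "mu_a M Q \<Lambda> a e1 = 0" "mu_a M Q \<Lambda> a e2 = 0"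
    and k_nz: "\<And>z. z \<in> strip lo hi \<Longrightarrow> k_fac \<Lambda> a e1 e2 z \<noteq> 0"
    and lam_small: "\<bar>lam \<Lambda> a\<bar> \<le> 1 / 8"
    and slope: "\<beta> * of_real (e2 - e1) = \<sigma> * of_real (e1\<^sup>2 + e2\<^sup>2 + 2 * a\<^sup>2) + of_real (s * (e1 + e2))"
    and R_hol: "R holomorphic_on strip lo hi" and R1: "R (of_real e1) = 1"
    and S_hol: "S holomorphic_on ball 0 2" and S1: "S (- 1) = 1"
    and R_ode: "\<And>z. z \<in> strip lo hi \<Longrightarrow>
      ((\<lambda>z. (z - of_real e1) * (z - of_real e2) * k_fac \<Lambda> a e1 e2 z * deriv R z) has_field_derivative
        (W_fun \<Lambda> (lam \<Lambda> a) \<sigma> s a \<beta> e1 e2 z + of_real (m\<^sup>2) * z\<^sup>2 + l) * R z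
          - 2 * \<i> * N_fun (lam \<Lambda> a) \<sigma> s a \<beta> e2 z * deriv R z - \<i> * of_real (1 + lam \<Lambda> a) * \<beta> * R z) (at z)"
    and S_ode: "\<And>z. z \<in> ball 0 2 \<Longrightarrow>
      ((\<lambda>z. (z + 1) * (z - 1) * (- (1 + of_real (lam \<Lambda> a) * z\<^sup>2)) * deriv S z) has_field_derivative
        (of_real (a\<^sup>2) * (of_real ((1 + lam \<Lambda> a)\<^sup>2) * \<sigma>\<^sup>2 * (1 - z\<^sup>2) / (1 + of_real (lam \<Lambda> a) * z\<^sup>2) + of_real (m\<^sup>2) * z\<^sup>2) - l) * S z) (at z)"

text \<open>Multiplying both equations by \<open>s^2\<close> undoes the scaling, because
  \<open>s^2 * v\<close> and \<open>s^2 * y\<close> are the derivatives of \<open>Rf\<close> and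
  \<open>Sf\<close>.\<close>

lemma (in mode_params) sep_mode_of_solution:
  assumes p: "p \<in> P" and dom: "\<Omega>r = strip lo hi" and kf: "k p = k_fac L (a p) (e1 p) (e2 p)" and lm: "lam p = Defs.lam L (a p)"
    and L: "L > 0" and e: "lo < e1 p" "e2 p < hi"
    and roots: "mu_a M Q L (a p) (e1 p) = 0" "mu_a M Q L (a p) (e2 p) = 0"
    and scaled: "(s p)\<^sup>2 * M2 p = m\<^sup>2" "(s p)\<^sup>2 * A2 p = (a p)\<^sup>2"
    and hol: "v holomorphic_on \<Omega>r" "y holomorphic_on ball 0 2"
    and rode: "\<And>z. z \<in> \<Omega>r \<Longrightarrow> ((\<lambda>z. (z - E1 p) * (z - E2 p) * k p z * v z) has_field_derivative
        (Wh p \<tau> z + of_real (M2 p) * (z * z) + of_real (s p) * l) * Rf p v z - 2 * \<i> * of_real (s p) * Nh p \<tau> z * v z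
          - \<i> * of_real ((1 + lam p) * DD p / (e2 p - e1 p)) * \<tau> * Rf p v z) (at z)"
    and sode: "\<And>z. z \<in> ball 0 2 \<Longrightarrow> ((\<lambda>z. (z + 1) * (z - 1) * (- (1 + of_real (lam p) * (z * z))) * y z) has_field_derivative
        ((of_real (s p))\<^sup>2 * Uh p \<tau> z - of_real (s p) * l) * Sf p y z) (at z)"
  shows "sep_mode M Q L lo hi (of_real (s p) * Amp p \<tau>) (s p) m (a p) (of_real (s p) * be p \<tau>) (of_real ((s p) ^ 3) * l)
    (e1 p) (e2 p) (Rf p v) (Sf p y)"
proof -
  define \<sigma> where "\<sigma> = of_real (s p) * Amp p \<tau>"
  define \<beta> where "\<beta> = of_real (s p) * be p \<tau>"
  have e12: "e1 p < e2 p" using d0(1) d0(2)[OF p] by linarith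
  have dR: "(Rf p v has_field_derivative of_real ((s p)\<^sup>2) * v z) (at z)" if "z \<in> \<Omega>r" for z
    unfolding Rf_def
    by (rule DERIV_cong[OF DERIV_add[OF DERIV_const DERIV_cmult[OF DERIV_cmult[OF prim_deriv[OF open_r convex_r hol(1) e_dom(1)[OF p] that]]]]])
       (simp add: power2_eq_square)
  have dS: "(Sf p y has_field_derivative of_real ((s p)\<^sup>2) * y z) (at z)" if "z \<in> ball 0 2" for z
    unfolding Sf_def
    by (rule DERIV_cong[OF DERIV_add[OF DERIV_const DERIV_cmult[OF DERIV_cmult[OF prim_deriv[OF open_ball convex_ball hol(2) _ that]]]]])
       (simp_all add: power2_eq_square)
  have W: "of_real ((s p)\<^sup>2) * Wh p \<tau> z = W_fun L (lam p) \<sigma> (s p) (a p) \<beta> (e1 p) (e2 p) z" for z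
  proof -
    have "r\<^sup>2 * (c * ((b + (- 1) * (A * f) + (- 1)) * (b + A * g + 1)) * i) = c * ((r * b - r * A * f - r) * (r * b + r * A * g + r)) * i"
      for r c b A f g i :: complex by (simp add: power2_eq_square algebra_simps)
    then show ?thesis unfolding Wh_def W_fun_def kf \<sigma>_def \<beta>_def divide_inverse of_real_power[of "s p"] .
  qed
  have N: "of_real (s p) * Nh p \<tau> z = N_fun (lam p) \<sigma> (s p) (a p) \<beta> (e2 p) z" for z
    unfolding Nh_def N_fun_def \<sigma>_def \<beta>_def by (simp add: power2_eq_square algebra_simps)
  have be': "\<beta> = of_real ((s p)\<^sup>2) * (of_real (DD p / (e2 p - e1 p)) * \<tau>)"
    by (simp add: \<beta>_def be_def power2_eq_square)
  have slope: "\<beta> * of_real (e2 p - e1 p) = \<sigma> * of_real (DD p) + of_real (s p * (e1 p + e2 p))"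
  proof -
    have "sg1 p * DD p = - (e1 p + e2 p)" using DD_lower(2)[OF p] by (simp add: sg1_def)
    then have sg: "complex_of_real (sg1 p) * of_real (DD p) = - of_real (e1 p + e2 p)" by (simp only: flip: of_real_mult of_real_minus)
    have ne: "complex_of_real (e2 p - e1 p) \<noteq> 0" using e12 by simp
    have "\<beta> * of_real (e2 p - e1 p) = of_real ((s p)\<^sup>2) * (of_real (DD p) * \<tau>)"
      unfolding be' of_real_divide using ne by simp
    moreover have "\<sigma> * of_real (DD p) = of_real (s p) * (complex_of_real (sg1 p) * of_real (DD p)) + of_real ((s p)\<^sup>2) * (of_real (DD p) * \<tau>)"
      by (simp add: \<sigma>_def Amp_def power2_eq_square algebra_simps)
    ultimately show ?thesis unfolding sg by (simp add: algebra_simps)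
  qed
  have R_ode: "((\<lambda>z. (z - E1 p) * (z - E2 p) * k_fac L (a p) (e1 p) (e2 p) z * deriv (Rf p v) z) has_field_derivative
      (W_fun L (lam p) \<sigma> (s p) (a p) \<beta> (e1 p) (e2 p) z + of_real (m\<^sup>2) * z\<^sup>2 + of_real ((s p) ^ 3) * l) * Rf p v z
      - 2 * \<i> * N_fun (lam p) \<sigma> (s p) (a p) \<beta> (e2 p) z * deriv (Rf p v) z - \<i> * of_real (1 + lam p) * \<beta> * Rf p v z) (at z)"
    if z: "z \<in> \<Omega>r" for z
  proof -
    have eq: "of_real ((s p)\<^sup>2) * ((Wh p \<tau> z + of_real (M2 p) * (z * z) + of_real (s p) * l) * Rf p v z - 2 * \<i> * of_real (s p) * Nh p \<tau> z * v z
          - \<i> * of_real ((1 + lam p) * DD p / (e2 p - e1 p)) * \<tau> * Rf p v z) =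
        (of_real ((s p)\<^sup>2) * Wh p \<tau> z + of_real ((s p)\<^sup>2 * M2 p) * z\<^sup>2 + of_real ((s p) ^ 3) * l) * Rf p v z
        - 2 * \<i> * (of_real (s p) * Nh p \<tau> z) * (of_real ((s p)\<^sup>2) * v z)
        - \<i> * of_real (1 + lam p) * (of_real ((s p)\<^sup>2) * (of_real (DD p / (e2 p - e1 p)) * \<tau>)) * Rf p v z"
      by (simp add: power2_eq_square power3_eq_cube algebra_simps)
    have "((\<lambda>z. of_real ((s p)\<^sup>2) * ((z - E1 p) * (z - E2 p) * k p z * v z)) has_field_derivative
       of_real ((s p)\<^sup>2) * ((Wh p \<tau> z + of_real (M2 p) * (z * z) + of_real (s p) * l) * Rf p v z - 2 * \<i> * of_real (s p) * Nh p \<tau> z * v z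
          - \<i> * of_real ((1 + lam p) * DD p / (e2 p - e1 p)) * \<tau> * Rf p v z)) (at z)"
      by (rule DERIV_cmult[OF rode[OF z]])
    then show ?thesis
      unfolding eq W N be'[symmetric] scaled DERIV_imp_deriv[OF dR[OF z]]
    proof (rule has_field_derivative_transform_within_open[OF _ open_r z])
      fix w assume "w \<in> \<Omega>r"
      then show "of_real ((s p)\<^sup>2) * ((w - E1 p) * (w - E2 p) * k p w * v w) = (w - E1 p) * (w - E2 p) * k_fac L (a p) (e1 p) (e2 p) w * deriv (Rf p v) w"
        by (simp add: DERIV_imp_deriv[OF dR] kf)
    qed
  qed
  have S_ode: "((\<lambda>z. (z + 1) * (z - 1) * (- (1 + of_real (lam p) * z\<^sup>2)) * deriv (Sf p y) z) has_field_derivative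
        (of_real ((a p)\<^sup>2) * (of_real ((1 + lam p)\<^sup>2) * \<sigma>\<^sup>2 * (1 - z\<^sup>2) / (1 + of_real (lam p) * z\<^sup>2) + of_real (m\<^sup>2) * z\<^sup>2)
         - of_real ((s p) ^ 3) * l) * Sf p y z) (at z)"
    if z: "z \<in> ball 0 2" for z
  proof -
    have eq: "of_real ((s p)\<^sup>2) * (((of_real (s p))\<^sup>2 * Uh p \<tau> z - of_real (s p) * l) * Sf p y z) =
        (of_real ((a p)\<^sup>2) * (of_real ((1 + lam p)\<^sup>2) * \<sigma>\<^sup>2 * (1 - z\<^sup>2) / (1 + of_real (lam p) * z\<^sup>2) + of_real (m\<^sup>2) * z\<^sup>2)
         - of_real ((s p) ^ 3) * l) * Sf p y z"
    proof -
      have "r\<^sup>2 * ((r\<^sup>2 * (t * (c * (A * A) * (1 + (- 1) * (z * z)) * i + u * (z * z))) - r * l) * S) =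
        ((r\<^sup>2 * t) * (c * (r * A)\<^sup>2 * (1 - z * z) * i + (r\<^sup>2 * u) * (z * z)) - r ^ 3 * l) * S" for r t c A i u S :: complex
        by (simp add: power2_eq_square power3_eq_cube algebra_simps)
      then show ?thesis
        unfolding Uh_def \<sigma>_def scaled[symmetric] divide_inverse of_real_mult of_real_power[of "s p"] power2_eq_square[of z] .
    qed
    have "((\<lambda>z. of_real ((s p)\<^sup>2) * ((z + 1) * (z - 1) * (- (1 + of_real (lam p) * (z * z))) * y z)) has_field_derivative
       of_real ((s p)\<^sup>2) * (((of_real (s p))\<^sup>2 * Uh p \<tau> z - of_real (s p) * l) * Sf p y z)) (at z)"
      by (rule DERIV_cmult[OF sode[OF z]])
    then show ?thesis
      unfolding eq
    proof (rule has_field_derivative_transform_within_open[OF _ open_ball z])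
      fix w :: complex assume "w \<in> ball 0 2"
      then show "of_real ((s p)\<^sup>2) * ((w + 1) * (w - 1) * (- (1 + of_real (lam p) * (w * w))) * y w) =
         (w + 1) * (w - 1) * (- (1 + of_real (lam p) * w\<^sup>2)) * deriv (Sf p y) w"
        unfolding DERIV_imp_deriv[OF dS[OF \<open>w \<in> ball 0 2\<close>]] power2_eq_square[of w] by (simp only: mult_ac)
    qed
  qed
  have k_nz: "k_fac L (a p) (e1 p) (e2 p) z \<noteq> 0" if "z \<in> strip lo hi" for z
    using k0(2)[OF p, of z] k0(1) that unfolding dom[symmetric] kf[symmetric] by auto
  show ?thesis
    unfolding \<sigma>_def[symmetric] \<beta>_def[symmetric]
  proof unfold_locales
    show "Rf p v holomorphic_on strip lo hi" unfolding dom[symmetric] using dR by (auto simp: holomorphic_on_open[OF open_r])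
    show "Sf p y holomorphic_on ball 0 2" unfolding holomorphic_on_open[OF open_ball] using dS by blast
    show "Rf p v (E1 p) = 1" "Sf p y (- 1) = 1" by (simp_all add: Rf_def Sf_def prim_def)
    show "\<beta> * of_real (e2 p - e1 p) = \<sigma> * of_real ((e1 p)\<^sup>2 + (e2 p)\<^sup>2 + 2 * (a p)\<^sup>2) + of_real (s p * (e1 p + e2 p))"
      using slope unfolding DD_def .
    show "k_fac L (a p) (e1 p) (e2 p) z \<noteq> 0" if "z \<in> strip lo hi" for z using k_nz[OF that] .
  qed (use L e e12 roots lam_bd[OF p] R_ode[unfolded lm] S_ode[unfolded lm] in \<open>simp_all only: lm[symmetric] dom\<close>)
qed

text \<open>\<open>c0\<close> is chosen before \<open>lo\<close>, \<open>hi\<close> and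
  \<open>\<epsilon>0\<close>, because in the end it may depend on \<open>\<Lambda>\<close> but not
  on \<open>\<eta>\<close>. The inequalities are verified at \<open>a = 0\<close> and carried over
  to small \<open>a\<close> by continuity.\<close>

lemma growing_mode_ode:
  assumes M: "M > 0" and Q: "0 < \<bar>Q\<bar>" "\<bar>Q\<bar> < 3 * M / (2 * sqrt 2)"
    and L: "0 < \<Lambda>" "\<Lambda> < 1 / (1000 * M\<^sup>2)" and St: "standing_assumption M Q \<Lambda> rn rc rm rp"
  shows "\<exists>c0>0. \<forall>lo hi \<epsilon>0. rc < lo \<and> lo < rm \<and> rp < hi \<and> 0 < \<epsilon>0 \<longrightarrow>
    (\<exists>q0>0. \<exists>c1>0. \<forall>m q a :: real. m\<^sup>2 \<le> c0 * q\<^sup>2 \<and> a\<^sup>2 \<le> c0 * q\<^sup>2 \<and> 0 < \<bar>q\<bar> \<and> \<bar>q\<bar> < q0 \<longrightarrow>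
      (\<exists>\<sigma> \<beta> l e1 e2 R S. Im \<sigma> \<ge> c1 * q\<^sup>2 \<and> \<bar>e1 - rm\<bar> < \<epsilon>0 \<and> \<bar>e2 - rp\<bar> < \<epsilon>0 \<and>
        sep_mode M Q \<Lambda> lo hi \<sigma> (q * Q) m a \<beta> l e1 e2 R S))"
proof -
  have o: "rn < 0" "0 < rc" "rc < rm" "rm < rp" using St unfolding standing_assumption_def by auto
  note ratio = horizon_ratio[OF M Q L St] and vieta = mu_a_vieta[OF L(1) St]
  obtain \<delta>1 e1f where e1f: "\<delta>1 > 0" "(e1f \<longlongrightarrow> rm) (nhds 0)" "\<And>a. \<bar>a\<bar> < \<delta>1 \<Longrightarrow> mu_a M Q \<Lambda> a (e1f a) = 0"
    using horizons_perturbed[OF L(1) St, of rm] by blast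
  obtain \<delta>2 e2f where e2f: "\<delta>2 > 0" "(e2f \<longlongrightarrow> rp) (nhds 0)" "\<And>a. \<bar>a\<bar> < \<delta>2 \<Longrightarrow> mu_a M Q \<Lambda> a (e2f a) = 0"
    using horizons_perturbed[OF L(1) St, of rp] by blast
  define h where "h a = e1f a + e2f a" for a
  define D where "D a = (e1f a)\<^sup>2 + (e2f a)\<^sup>2 + 2 * a\<^sup>2" for a
  define g where "g a = (h a)\<^sup>2 - e1f a * e2f a - 3 / \<Lambda> + a\<^sup>2" for a
  define r1 where "r1 a = ((e1f a)\<^sup>2 - e1f a * e2f a + 2 * a\<^sup>2) / h a" for a
  define r2 where "r2 a = ((e2f a)\<^sup>2 - e1f a * e2f a + 2 * a\<^sup>2) / h a" for a
  define lm where "lm a = lam \<Lambda> a" for a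
  \<comment> \<open>The growth term of \<open>Im_tau0\<close>; \<open>J0\<close> is its limit at
    \<open>a = 0\<close>.\<close>
  define J where "J a = (3 / \<Lambda>) * (1 + lm a)\<^sup>2 * (h a / D a)\<^sup>2 * ((r2 a - r1 a) / ((r2 a)\<^sup>2 + h a * r2 a + g a) *
    ((e2f a - e1f a) * (r2 a - h a / 2)))" for a
  define h0 where "h0 = rm + rp"
  define D0 where "D0 = rm\<^sup>2 + rp\<^sup>2"
  define g0 where "g0 = rn * rc"
  define r10 where "r10 = (rm\<^sup>2 - rm * rp) / h0"
  define r20 where "r20 = (rp\<^sup>2 - rm * rp) / h0"
  define J0 where "J0 = (3 / \<Lambda>) * (h0 / D0)\<^sup>2 * ((r20 - r10) / (r20\<^sup>2 + h0 * r20 + g0) * ((rp - rm) * (r20 - h0 / 2)))"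
  have h0: "h0 > 0" using o by (simp add: h0_def)
  have D0: "D0 > 0" using o by (simp add: D0_def add_pos_pos)
  have g0: "g0 < 0" using o by (simp add: g0_def mult_neg_pos)
  have rr: "rm * rp > rm * rm" "rp * rp > 5 * (rm * rp)"
    using o mult_strict_left_mono[of rm rp rm] mult_strict_right_mono[of "5 * rm" rp rp] ratio by auto
  have r10: "r10 < 0" unfolding r10_def using h0 rr by (simp add: power2_eq_square divide_neg_pos)
  have rmp: "rm * rp > 0" using o by simp
  have h0e: "rm * h0 = rm * rm + rm * rp" "rp * h0 = rm * rp + rp * rp" "h0 / 2 * h0 = (rm * rm + 2 * (rm * rp) + rp * rp) / 2"
    unfolding h0_def by (simp_all add: algebra_simps)
  \<comment> \<open>Equivalent to \<open>r20 > h0 / 2\<close>, the sign on which the growth rests.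
    The ratio 5 suffices since \<open>5 * (rm * rp) > rm * rm + 4 * (rm * rp)\<close>.\<close>
  have k3: "rm * rm + 4 * (rm * rp) < rp * rp" using rr by linarith
  have r20: "rm < r20" "r20 < rp" "h0 / 2 < r20"
    unfolding r20_def pos_less_divide_eq[OF h0] pos_divide_less_eq[OF h0] power2_eq_square h0e
    using k3 rr rmp by (linarith, linarith, simp add: field_simps)
  have h0': "h0 = - (rn + rc)" using vieta(1) by (simp add: h0_def)
  have quad: "x\<^sup>2 + h0 * x + g0 = (x - rn) * (x - rc)" for x
    unfolding h0' g0_def by (simp add: algebra_simps power2_eq_square)
  have qp: "x\<^sup>2 + h0 * x + g0 > 0" if "x > rc" for x
    unfolding quad using that o by (intro mult_pos_pos) auto
  have J0: "J0 > 0"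
    unfolding J0_def using L h0 D0 r20 r10 o qp[of r20] by (intro mult_pos_pos divide_pos_pos zero_less_power) auto
  \<comment> \<open>For \<open>m\<^sup>2 \<le> c0 * q\<^sup>2\<close> the mass term is at most
    \<open>c0 / Q\<^sup>2 * rp ^ 3 = J0 / 4\<close>, half of the lower bound \<open>J0 / 2\<close>
    for the growth term.\<close>
  define c0 where "c0 = Q\<^sup>2 * J0 / (4 * rp ^ 3)"
  have Q2: "Q\<^sup>2 > 0" using Q by (simp add: zero_less_abs_iff)
  have c0: "c0 > 0" using Q2 J0 o by (simp add: c0_def)

  have idt: "((\<lambda>x. x) \<longlongrightarrow> (0::real)) (nhds 0)" by (rule filterlim_ident)
  note ti = tendsto_intros e1f(2) e2f(2) idt
  have th: "(h \<longlongrightarrow> h0) (nhds 0)" unfolding h_def h0_def by (intro ti)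
  have tD: "(D \<longlongrightarrow> D0) (nhds 0)" unfolding D_def D0_def by (rule tendsto_eq_intros e1f(2) e2f(2) idt refl | simp)+
  have tg: "(g \<longlongrightarrow> g0) (nhds 0)" unfolding g_def g0_def
    by (rule tendsto_eq_intros e1f(2) e2f(2) idt th refl | simp)+ (use vieta(2) in \<open>simp add: h0_def\<close>)
  have tr1: "(r1 \<longlongrightarrow> r10) (nhds 0)" unfolding r1_def r10_def
    by (rule tendsto_eq_intros e1f(2) e2f(2) idt th refl | use h0 in simp)+
  have tr2: "(r2 \<longlongrightarrow> r20) (nhds 0)" unfolding r2_def r20_def
    by (rule tendsto_eq_intros e1f(2) e2f(2) idt th refl | use h0 in simp)+
  have tl: "(lm \<longlongrightarrow> 0) (nhds 0)" unfolding lm_def lam_def by (rule tendsto_eq_intros idt refl | simp)+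
  have tJ: "(J \<longlongrightarrow> J0) (nhds 0)"
  proof -
    have "(J \<longlongrightarrow> (3 / \<Lambda>) * (1 + 0)\<^sup>2 * (h0 / D0)\<^sup>2 * ((r20 - r10) / (r20\<^sup>2 + h0 * r20 + g0) * ((rp - rm) * (r20 - h0 / 2)))) (nhds 0)"
      unfolding J_def by (intro tendsto_intros e1f(2) e2f(2) th tD tg tr1 tr2 tl) (use D0 qp[of r20] r20 o in auto)
    then show ?thesis by (simp add: J0_def)
  qed
  show ?thesis
  proof (rule exI[of _ c0], intro conjI c0 allI impI)
    fix lo hi \<epsilon>0 :: real assume "rc < lo \<and> lo < rm \<and> rp < hi \<and> 0 < \<epsilon>0"
    then have b: "rc < lo" "lo < rm" "rp < hi" "0 < \<epsilon>0" by auto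
    \<comment> \<open>Lower bound for the modulus of \<open>(z - rn) * (z - rc)\<close> on the
      strip, which lies to the right of \<open>rc\<close>; half of it survives for small
      \<open>a\<close>.\<close>
    define k1 where "k1 = (lo - rc)\<^sup>2"
    have k1: "k1 > 0" using b by (simp add: k1_def)
    obtain B where B: "\<And>z. z \<in> strip lo hi \<Longrightarrow> norm z \<le> B" "B > 0"
      using strip_props(3)[of lo hi] by (auto simp: bounded_pos)
    \<comment> \<open>\<open>J0 / 4\<close> remains in the numerator of the bound in
      \<open>Im_tau0\<close>, and \<open>2 * D0\<close> bounds its denominator.\<close>
    define c1 where "c1 = J0 / (8 * D0)"
    have c1: "c1 > 0" using J0 D0 by (simp add: c1_def)
    \<comment> \<open>The smallness conditions on \<open>a\<close> are collected as eventual
      properties at 0 and then replaced by a single \<open>\<delta>\<close>.\<close>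
    have ta: "\<forall>\<^sub>F a in nhds 0. \<bar>a\<bar> < d" if "d > 0" for d :: real
      using order_tendstoD(2)[OF tendsto_rabs[OF idt], of d] that by simp
    have te: "\<forall>\<^sub>F a in nhds 0. \<bar>f a - l\<bar> < d" if "(f \<longlongrightarrow> l) (nhds 0)" "d > 0" for f :: "real \<Rightarrow> real" and l d
      using order_tendstoD(2)[OF tendsto_rabs[OF tendsto_diff[OF that(1) tendsto_const[of l]]], of d] that(2) by simp
    have "\<forall>\<^sub>F a in nhds 0. \<bar>a\<bar> < \<delta>1" "\<forall>\<^sub>F a in nhds 0. \<bar>a\<bar> < \<delta>2" "\<forall>\<^sub>F a::real in nhds 0. \<bar>a\<bar> < 1"
      using ta[OF e1f(1)] ta[OF e2f(1)] ta[OF zero_less_one] by simp_all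
    moreover have "\<forall>\<^sub>F a in nhds 0. \<bar>e1f a - rm\<bar> < \<epsilon>0" "\<forall>\<^sub>F a in nhds 0. \<bar>e2f a - rp\<bar> < \<epsilon>0" "\<forall>\<^sub>F a in nhds 0. \<bar>lm a - 0\<bar> < 1 / 8"
      using te[OF e1f(2) b(4)] te[OF e2f(2) b(4)] te[OF tl, of "1 / 8"] by simp_all
    moreover have "\<forall>\<^sub>F a in nhds 0. lo < e1f a" by (rule order_tendstoD(1)[OF e1f(2) b(2)])
    moreover have "\<forall>\<^sub>F a in nhds 0. e2f a < hi" by (rule order_tendstoD(2)[OF e2f(2) b(3)])
    moreover have "\<forall>\<^sub>F a in nhds 0. (rp - rm) / 2 < e2f a - e1f a"
      by (rule order_tendstoD(1)[OF tendsto_diff[OF e2f(2) e1f(2)]]) (use o in simp)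
    moreover have "\<forall>\<^sub>F a in nhds 0. r2 a - e1f a > 0" "\<forall>\<^sub>F a in nhds 0. e2f a - r2 a > 0"
      using order_tendstoD(1)[OF tendsto_diff[OF tr2 e1f(2)], of 0] order_tendstoD(1)[OF tendsto_diff[OF e2f(2) tr2], of 0] r20 by auto
    moreover have "\<forall>\<^sub>F a in nhds 0. g a < 0" "\<forall>\<^sub>F a in nhds 0. r1 a < 0" "\<forall>\<^sub>F a in nhds 0. J a > J0 / 2"
      using order_tendstoD(2)[OF tg g0] order_tendstoD(2)[OF tr1 r10] order_tendstoD(1)[OF tJ, of "J0 / 2"] J0 by auto
    moreover have "\<forall>\<^sub>F a in nhds 0. \<bar>h a - h0\<bar> * B + \<bar>g a - g0\<bar> < k1 / 2"
    proof (rule order_tendstoD(2))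
      show "((\<lambda>a. \<bar>h a - h0\<bar> * B + \<bar>g a - g0\<bar>) \<longlongrightarrow> \<bar>h0 - h0\<bar> * B + \<bar>g0 - g0\<bar>) (nhds 0)"
        by (intro tendsto_intros th tg)
      show "\<bar>h0 - h0\<bar> * B + \<bar>g0 - g0\<bar> < k1 / 2" using k1 by simp
    qed
    moreover have "\<forall>\<^sub>F a in nhds 0. ((e2f a) ^ 3 - (e1f a) ^ 3) / 3 < rp ^ 3"
    proof (rule order_tendstoD(2))
      show "((\<lambda>a. ((e2f a) ^ 3 - (e1f a) ^ 3) / 3) \<longlongrightarrow> (rp ^ 3 - rm ^ 3) / 3) (nhds 0)"
        by (intro tendsto_intros e1f(2) e2f(2)) simp
      have "rm ^ 3 > 0" "rp ^ 3 > 0" using o by simp_all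
      then have "rp ^ 3 - rm ^ 3 < rp ^ 3 * 3" by linarith
      then show "(rp ^ 3 - rm ^ 3) / 3 < rp ^ 3" by (simp add: pos_divide_less_eq)
    qed
    moreover have "\<forall>\<^sub>F a in nhds 0. (1 + lm a) * D a < 2 * D0"
    proof (rule order_tendstoD(2))
      show "((\<lambda>a. (1 + lm a) * D a) \<longlongrightarrow> (1 + 0) * D0) (nhds 0)" by (intro tendsto_intros tl tD)
      show "(1 + 0) * D0 < 2 * D0" using D0 by simp
    qed
    ultimately have "\<forall>\<^sub>F a in nhds 0. (\<bar>a\<bar> < \<delta>1 \<and> \<bar>a\<bar> < \<delta>2 \<and> \<bar>a\<bar> < 1) \<and>
       (lo < e1f a \<and> e2f a < hi \<and> \<bar>e1f a - rm\<bar> < \<epsilon>0 \<and> \<bar>e2f a - rp\<bar> < \<epsilon>0 \<and> e2f a - e1f a \<ge> (rp - rm) / 2) \<and>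
       (e1f a \<le> r2 a \<and> r2 a \<le> e2f a) \<and> (g a < 0 \<and> r1 a < 0 \<and> J a > J0 / 2 \<and> \<bar>lm a\<bar> \<le> 1 / 8) \<and>
       \<bar>h a - h0\<bar> * B + \<bar>g a - g0\<bar> < k1 / 2 \<and> ((e2f a) ^ 3 - (e1f a) ^ 3) / 3 < rp ^ 3 \<and> (1 + lm a) * D a < 2 * D0"
      by eventually_elim auto
    then obtain \<delta> where \<delta>: "\<delta> > 0" and ev: "\<And>a. \<bar>a\<bar> < \<delta> \<Longrightarrow> (\<bar>a\<bar> < \<delta>1 \<and> \<bar>a\<bar> < \<delta>2 \<and> \<bar>a\<bar> < 1) \<and>
       (lo < e1f a \<and> e2f a < hi \<and> \<bar>e1f a - rm\<bar> < \<epsilon>0 \<and> \<bar>e2f a - rp\<bar> < \<epsilon>0 \<and> e2f a - e1f a \<ge> (rp - rm) / 2) \<and>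
       (e1f a \<le> r2 a \<and> r2 a \<le> e2f a) \<and> (g a < 0 \<and> r1 a < 0 \<and> J a > J0 / 2 \<and> \<bar>lm a\<bar> \<le> 1 / 8) \<and>
       \<bar>h a - h0\<bar> * B + \<bar>g a - g0\<bar> < k1 / 2 \<and> ((e2f a) ^ 3 - (e1f a) ^ 3) / 3 < rp ^ 3 \<and> (1 + lm a) * D a < 2 * D0"
      by (auto simp: eventually_nhds_metric dist_real_def)
    have kq: "norm (z * z + of_real (h a) * z + of_real (g a)) \<ge> k1 / 2" if "z \<in> strip lo hi" "\<bar>a\<bar> < \<delta>" for z a
    proof -
      have "z * z + of_real h0 * z + of_real g0 = (z - of_real rn) * (z - of_real rc)"
        unfolding h0' g0_def by (simp add: algebra_simps)
      moreover have "norm (z - of_real rn) \<ge> lo - rc" "norm (z - of_real rc) \<ge> lo - rc"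
        using complex_Re_le_cmod[of "z - of_real rn"] complex_Re_le_cmod[of "z - of_real rc"] that(1) o by (auto simp: strip_def)
      ultimately have n1: "norm (z * z + of_real h0 * z + of_real g0) \<ge> k1"
        using b by (simp add: norm_mult k1_def power2_eq_square mult_mono)
      have n2: "norm (of_real (h a - h0) * z + of_real (g a - g0)) \<le> \<bar>h a - h0\<bar> * B + \<bar>g a - g0\<bar>"
        by (rule norm_triangle_mono) (use B(1)[OF that(1)] in \<open>auto simp: norm_mult mult_left_mono simp flip: of_real_diff\<close>)
      have n3: "\<bar>h a - h0\<bar> * B + \<bar>g a - g0\<bar> < k1 / 2" using ev[OF that(2)] by blast
      have eq: "z * z + of_real (h a) * z + of_real (g a) = (z * z + of_real h0 * z + of_real g0) + (of_real (h a - h0) * z + of_real (g a - g0))"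
        by (simp add: algebra_simps)
      show ?thesis unfolding eq
        using n1 n2 n3 norm_diff_ineq[of "z * z + of_real h0 * z + of_real g0" "of_real (h a - h0) * z + of_real (g a - g0)"] by linarith
    qed
    \<comment> \<open>The first bound gives \<open>\<bar>s\<bar> \<le> 1\<close>, the second
      \<open>\<bar>a\<bar> < \<delta>\<close>, because
      \<open>a\<^sup>2 \<le> c0 * q\<^sup>2\<close>.\<close>
    define q1 where "q1 = min (1 / \<bar>Q\<bar>) (\<delta> / sqrt c0)"
    have q1: "q1 > 0" using Q \<delta> c0 by (simp add: q1_def)
    \<comment> \<open>All admissible triples form one parameter set, so the constants from
      \<open>modes_exist\<close> do not depend on \<open>m\<close>, \<open>q\<close> or
      \<open>a\<close>.\<close>
    define P where "P = {(m, q, a) | m q a. m\<^sup>2 \<le> c0 * q\<^sup>2 \<and> a\<^sup>2 \<le> c0 * q\<^sup>2 \<and> 0 < \<bar>q\<bar> \<and> \<bar>q\<bar> < q1}"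
    define sf :: "real \<times> real \<times> real \<Rightarrow> real" where "sf = (\<lambda>(m, q, a). q * Q)"
    define M2 :: "real \<times> real \<times> real \<Rightarrow> real" where "M2 = (\<lambda>(m, q, a). m\<^sup>2 / (q * Q)\<^sup>2)"
    define A2 :: "real \<times> real \<times> real \<Rightarrow> real" where "A2 = (\<lambda>(m, q, a). a\<^sup>2 / (q * Q)\<^sup>2)"
    define al :: "real \<times> real \<times> real \<Rightarrow> real" where "al = (\<lambda>(m, q, a). a)"
    define kf where "kf p = k_fac \<Lambda> (al p) (e1f (al p)) (e2f (al p))" for p
    have kf: "kf p z = - of_real (\<Lambda> / 3) * (z * z + of_real (h (al p)) * z + of_real (g (al p)))" for p z
      by (simp add: kf_def k_fac_def h_def g_def)
    have a\<delta>: "\<bar>a\<bar> < \<delta>" if "a\<^sup>2 \<le> c0 * q\<^sup>2" "\<bar>q\<bar> < q1" for a q :: real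
    proof -
      have "\<bar>a\<bar> \<le> sqrt (c0 * q\<^sup>2)" using that(1) real_le_rsqrt[of "\<bar>a\<bar>"] by simp
      also have "\<dots> = sqrt c0 * \<bar>q\<bar>" by (simp add: real_sqrt_mult)
      also have "\<dots> < sqrt c0 * (\<delta> / sqrt c0)" using that(2) c0 by (intro mult_strict_left_mono) (auto simp: q1_def)
      finally show ?thesis using c0 by simp
    qed
    have bd2: "x\<^sup>2 / (q * Q)\<^sup>2 \<le> c0 / Q\<^sup>2" if "x\<^sup>2 \<le> c0 * q\<^sup>2" "0 < \<bar>q\<bar>" for x q
      using that Q2 by (simp add: power_mult_distrib field_simps zero_less_abs_iff)
    interpret mode_params P sf M2 A2 "\<lambda>p. lm (al p)" al "\<lambda>p. e1f (al p)" "\<lambda>p. e2f (al p)" kf "strip lo hi" "max 1 (c0 / Q\<^sup>2)" "(rp - rm) / 2" "\<Lambda> / 3 * (k1 / 2)"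
    proof (unfold_locales, goal_cases)
      case 1 show ?case by (rule strip_props)
    next
      case 2 show ?case by (rule strip_props)
    next
      case 3 show ?case by (rule strip_props)
    next
      case 4
      have "of_real rm \<in> strip lo hi" using b o by (simp add: strip_def)
      then show ?case by auto
    next
      case (5 p) then show ?case using Q by (auto simp: P_def sf_def)
    next
      case (6 p) then show ?case using Q by (auto simp: P_def sf_def q1_def abs_mult field_simps)
    next
      case (7 p) then show ?case using bd2 by (auto simp: P_def M2_def le_max_iff_disj)
    next
      case (8 p) then show ?case using bd2 by (auto simp: P_def A2_def le_max_iff_disj)
    next
      case (9 p) then show ?case using ev a\<delta> by (fastforce simp: P_def al_def le_max_iff_disj)
    next
      case (10 p) then show ?case using ev a\<delta> by (fastforce simp: P_def al_def)
    next
      case (11 p)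
      then have "\<bar>al p\<bar> < \<delta>" using a\<delta> by (auto simp: P_def al_def)
      from ev[OF this] show ?case using o by (simp add: strip_def)
    next
      case (12 p)
      then have "\<bar>al p\<bar> < \<delta>" using a\<delta> by (auto simp: P_def al_def)
      from ev[OF this] show ?case using o by (simp add: strip_def)
    next
      case 13 show ?case using o by simp
    next
      case (14 p)
      then have "\<bar>al p\<bar> < \<delta>" using a\<delta> by (auto simp: P_def al_def)
      from ev[OF this] show ?case by simp
    next
      case (15 p) show ?case unfolding kf_def k_fac_def by (intro holomorphic_intros)
    next
      case 16 show ?case using L k1 by simp
    next
      case (17 p z)
      then have "\<bar>al p\<bar> < \<delta>" using a\<delta> by (auto simp: P_def al_def)
      from kq[OF 17(2) this] show ?case unfolding kf norm_mult norm_minus_cancel norm_of_real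
        using L k1 by (intro mult_mono) auto
    qed
    obtain \<epsilon> C where \<epsilon>: "\<epsilon> > 0" "C \<ge> 0" and modes: "\<And>p. p \<in> P \<Longrightarrow> \<bar>sf p\<bar> < \<epsilon> \<Longrightarrow> \<exists>\<tau> l v y. norm (\<tau> - tau0 p) \<le> C * \<bar>sf p\<bar> \<and>
     v holomorphic_on strip lo hi \<and> y holomorphic_on ball 0 2 \<and>
     (\<forall>z\<in>strip lo hi. ((\<lambda>z. (z - E1 p) * (z - E2 p) * kf p z * v z) has_field_derivative
        (Wh p \<tau> z + of_real (M2 p) * (z * z) + of_real (sf p) * l) * Rf p v z - 2 * \<i> * of_real (sf p) * Nh p \<tau> z * v z
          - \<i> * of_real ((1 + lm (al p)) * DD p / (e2f (al p) - e1f (al p))) * \<tau> * Rf p v z) (at z)) \<and>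
     (\<forall>z\<in>ball 0 2. ((\<lambda>z. (z + 1) * (z - 1) * (- (1 + of_real (lm (al p)) * (z * z))) * y z) has_field_derivative
        ((of_real (sf p))\<^sup>2 * Uh p \<tau> z - of_real (sf p) * l) * Sf p y z) (at z))"
      using modes_exist by blast
    \<comment> \<open>The second bound is the threshold of \<open>modes_exist\<close>; the third
      keeps the error \<open>C * \<bar>s\<bar>\<close> below \<open>c1 / 2\<close>.\<close>
    define q0 where "q0 = min q1 (min (\<epsilon> / \<bar>Q\<bar>) (c1 / (2 * (C + 1) * \<bar>Q\<bar>)))"
    show "\<exists>q0>0. \<exists>c1>0. \<forall>m q a :: real. m\<^sup>2 \<le> c0 * q\<^sup>2 \<and> a\<^sup>2 \<le> c0 * q\<^sup>2 \<and> 0 < \<bar>q\<bar> \<and> \<bar>q\<bar> < q0 \<longrightarrow>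
      (\<exists>\<sigma> \<beta> l e1 e2 R S. Im \<sigma> \<ge> c1 * q\<^sup>2 \<and> \<bar>e1 - rm\<bar> < \<epsilon>0 \<and> \<bar>e2 - rp\<bar> < \<epsilon>0 \<and>
        sep_mode M Q \<Lambda> lo hi \<sigma> (q * Q) m a \<beta> l e1 e2 R S)"
    proof -
      have q0: "q0 > 0" using q1 \<epsilon> c1 Q by (simp add: q0_def)
      have c1': "c1 / 2 * Q\<^sup>2 > 0" using c1 Q2 by simp
      have main: "\<exists>\<sigma> \<beta> l e1 e2 R S. Im \<sigma> \<ge> c1 / 2 * Q\<^sup>2 * q\<^sup>2 \<and> \<bar>e1 - rm\<bar> < \<epsilon>0 \<and> \<bar>e2 - rp\<bar> < \<epsilon>0 \<and>
        sep_mode M Q \<Lambda> lo hi \<sigma> (q * Q) m a \<beta> l e1 e2 R S"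
        if A: "m\<^sup>2 \<le> c0 * q\<^sup>2 \<and> a\<^sup>2 \<le> c0 * q\<^sup>2 \<and> 0 < \<bar>q\<bar> \<and> \<bar>q\<bar> < q0" for m q a :: real
      proof -
        define p where "p = (m, q, a)"
        have qs: "\<bar>q\<bar> < q1" "\<bar>q\<bar> < \<epsilon> / \<bar>Q\<bar>" "\<bar>q\<bar> < c1 / (2 * (C + 1) * \<bar>Q\<bar>)" using A by (auto simp: q0_def)
        have pP: "p \<in> P" using A qs(1) by (auto simp: P_def p_def)
        have alp: "al p = a" "sf p = q * Q" "M2 p = m\<^sup>2 / (q * Q)\<^sup>2" "A2 p = a\<^sup>2 / (q * Q)\<^sup>2"
          by (simp_all add: p_def al_def sf_def M2_def A2_def)
        note ea = ev[OF a\<delta>[of a q]]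
        have ea: "lo < e1f a" "e2f a < hi" "\<bar>e1f a - rm\<bar> < \<epsilon>0" "\<bar>e2f a - rp\<bar> < \<epsilon>0" "e2f a - e1f a \<ge> (rp - rm) / 2"
          "e1f a \<le> r2 a" "r2 a \<le> e2f a" "g a < 0" "r1 a < 0" "J a > J0 / 2" "\<bar>lm a\<bar> \<le> 1 / 8" "\<bar>a\<bar> < \<delta>1" "\<bar>a\<bar> < \<delta>2"
          "((e2f a) ^ 3 - (e1f a) ^ 3) / 3 < rp ^ 3" "(1 + lm a) * D a < 2 * D0" "\<bar>a\<bar> < \<delta>"
          using ev[OF a\<delta>[of a q]] a\<delta>[of a q] A qs(1) by auto
        have e12: "e1f a < e2f a" using ea(5) o less_le_trans[of 0 "(rp - rm) / 2" "e2f a - e1f a"] by simp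
        have "\<bar>sf p\<bar> < \<epsilon>" using qs(2) Q by (simp add: alp abs_mult pos_less_divide_eq)
        from modes[OF pP this] obtain \<tau> l v y where tau: "norm (\<tau> - tau0 p) \<le> C * \<bar>sf p\<bar>"
          and hol: "v holomorphic_on strip lo hi" "y holomorphic_on ball 0 2"
          and rode: "\<And>z. z \<in> strip lo hi \<Longrightarrow> ((\<lambda>z. (z - E1 p) * (z - E2 p) * kf p z * v z) has_field_derivative
            (Wh p \<tau> z + of_real (M2 p) * (z * z) + of_real (sf p) * l) * Rf p v z - 2 * \<i> * of_real (sf p) * Nh p \<tau> z * v z
              - \<i> * of_real ((1 + lm (al p)) * DD p / (e2f (al p) - e1f (al p))) * \<tau> * Rf p v z) (at z)"
          and sode: "\<And>z. z \<in> ball 0 2 \<Longrightarrow> ((\<lambda>z. (z + 1) * (z - 1) * (- (1 + of_real (lm (al p)) * (z * z))) * y z) has_field_derivative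
            ((of_real (sf p))\<^sup>2 * Uh p \<tau> z - of_real (sf p) * l) * Sf p y z) (at z)" by blast
        define s where "s = q * Q"
        have s0: "s \<noteq> 0" using A Q by (auto simp: s_def)
        have sfp: "sf p = s" by (simp add: alp s_def)
        have M2s: "s\<^sup>2 * M2 p = m\<^sup>2" "s\<^sup>2 * A2 p = a\<^sup>2" using s0 by (simp_all add: alp flip: s_def)
        have DDp: "DD p = D a" by (simp add: DD_def D_def alp)
        have Dp: "D a > 0" using DD_lower(2)[OF pP] by (simp add: DDp)
        define \<sigma> where "\<sigma> = of_real s * Amp p \<tau>"
        define \<beta> where "\<beta> = of_real s * be p \<tau>"
        have posq: "x\<^sup>2 + h a * x + g a > 0" if x: "e1f a \<le> x" "x \<le> e2f a" for x
        proof -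
          have xs: "complex_of_real x \<in> strip lo hi" using x ea(1,2) by (simp add: strip_def)
          have "\<bar>(h a - h0) * x + (g a - g0)\<bar> \<le> \<bar>h a - h0\<bar> * B + \<bar>g a - g0\<bar>"
            using B(1)[OF xs] abs_triangle_ineq[of "(h a - h0) * x" "g a - g0"] mult_left_mono[of "\<bar>x\<bar>" B "\<bar>h a - h0\<bar>"]
            by (simp add: abs_mult)
          also have "\<dots> < k1 / 2" using ev[OF ea(16)] by blast
          finally have "- (k1 / 2) < (h a - h0) * x + (g a - g0)" by linarith
          moreover have "k1 \<le> x\<^sup>2 + h0 * x + g0"
            unfolding quad unfolding k1_def power2_eq_square using x ea(1) b o by (intro mult_mono) auto
          moreover have "x\<^sup>2 + h a * x + g a = (x\<^sup>2 + h0 * x + g0) + ((h a - h0) * x + (g a - g0))" by (simp add: algebra_simps)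
          ultimately show ?thesis using k1 by linarith
        qed
        have kp: "kf p z = - of_real (\<Lambda> / 3) * (z * z + of_real (e1f (al p) + e2f (al p)) * z + of_real (g a))" for z
          unfolding kf alp h_def ..
        have "Im (tau0 p) \<ge> (J a - M2 p * (((e2f a) ^ 3 - (e1f a) ^ 3) / 3)) / ((1 + lm a) * D a)"
          using Im_tau0[OF pP kp L(1) ea(8), unfolded alp(1), folded h_def, folded r1_def r2_def, OF ea(9) _ e12 ea(6,7) posq] ea(1) b o
          unfolding J_def DDp by simp
        also have "(J a - M2 p * (((e2f a) ^ 3 - (e1f a) ^ 3) / 3)) / ((1 + lm a) * D a) \<ge> c1"
        proof -
          have "M2 p \<le> c0 / Q\<^sup>2" using bd2[of m q] A by (simp add: alp)
          then have "M2 p * (((e2f a) ^ 3 - (e1f a) ^ 3) / 3) \<le> c0 / Q\<^sup>2 * rp ^ 3"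
            using ea(14) c0 Q2 o e12 b ea(1) by (intro mult_mono) (auto intro!: divide_nonneg_nonneg power_mono)
          also have "\<dots> = J0 / 4" using Q2 o by (simp add: c0_def)
          finally have n: "J a - M2 p * (((e2f a) ^ 3 - (e1f a) ^ 3) / 3) \<ge> J0 / 4" using ea(10) by linarith
          have "c1 = (J0 / 4) / (2 * D0)" by (simp add: c1_def)
          also have "\<dots> \<le> (J a - M2 p * (((e2f a) ^ 3 - (e1f a) ^ 3) / 3)) / ((1 + lm a) * D a)"
            using n ea(15) ea(11) Dp J0 by (intro frac_le) (auto intro!: mult_pos_pos simp: abs_le_iff)
          finally show ?thesis .
        qed
        finally have t0: "Im (tau0 p) \<ge> c1" .
        have "C * \<bar>sf p\<bar> \<le> c1 / 2"
        proof -
          have "2 * ((C + 1) * (\<bar>q\<bar> * \<bar>Q\<bar>)) < c1" using qs(3) Q \<epsilon>(2) by (simp add: pos_less_divide_eq mult_ac)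
          moreover have "C * (\<bar>q\<bar> * \<bar>Q\<bar>) \<le> (C + 1) * (\<bar>q\<bar> * \<bar>Q\<bar>)" by (intro mult_right_mono) auto
          ultimately show ?thesis by (simp add: alp abs_mult)
        qed
        then have Imt: "Im \<tau> \<ge> c1 / 2" using t0 tau abs_Im_le_cmod[of "\<tau> - tau0 p"] by (simp add: abs_le_iff)
        \<comment> \<open>The first order value \<open>sg1\<close> is real, so only
          \<open>\<tau>\<close> contributes.\<close>
        have "Im \<sigma> = s\<^sup>2 * Im \<tau>" by (simp add: \<sigma>_def Amp_def sfp power2_eq_square)
        then have Ims: "Im \<sigma> \<ge> c1 / 2 * Q\<^sup>2 * q\<^sup>2"
          using mult_left_mono[OF Imt, of "s\<^sup>2"] by (simp add: s_def power_mult_distrib mult_ac)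
        have "sep_mode M Q \<Lambda> lo hi (of_real (sf p) * Amp p \<tau>) (sf p) m (al p) (of_real (sf p) * be p \<tau>) (of_real ((sf p) ^ 3) * l)
          (e1f (al p)) (e2f (al p)) (Rf p v) (Sf p y)"
          by (rule sep_mode_of_solution[OF pP refl _ _ L(1) _ _ _ _ _ _ hol rode sode])
             (use ea e12 e1f(3) e2f(3) M2s in \<open>auto simp: kf_def lm_def alp sfp\<close>)
        then have "sep_mode M Q \<Lambda> lo hi \<sigma> (q * Q) m a \<beta> (of_real (s ^ 3) * l) (e1f a) (e2f a) (Rf p v) (Sf p y)"
          by (simp only: \<sigma>_def \<beta>_def sfp alp(1) flip: s_def)
        then show ?thesis using Ims ea(3,4) by blast
      qed
      show ?thesis
        by (rule exI[of _ q0], rule conjI[OF q0], rule exI[of _ "c1 / 2 * Q\<^sup>2"], rule conjI[OF c1'], intro allI impI, rule main)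
    qed
  qed
qed

section \<open>Integrals over the coordinate box\<close>

definition bint :: "real \<Rightarrow> real \<Rightarrow> (real \<Rightarrow> real \<Rightarrow> real \<Rightarrow> complex) \<Rightarrow> complex" where
  "bint lo hi G = (LINT (r, \<theta>, \<phi>) : {lo<..<hi} \<times> {0<..<pi} \<times> {0<..<2*pi} | lborel. G r \<theta> \<phi>)"

definition bint_integrable :: "real \<Rightarrow> real \<Rightarrow> (real \<Rightarrow> real \<Rightarrow> real \<Rightarrow> complex) \<Rightarrow> bool" where
  "bint_integrable lo hi G \<longleftrightarrow> set_integrable lborel ({lo<..<hi} \<times> {0<..<pi} \<times> {0<..<2*pi}) (\<lambda>(r, \<theta>, \<phi>). G r \<theta> \<phi>)"

lemma distr_of_bint: "distr_of lo hi u \<psi> = bint lo hi (\<lambda>r \<theta> \<phi>. u (spherical r \<theta> \<phi>) * \<psi> r \<theta> \<phi>)"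
  by (simp add: distr_of_def bint_def)

lemma bint_cong:
  assumes "\<And>r \<theta> \<phi>. lo < r \<Longrightarrow> r < hi \<Longrightarrow> 0 < \<theta> \<Longrightarrow> \<theta> < pi \<Longrightarrow> G r \<theta> \<phi> = G' r \<theta> \<phi>"
  shows "bint lo hi G = bint lo hi G'"
  unfolding bint_def by (rule set_lebesgue_integral_cong) (use assms in \<open>auto simp: sets_lborel borel_open open_Times\<close>)

lemma bint_add:
  assumes "bint_integrable lo hi G" "bint_integrable lo hi G'"
  shows "bint lo hi (\<lambda>r \<theta> \<phi>. G r \<theta> \<phi> + G' r \<theta> \<phi>) = bint lo hi G + bint lo hi G'"
    and "bint_integrable lo hi (\<lambda>r \<theta> \<phi>. G r \<theta> \<phi> + G' r \<theta> \<phi>)"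
  using set_integral_add[OF assms[unfolded bint_integrable_def]]
  by (simp_all add: bint_def bint_integrable_def case_prod_unfold)

lemma bint_minus: "bint lo hi (\<lambda>r \<theta> \<phi>. - G r \<theta> \<phi>) = - bint lo hi G"
  by (simp add: bint_def case_prod_beta set_lebesgue_integral_def)

text \<open>One indicator per variable, so that the iterated integrals can be taken in any
  order.\<close>

lemma bint_as_integral:
  "bint lo hi G = (LINT p|lborel. indicator {lo<..<hi} (fst p) *\<^sub>R (indicator {0<..<pi} (fst (snd p)) *\<^sub>R
     (indicator {0<..<2*pi} (snd (snd p)) *\<^sub>R G (fst p) (fst (snd p)) (snd (snd p)))))"
  unfolding bint_def set_lebesgue_integral_def
  by (intro Bochner_Integration.integral_cong) (auto simp: indicator_def case_prod_beta)

lemma integral_pair_zero: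
  fixes f :: "'a::euclidean_space \<times> 'b::euclidean_space \<Rightarrow> complex"
  shows "(\<And>x. (LINT y|lborel. f (x, y)) = 0) \<Longrightarrow> (LINT p|lborel. f p) = 0"
    and "(\<And>y. (LINT x|lborel. f (x, y)) = 0) \<Longrightarrow> (LINT p|lborel. f p) = 0"
proof -
  have 1: "(LINT p|lborel. f p) = (LINT x|lborel. LINT y|lborel. f (x, y))"
     "(LINT p|lborel. f p) = (LINT y|lborel. LINT x|lborel. f (x, y))" if "integrable lborel f"
  proof -
    have i: "integrable (lborel \<Otimes>\<^sub>M lborel) (case_prod (\<lambda>x y. f (x, y)))" using that by (simp add: lborel_prod)
    show "(LINT p|lborel. f p) = (LINT x|lborel. LINT y|lborel. f (x, y))"
      using lborel_pair.integral_fst[OF i] by (simp add: lborel_prod)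
    show "(LINT p|lborel. f p) = (LINT y|lborel. LINT x|lborel. f (x, y))"
      using lborel_pair.integral_snd[OF i] by (simp add: lborel_prod)
  qed
  show "(\<And>x. (LINT y|lborel. f (x, y)) = 0) \<Longrightarrow> (LINT p|lborel. f p) = 0"
    using 1(1) not_integrable_integral_eq by (cases "integrable lborel f") auto
  show "(\<And>y. (LINT x|lborel. f (x, y)) = 0) \<Longrightarrow> (LINT p|lborel. f p) = 0"
    using 1(2) not_integrable_integral_eq by (cases "integrable lborel f") auto
qed

text \<open>Integrability is not required: integrals of non-integrable functions are \<open>0\<close> by convention.\<close>

lemma bint_zero_phi:
  assumes "\<And>r \<theta>. lo < r \<Longrightarrow> r < hi \<Longrightarrow> 0 < \<theta> \<Longrightarrow> \<theta> < pi \<Longrightarrow> (LINT \<phi>|lborel. indicator {0<..<2*pi} \<phi> *\<^sub>R G r \<theta> \<phi>) = 0"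
  shows "bint lo hi G = 0"
  unfolding bint_as_integral
proof (rule integral_pair_zero(1))
  fix r :: real
  show "(LINT q|lborel. indicator {lo<..<hi} (fst (r, q)) *\<^sub>R (indicator {0<..<pi} (fst (snd (r, q))) *\<^sub>R
     (indicator {0<..<2*pi} (snd (snd (r, q))) *\<^sub>R G (fst (r, q)) (fst (snd (r, q))) (snd (snd (r, q)))))) = 0"
    by (rule integral_pair_zero(1)) (use assms[of r] in \<open>auto simp: indicator_def\<close>)
qed

lemma bint_zero_theta:
  assumes "\<And>r \<phi>. lo < r \<Longrightarrow> r < hi \<Longrightarrow> (LINT \<theta>|lborel. indicator {0<..<pi} \<theta> *\<^sub>R G r \<theta> \<phi>) = 0"
  shows "bint lo hi G = 0"
  unfolding bint_as_integral
proof (rule integral_pair_zero(1))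
  fix r :: real
  have sw: "indicator {lo<..<hi} r *\<^sub>R (indicator {0<..<pi} \<theta> *\<^sub>R (indicator {0<..<2*pi} \<phi> *\<^sub>R G r \<theta> \<phi>))
    = (indicator {lo<..<hi} r * indicator {0<..<2*pi} \<phi>) *\<^sub>R (indicator {0<..<pi} \<theta> *\<^sub>R G r \<theta> \<phi>)" for \<theta> \<phi>
    by (simp add: mult_ac)
  show "(LINT q|lborel. indicator {lo<..<hi} (fst (r, q)) *\<^sub>R (indicator {0<..<pi} (fst (snd (r, q))) *\<^sub>R
     (indicator {0<..<2*pi} (snd (snd (r, q))) *\<^sub>R G (fst (r, q)) (fst (snd (r, q))) (snd (snd (r, q)))))) = 0"
    by (rule integral_pair_zero(2), unfold fst_conv snd_conv sw) (use assms[of r] in \<open>auto simp: indicator_def\<close>)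
qed

lemma bint_zero_r:
  assumes "\<And>\<theta> \<phi>. (LINT r|lborel. indicator {lo<..<hi} r *\<^sub>R G r \<theta> \<phi>) = 0"
  shows "bint lo hi G = 0"
  unfolding bint_as_integral
proof (rule integral_pair_zero(2))
  fix q :: "real \<times> real"
  have "(LINT r|lborel. indicator {lo<..<hi} r *\<^sub>R (indicator {0<..<pi} (fst q) *\<^sub>R
     (indicator {0<..<2*pi} (snd q) *\<^sub>R G r (fst q) (snd q))))
    = (LINT r|lborel. (indicator {0<..<pi} (fst q) * indicator {0<..<2*pi} (snd q)) *\<^sub>R (indicator {lo<..<hi} r *\<^sub>R G r (fst q) (snd q)))"
    by (simp add: mult_ac)
  also have "\<dots> = 0" by (simp only: integral_scaleR_right assms scaleR_zero_right)
  finally show "(LINT r|lborel. indicator {lo<..<hi} (fst (r, q)) *\<^sub>R (indicator {0<..<pi} (fst (snd (r, q))) *\<^sub>R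
     (indicator {0<..<2*pi} (snd (snd (r, q))) *\<^sub>R G (fst (r, q)) (fst (snd (r, q))) (snd (snd (r, q)))))) = 0" by simp
qed

lemma integral_derivative_open:
  fixes F f :: "real \<Rightarrow> complex"
  assumes "a \<le> b" "\<And>x. a \<le> x \<Longrightarrow> x \<le> b \<Longrightarrow> (F has_vector_derivative f x) (at x)" "continuous_on {a..b} f" "F a = F b"
  shows "(LINT x|lborel. indicator {a<..<b} x *\<^sub>R f x) = 0"
proof -
  have "(LINT x|lborel. indicator {a<..<b} x *\<^sub>R f x) = (LINT x|lborel. indicator {a..b} x *\<^sub>R f x)"
  proof (rule integral_cong_AE)
    have [measurable]: "(\<lambda>x. indicator {a..b} x *\<^sub>R f x) \<in> borel_measurable lborel"
      using borel_integrable_compact[OF _ assms(3)] by (simp add: borel_measurable_integrable)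
    then show "(\<lambda>x. indicator {a..b} x *\<^sub>R f x) \<in> borel_measurable lborel" .
    have "(\<lambda>x. indicator {a<..<b} x *\<^sub>R (indicator {a..b} x *\<^sub>R f x)) \<in> borel_measurable lborel" by measurable
    moreover have "(\<lambda>x. indicator {a<..<b} x *\<^sub>R (indicator {a..b} x *\<^sub>R f x)) = (\<lambda>x. indicator {a<..<b} x *\<^sub>R f x)"
      by (auto simp: indicator_def)
    ultimately show "(\<lambda>x. indicator {a<..<b} x *\<^sub>R f x) \<in> borel_measurable lborel" by simp
    show "AE x in lborel. indicator {a<..<b} x *\<^sub>R f x = indicator {a..b} x *\<^sub>R f x"
      using AE_lborel_singleton[of a] AE_lborel_singleton[of b] by eventually_elim (auto simp: indicator_def)
  qed
  also have "\<dots> = F b - F a"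
    by (rule integral_FTC_Icc[OF assms(1) _ assms(3)]) (use assms(2) in \<open>auto intro: has_vector_derivative_at_within\<close>)
  finally show ?thesis using assms(4) by simp
qed

text \<open>\<open>g\<close> is continuous for all angles and vanishes near the radial ends, so on
  the box it is carried by a compact set on which it is continuous.\<close>

lemma bint_integrableI:
  fixes g :: "real \<times> real \<times> real \<Rightarrow> complex"
  assumes "lo < lo'" "hi' < hi" "continuous_on ({lo<..<hi} \<times> UNIV \<times> UNIV) g"
    and "\<And>r \<theta> \<phi>. lo < r \<Longrightarrow> r < hi \<Longrightarrow> \<not> (lo' \<le> r \<and> r \<le> hi') \<Longrightarrow> g (r, \<theta>, \<phi>) = 0"
  shows "bint_integrable lo hi (\<lambda>r \<theta> \<phi>. g (r, \<theta>, \<phi>))"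
proof -
  let ?C = "{lo'..hi'} \<times> {0..pi} \<times> {0..2*pi}" and ?B = "{lo<..<hi} \<times> {0<..<pi} \<times> {0<..<2*pi}"
  have "compact ?C" by (intro compact_Times compact_Icc)
  moreover have "continuous_on ?C g" by (rule continuous_on_subset[OF assms(3)]) (use assms(1,2) in auto)
  ultimately have "set_integrable lborel ?C g"
    unfolding set_integrable_def by (rule borel_integrable_compact)
  then have "set_integrable lborel (?C \<inter> ?B) g"
  proof (rule set_integrable_subset)
    have "?C \<in> sets borel" "?B \<in> sets borel"
      by (intro borel_closed closed_Times closed_atLeastAtMost) (intro borel_open open_Times open_greaterThanLessThan)
    then show "?C \<inter> ?B \<in> sets lborel" by simp
  qed simp
  moreover have "(\<lambda>p. indicator (?C \<inter> ?B) p *\<^sub>R g p) = (\<lambda>p. indicator ?B p *\<^sub>R (\<lambda>(r, \<theta>, \<phi>). g (r, \<theta>, \<phi>)) p)"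
    using assms(4) by (fastforce simp: indicator_def)
  ultimately show ?thesis by (simp add: bint_integrable_def set_integrable_def)
qed

section \<open>Integration by parts in the coordinates\<close>

abbreviation coord_dom :: "real \<Rightarrow> real \<Rightarrow> (real \<times> real \<times> real) set" where
  "coord_dom lo hi \<equiv> {lo<..<hi} \<times> UNIV \<times> UNIV"

lemma open_coord_dom [simp]: "open (coord_dom lo hi)" by (intro open_Times) auto

definition pd1 :: "(real \<times> real \<times> real \<Rightarrow> complex) \<Rightarrow> real \<times> real \<times> real \<Rightarrow> complex" where
  "pd1 f p = frechet_derivative f (at p) (1, 0, 0)"
definition pd2 :: "(real \<times> real \<times> real \<Rightarrow> complex) \<Rightarrow> real \<times> real \<times> real \<Rightarrow> complex" where
  "pd2 f p = frechet_derivative f (at p) (0, 1, 0)"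
definition pd3 :: "(real \<times> real \<times> real \<Rightarrow> complex) \<Rightarrow> real \<times> real \<times> real \<Rightarrow> complex" where
  "pd3 f p = frechet_derivative f (at p) (0, 0, 1)"

lemma pd_smooth:
  assumes "C_k_on (Suc n) X f"
  shows "C_k_on n X (pd1 f)" "C_k_on n X (pd2 f)" "C_k_on n X (pd3 f)"
proof -
  have "(1, 0, 0) \<in> (Basis :: (real \<times> real \<times> real) set)" "(0, 1, 0) \<in> (Basis :: (real \<times> real \<times> real) set)"
    "(0, 0, 1) \<in> (Basis :: (real \<times> real \<times> real) set)"
    by (auto simp: Basis_prod_def zero_prod_def)
  then show "C_k_on n X (pd1 f)" "C_k_on n X (pd2 f)" "C_k_on n X (pd3 f)"
    using assms unfolding pd1_def[abs_def] pd2_def[abs_def] pd3_def[abs_def] by auto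
qed

lemma pd_has_derivative:
  assumes "C_k_on (Suc n) X f" "(r, \<theta>, \<phi>) \<in> X"
  shows "((\<lambda>x. f (x, \<theta>, \<phi>)) has_vector_derivative pd1 f (r, \<theta>, \<phi>)) (at r)"
    and "((\<lambda>x. f (r, x, \<phi>)) has_vector_derivative pd2 f (r, \<theta>, \<phi>)) (at \<theta>)"
    and "((\<lambda>x. f (r, \<theta>, x)) has_vector_derivative pd3 f (r, \<theta>, \<phi>)) (at \<phi>)"
proof -
  note d = C_k_on_has_derivative[OF assms]
  have lin: "frechet_derivative f (at (r, \<theta>, \<phi>)) (c *\<^sub>R v) = c *\<^sub>R frechet_derivative f (at (r, \<theta>, \<phi>)) v" for c v
    by (rule linear_cmul[OF has_derivative_linear[OF d]])
  show "((\<lambda>x. f (x, \<theta>, \<phi>)) has_vector_derivative pd1 f (r, \<theta>, \<phi>)) (at r)"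
    unfolding has_vector_derivative_def pd1_def
    by (rule has_derivative_eq_rhs[OF has_derivative_compose[of "\<lambda>x. (x, \<theta>, \<phi>)" _ _ _ f, OF _ d]])
       (auto intro!: derivative_eq_intros simp: zero_prod_def simp flip: lin)
  show "((\<lambda>x. f (r, x, \<phi>)) has_vector_derivative pd2 f (r, \<theta>, \<phi>)) (at \<theta>)"
    unfolding has_vector_derivative_def pd2_def
    by (rule has_derivative_eq_rhs[OF has_derivative_compose[of "\<lambda>x. (r, x, \<phi>)" _ _ _ f, OF _ d]])
       (auto intro!: derivative_eq_intros simp: zero_prod_def simp flip: lin)
  show "((\<lambda>x. f (r, \<theta>, x)) has_vector_derivative pd3 f (r, \<theta>, \<phi>)) (at \<phi>)"
    unfolding has_vector_derivative_def pd3_def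
    by (rule has_derivative_eq_rhs[OF has_derivative_compose[of "\<lambda>x. (r, \<theta>, x)" _ _ _ f, OF _ d]])
       (auto intro!: derivative_eq_intros simp: zero_prod_def simp flip: lin)
qed

lemma C_k_on_coord:
  "C_k_on k (coord_dom lo hi) (\<lambda>p. fst p)" "C_k_on k (coord_dom lo hi) (\<lambda>p. fst (snd p))" "C_k_on k (coord_dom lo hi) (\<lambda>p. snd (snd p))"
  by (intro C_k_on_linear open_coord_dom bounded_linear_fst bounded_linear_fst_comp bounded_linear_snd_comp bounded_linear_snd)+

lemma C_k_on_of_r:
  assumes "C_k_on k {lo<..<hi} (f :: real \<Rightarrow> 'b::real_normed_vector)"
  shows "C_k_on k (coord_dom lo hi) (\<lambda>p. f (fst p))"
  by (rule C_k_on_compose[OF open_coord_dom _ C_k_on_coord(1) assms]) auto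

lemma C_k_on_trig_theta:
  "C_k_on k (coord_dom lo hi) (\<lambda>p. sin (fst (snd p)))" "C_k_on k (coord_dom lo hi) (\<lambda>p. cos (fst (snd p)))"
  "C_k_on k (coord_dom lo hi) (\<lambda>p. sin (snd (snd p)))" "C_k_on k (coord_dom lo hi) (\<lambda>p. cos (snd (snd p)))"
  by (rule C_k_on_compose[OF open_coord_dom open_UNIV C_k_on_coord(2) C_k_on_sin] C_k_on_compose[OF open_coord_dom open_UNIV C_k_on_coord(2) C_k_on_cos]
    C_k_on_compose[OF open_coord_dom open_UNIV C_k_on_coord(3) C_k_on_sin] C_k_on_compose[OF open_coord_dom open_UNIV C_k_on_coord(3) C_k_on_cos], simp)+

lemma spherical_smooth:
  "C_k_on k (coord_dom lo hi) (\<lambda>p. spherical (fst p) (fst (snd p)) (snd (snd p)))"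
proof -
  have e: "spherical r \<theta> \<phi> = (r * sin \<theta> * cos \<phi>) *\<^sub>R axis 1 1 + (r * sin \<theta> * sin \<phi>) *\<^sub>R axis 2 1 + (r * cos \<theta>) *\<^sub>R axis 3 1" for r \<theta> \<phi>
    by (simp add: spherical_def vec_eq_iff forall_3 axis_def)
  show ?thesis unfolding e
    by (intro C_k_on_add C_k_on_scaleR C_k_on_mult C_k_on_coord C_k_on_trig_theta C_k_on_const open_coord_dom)
qed

lemma norm_spherical: "r > 0 \<Longrightarrow> norm (spherical r \<theta> \<phi>) = r"
proof -
  assume r: "r > 0"
  have "(norm (spherical r \<theta> \<phi>))\<^sup>2 = (r * sin \<theta> * cos \<phi>)\<^sup>2 + (r * sin \<theta> * sin \<phi>)\<^sup>2 + (r * cos \<theta>)\<^sup>2"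
    unfolding power2_norm_eq_inner by (simp add: spherical_def inner_vec_def sum_3 power2_eq_square)
  also have "\<dots> = r\<^sup>2 * ((sin \<theta>)\<^sup>2 * ((sin \<phi>)\<^sup>2 + (cos \<phi>)\<^sup>2) + (cos \<theta>)\<^sup>2)"
    unfolding power_mult_distrib by (simp only: ring_distribs ac_simps)
  also have "\<dots> = r\<^sup>2" by (simp only: sin_cos_squared_add mult_1_right)
  finally show ?thesis using r by (simp add: power2_eq_iff_nonneg)
qed

locale shell_box =
  fixes lo hi lo' hi' :: real
  assumes order: "0 < lo" "lo < lo'" "lo' \<le> hi'" "hi' < hi"
begin

text \<open>Integrands without boundary terms in \<open>r\<close> and \<open>\<phi>\<close>: they
  vanish near the radial ends and have period \<open>2 * pi\<close> in \<open>\<phi>\<close>. The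
  angles run over the whole line, so that derivatives exist at the ends of the coordinate box
  too.\<close>

definition adm :: "nat \<Rightarrow> (real \<times> real \<times> real \<Rightarrow> complex) \<Rightarrow> bool" where
  "adm n F \<longleftrightarrow> C_k_on n (coord_dom lo hi) F \<and>
     (\<forall>r \<theta> \<phi>. lo < r \<and> r < hi \<and> \<not> (lo' \<le> r \<and> r \<le> hi') \<longrightarrow> F (r, \<theta>, \<phi>) = 0) \<and>
     (\<forall>r \<theta> \<phi>. lo < r \<and> r < hi \<longrightarrow> F (r, \<theta>, \<phi> + 2 * pi) = F (r, \<theta>, \<phi>))"

lemma adm_C: "adm n F \<Longrightarrow> C_k_on n (coord_dom lo hi) F"
  by (simp add: adm_def)

lemma adm_zero: "adm n F \<Longrightarrow> lo < r \<Longrightarrow> r < hi \<Longrightarrow> \<not> (lo' \<le> r \<and> r \<le> hi') \<Longrightarrow> F (r, \<theta>, \<phi>) = 0"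
  unfolding adm_def by blast

lemma adm_periodic: "adm n F \<Longrightarrow> lo < r \<Longrightarrow> r < hi \<Longrightarrow> F (r, \<theta>, \<phi> + 2 * pi) = F (r, \<theta>, \<phi>)"
  unfolding adm_def by blast

lemma adm_derivs:
  assumes "adm (Suc n) F" "lo < r" "r < hi"
  shows "((\<lambda>x. F (x, \<theta>, \<phi>)) has_vector_derivative pd1 F (r, \<theta>, \<phi>)) (at r)"
    and "((\<lambda>x. F (r, x, \<phi>)) has_vector_derivative pd2 F (r, \<theta>, \<phi>)) (at \<theta>)"
    and "((\<lambda>x. F (r, \<theta>, x)) has_vector_derivative pd3 F (r, \<theta>, \<phi>)) (at \<phi>)"
  using pd_has_derivative[OF adm_C[OF assms(1)], of r \<theta> \<phi>] assms(2,3) by auto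

lemma open_off: "open {r. lo < r \<and> r < hi \<and> \<not> (lo' \<le> r \<and> r \<le> hi')}"
proof -
  have "{r. lo < r \<and> r < hi \<and> \<not> (lo' \<le> r \<and> r \<le> hi')} = {lo<..<lo'} \<union> {hi'<..<hi}" using order by auto
  then show ?thesis by (metis open_Un open_greaterThanLessThan)
qed

lemma adm_pd:
  assumes F: "adm (Suc n) F"
  shows "adm n (pd1 F)" "adm n (pd2 F)" "adm n (pd3 F)"
proof -
  note d = adm_derivs[OF F]
  have z: "pd1 F (r, \<theta>, \<phi>) = 0 \<and> pd2 F (r, \<theta>, \<phi>) = 0 \<and> pd3 F (r, \<theta>, \<phi>) = 0"
    if "lo < r \<and> r < hi \<and> \<not> (lo' \<le> r \<and> r \<le> hi')" for r \<theta> \<phi>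
  proof -
    have lr: "lo < r" "r < hi" using that by auto
    have "((\<lambda>x. 0) has_vector_derivative pd1 F (r, \<theta>, \<phi>)) (at r)"
      by (rule has_vector_derivative_transform_within_open[OF d(1)[OF lr] open_off]) (use that adm_zero[OF F] in auto)
    moreover have "((\<lambda>x. 0) has_vector_derivative pd2 F (r, \<theta>, \<phi>)) (at \<theta>)" "((\<lambda>x. 0) has_vector_derivative pd3 F (r, \<theta>, \<phi>)) (at \<phi>)"
      using d(2,3)[OF lr, where \<theta>=\<theta> and \<phi>=\<phi>] adm_zero[OF F] that by auto
    ultimately show ?thesis by (metis has_vector_derivative_const vector_derivative_unique_at)
  qed
  have p: "pd1 F (r, \<theta>, \<phi> + 2 * pi) = pd1 F (r, \<theta>, \<phi>) \<and> pd2 F (r, \<theta>, \<phi> + 2 * pi) = pd2 F (r, \<theta>, \<phi>)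
     \<and> pd3 F (r, \<theta>, \<phi> + 2 * pi) = pd3 F (r, \<theta>, \<phi>)"
    if lr: "lo < r" "r < hi" for r \<theta> \<phi>
  proof -
    have "((\<lambda>x. F (x, \<theta>, \<phi>)) has_vector_derivative pd1 F (r, \<theta>, \<phi> + 2 * pi)) (at r)"
      by (rule has_vector_derivative_transform_within_open[OF d(1)[OF lr] open_greaterThanLessThan[of lo hi]]) (use lr adm_periodic[OF F] in auto)
    moreover have "((\<lambda>x. F (r, x, \<phi>)) has_vector_derivative pd2 F (r, \<theta>, \<phi> + 2 * pi)) (at \<theta>)"
      using d(2)[OF lr, where \<theta>=\<theta> and \<phi>="\<phi> + 2 * pi"] adm_periodic[OF F lr] by simp
    moreover have "((\<lambda>x. F (r, \<theta>, x)) has_vector_derivative pd3 F (r, \<theta>, \<phi> + 2 * pi)) (at \<phi>)"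
    proof -
      have "((\<lambda>x. x + 2 * pi) has_vector_derivative 1) (at \<phi>)" by (auto intro!: derivative_eq_intros simp: has_vector_derivative_def)
      from vector_diff_chain_at[OF this d(3)[OF lr]] show ?thesis
        using adm_periodic[OF F lr] by (simp add: o_def)
    qed
    ultimately show ?thesis using d[OF lr] vector_derivative_unique_at by blast
  qed
  show "adm n (pd1 F)" "adm n (pd2 F)" "adm n (pd3 F)"
    using pd_smooth[OF adm_C[OF F]] z p by (auto simp: adm_def)
qed

lemma adm_mult:
  assumes "C_k_on n (coord_dom lo hi) (\<lambda>p. c (fst p) (fst (snd p)))" "adm n F"
  shows "adm n (\<lambda>p. c (fst p) (fst (snd p)) * F p)"
  using assms C_k_on_mult[OF open_coord_dom assms(1) adm_C[OF assms(2)]] by (auto simp: adm_def)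

lemma adm_add: "adm n F \<Longrightarrow> adm n G \<Longrightarrow> adm n (\<lambda>p. F p + G p)"
  using C_k_on_add[OF open_coord_dom] by (auto simp: adm_def)

lemma adm_integrable: "adm 0 F \<Longrightarrow> bint_integrable lo hi (\<lambda>r \<theta> \<phi>. F (r, \<theta>, \<phi>))"
  by (rule bint_integrableI[OF order(2,4)]) (use adm_zero[of 0 F] adm_C[of 0 F] in auto)

lemma adm_continuous: "adm 0 F \<Longrightarrow> continuous_on (coord_dom lo hi) F"
  by (drule adm_C) simp

lemma bint_pd1:
  assumes F: "adm (Suc 0) F"
  shows "bint lo hi (\<lambda>r \<theta> \<phi>. pd1 F (r, \<theta>, \<phi>)) = 0"
proof (rule bint_zero_r)
  fix \<theta> \<phi>
  obtain a where a: "lo < a" "a < lo'" using dense order(2) by blast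
  obtain b where b: "hi' < b" "b < hi" using dense order(4) by blast
  have e: "indicator {lo<..<hi} r *\<^sub>R pd1 F (r, \<theta>, \<phi>) = indicator {a<..<b} r *\<^sub>R pd1 F (r, \<theta>, \<phi>)" for r
    using adm_zero[OF adm_pd(1)[OF F], of r \<theta> \<phi>] a b order by (auto simp: indicator_def)
  show "(LINT r|lborel. indicator {lo<..<hi} r *\<^sub>R pd1 F (r, \<theta>, \<phi>)) = 0"
    unfolding e
  proof (rule integral_derivative_open[where F="\<lambda>r. F (r, \<theta>, \<phi>)"])
    show "((\<lambda>r. F (r, \<theta>, \<phi>)) has_vector_derivative pd1 F (x, \<theta>, \<phi>)) (at x)" if "a \<le> x" "x \<le> b" for x
      by (rule adm_derivs(1)[OF F]) (use that a b in auto)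
    show "continuous_on {a..b} (\<lambda>r. pd1 F (r, \<theta>, \<phi>))"
      by (rule continuous_on_compose2[OF adm_continuous[OF adm_pd(1)[OF F]]]) (use a b in \<open>auto intro!: continuous_intros\<close>)
    show "F (a, \<theta>, \<phi>) = F (b, \<theta>, \<phi>)" using a b adm_zero[OF F] order by simp
  qed (use a b order in simp)
qed

text \<open>\<open>adm\<close> says nothing about the poles, so equal boundary values at
  \<open>0\<close> and \<open>pi\<close> are a premise; it will be met through a factor
  \<open>sin \<theta>\<close>.\<close>

lemma bint_pd2:
  assumes F: "adm (Suc 0) F" and z: "\<And>r \<phi>. lo < r \<Longrightarrow> r < hi \<Longrightarrow> F (r, 0, \<phi>) = F (r, pi, \<phi>)"
  shows "bint lo hi (\<lambda>r \<theta> \<phi>. pd2 F (r, \<theta>, \<phi>)) = 0"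
proof (rule bint_zero_theta)
  fix r \<phi> assume r: "lo < r" "r < hi"
  show "(LINT \<theta>|lborel. indicator {0<..<pi} \<theta> *\<^sub>R pd2 F (r, \<theta>, \<phi>)) = 0"
  proof (rule integral_derivative_open[where F="\<lambda>\<theta>. F (r, \<theta>, \<phi>)"])
    show "continuous_on {0..pi} (\<lambda>\<theta>. pd2 F (r, \<theta>, \<phi>))"
      by (rule continuous_on_compose2[OF adm_continuous[OF adm_pd(2)[OF F]]]) (use r in \<open>auto intro!: continuous_intros\<close>)
  qed (use r z adm_derivs(2)[OF F] in auto)
qed

text \<open>\<open>c r \<theta>\<close> is constant along the \<open>\<phi>\<close>-integral and may
  be any function, for instance one containing \<open>g_phiphi\<close>, which is singular at the
  poles.\<close>

lemma bint_pd3: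
  assumes F: "adm (Suc 0) F"
  shows "bint lo hi (\<lambda>r \<theta> \<phi>. c r \<theta> * pd3 F (r, \<theta>, \<phi>)) = 0"
proof (rule bint_zero_phi)
  fix r \<theta> :: real assume r: "lo < r" "r < hi"
  show "(LINT \<phi>|lborel. indicator {0<..<2*pi} \<phi> *\<^sub>R (c r \<theta> * pd3 F (r, \<theta>, \<phi>))) = 0"
  proof (rule integral_derivative_open[where F="\<lambda>\<phi>. c r \<theta> * F (r, \<theta>, \<phi>)"])
    show "continuous_on {0..2*pi} (\<lambda>\<phi>. c r \<theta> * pd3 F (r, \<theta>, \<phi>))"
      by (intro continuous_intros continuous_on_compose2[OF adm_continuous[OF adm_pd(3)[OF F]]]) (use r in auto)
    show "c r \<theta> * F (r, \<theta>, 0) = c r \<theta> * F (r, \<theta>, 2 * pi)" using adm_periodic[OF F r, of \<theta> 0] by simp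
    show "((\<lambda>\<phi>. c r \<theta> * F (r, \<theta>, \<phi>)) has_vector_derivative c r \<theta> * pd3 F (r, \<theta>, x)) (at x)" for x
      by (rule has_vector_derivative_mult_right[OF adm_derivs(3)[OF F r]])
  qed simp
qed

text \<open>Evaluates the \<open>vector_derivative\<close> in \<open>D_r\<close> for a function that
  is known only on the radial interval, up to a factor constant in \<open>r\<close>.\<close>

lemma vector_derivative_r:
  assumes "adm (Suc n) F" "lo < r" "r < hi" "\<And>x. lo < x \<Longrightarrow> x < hi \<Longrightarrow> f x = c * F (x, \<theta>, \<phi>)"
  shows "vector_derivative f (at r) = c * pd1 F (r, \<theta>, \<phi>)"
  by (rule vector_derivative_at, rule has_vector_derivative_transform_within_open[OF has_vector_derivative_mult_right[OF adm_derivs(1)[OF assms(1-3)], of c] open_greaterThanLessThan[of lo hi]])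
     (use assms in auto)

lemma vector_derivative_theta:
  assumes "adm (Suc n) F" "lo < r" "r < hi" "0 < \<theta>" "\<theta> < pi" "\<And>x. 0 < x \<Longrightarrow> x < pi \<Longrightarrow> f x = c * F (r, x, \<phi>)"
  shows "vector_derivative f (at \<theta>) = c * pd2 F (r, \<theta>, \<phi>)"
  by (rule vector_derivative_at, rule has_vector_derivative_transform_within_open[OF has_vector_derivative_mult_right[OF adm_derivs(2)[OF assms(1-3)], of c] open_greaterThanLessThan[of 0 pi]])
     (use assms in auto)

lemma vector_derivative_phi:
  assumes "adm (Suc n) F" "lo < r" "r < hi" "\<And>x. f x = c * F (r, \<theta>, x)"
  shows "vector_derivative f (at \<phi>) = c * pd3 F (r, \<theta>, \<phi>)"
  unfolding assms(4) by (rule vector_derivative_at, rule has_vector_derivative_mult_right[OF adm_derivs(3)[OF assms(1-3)], of c])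

end

section \<open>The weak form of the separated equation\<close>

text \<open>A mode in real variables after the gauge transformation. \<open>flux\<close> is the
  radial equation in divergence form with the metric coefficients of \<open>hatP\<close>, so that it
  can be paired with a test function by the product rule.\<close>

locale pde_data =
  fixes M Q \<Lambda> rm \<eta> :: real and cp cm :: "real \<Rightarrow> real \<Rightarrow> real" and a lo hi :: real
    and \<sigma> :: complex and s m :: real and l :: complex and R R' S S' :: "real \<Rightarrow> complex"
  assumes lo: "0 < lo"
    and lam_small: "\<bar>lam \<Lambda> a\<bar> \<le> 1 / 8"
    and Rg_smooth: "\<And>k. C_k_on k {lo<..<hi} (Rg_tr M Q \<Lambda> rm \<eta> cp cm a)"
    and q_cont: "continuous_on {lo<..<hi} (q_sel M Q \<Lambda> rm \<eta> cp cm a)"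
    and R_smooth: "\<And>k. C_k_on k {lo<..<hi} R" and R'_smooth: "\<And>k. C_k_on k {lo<..<hi} R'"
    and R_deriv: "\<And>r. lo < r \<Longrightarrow> r < hi \<Longrightarrow> (R has_vector_derivative R' r) (at r)"
    and flux: "\<And>r. lo < r \<Longrightarrow> r < hi \<Longrightarrow>
      ((\<lambda>r. of_real (mu_a M Q \<Lambda> a r) * R' r
          + \<i> * (of_real (Rg_tr M Q \<Lambda> rm \<eta> cp cm a r) * (\<sigma> + of_real (s * r / (r\<^sup>2 + a\<^sup>2)))) * R r) has_vector_derivative
        - \<i> * (of_real (Rg_tr M Q \<Lambda> rm \<eta> cp cm a r) * (\<sigma> + of_real (s * r / (r\<^sup>2 + a\<^sup>2)))) * R' r
        + (of_real (q_sel M Q \<Lambda> rm \<eta> cp cm a r) * (\<sigma> + of_real (s * r / (r\<^sup>2 + a\<^sup>2)))\<^sup>2 + of_real (m\<^sup>2 * r\<^sup>2) + l) * R r) (at r)"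
    and S_smooth: "\<And>k. C_k_on k {-2<..<2} S" and S'_smooth: "\<And>k. C_k_on k {-2<..<2} S'"
    and S_deriv: "\<And>\<xi>. -2 < \<xi> \<Longrightarrow> \<xi> < 2 \<Longrightarrow> (S has_vector_derivative S' \<xi>) (at \<xi>)"
    and S_ode: "\<And>\<xi>. -2 < \<xi> \<Longrightarrow> \<xi> < 2 \<Longrightarrow>
      ((\<lambda>\<xi>. of_real ((1 - \<xi>\<^sup>2) * (1 + lam \<Lambda> a * \<xi>\<^sup>2)) * S' \<xi>) has_vector_derivative
        (of_real (a\<^sup>2) * (of_real ((1 + lam \<Lambda> a)\<^sup>2 * (1 - \<xi>\<^sup>2) / (1 + lam \<Lambda> a * \<xi>\<^sup>2)) * \<sigma>\<^sup>2 + of_real (m\<^sup>2 * \<xi>\<^sup>2)) - l) * S \<xi>) (at \<xi>)"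
begin

text \<open>On the unit sphere \<open>x $ 3 / norm x\<close> is \<open>cos \<theta>\<close>. The
  square root is \<open>\<rho>\<close>, which undoes the conjugation of the operator by
  \<open>\<rho>\<close>.\<close>

definition sep :: "real^3 \<Rightarrow> complex" where
  "sep x = (if x \<in> shell lo hi then of_real (sqrt ((norm x)\<^sup>2 + a\<^sup>2 * (x $ 3 / norm x)\<^sup>2)) * (R (norm x) * S (x $ 3 / norm x)) else 0)"

lemma sep_spherical:
  assumes "lo < r" "r < hi" shows "sep (spherical r \<theta> \<phi>) = of_real (rho a r \<theta>) * (R r * S (cos \<theta>))"
proof -
  have "r > 0" using assms lo by simp
  moreover have "spherical r \<theta> \<phi> $ 3 = r * cos \<theta>" by (simp add: spherical_def)
  ultimately show ?thesis using assms by (simp add: sep_def shell_def norm_spherical rho_def)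
qed

lemma rho_pos: "lo < r \<Longrightarrow> rho a r \<theta> > 0"
  using lo by (simp add: rho_def add_pos_nonneg)

lemma rho_sq: "(rho a r \<theta>)\<^sup>2 = r\<^sup>2 + a\<^sup>2 * (cos \<theta>)\<^sup>2"
  by (simp add: rho_def)

lemma kappa_pos: "kappa \<Lambda> a \<theta> > 0"
proof -
  have "(cos \<theta>)\<^sup>2 \<le> 1" by (simp add: abs_square_le_1)
  then have "\<bar>lam \<Lambda> a * (cos \<theta>)\<^sup>2\<bar> \<le> 1/8 * 1" unfolding abs_mult by (intro mult_mono lam_small) auto
  then show ?thesis by (simp add: kappa_def)
qed

lemma rho_smooth: "C_k_on k (coord_dom lo hi) (\<lambda>p. rho a (fst p) (fst (snd p)))"
  unfolding rho_def
  by (intro C_k_on_sqrt C_k_on_add C_k_on_mult C_k_on_power C_k_on_coord C_k_on_trig_theta C_k_on_const open_coord_dom)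
     (use lo in \<open>auto intro!: add_pos_nonneg\<close>)

lemma rho_nz: "p \<in> coord_dom lo hi \<Longrightarrow> rho a (fst p) \<theta> \<noteq> 0"
  using rho_pos[of "fst p" \<theta>] by auto

lemma V_smooth: "C_k_on k (coord_dom lo hi) (\<lambda>p. V_pot a (fst p) (fst (snd p)))"
  unfolding V_pot_def
  by (intro C_k_on_divide C_k_on_power C_k_on_coord rho_smooth open_coord_dom) (use rho_nz in simp)

lemma mu_a_smooth: "C_k_on k UNIV (mu_a M Q \<Lambda> a)"
  unfolding mu_a_def
  by (intro C_k_on_add C_k_on_diff C_k_on_divide C_k_on_mult C_k_on_power C_k_on_id C_k_on_const open_UNIV) auto

lemma Rphi_smooth: "C_k_on k {lo<..<hi} (Rg_rphi M Q \<Lambda> rm \<eta> cp cm a)"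
  unfolding Rg_rphi_def
  by (intro C_k_on_divide C_k_on_add C_k_on_mult C_k_on_power C_k_on_id C_k_on_const Rg_smooth) (use lo in \<open>auto simp: add_nonneg_eq_0_iff\<close>)

lemma S_cos_smooth:
  "C_k_on k (coord_dom lo hi) (\<lambda>p. S (cos (fst (snd p))))" "C_k_on k (coord_dom lo hi) (\<lambda>p. S' (cos (fst (snd p))))"
proof -
  have "cos x \<in> {-2<..<2}" for x :: real using cos_ge_minus_one[of x] cos_le_one[of x] by (auto simp del: cos_ge_minus_one cos_le_one)
  then show "C_k_on k (coord_dom lo hi) (\<lambda>p. S (cos (fst (snd p))))" "C_k_on k (coord_dom lo hi) (\<lambda>p. S' (cos (fst (snd p))))"
    using C_k_on_compose[OF open_coord_dom open_greaterThanLessThan C_k_on_trig_theta(2) S_smooth]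
      C_k_on_compose[OF open_coord_dom open_greaterThanLessThan C_k_on_trig_theta(2) S'_smooth] by blast+
qed

end

locale pde_test = pde_data + shell_box lo hi lo' hi' for lo' hi' +
  fixes h :: "real^3 \<Rightarrow> complex"
  assumes h_smooth: "smooth_on UNIV h" and h_zero: "\<And>x. \<not> (lo' \<le> norm x \<and> norm x \<le> hi') \<Longrightarrow> h x = 0"
begin

abbreviation "Rg \<equiv> Rg_tr M Q \<Lambda> rm \<eta> cp cm a"
abbreviation "Rphi \<equiv> Rg_rphi M Q \<Lambda> rm \<eta> cp cm a"
abbreviation "X r \<theta> \<equiv> \<sigma> + complex_of_real (s * V_pot a r \<theta>)"
abbreviation "w r \<theta> \<equiv> complex_of_real (a * s * V_pot a r \<theta> * (sin \<theta>)\<^sup>2)"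
abbreviation "Y r \<equiv> \<sigma> + complex_of_real (s * r / (r\<^sup>2 + a\<^sup>2))"
abbreviation "BK r \<equiv> of_real (Rg r) * Y r"
abbreviation "\<psi> r \<theta> \<phi> \<equiv> h (spherical r \<theta> \<phi>) * complex_of_real (sin \<theta>)"
abbreviation "T \<equiv> distr_of lo hi sep"

text \<open>The test function divided by \<open>\<rho>\<close>. Up to coefficients, all transposed
  derivatives fall on this function.\<close>

definition kk :: "real \<times> real \<times> real \<Rightarrow> complex" where
  "kk p = complex_of_real (1 / rho a (fst p) (fst (snd p))) * h (spherical (fst p) (fst (snd p)) (snd (snd p)))"

lemma lo_pos: "lo < r \<Longrightarrow> r > 0" using lo by simp

lemma adm_kk: "adm n kk"
proof -
  have "C_k_on n (coord_dom lo hi) (\<lambda>p. h (spherical (fst p) (fst (snd p)) (snd (snd p))))"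
    by (rule C_k_on_compose[OF open_coord_dom open_UNIV spherical_smooth]) (use h_smooth in \<open>auto simp: smooth_on_def\<close>)
  then have "C_k_on n (coord_dom lo hi) kk"
    unfolding kk_def by (intro C_k_on_mult C_k_on_of_real C_k_on_divide C_k_on_const rho_smooth open_coord_dom rho_nz)
  moreover have "kk (r, \<theta>, \<phi>) = 0" if "lo < r \<and> r < hi \<and> \<not> (lo' \<le> r \<and> r \<le> hi')" for r \<theta> \<phi>
    using that h_zero[of "spherical r \<theta> \<phi>"] norm_spherical[of r \<theta> \<phi>] lo by (simp add: kk_def)
  moreover have "kk (r, \<theta>, \<phi> + 2 * pi) = kk (r, \<theta>, \<phi>)" for r \<theta> \<phi>
    by (simp add: kk_def spherical_def)
  ultimately show ?thesis by (auto simp: adm_def)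
qed

lemma psi_kk: "lo < r \<Longrightarrow> complex_of_real (1 / rho a r \<theta>) * \<psi> r \<theta> \<phi> = of_real (sin \<theta>) * kk (r, \<theta>, \<phi>)"
  by (simp add: kk_def)

lemma psi_kk': "lo < r \<Longrightarrow> \<psi> r \<theta> \<phi> = of_real (rho a r \<theta> * sin \<theta>) * kk (r, \<theta>, \<phi>)"
  using rho_pos[of r \<theta>] by (simp add: kk_def)

lemma adm_r:
  assumes "C_k_on n {lo<..<hi} c" "adm n F" shows "adm n (\<lambda>p. c (fst p) * F p)"
  using adm_mult[OF C_k_on_of_r[OF assms(1)] assms(2)] .

text \<open>The products that stand under an outer derivative of the transposed operator, together
  with \<open>Bk\<close>, which is left of \<open>Pk\<close> after \<open>Zk\<close> has been split
  off.\<close>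

definition "Mk p = complex_of_real (mu_a M Q \<Lambda> a (fst p)) * pd1 kk p"
definition "Pk p = complex_of_real (Rg (fst p)) * X (fst p) (fst (snd p)) * kk p"
definition "Zk p = complex_of_real (Rphi (fst p)) * w (fst p) (fst (snd p)) * kk p"
definition "Bk p = BK (fst p) * kk p"
definition "G3 p = complex_of_real (Rphi (fst p)) * pd3 kk p"
definition "Kk p = complex_of_real (kappa \<Lambda> a (fst (snd p)) * sin (fst (snd p))) * pd2 kk p"

lemma X_smooth: "C_k_on k (coord_dom lo hi) (\<lambda>p. X (fst p) (fst (snd p)))"
  by (intro C_k_on_add C_k_on_const C_k_on_of_real C_k_on_mult V_smooth open_coord_dom)

lemma w_smooth: "C_k_on k (coord_dom lo hi) (\<lambda>p. w (fst p) (fst (snd p)))"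
  by (intro C_k_on_const C_k_on_of_real C_k_on_mult C_k_on_power V_smooth C_k_on_trig_theta open_coord_dom)

lemma BK_smooth: "C_k_on k {lo<..<hi} BK"
  by (intro C_k_on_add C_k_on_const C_k_on_of_real C_k_on_mult Rg_smooth C_k_on_divide C_k_on_id C_k_on_power open_greaterThanLessThan)
     (use lo in \<open>auto simp: add_nonneg_eq_0_iff\<close>)

lemma sin_smooth: "C_k_on k (coord_dom lo hi) (\<lambda>p. complex_of_real (sin (fst (snd p))))"
  by (intro C_k_on_of_real C_k_on_trig_theta open_coord_dom)

lemma kappa_smooth: "C_k_on k (coord_dom lo hi) (\<lambda>p. kappa \<Lambda> a (fst (snd p)))"
  unfolding kappa_def by (intro C_k_on_add C_k_on_mult C_k_on_power C_k_on_const C_k_on_trig_theta open_coord_dom)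

lemma adm_Mk: "adm n Mk"
  unfolding Mk_def
  by (rule adm_r[where c="\<lambda>r. complex_of_real (mu_a M Q \<Lambda> a r)"])
     (intro C_k_on_of_real C_k_on_subset[OF mu_a_smooth] subset_UNIV open_greaterThanLessThan adm_pd adm_kk)+

lemma adm_Pk: "adm n Pk"
  unfolding Pk_def
  by (rule adm_mult[where c="\<lambda>r \<theta>. complex_of_real (Rg r) * X r \<theta>"])
     (intro C_k_on_of_real C_k_on_mult C_k_on_of_r[OF Rg_smooth] X_smooth open_coord_dom adm_kk)+

lemma adm_Zk: "adm n Zk"
  unfolding Zk_def
  by (rule adm_mult[where c="\<lambda>r \<theta>. complex_of_real (Rphi r) * w r \<theta>"])
     (intro C_k_on_of_real C_k_on_mult C_k_on_of_r[OF Rphi_smooth] w_smooth open_coord_dom adm_kk)+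

lemma adm_Bk: "adm n Bk"
  unfolding Bk_def by (rule adm_r[where c=BK]) (intro BK_smooth adm_kk)+

lemma adm_G3: "adm n G3"
  unfolding G3_def
  by (rule adm_r[where c="\<lambda>r. complex_of_real (Rphi r)"]) (intro C_k_on_of_real Rphi_smooth open_greaterThanLessThan adm_pd adm_kk)+

lemma adm_Kk: "adm n Kk"
  unfolding Kk_def
  by (rule adm_mult[where c="\<lambda>r \<theta>. complex_of_real (kappa \<Lambda> a \<theta> * sin \<theta>)"])
     (intro C_k_on_of_real C_k_on_mult kappa_smooth C_k_on_trig_theta open_coord_dom adm_pd adm_kk)+

text \<open>Follows from \<open>\<rho>\<^sup>2 = r\<^sup>2 + a\<^sup>2 - a\<^sup>2 * (sin
  \<theta>)\<^sup>2\<close>. The second summand depends on \<open>r\<close> alone; the first is a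
  multiple of \<open>w\<close>, the zeroth order part that accompanies the
  \<open>\<phi>\<close>-derivative.\<close>

lemma V_split:
  assumes r: "lo < r"
  shows "s * V_pot a r \<theta> = a / (r\<^sup>2 + a\<^sup>2) * (a * s * V_pot a r \<theta> * (sin \<theta>)\<^sup>2) + s * r / (r\<^sup>2 + a\<^sup>2)"
proof -
  let ?d = "r\<^sup>2 + a\<^sup>2"
  have d: "?d > 0" and r2: "(rho a r \<theta>)\<^sup>2 > 0" using lo_pos[OF r] rho_pos[OF r, of \<theta>] by (auto intro: add_pos_nonneg)
  have e: "(rho a r \<theta>)\<^sup>2 = ?d - a\<^sup>2 * (sin \<theta>)\<^sup>2"
    unfolding rho_sq by (simp add: cos_squared_eq algebra_simps)
  have "a / d * (a * s * (r / P) * S2) + s * r / d = s * r * (a\<^sup>2 * S2 + P) / (d * P)" if "d > 0" "P > 0" for d P S2 :: real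
    using that by (simp add: divide_simps) (simp add: algebra_simps power2_eq_square)
  from this[OF d r2, of "(sin \<theta>)\<^sup>2"]
  have "a / ?d * (a * s * V_pot a r \<theta> * (sin \<theta>)\<^sup>2) + s * r / ?d = s * r * (a\<^sup>2 * (sin \<theta>)\<^sup>2 + (rho a r \<theta>)\<^sup>2) / (?d * (rho a r \<theta>)\<^sup>2)"
    unfolding V_pot_def .
  also have "a\<^sup>2 * (sin \<theta>)\<^sup>2 + (rho a r \<theta>)\<^sup>2 = ?d" using e by simp
  also have "s * r * ?d / (?d * (rho a r \<theta>)\<^sup>2) = s * V_pot a r \<theta>" unfolding V_pot_def using d by simp
  finally show ?thesis by simp
qed

lemma X_split: "lo < r \<Longrightarrow> X r \<theta> = of_real (a / (r\<^sup>2 + a\<^sup>2)) * w r \<theta> + Y r"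
  using arg_cong[OF V_split[of r \<theta>], of complex_of_real] by (simp only: of_real_add of_real_mult add_ac)

text \<open>The term \<open>Rphi w\<close> cancels against the contribution of \<open>\<partial>\<^sub>\<phi> + i a s V sin\<^sup>2 \<theta>\<close>, so that the first order terms are
  governed by the function \<open>BK\<close> of \<open>r\<close> alone, which makes the equation separable.\<close>

lemma Rg_X: "lo < r \<Longrightarrow> complex_of_real (Rg r) * X r \<theta> = complex_of_real (Rphi r) * w r \<theta> + BK r"
  unfolding X_split Rg_rphi_def by (simp only: of_real_mult distrib_left mult_ac)

lemma Pk_Zk_Bk: "lo < r \<Longrightarrow> Pk (r, \<theta>, \<phi>) = Zk (r, \<theta>, \<phi>) + Bk (r, \<theta>, \<phi>)"
  unfolding Pk_def Zk_def Bk_def fst_conv snd_conv by (simp only: Rg_X distrib_right)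

lemma pd1_Pk: 
  assumes "lo < r" "r < hi" shows "pd1 Pk (r, \<theta>, \<phi>) = pd1 Zk (r, \<theta>, \<phi>) + pd1 Bk (r, \<theta>, \<phi>)"
proof -
  have "((\<lambda>x. Pk (x, \<theta>, \<phi>)) has_vector_derivative pd1 Zk (r, \<theta>, \<phi>) + pd1 Bk (r, \<theta>, \<phi>)) (at r)"
    by (rule has_vector_derivative_transform_within_open[OF has_vector_derivative_add[OF adm_derivs(1)[OF adm_Zk] adm_derivs(1)[OF adm_Bk]]
      open_greaterThanLessThan[of lo hi]]) (use assms Pk_Zk_Bk in auto)
  with adm_derivs(1)[OF adm_Pk assms] show ?thesis using vector_derivative_unique_at by blast
qed

lemma dr_psi: "lo < r \<Longrightarrow> r < hi \<Longrightarrow> vector_derivative (\<lambda>x. complex_of_real (1 / rho a x \<theta>) * \<psi> x \<theta> \<phi>) (at r) = of_real (sin \<theta>) * pd1 kk (r, \<theta>, \<phi>)"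
  by (rule vector_derivative_r[OF adm_kk]) (simp_all only: psi_kk)

lemma dr_i_psi: "lo < r \<Longrightarrow> r < hi \<Longrightarrow> vector_derivative (\<lambda>x. \<i> / complex_of_real (rho a x \<theta>) * \<psi> x \<theta> \<phi>) (at r) = \<i> * of_real (sin \<theta>) * pd1 kk (r, \<theta>, \<phi>)"
  by (rule vector_derivative_r[OF adm_kk]) (simp_all add: kk_def)

lemma dr_Rg_X_psi: "lo < r \<Longrightarrow> r < hi \<Longrightarrow> vector_derivative (\<lambda>x. complex_of_real (Rg x) * (X x \<theta> * (\<i> / complex_of_real (rho a x \<theta>) * \<psi> x \<theta> \<phi>))) (at r)
  = \<i> * of_real (sin \<theta>) * pd1 Pk (r, \<theta>, \<phi>)"
  by (rule vector_derivative_r[OF adm_Pk]) (simp_all add: kk_def Pk_def)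

lemma dr_mu_dr_psi: "lo < r \<Longrightarrow> r < hi \<Longrightarrow> vector_derivative (\<lambda>x. complex_of_real (mu_a M Q \<Lambda> a x) *
     vector_derivative (\<lambda>x. complex_of_real (1 / rho a x \<theta>) * \<psi> x \<theta> \<phi>) (at x)) (at r) = of_real (sin \<theta>) * pd1 Mk (r, \<theta>, \<phi>)"
  by (rule vector_derivative_r[OF adm_Mk]) (simp_all only: dr_psi Mk_def fst_conv, simp)

lemma dphi_psi_twice_scaled: "lo < r \<Longrightarrow> r < hi \<Longrightarrow> vector_derivative (\<lambda>\<phi>. c1 * (c2 * \<psi> r \<theta> \<phi>)) (at \<phi>)
   = c1 * c2 * of_real (rho a r \<theta> * sin \<theta>) * pd3 kk (r, \<theta>, \<phi>)"
  by (rule vector_derivative_phi[OF adm_kk]) (simp_all only: psi_kk' mult.assoc)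

lemma dphi_psi: "lo < r \<Longrightarrow> r < hi \<Longrightarrow> vector_derivative (\<lambda>\<phi>. c2 * \<psi> r \<theta> \<phi>) (at \<phi>)
   = c2 * of_real (rho a r \<theta> * sin \<theta>) * pd3 kk (r, \<theta>, \<phi>)"
  by (rule vector_derivative_phi[OF adm_kk]) (simp_all only: psi_kk' mult.assoc)

lemma dphi_dr_psi: "lo < r \<Longrightarrow> r < hi \<Longrightarrow> vector_derivative (\<lambda>\<phi>. c *
     vector_derivative (\<lambda>x. complex_of_real (1 / rho a x \<theta>) * \<psi> x \<theta> \<phi>) (at r)) (at \<phi>) = c * of_real (sin \<theta>) * pd3 (pd1 kk) (r, \<theta>, \<phi>)"
  by (rule vector_derivative_phi[OF adm_pd(1)[OF adm_kk]]) (simp_all only: dr_psi mult.assoc)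

lemma dr_Rphi_dphi_psi: "lo < r \<Longrightarrow> r < hi \<Longrightarrow> vector_derivative (\<lambda>x. complex_of_real (Rphi x) *
     vector_derivative (\<lambda>\<phi>. complex_of_real (1 / rho a x \<theta>) * \<psi> x \<theta> \<phi>) (at \<phi>)) (at r) = of_real (sin \<theta>) * pd1 G3 (r, \<theta>, \<phi>)"
proof (rule vector_derivative_r[OF adm_G3])
  fix x assume x: "lo < x" "x < hi"
  show "complex_of_real (Rphi x) * vector_derivative (\<lambda>\<phi>. complex_of_real (1 / rho a x \<theta>) * \<psi> x \<theta> \<phi>) (at \<phi>) = of_real (sin \<theta>) * G3 (x, \<theta>, \<phi>)"
    unfolding dphi_psi[OF x] G3_def fst_conv using rho_pos[OF x(1), of \<theta>] by simp
qed

lemma dr_Rphi_w_psi: "lo < r \<Longrightarrow> r < hi \<Longrightarrow> vector_derivative (\<lambda>x. complex_of_real (Rphi x) *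
     (\<i> * w x \<theta> * (complex_of_real (1 / rho a x \<theta>) * \<psi> x \<theta> \<phi>))) (at r) = \<i> * of_real (sin \<theta>) * pd1 Zk (r, \<theta>, \<phi>)"
  by (rule vector_derivative_r[OF adm_Zk]) (simp_all add: kk_def Zk_def)

lemma dtheta_kappa_dtheta_psi:
  assumes "lo < r" "r < hi" "0 < \<theta>" "\<theta> < pi"
  shows "vector_derivative (\<lambda>x. complex_of_real (kappa \<Lambda> a x * sin x) *
     vector_derivative (\<lambda>x. complex_of_real (1 / (rho a r x * sin x)) * \<psi> r x \<phi>) (at x)) (at \<theta>) = pd2 Kk (r, \<theta>, \<phi>)"
proof -
  have 1: "complex_of_real (1 / (rho a r x * sin x)) * \<psi> r x \<phi> = 1 * kk (r, x, \<phi>)" if "0 < x" "x < pi" for x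
    using sin_gt_zero[OF that] by (simp add: kk_def)
  have *: "vector_derivative (\<lambda>x. complex_of_real (1 / (rho a r x * sin x)) * \<psi> r x \<phi>) (at x) = 1 * pd2 kk (r, x, \<phi>)"
    if "0 < x" "x < pi" for x
    by (rule vector_derivative_theta[OF adm_kk assms(1,2) that]) (rule 1)
  have "vector_derivative (\<lambda>x. complex_of_real (kappa \<Lambda> a x * sin x) *
     vector_derivative (\<lambda>x. complex_of_real (1 / (rho a r x * sin x)) * \<psi> r x \<phi>) (at x)) (at \<theta>) = 1 * pd2 Kk (r, \<theta>, \<phi>)"
    by (rule vector_derivative_theta[OF adm_Kk assms]) (simp only: * Kk_def fst_conv snd_conv mult_1_left)
  then show ?thesis by simp
qed

lemma dphi_dphi_psi: "lo < r \<Longrightarrow> r < hi \<Longrightarrow> vector_derivative (\<lambda>\<phi>. vector_derivative (\<lambda>\<phi>. c2 * \<psi> r \<theta> \<phi>) (at \<phi>)) (at \<phi>)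
   = c2 * of_real (rho a r \<theta> * sin \<theta>) * pd3 (pd3 kk) (r, \<theta>, \<phi>)"
  by (rule vector_derivative_phi[OF adm_pd(3)[OF adm_kk]]) (simp_all only: dphi_psi)

lemma T_eval:
  assumes "\<And>r \<theta> \<phi>. lo < r \<Longrightarrow> r < hi \<Longrightarrow> 0 < \<theta> \<Longrightarrow> \<theta> < pi \<Longrightarrow> of_real (rho a r \<theta>) * (R r * S (cos \<theta>)) * f r \<theta> \<phi> = g (r, \<theta>, \<phi>)"
  shows "T f = bint lo hi (\<lambda>r \<theta> \<phi>. g (r, \<theta>, \<phi>))"
  unfolding distr_of_bint by (rule bint_cong) (simp add: sep_spherical assms)

text \<open>\<open>sep\<close> does not depend on \<open>\<phi>\<close>, so its pairing with a
  \<open>\<phi>\<close>-derivative of a periodic function vanishes.\<close>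

lemma T_phi:
  assumes "\<And>r \<theta> \<phi>. lo < r \<Longrightarrow> r < hi \<Longrightarrow> 0 < \<theta> \<Longrightarrow> \<theta> < pi \<Longrightarrow> f r \<theta> \<phi> = c r \<theta> * pd3 F (r, \<theta>, \<phi>)" "adm (Suc 0) F"
  shows "T f = 0"
proof -
  have "T f = bint lo hi (\<lambda>r \<theta> \<phi>. (of_real (rho a r \<theta>) * (R r * S (cos \<theta>)) * c r \<theta>) * pd3 F (r, \<theta>, \<phi>))"
    unfolding distr_of_bint by (rule bint_cong) (simp add: sep_spherical assms)
  also have "\<dots> = 0" by (rule bint_pd3[OF assms(2)])
  finally show ?thesis .
qed

end

section \<open>The terms of the operator as integrals\<close>

context pde_test
begin

abbreviation "I g \<equiv> bint lo hi (\<lambda>r \<theta> \<phi>. g (r, \<theta>, \<phi>))"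

lemma I_add: "adm 0 f \<Longrightarrow> adm 0 g \<Longrightarrow> I (\<lambda>p. f p + g p) = I f + I g"
  using bint_add(1)[OF adm_integrable adm_integrable] .

lemma T_eval_neg:
  assumes "\<And>r \<theta> \<phi>. lo < r \<Longrightarrow> r < hi \<Longrightarrow> 0 < \<theta> \<Longrightarrow> \<theta> < pi \<Longrightarrow> of_real (rho a r \<theta>) * (R r * S (cos \<theta>)) * f r \<theta> \<phi> = - g (r, \<theta>, \<phi>)"
  shows "T f = - I g"
  using T_eval[of f "\<lambda>p. - g p"] assms bint_minus by simp

text \<open>The mode without its factor \<open>\<rho>\<close>, times the \<open>sin \<theta>\<close>
  of the test density.\<close>

definition "J p = R (fst p) * S (cos (fst (snd p))) * complex_of_real (sin (fst (snd p)))"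
definition "Rho2 p = complex_of_real ((rho a (fst p) (fst (snd p)))\<^sup>2)"
abbreviation "gtt p \<equiv> complex_of_real (g_tt M Q \<Lambda> rm \<eta> cp cm a (fst p) (fst (snd p)))"
abbreviation "gtp p \<equiv> complex_of_real (g_tphi M Q \<Lambda> rm \<eta> cp cm a (fst p) (fst (snd p)))"
abbreviation "XX p \<equiv> X (fst p) (fst (snd p))"
abbreviation "ww p \<equiv> w (fst p) (fst (snd p))"
abbreviation "qq p \<equiv> complex_of_real (q_sel M Q \<Lambda> rm \<eta> cp cm a (fst p))"
abbreviation "kap p \<equiv> complex_of_real (kappa \<Lambda> a (fst (snd p)))"

text \<open>The integrands of the terms of \<open>hatP\<close>, up to \<open>\<phi>\<close>-derivatives, which integrate to \<open>0\<close>. In the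
  last factor of \<open>u_phiphi\<close> the singularity of \<open>g_phiphi\<close> at the poles is cancelled by hand.\<close>

definition "u_tt p = - Rho2 p * gtt p * (XX p)\<^sup>2 * (J p * kk p)"
definition "u_tphi p = 2 * Rho2 p * gtp p * ww p * XX p * (J p * kk p)"
definition "u_phiphi p = - (of_real (a\<^sup>2 / ((fst p)\<^sup>2 + a\<^sup>2)\<^sup>2) * - qq p * (ww p)\<^sup>2 
   - of_real ((1 + lam \<Lambda> a)\<^sup>2) / kap p * (of_real (a * s * V_pot a (fst p) (fst (snd p)) * sin (fst (snd p))))\<^sup>2) * (J p * kk p)"
definition "u_mass p = of_real (m\<^sup>2) * Rho2 p * (J p * kk p)"
definition "u_tr_outer p = \<i> * (J p * pd1 Pk p)"
definition "u_tr_inner p = \<i> * (of_real (Rg (fst p)) * XX p) * (J p * pd1 kk p)"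
definition "u_rr p = - (J p * pd1 Mk p)"
definition "u_phir p = - \<i> * (of_real (Rphi (fst p)) * ww p) * (J p * pd1 kk p)"
definition "u_rphi p = J p * pd1 G3 p"
definition "u_rphi_w p = - \<i> * (J p * pd1 Zk p)"
definition "u_thetatheta p = - (R (fst p) * S (cos (fst (snd p))) * pd2 Kk p)"

text \<open>The left-hand side is \<open>hatP\<close> after unfolding, where each transposed
  derivative has contributed a sign and pairs of signs have cancelled. Only the signs are sorted
  here.\<close>

lemma sum_of_terms:
  assumes "term_tt = - I u_tt" "term_tr_outer = I u_tr_outer" "term_tr_inner = I u_tr_inner" "term_tphi_deriv = 0" "term_tphi = - I u_tphi" "term_rr = - I u_rr"
   "term_rphi_deriv = 0" "term_phir = - I u_phir" "term_rphi = I u_rphi" "term_rphi_w = - I u_rphi_w" "term_thetatheta = - I u_thetatheta" "term_phiphi_2 = 0" "term_phiphi_1 = 0" "term_phiphi_1r = 0" "term_phiphi = I u_phiphi" "term_mass = I u_mass"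
   "I u_tt + I u_tr_outer + I u_tr_inner + I u_tphi + I u_rr + I u_phir + I u_rphi + I u_rphi_w + I u_thetatheta + I u_phiphi + I u_mass = 0"
  shows "- term_tt - (- term_tr_outer + - term_tr_inner) - (- term_tphi_deriv + term_tphi) - term_rr + (- (- term_rphi_deriv + term_phir) + (term_rphi + - term_rphi_w)) - term_thetatheta
    + (- (- term_phiphi_2 + term_phiphi_1) + (- term_phiphi_1r + term_phiphi)) + term_mass = 0"
  using assms by (simp add: algebra_simps)

lemma term_tt: "T (\<lambda>r \<theta> \<phi>. X r \<theta> * (X r \<theta> * (complex_of_real (g_tt M Q \<Lambda> rm \<eta> cp cm a r \<theta>) * (\<psi> r \<theta> \<phi>)))) = - I u_tt"
proof (rule T_eval_neg)
  fix r \<theta> \<phi> :: real assume r: "lo < r" "r < hi" and th: "0 < \<theta>" "\<theta> < pi"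
  have "rho a r \<theta> \<noteq> 0" using rho_pos[OF r(1), of \<theta>] by simp
  then show "of_real (rho a r \<theta>) * (R r * S (cos \<theta>)) * (X r \<theta> * (X r \<theta> * (complex_of_real (g_tt M Q \<Lambda> rm \<eta> cp cm a r \<theta>) * (\<psi> r \<theta> \<phi>)))) = - u_tt (r, \<theta>, \<phi>)"
    unfolding psi_kk'[OF r(1)] unfolding u_tt_def J_def Rho2_def fst_conv snd_conv by (simp add: field_simps power2_eq_square)
qed

lemma term_tr_outer: "T (\<lambda>r \<theta> \<phi>. complex_of_real (1 / rho a r \<theta>) * vector_derivative (\<lambda>x. complex_of_real (Rg x) * (X x \<theta> * (\<i> / complex_of_real (rho a x \<theta>) * \<psi> x \<theta> \<phi>))) (at r)) = I u_tr_outer"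
proof (rule T_eval)
  fix r \<theta> \<phi> :: real assume r: "lo < r" "r < hi" and th: "0 < \<theta>" "\<theta> < pi"
  have "rho a r \<theta> \<noteq> 0" using rho_pos[OF r(1), of \<theta>] by simp
  then show "of_real (rho a r \<theta>) * (R r * S (cos \<theta>)) * (complex_of_real (1 / rho a r \<theta>) * vector_derivative (\<lambda>x. complex_of_real (Rg x) * (X x \<theta> * (\<i> / complex_of_real (rho a x \<theta>) * \<psi> x \<theta> \<phi>))) (at r)) = u_tr_outer (r, \<theta>, \<phi>)"
    unfolding dr_Rg_X_psi[OF r] unfolding u_tr_outer_def J_def Rho2_def fst_conv snd_conv by (simp add: field_simps power2_eq_square)
qed

lemma term_tr_inner: "T (\<lambda>r \<theta> \<phi>. complex_of_real (1 / rho a r \<theta>) * (X r \<theta> * (complex_of_real (Rg r) * vector_derivative (\<lambda>x. \<i> / complex_of_real (rho a x \<theta>) * \<psi> x \<theta> \<phi>) (at r)))) = I u_tr_inner"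
proof (rule T_eval)
  fix r \<theta> \<phi> :: real assume r: "lo < r" "r < hi" and th: "0 < \<theta>" "\<theta> < pi"
  have "rho a r \<theta> \<noteq> 0" using rho_pos[OF r(1), of \<theta>] by simp
  then show "of_real (rho a r \<theta>) * (R r * S (cos \<theta>)) * (complex_of_real (1 / rho a r \<theta>) * (X r \<theta> * (complex_of_real (Rg r) * vector_derivative (\<lambda>x. \<i> / complex_of_real (rho a x \<theta>) * \<psi> x \<theta> \<phi>) (at r)))) = u_tr_inner (r, \<theta>, \<phi>)"
    unfolding dr_i_psi[OF r] unfolding u_tr_inner_def J_def Rho2_def fst_conv snd_conv by (simp add: field_simps power2_eq_square)
qed

lemma term_tphi_deriv: "T (\<lambda>r \<theta> \<phi>. vector_derivative (\<lambda>\<phi>. X r \<theta> * (2 * \<i> * complex_of_real (g_tphi M Q \<Lambda> rm \<eta> cp cm a r \<theta>) * (\<psi> r \<theta> \<phi>))) (at \<phi>)) = 0"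
  by (rule T_phi[where c="\<lambda>r \<theta>. X r \<theta> * (2 * \<i> * complex_of_real (g_tphi M Q \<Lambda> rm \<eta> cp cm a r \<theta>)) * complex_of_real (rho a r \<theta> * sin \<theta>)" and F="kk"], subst dphi_psi_twice_scaled, assumption, assumption, simp only: mult.assoc)
    (rule adm_kk)

lemma term_tphi: "T (\<lambda>r \<theta> \<phi>. \<i> * w r \<theta> * (X r \<theta> * (2 * \<i> * complex_of_real (g_tphi M Q \<Lambda> rm \<eta> cp cm a r \<theta>) * (\<psi> r \<theta> \<phi>)))) = - I u_tphi"
proof (rule T_eval_neg)
  fix r \<theta> \<phi> :: real assume r: "lo < r" "r < hi" and th: "0 < \<theta>" "\<theta> < pi"
  have "rho a r \<theta> \<noteq> 0" using rho_pos[OF r(1), of \<theta>] by simp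
  then show "of_real (rho a r \<theta>) * (R r * S (cos \<theta>)) * (\<i> * w r \<theta> * (X r \<theta> * (2 * \<i> * complex_of_real (g_tphi M Q \<Lambda> rm \<eta> cp cm a r \<theta>) * (\<psi> r \<theta> \<phi>)))) = - u_tphi (r, \<theta>, \<phi>)"
    unfolding psi_kk'[OF r(1)] unfolding u_tphi_def J_def Rho2_def fst_conv snd_conv by (simp add: field_simps power2_eq_square)
qed

lemma term_rr: "T (\<lambda>r \<theta> \<phi>. complex_of_real (1 / rho a r \<theta>) * vector_derivative (\<lambda>x. complex_of_real (mu_a M Q \<Lambda> a x) * vector_derivative (\<lambda>x. complex_of_real (1 / rho a x \<theta>) * \<psi> x \<theta> \<phi>) (at x)) (at r)) = - I u_rr"
proof (rule T_eval_neg)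
  fix r \<theta> \<phi> :: real assume r: "lo < r" "r < hi" and th: "0 < \<theta>" "\<theta> < pi"
  have "rho a r \<theta> \<noteq> 0" using rho_pos[OF r(1), of \<theta>] by simp
  then show "of_real (rho a r \<theta>) * (R r * S (cos \<theta>)) * (complex_of_real (1 / rho a r \<theta>) * vector_derivative (\<lambda>x. complex_of_real (mu_a M Q \<Lambda> a x) * vector_derivative (\<lambda>x. complex_of_real (1 / rho a x \<theta>) * \<psi> x \<theta> \<phi>) (at x)) (at r)) = - u_rr (r, \<theta>, \<phi>)"
    unfolding dr_mu_dr_psi[OF r] unfolding u_rr_def J_def Rho2_def fst_conv snd_conv by (simp add: field_simps power2_eq_square)
qed

lemma term_rphi_deriv: "T (\<lambda>r \<theta> \<phi>. complex_of_real (1 / rho a r \<theta>) * vector_derivative (\<lambda>\<phi>. complex_of_real (Rphi r) * vector_derivative (\<lambda>x. complex_of_real (1 / rho a x \<theta>) * \<psi> x \<theta> \<phi>) (at r)) (at \<phi>)) = 0"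
  by (rule T_phi[where c="\<lambda>r \<theta>. complex_of_real (1 / rho a r \<theta>) * (complex_of_real (Rphi r) * complex_of_real (sin \<theta>))" and F="pd1 kk"], subst dphi_dr_psi, assumption, assumption, simp only: mult.assoc)
    (rule adm_pd(1)[OF adm_kk])

lemma term_phir: "T (\<lambda>r \<theta> \<phi>. complex_of_real (1 / rho a r \<theta>) * (\<i> * w r \<theta> * (complex_of_real (Rphi r) * vector_derivative (\<lambda>x. complex_of_real (1 / rho a x \<theta>) * \<psi> x \<theta> \<phi>) (at r)))) = - I u_phir"
proof (rule T_eval_neg)
  fix r \<theta> \<phi> :: real assume r: "lo < r" "r < hi" and th: "0 < \<theta>" "\<theta> < pi"
  have "rho a r \<theta> \<noteq> 0" using rho_pos[OF r(1), of \<theta>] by simp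
  then show "of_real (rho a r \<theta>) * (R r * S (cos \<theta>)) * (complex_of_real (1 / rho a r \<theta>) * (\<i> * w r \<theta> * (complex_of_real (Rphi r) * vector_derivative (\<lambda>x. complex_of_real (1 / rho a x \<theta>) * \<psi> x \<theta> \<phi>) (at r)))) = - u_phir (r, \<theta>, \<phi>)"
    unfolding dr_psi[OF r] unfolding u_phir_def J_def Rho2_def fst_conv snd_conv by (simp add: field_simps power2_eq_square)
qed

lemma term_rphi: "T (\<lambda>r \<theta> \<phi>. complex_of_real (1 / rho a r \<theta>) * vector_derivative (\<lambda>x. complex_of_real (Rphi x) * vector_derivative (\<lambda>\<phi>. complex_of_real (1 / rho a x \<theta>) * \<psi> x \<theta> \<phi>) (at \<phi>)) (at r)) = I u_rphi"
proof (rule T_eval)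
  fix r \<theta> \<phi> :: real assume r: "lo < r" "r < hi" and th: "0 < \<theta>" "\<theta> < pi"
  have "rho a r \<theta> \<noteq> 0" using rho_pos[OF r(1), of \<theta>] by simp
  then show "of_real (rho a r \<theta>) * (R r * S (cos \<theta>)) * (complex_of_real (1 / rho a r \<theta>) * vector_derivative (\<lambda>x. complex_of_real (Rphi x) * vector_derivative (\<lambda>\<phi>. complex_of_real (1 / rho a x \<theta>) * \<psi> x \<theta> \<phi>) (at \<phi>)) (at r)) = u_rphi (r, \<theta>, \<phi>)"
    unfolding dr_Rphi_dphi_psi[OF r] unfolding u_rphi_def J_def Rho2_def fst_conv snd_conv by (simp add: field_simps power2_eq_square)
qed

lemma term_rphi_w: "T (\<lambda>r \<theta> \<phi>. complex_of_real (1 / rho a r \<theta>) * vector_derivative (\<lambda>x. complex_of_real (Rphi x) * (\<i> * w x \<theta> * (complex_of_real (1 / rho a x \<theta>) * \<psi> x \<theta> \<phi>))) (at r)) = - I u_rphi_w"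
proof (rule T_eval_neg)
  fix r \<theta> \<phi> :: real assume r: "lo < r" "r < hi" and th: "0 < \<theta>" "\<theta> < pi"
  have "rho a r \<theta> \<noteq> 0" using rho_pos[OF r(1), of \<theta>] by simp
  then show "of_real (rho a r \<theta>) * (R r * S (cos \<theta>)) * (complex_of_real (1 / rho a r \<theta>) * vector_derivative (\<lambda>x. complex_of_real (Rphi x) * (\<i> * w x \<theta> * (complex_of_real (1 / rho a x \<theta>) * \<psi> x \<theta> \<phi>))) (at r)) = - u_rphi_w (r, \<theta>, \<phi>)"
    unfolding dr_Rphi_w_psi[OF r] unfolding u_rphi_w_def J_def Rho2_def fst_conv snd_conv by (simp add: field_simps power2_eq_square)
qed

lemma term_thetatheta: "T (\<lambda>r \<theta> \<phi>. complex_of_real (1 / rho a r \<theta>) * vector_derivative (\<lambda>x. complex_of_real (kappa \<Lambda> a x * sin x) * vector_derivative (\<lambda>x. complex_of_real (1 / (rho a r x * sin x)) * \<psi> r x \<phi>) (at x)) (at \<theta>)) = - I u_thetatheta"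
proof (rule T_eval_neg)
  fix r \<theta> \<phi> :: real assume r: "lo < r" "r < hi" and th: "0 < \<theta>" "\<theta> < pi"
  have "rho a r \<theta> \<noteq> 0" using rho_pos[OF r(1), of \<theta>] by simp
  then show "of_real (rho a r \<theta>) * (R r * S (cos \<theta>)) * (complex_of_real (1 / rho a r \<theta>) * vector_derivative (\<lambda>x. complex_of_real (kappa \<Lambda> a x * sin x) * vector_derivative (\<lambda>x. complex_of_real (1 / (rho a r x * sin x)) * \<psi> r x \<phi>) (at x)) (at \<theta>)) = - u_thetatheta (r, \<theta>, \<phi>)"
    unfolding dtheta_kappa_dtheta_psi[OF r th] unfolding u_thetatheta_def J_def Rho2_def fst_conv snd_conv by (simp add: field_simps power2_eq_square)
qed

lemma term_phiphi_2: "T (\<lambda>r \<theta> \<phi>. vector_derivative (\<lambda>\<phi>. vector_derivative (\<lambda>\<phi>. complex_of_real (g_phiphi M Q \<Lambda> rm \<eta> cp cm a r \<theta>) * (\<psi> r \<theta> \<phi>)) (at \<phi>)) (at \<phi>)) = 0"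
  by (rule T_phi[where c="\<lambda>r \<theta>. complex_of_real (g_phiphi M Q \<Lambda> rm \<eta> cp cm a r \<theta>) * complex_of_real (rho a r \<theta> * sin \<theta>)" and F="pd3 kk"], subst dphi_dphi_psi, assumption, assumption, simp only: mult.assoc)
    (rule adm_pd(3)[OF adm_kk])

lemma term_phiphi_1: "T (\<lambda>r \<theta> \<phi>. \<i> * w r \<theta> * vector_derivative (\<lambda>\<phi>. complex_of_real (g_phiphi M Q \<Lambda> rm \<eta> cp cm a r \<theta>) * (\<psi> r \<theta> \<phi>)) (at \<phi>)) = 0"
  by (rule T_phi[where c="\<lambda>r \<theta>. \<i> * w r \<theta> * (complex_of_real (g_phiphi M Q \<Lambda> rm \<eta> cp cm a r \<theta>) * complex_of_real (rho a r \<theta> * sin \<theta>))" and F="kk"], subst dphi_psi, assumption, assumption, simp only: mult.assoc)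
    (rule adm_kk)

lemma term_phiphi_1r: "T (\<lambda>r \<theta> \<phi>. vector_derivative (\<lambda>\<phi>. \<i> * w r \<theta> * (complex_of_real (g_phiphi M Q \<Lambda> rm \<eta> cp cm a r \<theta>) * (\<psi> r \<theta> \<phi>))) (at \<phi>)) = 0"
  by (rule T_phi[where c="\<lambda>r \<theta>. \<i> * w r \<theta> * complex_of_real (g_phiphi M Q \<Lambda> rm \<eta> cp cm a r \<theta>) * complex_of_real (rho a r \<theta> * sin \<theta>)" and F="kk"], subst dphi_psi_twice_scaled, assumption, assumption, simp only: mult.assoc)
    (rule adm_kk)

lemma term_phiphi: "T (\<lambda>r \<theta> \<phi>. \<i> * w r \<theta> * (\<i> * w r \<theta> * (complex_of_real (g_phiphi M Q \<Lambda> rm \<eta> cp cm a r \<theta>) * (\<psi> r \<theta> \<phi>)))) = I u_phiphi"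
proof (rule T_eval)
  fix r \<theta> \<phi> :: real assume r: "lo < r" "r < hi" and th: "0 < \<theta>" "\<theta> < pi"
  let ?L = "(1 + lam \<Lambda> a)\<^sup>2" and ?v = "a * s * V_pot a r \<theta>" and ?q = "q_sel M Q \<Lambda> rm \<eta> cp cm a r"
  have nz: "rho a r \<theta> \<noteq> 0" "sin \<theta> \<noteq> 0" "kappa \<Lambda> a \<theta> \<noteq> 0" using rho_pos[OF r(1), of \<theta>] sin_gt_zero[OF th] kappa_pos[of \<theta>] by simp_all
  have 1: "g_phiphi M Q \<Lambda> rm \<eta> cp cm a r \<theta> * (rho a r \<theta>)\<^sup>2 * (?v * (sin \<theta>)\<^sup>2)\<^sup>2
     = a\<^sup>2 / (r\<^sup>2 + a\<^sup>2)\<^sup>2 * - ?q * (?v * (sin \<theta>)\<^sup>2)\<^sup>2 - ?L / kappa \<Lambda> a \<theta> * (?v * sin \<theta>)\<^sup>2"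
  proof -
    have "(A - L / (K * n\<^sup>2)) / P\<^sup>2 * P\<^sup>2 * (v * n\<^sup>2)\<^sup>2 = A * (v * n\<^sup>2)\<^sup>2 - L / K * (v * n)\<^sup>2" 
      if "P \<noteq> 0" "n \<noteq> 0" "K \<noteq> 0" for A L K n P v :: real
      using that by (simp add: field_simps power2_eq_square)
    from this[OF nz] show ?thesis unfolding g_phiphi_def by simp
  qed
  have "complex_of_real (g_phiphi M Q \<Lambda> rm \<eta> cp cm a r \<theta>) * (of_real (rho a r \<theta>))\<^sup>2 * (w r \<theta>)\<^sup>2
     = of_real (a\<^sup>2 / (r\<^sup>2 + a\<^sup>2)\<^sup>2) * - of_real ?q * (w r \<theta>)\<^sup>2 - of_real ?L / of_real (kappa \<Lambda> a \<theta>) * (of_real (?v * sin \<theta>))\<^sup>2"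
    using arg_cong[OF 1, of complex_of_real] by simp
  then have "u_phiphi (r, \<theta>, \<phi>) = - (complex_of_real (g_phiphi M Q \<Lambda> rm \<eta> cp cm a r \<theta>) * (of_real (rho a r \<theta>))\<^sup>2 * (w r \<theta>)\<^sup>2) * (J (r, \<theta>, \<phi>) * kk (r, \<theta>, \<phi>))"
    unfolding u_phiphi_def fst_conv snd_conv by (simp only:)
  then show "of_real (rho a r \<theta>) * (R r * S (cos \<theta>)) * (\<i> * w r \<theta> * (\<i> * w r \<theta> * (complex_of_real (g_phiphi M Q \<Lambda> rm \<eta> cp cm a r \<theta>) * (\<psi> r \<theta> \<phi>)))) = u_phiphi (r, \<theta>, \<phi>)"
    unfolding psi_kk'[OF r(1)] by (simp add: J_def power2_eq_square mult_ac)
qed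

lemma term_mass: "T (\<lambda>r \<theta> \<phi>. complex_of_real (m\<^sup>2) * (\<psi> r \<theta> \<phi>)) = I u_mass"
proof (rule T_eval)
  fix r \<theta> \<phi> :: real assume r: "lo < r" "r < hi" and th: "0 < \<theta>" "\<theta> < pi"
  have "rho a r \<theta> \<noteq> 0" using rho_pos[OF r(1), of \<theta>] by simp
  then show "of_real (rho a r \<theta>) * (R r * S (cos \<theta>)) * (complex_of_real (m\<^sup>2) * (\<psi> r \<theta> \<phi>)) = u_mass (r, \<theta>, \<phi>)"
    unfolding psi_kk'[OF r(1)] unfolding u_mass_def J_def Rho2_def fst_conv snd_conv by (simp add: field_simps power2_eq_square)
qed

lemma hatP_sep:
  assumes sum: "I u_tt + I u_tr_outer + I u_tr_inner + I u_tphi + I u_rr + I u_phir + I u_rphi + I u_rphi_w + I u_thetatheta + I u_phiphi + I u_mass = 0"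
  shows "hatP M Q \<Lambda> rm \<eta> cp cm a \<sigma> s m T (test_density h) = 0"
  unfolding hatP_def Let_def
  by (simp only: plus_fun_apply o_apply uminus_apply minus_apply test_density_def mult_def D_r_def D_theta_def D_phi_def minus_minus)
     (rule sum_of_terms[OF term_tt term_tr_outer term_tr_inner term_tphi_deriv term_tphi term_rr term_rphi_deriv term_phir term_rphi term_rphi_w term_thetatheta term_phiphi_2 term_phiphi_1 term_phiphi_1r term_phiphi term_mass sum])

end

section \<open>The integrands add up to derivatives\<close>

context pde_test
begin

lemma J_smooth: "C_k_on k (coord_dom lo hi) (\<lambda>p. R (fst p) * S (cos (fst (snd p))) * complex_of_real (sin (fst (snd p))))"
  by (intro C_k_on_mult C_k_on_of_r[OF R_smooth] S_cos_smooth sin_smooth open_coord_dom)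

lemma adm_J: "adm n F \<Longrightarrow> adm n (\<lambda>p. J p * F p)"
  unfolding J_def by (rule adm_mult[where c="\<lambda>r \<theta>. R r * S (cos \<theta>) * complex_of_real (sin \<theta>)", OF J_smooth])

lemma adm_0_mult:
  assumes "continuous_on (coord_dom lo hi) c" "\<And>p. c p = c' (fst p) (fst (snd p))" "adm 0 F"
  shows "adm 0 (\<lambda>p. c p * F p)"
proof -
  have "c = (\<lambda>p. c' (fst p) (fst (snd p)))" using assms(2) by blast
  then show ?thesis using adm_mult[where c=c', of 0 F] assms(1,3) by simp
qed

lemma cont_of_r: "continuous_on {lo<..<hi} f \<Longrightarrow> continuous_on (coord_dom lo hi) (\<lambda>p. f (fst p))"
  by (rule continuous_on_compose2[of "{lo<..<hi}" f]) (auto intro!: continuous_intros)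

lemma coefficients_continuous:
  "continuous_on (coord_dom lo hi) (\<lambda>p. q_sel M Q \<Lambda> rm \<eta> cp cm a (fst p))"
  "continuous_on (coord_dom lo hi) (\<lambda>p. Rg (fst p))" "continuous_on (coord_dom lo hi) (\<lambda>p. Rphi (fst p))"
  "continuous_on (coord_dom lo hi) (\<lambda>p. rho a (fst p) (fst (snd p)))" "continuous_on (coord_dom lo hi) (\<lambda>p. V_pot a (fst p) (fst (snd p)))"
  "continuous_on (coord_dom lo hi) (\<lambda>p. kappa \<Lambda> a (fst (snd p)))" "continuous_on (coord_dom lo hi) (\<lambda>p. R (fst p))"
  "continuous_on (coord_dom lo hi) (\<lambda>p. R' (fst p))"
  "continuous_on (coord_dom lo hi) (\<lambda>p. S (cos (fst (snd p))))"
  using cont_of_r[OF q_cont] C_k_on_of_r[OF Rg_smooth, of 0] C_k_on_of_r[OF Rphi_smooth, of 0] rho_smooth[of 0] V_smooth[of 0]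
    kappa_smooth[of 0] C_k_on_of_r[OF R_smooth, of 0] C_k_on_of_r[OF R'_smooth, of 0] S_cos_smooth(1)[of 0] by simp_all

lemma nz: "p \<in> coord_dom lo hi \<Longrightarrow> (rho a (fst p) (fst (snd p)))\<^sup>2 \<noteq> 0" "kappa \<Lambda> a \<theta> \<noteq> 0"
   "p \<in> coord_dom lo hi \<Longrightarrow> (fst p)\<^sup>2 + a\<^sup>2 \<noteq> 0"
  using rho_nz[of p] kappa_pos[of \<theta>] lo by (auto simp: add_nonneg_eq_0_iff)

text \<open>Makes each term integrable, which allows the eleven integrals to be merged into one. The
  products with \<open>Rho2\<close> are regular because it cancels the denominators of
  \<open>g_tt\<close> and \<open>g_tphi\<close>.\<close>

lemma adm_integrands:
  "adm 0 u_tt" "adm 0 u_tr_outer" "adm 0 u_tr_inner" "adm 0 u_tphi" "adm 0 u_rr" "adm 0 u_phir" "adm 0 u_rphi" "adm 0 u_rphi_w" "adm 0 u_thetatheta" "adm 0 u_phiphi" "adm 0 u_mass"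
proof -
  have Jk: "adm 0 (\<lambda>p. J p * kk p)" by (rule adm_J[OF adm_kk])
  have Rho2: "continuous_on (coord_dom lo hi) (\<lambda>p. Rho2 p * gtt p)" "continuous_on (coord_dom lo hi) (\<lambda>p. Rho2 p * gtp p)"
    "continuous_on (coord_dom lo hi) Rho2"
  proof -
    have "Rho2 p * gtt p = of_real (- q_sel M Q \<Lambda> rm \<eta> cp cm a (fst p) - (1 + lam \<Lambda> a)\<^sup>2 * a\<^sup>2 * (sin (fst (snd p)))\<^sup>2 / kappa \<Lambda> a (fst (snd p)))"
      "Rho2 p * gtp p = of_real (- (a / ((fst p)\<^sup>2 + a\<^sup>2)) * q_sel M Q \<Lambda> rm \<eta> cp cm a (fst p) - (1 + lam \<Lambda> a)\<^sup>2 * a / kappa \<Lambda> a (fst (snd p)))"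
      if "p \<in> coord_dom lo hi" for p
      using nz(1)[OF that] unfolding Rho2_def g_tt_def g_tphi_def by (simp_all flip: of_real_mult of_real_diff)
    note e = this
    have "continuous_on (coord_dom lo hi) (\<lambda>p. complex_of_real (- q_sel M Q \<Lambda> rm \<eta> cp cm a (fst p) - (1 + lam \<Lambda> a)\<^sup>2 * a\<^sup>2 * (sin (fst (snd p)))\<^sup>2 / kappa \<Lambda> a (fst (snd p))))"
      "continuous_on (coord_dom lo hi) (\<lambda>p. complex_of_real (- (a / ((fst p)\<^sup>2 + a\<^sup>2)) * q_sel M Q \<Lambda> rm \<eta> cp cm a (fst p) - (1 + lam \<Lambda> a)\<^sup>2 * a / kappa \<Lambda> a (fst (snd p))))"
      by (intro continuous_intros coefficients_continuous ballI nz; assumption)+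
    then show "continuous_on (coord_dom lo hi) (\<lambda>p. Rho2 p * gtt p)" "continuous_on (coord_dom lo hi) (\<lambda>p. Rho2 p * gtp p)"
      by (simp_all only: e cong: continuous_on_cong)
    show "continuous_on (coord_dom lo hi) Rho2" unfolding Rho2_def[abs_def] by (intro continuous_intros coefficients_continuous)
  qed
  have m1: "adm 0 (\<lambda>p. (- 1) * F p)" if "adm 0 F" for F :: "real \<times> real \<times> real \<Rightarrow> complex"
    by (rule adm_0_mult[where c'="\<lambda>r \<theta>. -1"]) (use that in auto)
  have i1: "adm 0 (\<lambda>p. \<i> * F p)" if "adm 0 F" for F :: "real \<times> real \<times> real \<Rightarrow> complex"
    by (rule adm_0_mult[where c'="\<lambda>r \<theta>. \<i>"]) (use that in auto)
  have i2: "adm 0 (\<lambda>p. (- \<i>) * F p)" if "adm 0 F" for F :: "real \<times> real \<times> real \<Rightarrow> complex"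
    by (rule adm_0_mult[where c'="\<lambda>r \<theta>. -\<i>"]) (use that in auto)
  show "adm 0 u_tr_outer" unfolding u_tr_outer_def[abs_def] by (intro i1 adm_J adm_pd adm_Pk)
  show "adm 0 u_rr" using m1[OF adm_J[OF adm_pd(1)[OF adm_Mk]]] unfolding u_rr_def[abs_def] by simp
  show "adm 0 u_rphi" unfolding u_rphi_def[abs_def] by (intro adm_J adm_pd adm_G3)
  show "adm 0 u_rphi_w" unfolding u_rphi_w_def[abs_def] by (intro i2 adm_J adm_pd adm_Zk)
  show "adm 0 u_tr_inner" unfolding u_tr_inner_def[abs_def]
    by (rule adm_0_mult[where c'="\<lambda>r \<theta>. \<i> * (of_real (Rg r) * X r \<theta>)"])
       (intro continuous_intros coefficients_continuous, simp, intro adm_J adm_pd adm_kk)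
  show "adm 0 u_phir" unfolding u_phir_def[abs_def]
    by (rule adm_0_mult[where c'="\<lambda>r \<theta>. - \<i> * (of_real (Rphi r) * w r \<theta>)"])
       (intro continuous_intros coefficients_continuous, simp, intro adm_J adm_pd adm_kk)
  have "adm 0 (\<lambda>p. R (fst p) * S (cos (fst (snd p))) * pd2 Kk p)"
    by (rule adm_0_mult[where c'="\<lambda>r \<theta>. R r * S (cos \<theta>)"])
       (intro continuous_intros coefficients_continuous, simp, intro adm_pd adm_Kk)
  from m1[OF this] show "adm 0 u_thetatheta" unfolding u_thetatheta_def[abs_def] by simp
  have "adm 0 (\<lambda>p. (- (Rho2 p * gtt p) * (XX p)\<^sup>2) * (J p * kk p))"
    by (rule adm_0_mult[where c'="\<lambda>r \<theta>. - (of_real ((rho a r \<theta>)\<^sup>2) * complex_of_real (g_tt M Q \<Lambda> rm \<eta> cp cm a r \<theta>)) * (X r \<theta>)\<^sup>2", OF _ _ Jk])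
       (intro continuous_intros coefficients_continuous Rho2, simp add: Rho2_def)
  then show "adm 0 u_tt" unfolding u_tt_def[abs_def] by (simp only: mult_minus_left mult.assoc)
  have "adm 0 (\<lambda>p. (2 * (Rho2 p * gtp p) * ww p * XX p) * (J p * kk p))"
    by (rule adm_0_mult[where c'="\<lambda>r \<theta>. 2 * (of_real ((rho a r \<theta>)\<^sup>2) * complex_of_real (g_tphi M Q \<Lambda> rm \<eta> cp cm a r \<theta>)) * w r \<theta> * X r \<theta>", OF _ _ Jk])
       (intro continuous_intros coefficients_continuous Rho2, simp add: Rho2_def)
  then show "adm 0 u_tphi" unfolding u_tphi_def[abs_def] by (simp only: mult.assoc)
  show "adm 0 u_mass" unfolding u_mass_def[abs_def]
    by (rule adm_0_mult[where c'="\<lambda>r \<theta>. of_real (m\<^sup>2) * of_real ((rho a r \<theta>)\<^sup>2)", OF _ _ Jk])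
       (intro continuous_intros coefficients_continuous Rho2, simp add: Rho2_def)
  show "adm 0 u_phiphi" unfolding u_phiphi_def[abs_def]
    by (rule adm_0_mult[where c'="\<lambda>r \<theta>. - (of_real (a\<^sup>2 / (r\<^sup>2 + a\<^sup>2)\<^sup>2) * - complex_of_real (q_sel M Q \<Lambda> rm \<eta> cp cm a r) * (w r \<theta>)\<^sup>2 
   - of_real ((1 + lam \<Lambda> a)\<^sup>2) / complex_of_real (kappa \<Lambda> a \<theta>) * (of_real (a * s * V_pot a r \<theta> * sin \<theta>))\<^sup>2)", OF _ _ Jk])
       (intro continuous_intros coefficients_continuous ballI, rule power_not_zero, rule nz, assumption, simp only: of_real_eq_0_iff, rule nz, simp_all)
qed

text \<open>The boundary terms of Green's formula: \<open>F1\<close> collects the radial ones,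
  \<open>F2\<close> the angular ones, and \<open>F3\<close> is the \<open>\<phi>\<close>-derivative
  left over from the mixed terms.\<close>

definition "F1 p = complex_of_real (sin (fst (snd p))) * S (cos (fst (snd p))) *
   ((- R (fst p)) * Mk p + ((of_real (mu_a M Q \<Lambda> a (fst p)) * R' (fst p) + \<i> * BK (fst p) * R (fst p)) * kk p
    + ((\<i> * R (fst p)) * Bk p + R (fst p) * G3 p)))"
text \<open>Equals \<open>- kappa \<Lambda> a \<theta> * sin \<theta>\<close> times the
  \<open>\<theta>\<close>-derivative of \<open>S (cos \<theta>)\<close>, in the form to which
  \<open>S_ode\<close> applies.\<close>

definition "E \<theta> = complex_of_real ((1 - (cos \<theta>)\<^sup>2) * (1 + lam \<Lambda> a * (cos \<theta>)\<^sup>2)) * S' (cos \<theta>)"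
definition "F2 p = (- R (fst p) * S (cos (fst (snd p)))) * Kk p + (- R (fst p) * E (fst (snd p))) * kk p"
definition "F3 p = (- R' (fst p) * S (cos (fst (snd p))) * of_real (sin (fst (snd p))) * of_real (Rphi (fst p))) * pd3 kk p"

lemma adm_F: "adm 1 F1" "adm 1 F2" "adm 0 F3"
proof -
  have mu: "C_k_on k {lo<..<hi} (\<lambda>r. complex_of_real (mu_a M Q \<Lambda> a r))" for k
    by (intro C_k_on_of_real C_k_on_subset[OF mu_a_smooth] subset_UNIV open_greaterThanLessThan)
  have "adm 1 (\<lambda>p. (- R (fst p)) * Mk p + ((of_real (mu_a M Q \<Lambda> a (fst p)) * R' (fst p) + \<i> * BK (fst p) * R (fst p)) * kk p
    + ((\<i> * R (fst p)) * Bk p + R (fst p) * G3 p)))"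
    by (intro adm_add; rule adm_r[where c="\<lambda>r. - R r"] adm_r[where c="\<lambda>r. of_real (mu_a M Q \<Lambda> a r) * R' r + \<i> * BK r * R r"]
      adm_r[where c="\<lambda>r. \<i> * R r"] adm_r[where c=R])
      (intro C_k_on_minus C_k_on_add C_k_on_mult mu R_smooth R'_smooth BK_smooth C_k_on_const open_greaterThanLessThan adm_Mk adm_kk adm_Bk adm_G3)+
  then show "adm 1 F1" unfolding F1_def
    by (intro adm_mult[where c="\<lambda>r \<theta>. complex_of_real (sin \<theta>) * S (cos \<theta>)"] C_k_on_mult sin_smooth S_cos_smooth open_coord_dom)
  have E: "C_k_on k (coord_dom lo hi) (\<lambda>p. E (fst (snd p)))" for k
    unfolding E_def by (intro C_k_on_mult C_k_on_of_real C_k_on_add C_k_on_diff C_k_on_power C_k_on_const C_k_on_trig_theta S_cos_smooth open_coord_dom)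
  show "adm 1 F2" unfolding F2_def
    by (intro adm_add; rule adm_mult[where c="\<lambda>r \<theta>. - R r * S (cos \<theta>)"] adm_mult[where c="\<lambda>r \<theta>. - R r * E \<theta>"])
      (intro C_k_on_minus C_k_on_mult C_k_on_of_r[OF R_smooth] S_cos_smooth E open_coord_dom adm_Kk adm_kk)+
  show "adm 0 F3" unfolding F3_def
    by (rule adm_0_mult[where c'="\<lambda>r \<theta>. - R' r * S (cos \<theta>) * of_real (sin \<theta>) * of_real (Rphi r)"])
      (intro continuous_intros coefficients_continuous, simp, intro adm_pd adm_kk)
qed

text \<open>\<open>flux\<close> differentiates the bracket in front of \<open>kk\<close>. Afterwards
  the terms with \<open>R'\<close> cancel in pairs, through \<open>Mk\<close> and through
  \<open>Bk\<close>, except for the one with \<open>G3\<close>.\<close>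

lemma pd1_F1:
  assumes r: "lo < r" "r < hi"
  shows "pd1 F1 (r, \<theta>, \<phi>) = complex_of_real (sin \<theta>) * S (cos \<theta>) *
   (- R r * pd1 Mk (r, \<theta>, \<phi>) + \<i> * BK r * R r * pd1 kk (r, \<theta>, \<phi>)
    + (of_real (q_sel M Q \<Lambda> rm \<eta> cp cm a r) * (Y r)\<^sup>2 + of_real (m\<^sup>2 * r\<^sup>2) + l) * R r * kk (r, \<theta>, \<phi>)
    + \<i> * R r * pd1 Bk (r, \<theta>, \<phi>) + R' r * G3 (r, \<theta>, \<phi>) + R r * pd1 G3 (r, \<theta>, \<phi>))"
proof -
  let ?p = "(r, \<theta>, \<phi>)"
  let ?W = "of_real (q_sel M Q \<Lambda> rm \<eta> cp cm a r) * (Y r)\<^sup>2 + of_real (m\<^sup>2 * r\<^sup>2) + l"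
  have fl: "((\<lambda>r. of_real (mu_a M Q \<Lambda> a r) * R' r + \<i> * BK r * R r) has_vector_derivative - \<i> * BK r * R' r + ?W * R r) (at r)"
    using flux[OF r] by (simp only: mult.assoc)
  have "((\<lambda>x. F1 (x, \<theta>, \<phi>)) has_vector_derivative complex_of_real (sin \<theta>) * S (cos \<theta>) *
     ((- R r * pd1 Mk ?p + (- R' r) * Mk ?p)
     + (((of_real (mu_a M Q \<Lambda> a r) * R' r + \<i> * BK r * R r) * pd1 kk ?p + (- \<i> * BK r * R' r + ?W * R r) * kk ?p)
     + ((\<i> * R r * pd1 Bk ?p + (\<i> * R' r) * Bk ?p) + (R r * pd1 G3 ?p + R' r * G3 ?p))))) (at r)"
    unfolding F1_def fst_conv snd_conv
    by (intro has_vector_derivative_mult_right has_vector_derivative_add has_vector_derivative_mult has_vector_derivative_minus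
      R_deriv fl r adm_derivs(1)[OF adm_Mk r] adm_derivs(1)[OF adm_kk r] adm_derivs(1)[OF adm_Bk r] adm_derivs(1)[OF adm_G3 r])
  then have "pd1 F1 ?p = complex_of_real (sin \<theta>) * S (cos \<theta>) *
     ((- R r * pd1 Mk ?p + (- R' r) * Mk ?p)
     + (((of_real (mu_a M Q \<Lambda> a r) * R' r + \<i> * BK r * R r) * pd1 kk ?p + (- \<i> * BK r * R' r + ?W * R r) * kk ?p)
     + ((\<i> * R r * pd1 Bk ?p + (\<i> * R' r) * Bk ?p) + (R r * pd1 G3 ?p + R' r * G3 ?p))))"
    by (rule vector_derivative_unique_at[OF adm_derivs(1)[of 0, folded One_nat_def, OF adm_F(1) r]])
  moreover have "Mk ?p = of_real (mu_a M Q \<Lambda> a r) * pd1 kk ?p" "Bk ?p = BK r * kk ?p" by (simp_all add: Mk_def Bk_def)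
  ultimately show ?thesis by (simp only:) (simp only: ring_distribs mult_minus_left mult_minus_right minus_minus add_ac mult_ac, simp)
qed

lemma pd2_F2:
  assumes r: "lo < r" "r < hi"
  shows "pd2 F2 (r, \<theta>, \<phi>) = - R r * S (cos \<theta>) * pd2 Kk (r, \<theta>, \<phi>)
    + R r * of_real (sin \<theta>) * ((of_real (a\<^sup>2) * (of_real ((1 + lam \<Lambda> a)\<^sup>2 * (1 - (cos \<theta>)\<^sup>2) / (1 + lam \<Lambda> a * (cos \<theta>)\<^sup>2)) * \<sigma>\<^sup>2
      + of_real (m\<^sup>2 * (cos \<theta>)\<^sup>2)) - l) * S (cos \<theta>)) * kk (r, \<theta>, \<phi>)"
proof -
  let ?p = "(r, \<theta>, \<phi>)" and ?U = "(of_real (a\<^sup>2) * (of_real ((1 + lam \<Lambda> a)\<^sup>2 * (1 - (cos \<theta>)\<^sup>2) / (1 + lam \<Lambda> a * (cos \<theta>)\<^sup>2)) * \<sigma>\<^sup>2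
      + of_real (m\<^sup>2 * (cos \<theta>)\<^sup>2)) - l) * S (cos \<theta>)"
  have c: "-2 < cos \<theta>" "cos \<theta> < 2" using cos_ge_minus_one[of \<theta>] cos_le_one[of \<theta>] by linarith+
  have dc: "(cos has_vector_derivative - sin \<theta>) (at \<theta>)"
    using DERIV_cos has_real_derivative_iff_has_vector_derivative by blast
  have dS: "((\<lambda>\<theta>. S (cos \<theta>)) has_vector_derivative (- sin \<theta>) *\<^sub>R S' (cos \<theta>)) (at \<theta>)"
    using vector_diff_chain_at[OF dc S_deriv[OF c]] by (simp add: o_def)
  have dE: "(E has_vector_derivative (- sin \<theta>) *\<^sub>R ?U) (at \<theta>)"
    using vector_diff_chain_at[OF dc S_ode[OF c]] by (simp add: o_def E_def[abs_def])
  have "((\<lambda>x. F2 (r, x, \<phi>)) has_vector_derivative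
     ((- R r * S (cos \<theta>)) * pd2 Kk ?p + (- R r * ((- sin \<theta>) *\<^sub>R S' (cos \<theta>))) * Kk ?p)
     + ((- R r * E \<theta>) * pd2 kk ?p + (- R r * ((- sin \<theta>) *\<^sub>R ?U)) * kk ?p)) (at \<theta>)"
    unfolding F2_def fst_conv snd_conv
    by (intro has_vector_derivative_add has_vector_derivative_mult has_vector_derivative_mult_right
      dS dE adm_derivs(2)[OF adm_Kk r] adm_derivs(2)[OF adm_kk r])
  then have "pd2 F2 ?p = ((- R r * S (cos \<theta>)) * pd2 Kk ?p + (- R r * ((- sin \<theta>) *\<^sub>R S' (cos \<theta>))) * Kk ?p)
     + ((- R r * E \<theta>) * pd2 kk ?p + (- R r * ((- sin \<theta>) *\<^sub>R ?U)) * kk ?p)"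
    by (rule vector_derivative_unique_at[OF adm_derivs(2)[of 0, folded One_nat_def, OF adm_F(2) r]])
  moreover have "Kk ?p = of_real (kappa \<Lambda> a \<theta> * sin \<theta>) * pd2 kk ?p" by (simp add: Kk_def)
  moreover have "E \<theta> = of_real (sin \<theta> * (kappa \<Lambda> a \<theta> * sin \<theta>)) * S' (cos \<theta>)"
  proof -
    have "(1 - (cos \<theta>)\<^sup>2) * (1 + lam \<Lambda> a * (cos \<theta>)\<^sup>2) = sin \<theta> * (kappa \<Lambda> a \<theta> * sin \<theta>)"
      unfolding kappa_def sin_squared_eq[symmetric] by (simp add: power2_eq_square)
    then show ?thesis by (simp only: E_def)
  qed
  moreover have "((- R0 * S0) * K + (- R0 * ((- n) * S1)) * (kp * n * k2)) + ((- R0 * (n * (kp * n) * S1)) * k2 + (- R0 * ((- n) * U)) * k)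
    = - R0 * S0 * K + R0 * n * U * k" for R0 S0 K n S1 kp k2 U k :: complex
    by (simp add: algebra_simps)
  ultimately show ?thesis by (simp only: scaleR_conv_of_real of_real_minus of_real_mult)
qed

text \<open>Two squares are completed: the terms with \<open>q_sel\<close> combine to the square of
  \<open>X - a / (r\<^sup>2 + a\<^sup>2) * w = Y\<close>, those with \<open>1 / kappa\<close> to the
  square of \<open>X - s V = \<sigma>\<close>. What remains is a function of \<open>r\<close> plus a
  function of \<open>\<theta>\<close>.\<close>

lemma zero_order:
  assumes r: "lo < r" "r < hi" and th: "0 < \<theta>" "\<theta> < pi"
  shows "u_tt (r, \<theta>, \<phi>) + u_tphi (r, \<theta>, \<phi>) + u_phiphi (r, \<theta>, \<phi>) + u_mass (r, \<theta>, \<phi>)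
    = (of_real (q_sel M Q \<Lambda> rm \<eta> cp cm a r) * (Y r)\<^sup>2 + of_real (m\<^sup>2 * r\<^sup>2)
     + of_real (a\<^sup>2) * (of_real ((1 + lam \<Lambda> a)\<^sup>2 * (1 - (cos \<theta>)\<^sup>2) / (1 + lam \<Lambda> a * (cos \<theta>)\<^sup>2)) * \<sigma>\<^sup>2
      + of_real (m\<^sup>2 * (cos \<theta>)\<^sup>2))) * (J (r, \<theta>, \<phi>) * kk (r, \<theta>, \<phi>))"
proof -
  let ?q = "complex_of_real (q_sel M Q \<Lambda> rm \<eta> cp cm a r)" and ?L = "complex_of_real ((1 + lam \<Lambda> a)\<^sup>2)"
    and ?ki = "complex_of_real (1 / kappa \<Lambda> a \<theta>)" and ?D = "complex_of_real (a / (r\<^sup>2 + a\<^sup>2))" and ?v = "complex_of_real (s * V_pot a r \<theta>)"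
    and ?A = "complex_of_real a" and ?n = "complex_of_real (sin \<theta>)" and ?p = "(r, \<theta>, \<phi>)"
  have nz: "rho a r \<theta> \<noteq> 0" "kappa \<Lambda> a \<theta> \<noteq> 0" using rho_pos[OF r(1), of \<theta>] kappa_pos[of \<theta>] by simp_all
  have 1: "Rho2 ?p * gtt ?p = - ?q - ?L * ?A\<^sup>2 * ?n\<^sup>2 * ?ki" "Rho2 ?p * gtp ?p = - ?D * ?q - ?L * ?A * ?ki"
  proof -
    have "(rho a r \<theta>)\<^sup>2 * g_tt M Q \<Lambda> rm \<eta> cp cm a r \<theta> = - q_sel M Q \<Lambda> rm \<eta> cp cm a r - (1 + lam \<Lambda> a)\<^sup>2 * a\<^sup>2 * (sin \<theta>)\<^sup>2 * (1 / kappa \<Lambda> a \<theta>)"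
      "(rho a r \<theta>)\<^sup>2 * g_tphi M Q \<Lambda> rm \<eta> cp cm a r \<theta> = - (a / (r\<^sup>2 + a\<^sup>2)) * q_sel M Q \<Lambda> rm \<eta> cp cm a r - (1 + lam \<Lambda> a)\<^sup>2 * a * (1 / kappa \<Lambda> a \<theta>)"
      unfolding g_tt_def g_tphi_def using nz by simp_all
    from this[THEN arg_cong[of _ _ complex_of_real]] show "Rho2 ?p * gtt ?p = - ?q - ?L * ?A\<^sup>2 * ?n\<^sup>2 * ?ki" "Rho2 ?p * gtp ?p = - ?D * ?q - ?L * ?A * ?ki"
      unfolding Rho2_def fst_conv snd_conv by (simp_all only: of_real_mult of_real_diff of_real_minus of_real_power)
  qed
  have 2: "of_real (a\<^sup>2 / (r\<^sup>2 + a\<^sup>2)\<^sup>2) = ?D\<^sup>2" "?L / kap ?p = ?L * ?ki" "complex_of_real (a * s * V_pot a r \<theta> * sin \<theta>) = ?A * ?v * ?n"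
    "w r \<theta> = ?A * ?v * ?n\<^sup>2"
    by (simp_all add: power_divide)
  have rho2: "Rho2 ?p = of_real (r\<^sup>2) + ?A\<^sup>2 * of_real ((cos \<theta>)\<^sup>2)" unfolding Rho2_def fst_conv snd_conv rho_sq by simp
  have ki: "complex_of_real ((1 + lam \<Lambda> a)\<^sup>2 * (1 - (cos \<theta>)\<^sup>2) / (1 + lam \<Lambda> a * (cos \<theta>)\<^sup>2)) = ?L * ?n\<^sup>2 * ?ki"
    unfolding sin_squared_eq[symmetric] kappa_def by simp
  have Y: "Y r = X r \<theta> - ?D * (?A * ?v * ?n\<^sup>2)" using X_split[OF r(1), of \<theta>] unfolding 2 by (simp only: eq_diff_eq add.commute)
  have alg: "- (- q - L * A\<^sup>2 * n\<^sup>2 * ki) * (\<sigma> + v)\<^sup>2 * k + 2 * (- D * q - L * A * ki) * (A * v * n\<^sup>2) * (\<sigma> + v) * k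
     + - (D\<^sup>2 * - q * (A * v * n\<^sup>2)\<^sup>2 - L * ki * (A * v * n)\<^sup>2) * k + m2 * (r2 + A\<^sup>2 * c2) * k
     = (q * (\<sigma> + v - D * (A * v * n\<^sup>2))\<^sup>2 + m2 * r2 + A\<^sup>2 * (L * n\<^sup>2 * ki * \<sigma>\<^sup>2 + m2 * c2)) * k" for q L A n ki v D m2 r2 c2 k :: complex
    by (simp add: algebra_simps power2_eq_square)
  have "u_tt ?p + u_tphi ?p + u_phiphi ?p + u_mass ?p = - (Rho2 ?p * gtt ?p) * (X r \<theta>)\<^sup>2 * (J ?p * kk ?p) + 2 * (Rho2 ?p * gtp ?p) * w r \<theta> * X r \<theta> * (J ?p * kk ?p)
    + - (of_real (a\<^sup>2 / (r\<^sup>2 + a\<^sup>2)\<^sup>2) * - ?q * (w r \<theta>)\<^sup>2 - ?L / kap ?p * (of_real (a * s * V_pot a r \<theta> * sin \<theta>))\<^sup>2) * (J ?p * kk ?p)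
    + of_real (m\<^sup>2) * Rho2 ?p * (J ?p * kk ?p)"
    unfolding u_tt_def u_tphi_def u_phiphi_def u_mass_def fst_conv snd_conv by (simp only: mult.assoc mult_minus_left)
  also have "\<dots> = (?q * (Y r)\<^sup>2 + of_real (m\<^sup>2) * of_real (r\<^sup>2) + ?A\<^sup>2 * (?L * ?n\<^sup>2 * ?ki * \<sigma>\<^sup>2 + of_real (m\<^sup>2) * of_real ((cos \<theta>)\<^sup>2))) * (J ?p * kk ?p)"
    unfolding Y unfolding 1 2 unfolding rho2 by (rule alg)
  finally show ?thesis unfolding ki by (simp only: of_real_mult of_real_power)
qed

text \<open>Pointwise the integrands add up to \<open>pd1 F1 + pd2 F2 + F3\<close>. The separation
  constant \<open>l\<close> enters the first two with opposite signs and drops out.\<close>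

lemma sum_zero: "I u_tt + I u_tr_outer + I u_tr_inner + I u_tphi + I u_rr + I u_phir + I u_rphi + I u_rphi_w + I u_thetatheta + I u_phiphi + I u_mass = 0"
proof -
  define In where "In g = I g" for g
  have In_add: "In f + In g = In (\<lambda>p. f p + g p)" if "adm 0 f" "adm 0 g" for f g
    unfolding In_def by (rule I_add[OF that, symmetric])
  have "I u_tt + I u_tr_outer + I u_tr_inner + I u_tphi + I u_rr + I u_phir + I u_rphi + I u_rphi_w + I u_thetatheta + I u_phiphi + I u_mass
    = I (\<lambda>p. u_tt p + u_tr_outer p + u_tr_inner p + u_tphi p + u_rr p + u_phir p + u_rphi p + u_rphi_w p + u_thetatheta p + u_phiphi p + u_mass p)"
    by (simp only: In_add adm_add adm_integrands flip: In_def) (simp only: In_def)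
  also have "\<dots> = I (\<lambda>p. pd1 F1 p + pd2 F2 p + F3 p)"
  proof (rule bint_cong)
    fix r \<theta> \<phi> :: real assume r: "lo < r" "r < hi" and th: "0 < \<theta>" "\<theta> < pi"
    let ?p = "(r, \<theta>, \<phi>)"
    let ?W = "of_real (q_sel M Q \<Lambda> rm \<eta> cp cm a r) * (Y r)\<^sup>2 + of_real (m\<^sup>2 * r\<^sup>2)"
      and ?U = "of_real (a\<^sup>2) * (of_real ((1 + lam \<Lambda> a)\<^sup>2 * (1 - (cos \<theta>)\<^sup>2) / (1 + lam \<Lambda> a * (cos \<theta>)\<^sup>2)) * \<sigma>\<^sup>2
      + of_real (m\<^sup>2 * (cos \<theta>)\<^sup>2))"
    have alg: "(W + U) * (R0 * S0 * n * k) + \<i> * (R0 * S0 * n * (Z1 + B1)) + \<i> * (Z + B) * (R0 * S0 * n * k1) + - (R0 * S0 * n * M1)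
       + - \<i> * Z * (R0 * S0 * n * k1) + R0 * S0 * n * g1 + - \<i> * (R0 * S0 * n * Z1) + - (R0 * S0 * K2)
       = n * S0 * (- R0 * M1 + \<i> * B * R0 * k1 + (W + l) * R0 * k + \<i> * R0 * B1 + R1 * (P * k3) + R0 * g1)
         + (- R0 * S0 * K2 + R0 * n * ((U - l) * S0) * k) + (- R1 * S0 * n * P) * k3"
      for W U R0 S0 n k Z1 B1 Z B k1 M1 g1 K2 R1 P k3 :: complex
      by (simp add: algebra_simps)
    have "u_tt ?p + u_tr_outer ?p + u_tr_inner ?p + u_tphi ?p + u_rr ?p + u_phir ?p + u_rphi ?p + u_rphi_w ?p + u_thetatheta ?p + u_phiphi ?p + u_mass ?p
      = (u_tt ?p + u_tphi ?p + u_phiphi ?p + u_mass ?p) + u_tr_outer ?p + u_tr_inner ?p + u_rr ?p + u_phir ?p + u_rphi ?p + u_rphi_w ?p + u_thetatheta ?p" by simp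
    also have "\<dots> = pd1 F1 ?p + pd2 F2 ?p + F3 ?p"
      unfolding zero_order[OF r th] pd1_F1[OF r] pd2_F2[OF r] u_tr_outer_def u_tr_inner_def u_rr_def u_phir_def u_rphi_def u_rphi_w_def u_thetatheta_def F3_def J_def G3_def fst_conv snd_conv
        pd1_Pk[OF r] Rg_X[OF r(1)]
      by (rule alg)
    finally show "u_tt (r, \<theta>, \<phi>) + u_tr_outer (r, \<theta>, \<phi>) + u_tr_inner (r, \<theta>, \<phi>) + u_tphi (r, \<theta>, \<phi>) + u_rr (r, \<theta>, \<phi>) + u_phir (r, \<theta>, \<phi>) + u_rphi (r, \<theta>, \<phi>)
      + u_rphi_w (r, \<theta>, \<phi>) + u_thetatheta (r, \<theta>, \<phi>) + u_phiphi (r, \<theta>, \<phi>) + u_mass (r, \<theta>, \<phi>) = pd1 F1 (r, \<theta>, \<phi>) + pd2 F2 (r, \<theta>, \<phi>) + F3 (r, \<theta>, \<phi>)" .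
  qed
  also have "\<dots> = I (pd1 F1) + I (pd2 F2) + I F3"
    proof -
    have "adm 0 (pd1 F1)" "adm 0 (pd2 F2)" using adm_F adm_pd by auto
    then have "In (pd1 F1) + In (pd2 F2) + In F3 = In (\<lambda>p. pd1 F1 p + pd2 F2 p + F3 p)"
      using adm_F(3) by (simp only: In_add adm_add)
    then show ?thesis by (simp only: In_def)
  qed
  also have "I (pd1 F1) = 0" by (rule bint_pd1) (use adm_F in simp)
  \<comment> \<open>Both summands of \<open>F2\<close> contain a factor that vanishes at the poles:
    \<open>sin \<theta>\<close> in \<open>Kk\<close>, and \<open>1 - (cos \<theta>)\<^sup>2\<close>
    in \<open>E\<close>.\<close>
  also have "I (pd2 F2) = 0" by (rule bint_pd2) (use adm_F in \<open>simp_all add: F2_def E_def Kk_def\<close>)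
  also have "I F3 = 0"
    unfolding F3_def fst_conv snd_conv by (rule bint_pd3) (rule adm_kk)
  finally show ?thesis by simp
qed

lemma D_phi_sep: "D_phi T (test_density h) = 0"
proof -
  have "T (\<lambda>r \<theta> \<phi>. vector_derivative (\<lambda>x. \<psi> r \<theta> x) (at \<phi>)) = 0"
    by (rule T_phi[where c="\<lambda>r \<theta>. of_real (rho a r \<theta> * sin \<theta>)" and F=kk], rule vector_derivative_phi[OF adm_kk])
       (simp_all only: psi_kk' adm_kk)
  then show ?thesis by (simp add: D_phi_def test_density_def)
qed

end

text \<open>A compact support inside the open shell leaves room for a closed radial interval
  \<open>[lo', hi']\<close>; if the support is empty, any point inside will do.\<close>

lemma (in pde_data) sep_kernel:
  assumes "lo < hi" and h: "h \<in> test_functions lo hi"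
  shows "hatP M Q \<Lambda> rm \<eta> cp cm a \<sigma> s m (distr_of lo hi sep) (test_density h) = 0"
    and "D_phi (distr_of lo hi sep) (test_density h) = 0"
proof -
  obtain K where K: "compact K" "K \<subseteq> shell lo hi" "\<And>x. x \<notin> K \<Longrightarrow> h x = 0" and hs: "smooth_on UNIV h"
    using h by (auto simp: test_functions_def)
  obtain lo' hi' where *: "lo < lo'" "lo' \<le> hi'" "hi' < hi" "\<And>x. x \<in> K \<Longrightarrow> lo' \<le> norm x \<and> norm x \<le> hi'"
  proof (cases "K = {}")
    case True
    obtain c where "lo < c" "c < hi" using dense assms(1) by blast
    then show ?thesis using that[of c c] True by auto
  next
    case False
    have n: "continuous_on K norm" by (intro continuous_intros)
    obtain x y where "x \<in> K" "y \<in> K" "\<And>z. z \<in> K \<Longrightarrow> norm x \<le> norm z \<and> norm z \<le> norm y"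
      using continuous_attains_inf[OF K(1) False n] continuous_attains_sup[OF K(1) False n] by blast
    then show ?thesis using that[of "norm x" "norm y"] K(2) by (auto simp: shell_def)
  qed
  interpret pde_test M Q \<Lambda> rm \<eta> cp cm a lo hi \<sigma> s m l R R' S S' lo' hi' h
    by unfold_locales (use lo * K hs in auto)
  show "hatP M Q \<Lambda> rm \<eta> cp cm a \<sigma> s m (distr_of lo hi sep) (test_density h) = 0"
    by (rule hatP_sep[OF sum_zero])
  show "D_phi (distr_of lo hi sep) (test_density h) = 0"
    by (rule D_phi_sep)
qed

section \<open>Gauge transformation and extension across the ends\<close>

text \<open>\<open>g\<close> is smooth beyond the ends and so has bounded derivatives on the closed
  interval; those of \<open>f\<close> differ from them by bounded amounts.\<close>

lemma extend_perturbed: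
  fixes f g :: "real \<Rightarrow> real"
  assumes "x1 < x2" "\<And>j. C_k_on j {x1<..<x2} f" "open S" "{x1..x2} \<subseteq> S" "\<And>j. C_k_on j S g"
    and "\<And>k. \<exists>C. \<forall>x\<in>{x1<..<x2}. \<bar>(deriv ^^ k) f x - (deriv ^^ k) g x\<bar> \<le> C"
  shows "\<exists>F. C_k_on N UNIV F \<and> (\<forall>x\<in>{x1<..<x2}. F x = f x)"
proof (rule extend_C_k[OF assms(1,2)])
  fix k
  obtain C where C: "\<And>x. x \<in> {x1<..<x2} \<Longrightarrow> \<bar>(deriv ^^ k) f x - (deriv ^^ k) g x\<bar> \<le> C" using assms(6) by blast
  obtain D where D: "\<And>x. x \<in> {x1..x2} \<Longrightarrow> \<bar>(deriv ^^ k) g x\<bar> \<le> D"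
    using deriv_funpow_bounded_compact[OF assms(3,5) compact_Icc assms(4)] by blast
  have "\<bar>(deriv ^^ k) f x\<bar> \<le> C + D" if "x \<in> {x1<..<x2}" for x
    using C[OF that] D[of x] that by auto
  then show "\<exists>C. \<forall>x\<in>{x1<..<x2}. \<bar>(deriv ^^ k) f x\<bar> \<le> C" by blast
qed

lemma C_k_on_glue:
  fixes f g :: "real \<Rightarrow> 'b::real_normed_vector"
  assumes "C_k_on k {\<alpha><..<\<beta>} f" "C_k_on k {t<..<\<beta>'} g" "t < \<beta>"
    and "\<And>x. x \<in> {\<alpha><..<\<beta>} \<Longrightarrow> F x = f x" "\<And>x. x \<in> {t<..<\<beta>'} \<Longrightarrow> F x = g x"
  shows "C_k_on k {\<alpha><..<\<beta>'} F"
proof -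
  have F: "C_k_on k {\<alpha><..<\<beta>} F" "C_k_on k {t<..<\<beta>'} F"
    using C_k_on_cong[OF open_greaterThanLessThan assms(4)[symmetric] assms(1)] C_k_on_cong[OF open_greaterThanLessThan assms(5)[symmetric] assms(2)]
    by blast+
  show ?thesis
  proof (rule C_k_on_open_cover)
    fix x assume x: "x \<in> {\<alpha><..<\<beta>'}"
    show "\<exists>T. open T \<and> x \<in> T \<and> C_k_on k T F"
    proof (cases "x < \<beta>")
      case True
      then show ?thesis using F(1) x by (intro exI[of _ "{\<alpha><..<\<beta>}"]) simp
    next
      case False
      then show ?thesis using F(2) x assms(3) by (intro exI[of _ "{t<..<\<beta>'}"]) simp
    qed
  qed simp
qed

lemma mu_neg:
  assumes "\<Lambda> > 0" "standing_assumption M Q \<Lambda> rn rc rm rp" "(rc < r \<and> r < rm) \<or> rp < r"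
  shows "mu M Q \<Lambda> r < 0"
proof -
  have o: "rn < 0" "0 < rc" "rc < rm" "rm < rp" using assms(2) unfolding standing_assumption_def by auto
  have r: "r > 0" using assms(3) o by auto
  have "(r - rn) * (r - rc) * ((r - rm) * (r - rp)) > 0"
  proof (cases "rp < r")
    case True then show ?thesis using o by (intro mult_pos_pos) auto
  next
    case False
    then have "rc < r" "r < rm" using assms(3) by auto
    then show ?thesis using o by (intro mult_pos_pos mult_neg_neg) auto
  qed
  then have "- (\<Lambda> / 3) * ((r - rn) * (r - rc) * (r - rm) * (r - rp)) < 0" using assms(1) by (simp add: mult_ac)
  then have "r\<^sup>2 * mu M Q \<Lambda> r < 0" using mu_a_quartic[OF assms(1,2), of r] mu_a_0[of r M Q \<Lambda>] r by simp
  then show ?thesis using r by (simp add: mult_less_0_iff)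
qed

lemma mu_smooth: "open X \<Longrightarrow> 0 \<notin> X \<Longrightarrow> C_k_on k X (mu M Q \<Lambda>)"
  unfolding mu_def
  by (intro C_k_on_add C_k_on_diff C_k_on_divide C_k_on_mult C_k_on_power C_k_on_id C_k_on_const) auto

text \<open>Where \<open>\<mu> < 0\<close> the radicand is at least 1, whatever real number
  \<open>c\<close> is.\<close>

lemma c0_smooth:
  assumes "open X" "\<And>r. r \<in> X \<Longrightarrow> mu M Q \<Lambda> r < 0" "0 \<notin> X"
  shows "C_k_on k X (\<lambda>r. (\<epsilon> * sqrt (1 - mu M Q \<Lambda> r * c\<^sup>2) - 1) / mu M Q \<Lambda> r)"
proof (intro C_k_on_divide C_k_on_diff C_k_on_mult C_k_on_sqrt C_k_on_const mu_smooth assms(1,3))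
  fix r assume "r \<in> X"
  then have "mu M Q \<Lambda> r * c\<^sup>2 \<le> 0" using assms(2) by (simp add: mult_nonpos_nonneg less_imp_le)
  then show "0 < 1 - mu M Q \<Lambda> r * c\<^sup>2" by simp
qed (use assms(2) in fastforce)

text \<open>Near the ends of \<open>Y\<close> the formula for \<open>c\<^sub>\<plusminus>\<close> at \<open>a = 0\<close> continues smoothly across the end, whatever
  the value of \<open>r_max\<close>, since \<open>\<mu> < 0\<close> there. Hence all derivatives of \<open>c\<^sub>\<plusminus>\<close> are bounded.\<close>

lemma coefficients_extend:
  assumes L: "\<Lambda> > 0" and St: "standing_assumption M Q \<Lambda> rn rc rm rp"
    and eta: "eta_admissible M Q \<Lambda> rm rp \<eta>" and fam: "admissible_family M Q \<Lambda> rm rp \<eta> a0 cp cm" and a: "\<bar>a\<bar> < a0"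
  shows "rc < rm - \<eta>"
    and "\<exists>F. C_k_on N UNIV F \<and> (\<forall>x\<in>{(rm + rp) / 2<..<rp + \<eta>}. F x = cp a x)"
    and "\<exists>F. C_k_on N UNIV F \<and> (\<forall>x\<in>{rm - \<eta><..<(rm + rp) / 2}. F x = cm a x)"
proof -
  define mid where mid_def: "mid = (rm + rp) / 2"
  have o: "rn < 0" "0 < rc" "rc < rm" "rm < rp" and zero: "{r. r \<noteq> 0 \<and> mu M Q \<Lambda> r = 0} = {rn, rc, rm, rp}"
    using St unfolding standing_assumption_def by auto
  have e: "0 < \<eta>" "2 * \<eta> < rp - rm" and ne: "\<And>r. rm - \<eta> \<le> r \<Longrightarrow> r < rm \<Longrightarrow> mu M Q \<Lambda> r \<noteq> 0"
    using eta unfolding eta_admissible_def by auto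
  show rc: "rc < rm - \<eta>"
  proof (rule ccontr)
    assume "\<not> rc < rm - \<eta>"
    then have "mu M Q \<Lambda> rc \<noteq> 0" using ne o by simp
    then show False using zero o by blast
  qed
  note fam' = fam[unfolded admissible_family_def Let_def]
  have sm: "C_k_on j {rm + \<eta><..<rp + \<eta>} (cp b)" "C_k_on j {rm - \<eta><..<rp - \<eta>} (cm b)" if "\<bar>b\<bar> < a0" for j b
    using fam' that by (auto simp: smooth_on_def abs_less_iff)
  have cp0: "cp 0 r = (- nu M Q \<Lambda> rm rp r - 1) / mu M Q \<Lambda> r" if "r \<in> {rm + \<eta><..<rp + \<eta>}" "mu M Q \<Lambda> r \<noteq> 0" for r
    using fam' that by blast
  have cm0: "cm 0 r = (nu M Q \<Lambda> rm rp r - 1) / mu M Q \<Lambda> r" if "r \<in> {rm - \<eta><..<rp - \<eta>}" "mu M Q \<Lambda> r \<noteq> 0" for r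
    using fam' that by blast
  have der: "\<exists>C. \<forall>b\<in>{-a0<..<a0}.
         (\<forall>r\<in>{rm + \<eta><..<rp + \<eta>}. \<bar>(deriv ^^ k) (cp b) r - (deriv ^^ k) (cp 0) r\<bar> \<le> C * b\<^sup>2) \<and>
         (\<forall>r\<in>{rm - \<eta><..<rp - \<eta>}. \<bar>(deriv ^^ k) (cm b) r - (deriv ^^ k) (cm 0) r\<bar> \<le> C * b\<^sup>2)" for k
    using fam' by blast
  have mid: "rm + \<eta> < mid" "mid < rp - \<eta>" using e by (simp_all add: mid_def field_simps)
  have a': "a \<in> {-a0<..<a0}" "\<bar>0\<bar> < a0" using a by auto
  let ?r0 = "r_max M Q \<Lambda> rm rp"
  define c where "c = 1 / sqrt (mu M Q \<Lambda> ?r0)"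
  define f where "f \<epsilon> r = (\<epsilon> * sqrt (1 - mu M Q \<Lambda> r * c\<^sup>2) - 1) / mu M Q \<Lambda> r" for \<epsilon> r
  have nu: "nu M Q \<Lambda> rm rp r = (if r \<ge> ?r0 then - sqrt (1 - mu M Q \<Lambda> r * c\<^sup>2) else sqrt (1 - mu M Q \<Lambda> r * c\<^sup>2))" for r
    by (simp add: nu_def Let_def c_def)
  show "\<exists>F. C_k_on N UNIV F \<and> (\<forall>x\<in>{(rm + rp) / 2<..<rp + \<eta>}. F x = cp a x)"
  proof -
    \<comment> \<open>\<open>nu\<close> switches its sign at \<open>r_max\<close>; between
      \<open>t\<close> and the end of the interval one sign \<open>\<epsilon>\<close> holds.\<close>
    obtain t \<epsilon> where t: "rp \<le> t" "t < rp + \<eta>" "\<And>r. t < r \<Longrightarrow> r < rp + \<eta> \<Longrightarrow> cp 0 r = f \<epsilon> r"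
    proof (cases "?r0 < rp + \<eta>")
      case True
      show ?thesis
      proof (rule that[of "max rp ?r0" 1])
        show "cp 0 r = f 1 r" if "max rp ?r0 < r" "r < rp + \<eta>" for r
          using that cp0[of r] mu_neg[OF L St, of r] e by (simp add: nu f_def)
      qed (use True e in auto)
    next
      case False
      show ?thesis
      proof (rule that[of rp "-1"])
        show "cp 0 r = f (- 1) r" if "rp < r" "r < rp + \<eta>" for r
          using that cp0[of r] mu_neg[OF L St, of r] e False by (simp add: nu f_def)
      qed (use e in auto)
    qed
    \<comment> \<open>Beyond the end \<open>cp 0\<close> is continued by the formula that already
      holds to the right of \<open>t\<close>.\<close>
    define g where "g r = (if r < rp + \<eta> then cp 0 r else f \<epsilon> r)" for r
    have g: "C_k_on j {rm + \<eta><..<rp + \<eta> + 1} g" for j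
    proof (rule C_k_on_glue[OF sm(1)[OF a'(2)], of _ t _ "f \<epsilon>"])
      show "C_k_on j {t<..<rp + \<eta> + 1} (f \<epsilon>)"
        unfolding f_def by (rule c0_smooth) (use t o mu_neg[OF L St] in auto)
    qed (use t in \<open>auto simp: g_def\<close>)
    show ?thesis
      unfolding mid_def[symmetric]
    proof (rule extend_perturbed[where g=g and S="{rm + \<eta><..<rp + \<eta> + 1}"])
      fix k
      obtain C where C: "\<And>r. r \<in> {rm + \<eta><..<rp + \<eta>} \<Longrightarrow> \<bar>(deriv ^^ k) (cp a) r - (deriv ^^ k) (cp 0) r\<bar> \<le> C * a\<^sup>2"
        using der[of k] a' by blast
      have eq: "(deriv ^^ k) (cp 0) r = (deriv ^^ k) g r" if "r \<in> {mid<..<rp + \<eta>}" for r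
        by (rule deriv_funpow_cong[OF open_greaterThanLessThan _ that]) (simp add: g_def)
      have "\<forall>x\<in>{mid<..<rp + \<eta>}. \<bar>(deriv ^^ k) (cp a) x - (deriv ^^ k) g x\<bar> \<le> C * a\<^sup>2"
      proof
        fix x assume x: "x \<in> {mid<..<rp + \<eta>}"
        show "\<bar>(deriv ^^ k) (cp a) x - (deriv ^^ k) g x\<bar> \<le> C * a\<^sup>2"
          unfolding eq[OF x, symmetric] by (rule C) (use x mid in auto)
      qed
      then show "\<exists>C. \<forall>x\<in>{mid<..<rp + \<eta>}. \<bar>(deriv ^^ k) (cp a) x - (deriv ^^ k) g x\<bar> \<le> C" by blast
      show "C_k_on j {mid<..<rp + \<eta>} (cp a)" for j
        by (rule C_k_on_subset[OF sm(1)[OF a]]) (use mid in auto)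
      show "{mid..rp + \<eta>} \<subseteq> {rm + \<eta><..<rp + \<eta> + 1}" using mid by auto
    qed (use mid e g in simp_all)
  qed
  show "\<exists>F. C_k_on N UNIV F \<and> (\<forall>x\<in>{rm - \<eta><..<(rm + rp) / 2}. F x = cm a x)"
  proof -
    obtain t \<epsilon> where t: "t \<le> rm" "rm - \<eta> < t" "\<And>r. rm - \<eta> < r \<Longrightarrow> r < t \<Longrightarrow> cm 0 r = f \<epsilon> r"
    proof (cases "rm - \<eta> < ?r0")
      case True
      show ?thesis
      proof (rule that[of "min rm ?r0" 1])
        show "cm 0 r = f 1 r" if "rm - \<eta> < r" "r < min rm ?r0" for r
          using that cm0[of r] mu_neg[OF L St, of r] e rc by (simp add: nu f_def)
      qed (use True e in auto)
    next
      case False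
      show ?thesis
      proof (rule that[of rm "-1"])
        show "cm 0 r = f (- 1) r" if "rm - \<eta> < r" "r < rm" for r
          using that cm0[of r] mu_neg[OF L St, of r] e rc False by (simp add: nu f_def)
      qed (use e in auto)
    qed
    define g where "g r = (if rm - \<eta> < r then cm 0 r else f \<epsilon> r)" for r
    have g: "C_k_on j {rc<..<rp - \<eta>} g" for j
    proof (rule C_k_on_glue[of _ rc t "f \<epsilon>" "rm - \<eta>" _ "cm 0"])
      show "C_k_on j {rc<..<t} (f \<epsilon>)"
        unfolding f_def by (rule c0_smooth) (use t o mu_neg[OF L St] in auto)
    qed (use t sm(2)[OF a'(2)] in \<open>auto simp: g_def\<close>)
    show ?thesis
      unfolding mid_def[symmetric]
    proof (rule extend_perturbed[where g=g and S="{rc<..<rp - \<eta>}"])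
      fix k
      obtain C where C: "\<And>r. r \<in> {rm - \<eta><..<rp - \<eta>} \<Longrightarrow> \<bar>(deriv ^^ k) (cm a) r - (deriv ^^ k) (cm 0) r\<bar> \<le> C * a\<^sup>2"
        using der[of k] a' by blast
      have eq: "(deriv ^^ k) (cm 0) r = (deriv ^^ k) g r" if "r \<in> {rm - \<eta><..<mid}" for r
        by (rule deriv_funpow_cong[OF open_greaterThanLessThan _ that]) (simp add: g_def)
      have "\<forall>x\<in>{rm - \<eta><..<mid}. \<bar>(deriv ^^ k) (cm a) x - (deriv ^^ k) g x\<bar> \<le> C * a\<^sup>2"
      proof
        fix x assume x: "x \<in> {rm - \<eta><..<mid}"
        show "\<bar>(deriv ^^ k) (cm a) x - (deriv ^^ k) g x\<bar> \<le> C * a\<^sup>2"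
          unfolding eq[OF x, symmetric] by (rule C) (use x mid in auto)
      qed
      then show "\<exists>C. \<forall>x\<in>{rm - \<eta><..<mid}. \<bar>(deriv ^^ k) (cm a) x - (deriv ^^ k) g x\<bar> \<le> C" by blast
      show "C_k_on j {rm - \<eta><..<mid} (cm a)" for j
        by (rule C_k_on_subset[OF sm(2)[OF a]]) (use mid in auto)
      show "{rm - \<eta>..mid} \<subseteq> {rc<..<rp - \<eta>}" using mid rc by auto
    qed (use mid e rc g in simp_all)
  qed
qed

section \<open>The gauge function that brings \<open>cp\<close> and \<open>cm\<close> back\<close>

locale gauge_mode = sep_mode M Q \<Lambda> lo' hi' \<sigma> s m a \<beta> l e1 e2 R S
  for M Q \<Lambda> lo' hi' :: real and \<sigma> :: complex and s m a :: real and \<beta> l :: complex and e1 e2 :: real and R S :: "complex \<Rightarrow> complex" +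
  fixes rn rc rm rp \<eta> a0 :: real and cp cm :: "real \<Rightarrow> real \<Rightarrow> real"
  assumes St: "standing_assumption M Q \<Lambda> rn rc rm rp" and eta: "eta_admissible M Q \<Lambda> rm rp \<eta>"
    and fam: "admissible_family M Q \<Lambda> rm rp \<eta> a0 cp cm" and a_small: "\<bar>a\<bar> < a0"
    and near: "\<bar>e1 - rm\<bar> < \<eta>" "\<bar>e2 - rp\<bar> < \<eta>" and dom: "rc < lo'" "lo' < rm - \<eta>" "rp + \<eta> < hi'"
begin

abbreviation "lo \<equiv> rm - \<eta>"
abbreviation "hi \<equiv> rp + \<eta>"
abbreviation "Rg \<equiv> Rg_tr M Q \<Lambda> rm \<eta> cp cm a"
abbreviation "qs \<equiv> q_sel M Q \<Lambda> rm \<eta> cp cm a"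
abbreviation "mua \<equiv> mu_a M Q \<Lambda> a"
abbreviation "lm \<equiv> lam \<Lambda> a"
abbreviation "Y r \<equiv> \<sigma> + complex_of_real (s * r / (r\<^sup>2 + a\<^sup>2))"
abbreviation "N r \<equiv> N_fun lm \<sigma> s a \<beta> e2 (complex_of_real r)"
abbreviation "W r \<equiv> W_fun \<Lambda> lm \<sigma> s a \<beta> e1 e2 (complex_of_real r)"

definition "kf r = - (\<Lambda> / 3) * (r\<^sup>2 + (e1 + e2) * r + ((e1 + e2)\<^sup>2 - e1 * e2 - 3 / \<Lambda> + a\<^sup>2))"
text \<open>Cofactors at the horizons: \<open>N - (1 + lm) K = (r - e2) * n1 r\<close> and, with the
  next definition, \<open>N + (1 + lm) K = (r - e1) * n2 r\<close>.\<close>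

definition "n1 r = of_real (1 + lm) * (\<beta> - \<sigma> * (of_real r + of_real e2) - of_real s)"
definition "n2 r = of_real (1 + lm) * (\<beta> + \<sigma> * (of_real r + of_real e1) + of_real s)"
text \<open>The gauge function shall have the derivative \<open>(N - Rg * Y) / \<mu>\<close>. Its
  singularities at the horizons are only apparent: \<open>gp\<close> is the quotient with the zero
  at \<open>e2\<close> cancelled, \<open>gm\<close> the one with the zero at \<open>e1\<close>
  cancelled.\<close>

definition "gp c r = n1 r / of_real ((r - e1) * kf r) - of_real (c r) * Y r"
definition "gm c r = n2 r / of_real ((r - e2) * kf r) + of_real (c r) * Y r"
definition "g r = (if rm + \<eta> < r then gp (cp a) r else gm (cm a) r)"

lemma order: "0 < rc" "rc < rm" "rm < rp" "0 < \<eta>" "2 * \<eta> < rp - rm"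
  using St eta unfolding standing_assumption_def eta_admissible_def by auto

lemma pos: "lo' < r \<Longrightarrow> 0 < r" using order dom by simp

lemma d_nz: "lo' < r \<Longrightarrow> r\<^sup>2 + a\<^sup>2 \<noteq> 0"
  using pos[of r] by (simp add: add_nonneg_eq_0_iff)

lemma kf_complex: "k_fac \<Lambda> a e1 e2 (of_real r) = of_real (kf r)"
  by (simp add: k_fac_def kf_def power2_eq_square)

lemma in_strip: "lo' < r \<Longrightarrow> r < hi' \<Longrightarrow> of_real r \<in> strip lo' hi'"
  by (simp add: strip_def)

lemma kf_nz: "lo' < r \<Longrightarrow> r < hi' \<Longrightarrow> kf r \<noteq> 0"
  using k_nz[OF in_strip, of r] unfolding kf_complex by simp

lemma mua_factor: "mua r = (r - e1) * (r - e2) * kf r"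
  unfolding kf_def by (rule mu_a_factor) (use L e roots in auto)

lemma K_Y: "lo' < r \<Longrightarrow> complex_of_real (r\<^sup>2 + a\<^sup>2) * Y r = \<sigma> * ((of_real r)\<^sup>2 + of_real (a\<^sup>2)) + of_real s * of_real r"
proof -
  assume r: "lo' < r"
  let ?d = "r\<^sup>2 + a\<^sup>2"
  have "complex_of_real ?d * of_real (s * r / ?d) = of_real (s * r)"
    unfolding of_real_mult[symmetric, of ?d] using d_nz[OF r] by simp
  then have "complex_of_real ?d * Y r = complex_of_real ?d * \<sigma> + of_real (s * r)" by (simp only: distrib_left)
  then show ?thesis by (simp only:) (simp add: mult.commute)
qed

lemma N_e2: "lo' < r \<Longrightarrow> N r = of_real ((1 + lm) * (r\<^sup>2 + a\<^sup>2)) * Y r + of_real (r - e2) * n1 r"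
  unfolding of_real_mult mult.assoc K_Y N_fun_def n1_def by (simp add: algebra_simps)

text \<open>Here \<open>slope\<close> enters: it says that the linear function, fixed by its value
  at \<open>e2\<close>, also has the value \<open>- (1 + lm) K\<close> at \<open>e1\<close>.\<close>

lemma N_e1: "lo' < r \<Longrightarrow> N r = - of_real ((1 + lm) * (r\<^sup>2 + a\<^sup>2)) * Y r + of_real (r - e1) * n2 r"
proof -
  assume r: "lo' < r"
  have "\<sigma> * (z\<^sup>2 + A) + t * z + (z - y) * (b - \<sigma> * (z + y) - t) = - (\<sigma> * (z\<^sup>2 + A) + t * z) + (z - x) * (b + \<sigma> * (z + x) + t)"
    if "b * (y - x) = \<sigma> * (x\<^sup>2 + y\<^sup>2 + 2 * A) + t * (x + y)" for z A t y x b :: complex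
    using that by algebra
  from this[of \<beta> "of_real e2" "of_real e1" "of_real (a\<^sup>2)" "of_real s" "of_real r"]
  have E: "\<sigma> * ((of_real r)\<^sup>2 + of_real (a\<^sup>2)) + of_real s * of_real r + (of_real r - of_real e2) * (\<beta> - \<sigma> * (of_real r + of_real e2) - of_real s)
    = - (\<sigma> * ((of_real r)\<^sup>2 + of_real (a\<^sup>2)) + of_real s * of_real r) + (of_real r - of_real e1) * (\<beta> + \<sigma> * (of_real r + of_real e1) + of_real s)"
    using slope by simp
  show ?thesis
    unfolding of_real_mult mult_minus_left mult.assoc K_Y[OF r] N_fun_def n2_def E
    by (simp only: distrib_left mult_minus_right of_real_diff mult.left_commute)
qed

lemma W_eq: "W r = n1 r * n2 r / of_real (kf r)"
  by (simp add: W_fun_def n1_def n2_def kf_complex power2_eq_square)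

text \<open>Write \<open>D = (1 + lm) (r\<^sup>2 + a\<^sup>2)\<close>,
  \<open>Rg = \<mu> c + D\<close> and \<open>q = \<mu> c\<^sup>2 + 2 D c\<close>. Then
  \<open>Rg\<^sup>2 - D\<^sup>2 = \<mu> q\<close>, hence \<open>g (N + Rg Y) = (N\<^sup>2 -
  Rg\<^sup>2 Y\<^sup>2) / \<mu> = W - q Y\<^sup>2\<close>. The proof never divides by
  \<open>\<mu>\<close>, since the identities are to hold at \<open>e2\<close> as well.\<close>

lemma gp_identities:
  assumes r: "lo' < r" "r < hi'" "r \<noteq> e1"
  shows "of_real (mua r) * gp c r = N r - of_real (mua r * c r + (1 + lm) * (r\<^sup>2 + a\<^sup>2)) * Y r"
    and "gp c r * (N r + of_real (mua r * c r + (1 + lm) * (r\<^sup>2 + a\<^sup>2)) * Y r)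
      = W r - of_real (mua r * (c r)\<^sup>2 + 2 * (1 + lm) * (r\<^sup>2 + a\<^sup>2) * c r) * (Y r)\<^sup>2"
proof -
  let ?p = "complex_of_real (r - e1)" and ?k = "complex_of_real (kf r)" and ?t = "complex_of_real (r - e2)"
    and ?D = "complex_of_real ((1 + lm) * (r\<^sup>2 + a\<^sup>2))" and ?c = "complex_of_real (c r)"
  have nz: "?p \<noteq> 0" "?k \<noteq> 0" using r kf_nz[OF r(1,2)] by simp_all
  have mu: "complex_of_real (mua r) = ?p * ?t * ?k" unfolding mua_factor by simp
  have N: "N r = ?D * Y r + ?t * n1 r" "N r = - ?D * Y r + ?p * n2 r" using N_e2 N_e1 r by blast+
  define A where "A = n1 r / (?p * ?k)"
  have A: "?p * ?k * A = n1 r" "W r = A * (?p * n2 r)" using nz by (simp_all add: A_def W_eq)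
  have g: "gp c r = A - ?c * Y r" by (simp add: gp_def A_def)
  show "of_real (mua r) * gp c r = N r - of_real (mua r * c r + (1 + lm) * (r\<^sup>2 + a\<^sup>2)) * Y r"
    unfolding g of_real_add[of "mua r * c r"] of_real_mult[of "mua r" "c r"] mu N(1) A(1)[symmetric] by (simp add: algebra_simps)
  have e: "of_real (mua r * (c r)\<^sup>2 + 2 * (1 + lm) * (r\<^sup>2 + a\<^sup>2) * c r) = of_real (mua r) * ?c\<^sup>2 + 2 * ?D * ?c"
    by (simp add: algebra_simps)
  have "(A - ?c * y) * (n + (u * ?c + D) * y) = A * (n + D * y) - (u * ?c\<^sup>2 + 2 * D * ?c) * y\<^sup>2"
    if "n = D * y + u * A" for y n u D
    unfolding that by (simp add: algebra_simps power2_eq_square)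
  from this[of "N r" ?D "Y r" "of_real (mua r)"]
  have "gp c r * (N r + (of_real (mua r) * ?c + ?D) * Y r) = A * (N r + ?D * Y r) - (of_real (mua r) * ?c\<^sup>2 + 2 * ?D * ?c) * (Y r)\<^sup>2"
    unfolding g mu N(1) A(1)[symmetric] by (simp add: mult_ac)
  moreover have "A * (N r + ?D * Y r) = W r" unfolding A(2) N(2) by simp
  ultimately show "gp c r * (N r + of_real (mua r * c r + (1 + lm) * (r\<^sup>2 + a\<^sup>2)) * Y r)
      = W r - of_real (mua r * (c r)\<^sup>2 + 2 * (1 + lm) * (r\<^sup>2 + a\<^sup>2) * c r) * (Y r)\<^sup>2"
    unfolding e by (simp only: of_real_add[of "mua r * c r"] of_real_mult[of "mua r" "c r"])
qed

lemma gm_identities: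
  assumes r: "lo' < r" "r < hi'" "r \<noteq> e2"
  shows "of_real (mua r) * gm c r = N r + of_real (mua r * c r + (1 + lm) * (r\<^sup>2 + a\<^sup>2)) * Y r"
    and "gm c r * (N r - of_real (mua r * c r + (1 + lm) * (r\<^sup>2 + a\<^sup>2)) * Y r)
      = W r - of_real (mua r * (c r)\<^sup>2 + 2 * (1 + lm) * (r\<^sup>2 + a\<^sup>2) * c r) * (Y r)\<^sup>2"
proof -
  let ?p = "complex_of_real (r - e1)" and ?k = "complex_of_real (kf r)" and ?t = "complex_of_real (r - e2)"
    and ?D = "complex_of_real ((1 + lm) * (r\<^sup>2 + a\<^sup>2))" and ?c = "complex_of_real (c r)"
  have nz: "?t \<noteq> 0" "?k \<noteq> 0" using r kf_nz[OF r(1,2)] by simp_all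
  have mu: "complex_of_real (mua r) = ?p * ?t * ?k" unfolding mua_factor by simp
  have N: "N r = ?D * Y r + ?t * n1 r" "N r = - ?D * Y r + ?p * n2 r" using N_e2 N_e1 r by blast+
  define A where "A = n2 r / (?t * ?k)"
  have A: "?t * ?k * A = n2 r" "W r = A * (?t * n1 r)" using nz by (simp_all add: A_def W_eq)
  have g: "gm c r = A + ?c * Y r" by (simp add: gm_def A_def)
  show "of_real (mua r) * gm c r = N r + of_real (mua r * c r + (1 + lm) * (r\<^sup>2 + a\<^sup>2)) * Y r"
    unfolding g of_real_add[of "mua r * c r"] of_real_mult[of "mua r" "c r"] mu N(2) A(1)[symmetric] by (simp add: algebra_simps)
  have e: "of_real (mua r * (c r)\<^sup>2 + 2 * (1 + lm) * (r\<^sup>2 + a\<^sup>2) * c r) = of_real (mua r) * ?c\<^sup>2 + 2 * ?D * ?c"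
    by (simp add: algebra_simps)
  have "(A + ?c * y) * (n - (u * ?c + D) * y) = A * (n - D * y) - (u * ?c\<^sup>2 + 2 * D * ?c) * y\<^sup>2"
    if "n = - D * y + u * A" for y n u D
    unfolding that by (simp add: algebra_simps power2_eq_square)
  from this[of "N r" ?D "Y r" "of_real (mua r)"]
  have "gm c r * (N r - (of_real (mua r) * ?c + ?D) * Y r) = A * (N r - ?D * Y r) - (of_real (mua r) * ?c\<^sup>2 + 2 * ?D * ?c) * (Y r)\<^sup>2"
    unfolding g mu N(2) A(1)[symmetric] by (simp add: mult_ac)
  moreover have "A * (N r - ?D * Y r) = W r" unfolding A(2) N(1) by simp
  ultimately show "gm c r * (N r - of_real (mua r * c r + (1 + lm) * (r\<^sup>2 + a\<^sup>2)) * Y r)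
      = W r - of_real (mua r * (c r)\<^sup>2 + 2 * (1 + lm) * (r\<^sup>2 + a\<^sup>2) * c r) * (Y r)\<^sup>2"
    unfolding e by (simp only: of_real_add[of "mua r * c r"] of_real_mult[of "mua r" "c r"])
qed

text \<open>Multiplied by \<open>\<mu>\<close>, the agreement of the two expressions for
  \<open>T'\<close> says that \<open>Rg\<close> is the same in both versions. The other two
  quantities are determined by \<open>Rg\<close> where \<open>\<mu> \<noteq> 0\<close>: one through
  \<open>\<mu> q = Rg\<^sup>2 - D\<^sup>2\<close>, the other through
  \<open>\<mu> g = N - Rg Y\<close>.\<close>

lemma overlap:
  assumes r: "rm + \<eta> < r" "r < rp - \<eta>"
  shows "mua r \<noteq> 0" and "mua r * cp a r + (1 + lm) * (r\<^sup>2 + a\<^sup>2) = - (mua r * cm a r + (1 + lm) * (r\<^sup>2 + a\<^sup>2))"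
    and "mua r * (cp a r)\<^sup>2 + 2 * (1 + lm) * (r\<^sup>2 + a\<^sup>2) * cp a r = mua r * (cm a r)\<^sup>2 + 2 * (1 + lm) * (r\<^sup>2 + a\<^sup>2) * cm a r"
    and "gp (cp a) r = gm (cm a) r"
proof -
  let ?D = "(1 + lm) * (r\<^sup>2 + a\<^sup>2)"
  have rr: "lo' < r" "r < hi'" "r \<noteq> e1" "r \<noteq> e2" using r near dom order by auto
  show mu: "mua r \<noteq> 0" unfolding mua_factor using rr kf_nz by simp
  have "a \<in> {-a0<..<a0}" "r \<in> {rm + \<eta><..<rp + \<eta>} \<inter> {rm - \<eta><..<rp - \<eta>}" using a_small r order by auto
  then have "?D / mua r + cp a r = - (?D / mua r + cm a r)"
    using fam unfolding admissible_family_def Let_def by blast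
  from arg_cong[OF this, of "\<lambda>x. mua r * x"]
  have T: "mua r * (?D / mua r + cp a r) = - (mua r * (?D / mua r + cm a r))" by (simp only: mult_minus_right)
  have E: "u * (D / u + x) = u * x + D" if "u \<noteq> 0" for u D x :: real using that by (simp add: distrib_left)
  show 1: "mua r * cp a r + ?D = - (mua r * cm a r + ?D)" using T unfolding E[OF mu] .
  have "mua r * (mua r * (cp a r)\<^sup>2 + 2 * ?D * cp a r) = (mua r * cp a r + ?D)\<^sup>2 - ?D\<^sup>2" by (simp add: algebra_simps power2_eq_square)
  also have "\<dots> = mua r * (mua r * (cm a r)\<^sup>2 + 2 * ?D * cm a r)" unfolding 1 by (simp add: algebra_simps power2_eq_square)
  finally show "mua r * (cp a r)\<^sup>2 + 2 * (1 + lm) * (r\<^sup>2 + a\<^sup>2) * cp a r = mua r * (cm a r)\<^sup>2 + 2 * (1 + lm) * (r\<^sup>2 + a\<^sup>2) * cm a r"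
    unfolding mult_left_cancel[OF mu] by (simp only: mult.assoc)
  have "of_real (mua r) * gp (cp a) r = of_real (mua r) * gm (cm a) r"
    unfolding gp_identities(1)[OF rr(1,2,3)] gm_identities(1)[OF rr(1,2,4)] 1 by (simp only: of_real_minus mult_minus_left diff_minus_eq_add)
  then show "gp (cp a) r = gm (cm a) r" using mu by simp
qed

lemma minus_version:
  assumes "lo < r" "r < rp - \<eta>"
  shows "Rg r = - (mua r * cm a r + (1 + lm) * (r\<^sup>2 + a\<^sup>2))" "qs r = mua r * (cm a r)\<^sup>2 + 2 * (1 + lm) * (r\<^sup>2 + a\<^sup>2) * cm a r"
    "g r = gm (cm a) r"
  using overlap[of r] assms by (auto simp: Rg_tr_def q_sel_def c_sel_def sgn_sel_def g_def)

lemma plus_version: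
  assumes "rm + \<eta> < r"
  shows "Rg r = mua r * cp a r + (1 + lm) * (r\<^sup>2 + a\<^sup>2)" "qs r = mua r * (cp a r)\<^sup>2 + 2 * (1 + lm) * (r\<^sup>2 + a\<^sup>2) * cp a r"
    "g r = gp (cp a) r"
  using assms by (auto simp: Rg_tr_def q_sel_def c_sel_def sgn_sel_def g_def)

lemma g_identities:
  assumes r: "lo < r" "r < hi"
  shows "of_real (mua r) * g r = N r - of_real (Rg r) * Y r"
    and "g r * (N r + of_real (Rg r) * Y r) = W r - of_real (qs r) * (Y r)\<^sup>2"
proof -
  have "of_real (mua r) * g r = N r - of_real (Rg r) * Y r \<and> g r * (N r + of_real (Rg r) * Y r) = W r - of_real (qs r) * (Y r)\<^sup>2"
  proof (cases "rm + \<eta> < r")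
    case True
    have rr: "lo' < r" "r < hi'" "r \<noteq> e1" using r True near dom by auto
    show ?thesis unfolding plus_version[OF True] using gp_identities[OF rr, of "cp a"] by blast
  next
    case False
    have rr: "lo' < r" "r < hi'" "r \<noteq> e2" "r < rp - \<eta>" using r False near dom order by auto
    show ?thesis unfolding minus_version[OF r(1) rr(4)] using gm_identities[OF rr(1-3), of "cm a"] by (simp only: of_real_minus mult_minus_left diff_minus_eq_add simp_thms add_uminus_conv_diff)
  qed
  then show "of_real (mua r) * g r = N r - of_real (Rg r) * Y r" "g r * (N r + of_real (Rg r) * Y r) = W r - of_real (qs r) * (Y r)\<^sup>2" by auto
qed

end

section \<open>The gauged mode and its regularity up to the boundary of \<open>Y\<close>\<close>

context gauge_mode
begin

lemma Y_smooth: "open X \<Longrightarrow> X \<subseteq> {lo'<..} \<Longrightarrow> C_k_on k X Y"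
  by (intro C_k_on_add C_k_on_const C_k_on_of_real C_k_on_mult C_k_on_divide C_k_on_id C_k_on_power) (use d_nz in auto)

lemma kf_smooth: "open X \<Longrightarrow> C_k_on k X kf"
  unfolding kf_def by (intro C_k_on_add C_k_on_const C_k_on_mult C_k_on_id C_k_on_power)

lemma n_smooth: "open X \<Longrightarrow> C_k_on k X n1" "open X \<Longrightarrow> C_k_on k X n2"
  unfolding n1_def n2_def
  by (intro C_k_on_add C_k_on_diff C_k_on_const C_k_on_mult C_k_on_of_real C_k_on_id; assumption)+

lemma gp_smooth: "open X \<Longrightarrow> X \<subseteq> {rm + \<eta><..<hi'} \<Longrightarrow> C_k_on k X c \<Longrightarrow> C_k_on k X (gp c)"
  unfolding gp_def
  by (intro C_k_on_diff C_k_on_divide C_k_on_mult C_k_on_of_real C_k_on_id C_k_on_const n_smooth kf_smooth Y_smooth)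
     (use kf_nz dom near order in force)+

lemma gm_smooth: "open X \<Longrightarrow> X \<subseteq> {lo'<..<rp - \<eta>} \<Longrightarrow> C_k_on k X c \<Longrightarrow> C_k_on k X (gm c)"
  unfolding gm_def
  by (intro C_k_on_add C_k_on_diff C_k_on_divide C_k_on_mult C_k_on_of_real C_k_on_id C_k_on_const n_smooth kf_smooth Y_smooth)
     (use kf_nz dom near order in force)+

lemma c_smooth: "C_k_on k {rm + \<eta><..<rp + \<eta>} (cp a)" "C_k_on k {rm - \<eta><..<rp - \<eta>} (cm a)"
  using fam a_small unfolding admissible_family_def Let_def smooth_on_def by (auto simp: abs_less_iff)

lemma mua_smooth: "open X \<Longrightarrow> C_k_on k X mua"
  unfolding mu_a_def
  by (intro C_k_on_add C_k_on_diff C_k_on_divide C_k_on_mult C_k_on_power C_k_on_id C_k_on_const) auto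

lemma glued_smooth:
  fixes f :: "real \<Rightarrow> 'b::real_normed_vector"
  assumes "C_k_on k {rm - \<eta><..<rp - \<eta>} fm" "C_k_on k {rm + \<eta><..<rp + \<eta>} fp"
    "\<And>r. lo < r \<Longrightarrow> r < rp - \<eta> \<Longrightarrow> f r = fm r" "\<And>r. rm + \<eta> < r \<Longrightarrow> f r = fp r"
  shows "C_k_on k {lo<..<hi} f"
  by (rule C_k_on_glue[OF assms(1,2)]) (use order assms(3,4) in auto)

lemma Rg_smooth: "C_k_on k {lo<..<hi} Rg"
  by (rule glued_smooth[OF _ _ minus_version(1) plus_version(1)])
     (intro C_k_on_minus C_k_on_add C_k_on_mult C_k_on_power C_k_on_id C_k_on_const mua_smooth c_smooth open_greaterThanLessThan)+

lemma qs_smooth: "C_k_on k {lo<..<hi} qs"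
  by (rule glued_smooth[OF _ _ minus_version(2) plus_version(2)])
     (intro C_k_on_minus C_k_on_add C_k_on_mult C_k_on_power C_k_on_id C_k_on_const mua_smooth c_smooth open_greaterThanLessThan)+

lemma g_smooth: "C_k_on k {lo<..<hi} g"
  by (rule glued_smooth[OF gm_smooth[OF _ _ c_smooth(2)] gp_smooth[OF _ _ c_smooth(1)] minus_version(3) plus_version(3)])
     (use dom in auto)

text \<open>\<open>gp c\<close> and \<open>gm c\<close> inherit the regularity of \<open>c\<close>
  away from the opposite horizon, so the extensions of \<open>cp a\<close> and \<open>cm a\<close>
  continue \<open>g\<close> on both sides.\<close>

lemma g_extends: "\<exists>gE. C_k_on n {lo'<..<hi'} gE \<and> (\<forall>r\<in>{lo<..<hi}. gE r = g r)"
proof -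
  define mid where mid: "mid = (rm + rp) / 2"
  note ext = coefficients_extend(2,3)[OF L St eta fam a_small, where N=n, folded mid]
  obtain P where P: "C_k_on n UNIV P" "\<And>x. x \<in> {mid<..<rp + \<eta>} \<Longrightarrow> P x = cp a x" using ext(1) by blast
  obtain Mn where Mn: "C_k_on n UNIV Mn" "\<And>x. x \<in> {rm - \<eta><..<mid} \<Longrightarrow> Mn x = cm a x" using ext(2) by blast
  have m: "rm + \<eta> < mid" "mid < rp - \<eta>" using order unfolding mid by (simp_all add: field_simps)
  define gE where "gE r = (if r \<le> lo then gm Mn r else if r < hi then g r else gp P r)" for r
  have 1: "C_k_on n {lo'<..<mid} (gm Mn)" by (rule gm_smooth) (use m P Mn C_k_on_subset[OF Mn(1)] in auto)
  have 2: "C_k_on n {mid<..<hi'} (gp P)" by (rule gp_smooth) (use m C_k_on_subset[OF P(1)] in auto)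
  have 3: "C_k_on n {lo<..<hi'} gE"
  proof (rule C_k_on_glue[OF g_smooth 2])
    show "gE x = gp P x" if "x \<in> {mid<..<hi'}" for x
    proof (cases "x < hi")
      case True
      then have "P x = cp a x" using P(2) that by simp
      then show ?thesis using that m True order by (simp add: gE_def plus_version(3) gp_def)
    qed (use that m order in \<open>auto simp: gE_def\<close>)
  qed (use m order in \<open>auto simp: gE_def\<close>)
  have "C_k_on n {lo'<..<hi'} gE"
  proof (rule C_k_on_glue[OF 1 3])
    show "gE x = gm Mn x" if "x \<in> {lo'<..<mid}" for x
    proof (cases "lo < x")
      case True
      then have "Mn x = cm a x" using Mn(2) that by simp
      then show ?thesis using that m True order by (simp add: gE_def minus_version(3) gm_def)
    qed (use that m order in \<open>auto simp: gE_def\<close>)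
  qed (use m order in auto)
  then show ?thesis by (intro exI[of _ gE]) (auto simp: gE_def)
qed

text \<open>For each order \<open>n\<close> a different extension of \<open>g\<close> may be used,
  so \<open>G\<close> has only order \<open>n\<close> beyond the ends; inside
  \<open>(lo, hi)\<close> its derivative is the smooth function \<open>g\<close>.\<close>

lemma gauge_exists:
  "\<exists>G::real \<Rightarrow> complex. (\<forall>r. lo < r \<and> r < hi \<longrightarrow> (G has_vector_derivative g r) (at r)) \<and>
     (\<exists>lo2 hi2. lo' < lo2 \<and> lo2 < lo \<and> hi < hi2 \<and> hi2 < hi' \<and> C_k_on n {lo2<..<hi2} G)"
proof -
  obtain gE where gE: "C_k_on n {lo'<..<hi'} gE" "\<And>r. r \<in> {lo<..<hi} \<Longrightarrow> gE r = g r" using g_extends by blast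
  obtain lo2 where lo2: "lo' < lo2" "lo2 < lo" using dense dom by blast
  obtain hi2 where hi2: "hi < hi2" "hi2 < hi'" using dense dom by blast
  have "continuous_on {lo2..hi2} gE"
    by (rule continuous_on_subset[OF C_k_on_continuous_on[OF gE(1)]]) (use lo2 hi2 in auto)
  then obtain G where G: "\<And>x. x \<in> {lo2..hi2} \<Longrightarrow> (G has_vector_derivative gE x) (at x within {lo2..hi2})"
    using antiderivative_continuous by blast
  have G': "(G has_vector_derivative gE x) (at x)" if "x \<in> {lo2<..<hi2}" for x
    using G[of x] that by (simp add: at_within_Icc_at)
  have "C_k_on (Suc n) {lo2<..<hi2} G"
    by (rule C_k_on_real_SucI[OF _ G' C_k_on_subset[OF gE(1)]]) (use lo2 hi2 in auto)
  then have "C_k_on n {lo2<..<hi2} G" by (rule C_k_on_lower)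
  moreover have "(G has_vector_derivative g r) (at r)" if "lo < r \<and> r < hi" for r
    using G'[of r] gE(2)[of r] that lo2 hi2 by auto
  ultimately show ?thesis using lo2 hi2 by blast
qed

lemma R_real:
  assumes "lo' < r" "r < hi'"
  shows "((\<lambda>x. R (of_real x)) has_vector_derivative deriv R (of_real r)) (at r)"
    and "((\<lambda>r. of_real (mua r) * deriv R (of_real r)) has_vector_derivative
        (W r + of_real (m\<^sup>2 * r\<^sup>2) + l) * R (of_real r)
          - 2 * \<i> * N r * deriv R (of_real r) - \<i> * of_real (1 + lm) * \<beta> * R (of_real r)) (at r)"
proof -
  note st = in_strip[OF assms]
  have "(R has_field_derivative deriv R (of_real r)) (at (of_real r))"
    using R_hol strip_props(1) st holomorphic_derivI by blast
  then show "((\<lambda>x. R (of_real x)) has_vector_derivative deriv R (of_real r)) (at r)"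
    by (rule has_vector_derivative_real_field)
  have "complex_of_real (mua x) = (of_real x - of_real e1) * (of_real x - of_real e2) * k_fac \<Lambda> a e1 e2 (of_real x)" for x
    unfolding mua_factor kf_complex by simp
  then show "((\<lambda>r. of_real (mua r) * deriv R (of_real r)) has_vector_derivative
        (W r + of_real (m\<^sup>2 * r\<^sup>2) + l) * R (of_real r)
          - 2 * \<i> * N r * deriv R (of_real r) - \<i> * of_real (1 + lm) * \<beta> * R (of_real r)) (at r)"
    using has_vector_derivative_real_field[OF R_ode[OF st]] by simp
qed

lemma N_deriv: "(N has_vector_derivative of_real (1 + lm) * \<beta>) (at r)"
proof -
  have "(N_fun lm \<sigma> s a \<beta> e2 has_field_derivative of_real (1 + lm) * \<beta>) (at z)" for z
    unfolding N_fun_def by (auto intro!: derivative_eq_intros simp: algebra_simps)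
  then show ?thesis by (rule has_vector_derivative_real_field)
qed

lemma smooth_norm: "open T \<Longrightarrow> 0 \<notin> T \<Longrightarrow> C_k_on k T (norm :: real^3 \<Rightarrow> real)"
proof -
  assume T: "open T" "(0::real^3) \<notin> T"
  have n: "norm x = sqrt ((x $ 1)\<^sup>2 + (x $ 2)\<^sup>2 + (x $ 3)\<^sup>2)" for x :: "real^3"
    by (simp add: norm_vec_def L2_set_def sum_3)
  have "(x $ 1)\<^sup>2 + (x $ 2)\<^sup>2 + (x $ 3)\<^sup>2 > 0" if "x \<in> T" for x :: "real^3"
  proof -
    have "norm x > 0" using that T by auto
    then show ?thesis unfolding n by simp
  qed
  then show ?thesis unfolding n
    by (intro C_k_on_sqrt C_k_on_add C_k_on_power C_k_on_linear bounded_linear_vec_nth T(1)) auto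
qed

lemma smooth_R: "open X \<Longrightarrow> X \<subseteq> {lo'<..<hi'} \<Longrightarrow> C_k_on k X (\<lambda>x. R (of_real x))" "open X \<Longrightarrow> X \<subseteq> {lo'<..<hi'} \<Longrightarrow> C_k_on k X (\<lambda>x. deriv R (of_real x))"
  by (rule C_k_on_of_real_holomorphic[OF strip_props(1)[of lo' hi']]; use R_hol in_strip holomorphic_deriv[OF R_hol strip_props(1)] in force)+

lemma smooth_S: "C_k_on k {-2<..<2} (\<lambda>x. S (of_real x))" "C_k_on k {-2<..<2} (\<lambda>x. deriv S (of_real x))"
proof -
  have "complex_of_real ` {-2<..<2} \<subseteq> ball 0 2" by auto
  then show "C_k_on k {-2<..<2} (\<lambda>x. S (of_real x))" "C_k_on k {-2<..<2} (\<lambda>x. deriv S (of_real x))"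
    using C_k_on_of_real_holomorphic[OF open_ball S_hol open_greaterThanLessThan]
      C_k_on_of_real_holomorphic[OF open_ball holomorphic_deriv[OF S_hol open_ball] open_greaterThanLessThan] by blast+
qed

lemma S_real:
  assumes "-2 < \<xi>" "\<xi> < 2"
  shows "((\<lambda>x. S (of_real x)) has_vector_derivative deriv S (of_real \<xi>)) (at \<xi>)"
    and "((\<lambda>\<xi>. of_real ((1 - \<xi>\<^sup>2) * (1 + lm * \<xi>\<^sup>2)) * deriv S (of_real \<xi>)) has_vector_derivative
        (of_real (a\<^sup>2) * (of_real ((1 + lm)\<^sup>2 * (1 - \<xi>\<^sup>2) / (1 + lm * \<xi>\<^sup>2)) * \<sigma>\<^sup>2 + of_real (m\<^sup>2 * \<xi>\<^sup>2)) - l) * S (of_real \<xi>)) (at \<xi>)"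
proof -
  have b: "complex_of_real \<xi> \<in> ball 0 2" using assms by simp
  have "(S has_field_derivative deriv S (of_real \<xi>)) (at (of_real \<xi>))"
    using S_hol open_ball b holomorphic_derivI by blast
  then show "((\<lambda>x. S (of_real x)) has_vector_derivative deriv S (of_real \<xi>)) (at \<xi>)"
    by (rule has_vector_derivative_real_field)
  have 1: "complex_of_real ((1 - x\<^sup>2) * (1 + lm * x\<^sup>2)) = (of_real x + 1) * (of_real x - 1) * (- (1 + of_real lm * (of_real x)\<^sup>2))" for x
    by (simp add: algebra_simps power2_eq_square)
  have 2: "complex_of_real ((1 + lm)\<^sup>2 * (1 - \<xi>\<^sup>2) / (1 + lm * \<xi>\<^sup>2)) * \<sigma>\<^sup>2
     = of_real ((1 + lm)\<^sup>2) * \<sigma>\<^sup>2 * (1 - (of_real \<xi>)\<^sup>2) / (1 + of_real lm * (of_real \<xi>)\<^sup>2)"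
    by simp
  show "((\<lambda>\<xi>. of_real ((1 - \<xi>\<^sup>2) * (1 + lm * \<xi>\<^sup>2)) * deriv S (of_real \<xi>)) has_vector_derivative
        (of_real (a\<^sup>2) * (of_real ((1 + lm)\<^sup>2 * (1 - \<xi>\<^sup>2) / (1 + lm * \<xi>\<^sup>2)) * \<sigma>\<^sup>2 + of_real (m\<^sup>2 * \<xi>\<^sup>2)) - l) * S (of_real \<xi>)) (at \<xi>)"
    unfolding 1 2 of_real_mult[of "m\<^sup>2"] of_real_power[of \<xi>] by (rule has_vector_derivative_real_field[OF S_ode[OF b]])
qed

text \<open>Multiplication by \<open>exp (\<i> * G r)\<close> with \<open>G' = g\<close> turns the
  coefficient \<open>N\<close> of the radial equation into \<open>Rg * Y\<close> and
  \<open>W\<close> into \<open>qs * Y\<^sup>2\<close>, by \<open>g_identities\<close>; the result is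
  \<open>flux\<close>. Membership in \<open>ext_sobolev\<close> comes from a cutoff outside the
  shell.\<close>

lemma mode_in_kernel:
  obtains u where "u \<in> Ker \<gamma> lo hi (hatP M Q \<Lambda> rm \<eta> cp cm a \<sigma> s m)" "u \<in> Ker \<gamma> lo hi D_phi" "u \<noteq> (\<lambda>x. 0)"
proof -
  obtain k0 :: nat where k0: "\<gamma> + 3 \<le> real k0" using real_arch_simple by blast
  define k where "k = k0 + 3"
  have k: "2 * real k \<ge> \<gamma> + 3" "k \<ge> 3" using k0 by (simp_all add: k_def)
  obtain G :: "real \<Rightarrow> complex" and lo2 hi2 where G: "\<And>r. lo < r \<Longrightarrow> r < hi \<Longrightarrow> (G has_vector_derivative g r) (at r)"
    and ends: "lo' < lo2" "lo2 < lo" "hi < hi2" "hi2 < hi'" and G2: "C_k_on (2 * k) {lo2<..<hi2} G"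
    using gauge_exists[of "2 * k"] by blast
  have Gs: "C_k_on j {lo<..<hi} G" for j
    by (rule C_k_on_lower, rule C_k_on_real_SucI[OF open_greaterThanLessThan G g_smooth]) auto
  define Rt where "Rt r = exp (\<i> * G r) * R (of_real r)" for r
  define Rt' where "Rt' r = exp (\<i> * G r) * (\<i> * g r * R (of_real r) + deriv R (of_real r))" for r
  have Rt_smooth: "C_k_on j X Rt" if "open X" "X \<subseteq> {lo'<..<hi'}" "C_k_on j X G" for j X
    unfolding Rt_def by (intro C_k_on_mult C_k_on_exp C_k_on_const smooth_R that)
  have sub: "{lo<..<hi} \<subseteq> {lo'<..<hi'}" using dom by auto
  have Rt'_smooth: "C_k_on j {lo<..<hi} Rt'" for j
    unfolding Rt'_def by (intro C_k_on_mult C_k_on_add C_k_on_exp C_k_on_const smooth_R Gs g_smooth sub open_greaterThanLessThan)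
  have dE: "((\<lambda>r. exp (\<i> * G r)) has_vector_derivative \<i> * g r * exp (\<i> * G r)) (at r)" if "lo < r" "r < hi" for r
    using field_vector_diff_chain_at[OF has_vector_derivative_mult_right[OF G[OF that], of "\<i>"] DERIV_exp] by (simp add: o_def)
  interpret pde_data M Q \<Lambda> rm \<eta> cp cm a lo hi \<sigma> s m l Rt Rt' "\<lambda>x. S (of_real x)" "\<lambda>x. deriv S (of_real x)"
  proof
    show "0 < lo" using dom order by simp
    show "C_k_on j {lo<..<hi} Rt" for j by (rule Rt_smooth[OF _ sub Gs]) simp
    show "continuous_on {lo<..<hi} qs" using qs_smooth[of 0] by simp
    fix r assume r: "lo < r" "r < hi"
    have r': "lo' < r" "r < hi'" using r dom by auto
    note dR = R_real[OF r']
    show "(Rt has_vector_derivative Rt' r) (at r)"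
      unfolding Rt_def using has_vector_derivative_mult[OF dE[OF r] dR(1)] by (simp add: Rt'_def algebra_simps)
    \<comment> \<open>The derivative of the gauge factor times \<open>\<mu> R' + \<i> N R\<close>.
      In it the slope of \<open>N\<close> cancels the term with \<open>\<beta>\<close> in the radial
      equation.\<close>
    have f1: "((\<lambda>r. exp (\<i> * G r) * (of_real (mua r) * deriv R (of_real r) + \<i> * (N r * R (of_real r)))) has_vector_derivative
      exp (\<i> * G r) * (((W r + of_real (m\<^sup>2 * r\<^sup>2) + l) * R (of_real r)
          - 2 * \<i> * N r * deriv R (of_real r) - \<i> * of_real (1 + lm) * \<beta> * R (of_real r))
          + \<i> * (N r * deriv R (of_real r) + of_real (1 + lm) * \<beta> * R (of_real r)))
      + \<i> * g r * exp (\<i> * G r) * (of_real (mua r) * deriv R (of_real r) + \<i> * (N r * R (of_real r)))) (at r)"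
      by (intro has_vector_derivative_mult has_vector_derivative_add has_vector_derivative_mult_right dE[OF r] dR N_deriv)
    have a1: "E * ((w + p + c) * x - 2 * \<i> * n * y - \<i> * L * b * x + \<i> * (n * y + L * b * x)) + \<i> * g * E * (u * y + \<i> * (n * x))
       = - \<i> * B * (E * (\<i> * g * x + y)) + (q + p + c) * (E * x)" if "u * g = n - B" "g * (n + B) = w - q" for E w p c x n y L b g u B q :: complex
    proof -
      have w: "w = g * (n + B) + q" and n: "n = u * g + B" using that by simp_all
      show ?thesis unfolding w unfolding n by (simp add: algebra_simps)
    qed
    have a2: "u * (E * (\<i> * g * x + y)) + \<i> * B * (E * x) = E * (u * y + \<i> * (n * x))" if "u * g = n - B" for E g x y u n B :: complex
    proof -
      have n: "n = u * g + B" using that by simp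
      show ?thesis unfolding n by (simp add: algebra_simps)
    qed
    show "((\<lambda>r. of_real (mua r) * Rt' r + \<i> * (of_real (Rg r) * Y r) * Rt r) has_vector_derivative
        - \<i> * (of_real (Rg r) * Y r) * Rt' r + (of_real (qs r) * (Y r)\<^sup>2 + of_real (m\<^sup>2 * r\<^sup>2) + l) * Rt r) (at r)"
      unfolding Rt_def Rt'_def a1[where L="of_real (1 + lm)" and b=\<beta>, OF g_identities[OF r], symmetric]
    proof (rule has_vector_derivative_transform_within_open[OF f1 open_greaterThanLessThan[of lo hi]])
      fix x assume x: "x \<in> {lo<..<hi}"
      show "exp (\<i> * G x) * (of_real (mua x) * deriv R (of_real x) + \<i> * (N x * R (of_real x))) =
        of_real (mua x) * (exp (\<i> * G x) * (\<i> * g x * R (of_real x) + deriv R (of_real x))) + \<i> * (of_real (Rg x) * Y x) * (exp (\<i> * G x) * R (of_real x))"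
        by (rule a2[symmetric], rule g_identities) (use x in auto)
    qed (use r in auto)
  qed (use lam_small Rg_smooth Rt'_smooth smooth_S S_real in auto)
  \<comment> \<open>\<open>sep\<close> continued beyond the shell with the extended
    \<open>G\<close>, and cut off.\<close>
  define v where "v \<zeta> x = of_real (\<zeta> (norm x)) * (of_real (sqrt ((norm x)\<^sup>2 + a\<^sup>2 * (x $ 3 / norm x)\<^sup>2)) * (Rt (norm x) * S (of_real (x $ 3 / norm x))))"
    for \<zeta> :: "real \<Rightarrow> real" and x :: "real^3"
  obtain lo3 where lo3: "lo2 < lo3" "lo3 < lo" using dense ends by blast
  obtain hi3 where hi3: "hi < hi3" "hi3 < hi2" using dense ends by blast
  have lh: "lo < hi" using order by simp
  obtain \<zeta> :: "real \<Rightarrow> real" where z: "C_k_on (2 * k) UNIV \<zeta>" "\<And>x. x \<in> {lo..hi} \<Longrightarrow> \<zeta> x = 1" "\<And>x. x \<notin> {lo3..hi3} \<Longrightarrow> \<zeta> x = 0"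
    using cutoff_exists[OF lo3(2) lh hi3(1), of "2 * k"] by blast
  have sep_v: "sep = (\<lambda>x. if x \<in> shell lo hi then v \<zeta> x else 0)"
    using z(2) by (auto simp: sep_def v_def shell_def fun_eq_iff)
  have pos2: "0 < lo2" using ends order dom by simp
  have "C_k_on (2 * k) UNIV (v \<zeta>)"
  proof (rule C_k_on_open_cover)
    fix x :: "real^3"
    show "\<exists>T. open T \<and> x \<in> T \<and> C_k_on (2 * k) T (v \<zeta>)"
    proof (cases "lo2 < norm x \<and> norm x < hi2")
      case True
      \<comment> \<open>The region where the extended \<open>G\<close> is available. It avoids the
        origin, so \<open>norm\<close> is smooth on it.\<close>
      define T where "T = {x::real^3. lo2 < norm x \<and> norm x < hi2}"
      have oT: "open T" unfolding T_def by (intro open_Collect_conj open_Collect_less continuous_intros)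
      have n: "C_k_on j T (norm :: real^3 \<Rightarrow> real)" for j by (rule smooth_norm[OF oT]) (use pos2 in \<open>auto simp: T_def\<close>)
      have nz: "norm y \<noteq> 0" if "y \<in> T" for y :: "real^3" using that pos2 by (auto simp: T_def)
      have xi: "C_k_on j T (\<lambda>x::real^3. x $ 3 / norm x)" for j
        by (intro C_k_on_divide n C_k_on_linear bounded_linear_vec_nth oT nz)
      have xi_range: "(\<lambda>x::real^3. x $ 3 / norm x) ` T \<subseteq> {-2<..<2}"
      proof safe
        fix y :: "real^3" assume y: "y \<in> T"
        have "\<bar>y $ 3 / norm y\<bar> \<le> 1" using component_le_norm_cart[of y 3] nz[OF y] by (simp add: divide_le_eq_1)
        then have "-2 < y $ 3 / norm y \<and> y $ 3 / norm y < 2" unfolding abs_le_iff by linarith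
        then show "y $ 3 / norm y \<in> {-2<..<2}" by simp
      qed
      have "C_k_on (2 * k) T (v \<zeta>)"
        unfolding v_def
      proof (intro C_k_on_mult C_k_on_of_real C_k_on_sqrt C_k_on_add C_k_on_power C_k_on_const n xi oT)
        show "C_k_on (2 * k) T (\<lambda>x. \<zeta> (norm x))" by (rule C_k_on_compose[OF oT open_UNIV n z(1)]) simp
        show "C_k_on (2 * k) T (\<lambda>x. Rt (norm x))"
          by (rule C_k_on_compose[OF oT open_greaterThanLessThan n Rt_smooth[OF _ _ G2]]) (use ends in \<open>auto simp: T_def\<close>)
        show "C_k_on (2 * k) T (\<lambda>x::real^3. S (of_real (x $ 3 / norm x)))"
          by (rule C_k_on_compose[OF oT open_greaterThanLessThan xi smooth_S(1) xi_range])
        show "0 < (norm y)\<^sup>2 + a\<^sup>2 * (y $ 3 / norm y)\<^sup>2" if "y \<in> T" for y :: "real^3"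
          using nz[OF that] by (intro add_pos_nonneg) auto
      qed
      then show ?thesis using oT True by (intro exI[of _ T]) (simp add: T_def)
    next
      case False
      define T where "T = {x::real^3. norm x < lo3 \<or> hi3 < norm x}"
      have oT: "open T" unfolding T_def by (intro open_Collect_disj open_Collect_less continuous_intros)
      have "C_k_on (2 * k) T (v \<zeta>)"
        by (rule C_k_on_cong[OF oT _ C_k_on_const[of _ _ 0]]) (use z(3) in \<open>auto simp: v_def T_def\<close>)
      moreover have "x \<in> T" using False lo3 hi3 by (auto simp: T_def)
      ultimately show ?thesis using oT by blast
    qed
  qed simp
  then have "v \<zeta> \<in> sobolev \<gamma>"
    by (rule compact_support_in_sobolev[OF k _ compact_cball[of 0 hi3]]) (use z(3) in \<open>auto simp: v_def\<close>)
  then have sob: "sep \<in> ext_sobolev \<gamma> lo hi" unfolding ext_sobolev_def sep_v by blast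
  show thesis
  proof (rule that[of sep])
    show "sep \<in> Ker \<gamma> lo hi (hatP M Q \<Lambda> rm \<eta> cp cm a \<sigma> s m)" "sep \<in> Ker \<gamma> lo hi D_phi"
      using sob sep_kernel[OF lh] by (auto simp: Ker_def)
    have e1: "lo < e1" "e1 < hi" using near order by auto
    have e1p: "0 < e1" using e1 dom order by simp
    \<comment> \<open>The point with \<open>r = e1\<close> and \<open>cos \<theta> = - 1\<close>,
      where \<open>R\<close> and \<open>S\<close> are normalised to 1.\<close>
    let ?x = "axis 3 (- e1) :: real^3"
    have nx: "norm ?x = e1" "?x $ 3 = - e1" using e1p by (simp_all add: norm_vec_def L2_set_def sum_3 axis_def)
    then have "sep ?x = of_real (sqrt (e1\<^sup>2 + a\<^sup>2)) * exp (\<i> * G e1)"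
      using e1 e1p R1 S1 by (simp add: sep_def shell_def Rt_def)
    moreover have "e1\<^sup>2 + a\<^sup>2 \<noteq> 0" using e1p by (simp add: add_nonneg_eq_0_iff)
    ultimately have "sep ?x \<noteq> 0" by (simp flip: of_real_power of_real_add)
    then show "sep \<noteq> (\<lambda>x. 0)" by auto
  qed
qed

end

theorem theorem5p1:
  fixes M Q :: real
  assumes "M > 0" and "0 < \<bar>Q\<bar>" and "\<bar>Q\<bar> < 3 * M / (2 * sqrt 2)"
  shows "\<exists>\<Lambda>0>0. \<forall>\<Lambda> rn rc rm rp.
    0 < \<Lambda> \<and> \<Lambda> < \<Lambda>0 \<and> standing_assumption M Q \<Lambda> rn rc rm rp \<longrightarrow>
    (\<exists>c0>0. \<forall>\<gamma> \<eta> a0 cp cm.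
       \<gamma> > 5 / 2 \<and> eta_admissible M Q \<Lambda> rm rp \<eta> \<and>
       admissible_family M Q \<Lambda> rm rp \<eta> a0 cp cm \<longrightarrow>
       (\<exists>q0>0. \<exists>c1>0. \<forall>m q a :: real.
          m > 0 \<and> m\<^sup>2 \<le> c0 * q\<^sup>2 \<and> a\<^sup>2 \<le> c0 * q\<^sup>2 \<and> 0 < \<bar>q\<bar> \<and> \<bar>q\<bar> < q0 \<longrightarrow>
          (\<exists>\<sigma>. Im \<sigma> \<ge> c1 * q\<^sup>2 \<and> c1 * q\<^sup>2 > 0 \<and>
             Ker \<gamma> (rm - \<eta>) (rp + \<eta>) (hatP M Q \<Lambda> rm \<eta> cp cm a \<sigma> (q * Q) m)
               \<inter> Ker \<gamma> (rm - \<eta>) (rp + \<eta>) D_phi \<noteq> {\<lambda>x. 0})))"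
proof -
  \<comment> \<open>The threshold of \<open>horizon_ratio\<close> serves as
    \<open>\<Lambda>0\<close>.\<close>
  have "1 / (1000 * M\<^sup>2) > 0" using assms(1) by simp
  moreover have "\<exists>c0>0. \<forall>\<gamma> \<eta> a0 cp cm.
       \<gamma> > 5 / 2 \<and> eta_admissible M Q \<Lambda> rm rp \<eta> \<and>
       admissible_family M Q \<Lambda> rm rp \<eta> a0 cp cm \<longrightarrow>
       (\<exists>q0>0. \<exists>c1>0. \<forall>m q a :: real.
          m > 0 \<and> m\<^sup>2 \<le> c0 * q\<^sup>2 \<and> a\<^sup>2 \<le> c0 * q\<^sup>2 \<and> 0 < \<bar>q\<bar> \<and> \<bar>q\<bar> < q0 \<longrightarrow>
          (\<exists>\<sigma>. Im \<sigma> \<ge> c1 * q\<^sup>2 \<and> c1 * q\<^sup>2 > 0 \<and>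
             Ker \<gamma> (rm - \<eta>) (rp + \<eta>) (hatP M Q \<Lambda> rm \<eta> cp cm a \<sigma> (q * Q) m)
               \<inter> Ker \<gamma> (rm - \<eta>) (rp + \<eta>) D_phi \<noteq> {\<lambda>x. 0}))"
    if L: "0 < \<Lambda>" "\<Lambda> < 1 / (1000 * M\<^sup>2)" and St: "standing_assumption M Q \<Lambda> rn rc rm rp" for \<Lambda> rn rc rm rp
  proof -
    obtain c0 where c0: "c0 > 0" and modes: "\<forall>lo hi \<epsilon>0. rc < lo \<and> lo < rm \<and> rp < hi \<and> 0 < \<epsilon>0 \<longrightarrow>
      (\<exists>q0>0. \<exists>c1>0. \<forall>m q a :: real. m\<^sup>2 \<le> c0 * q\<^sup>2 \<and> a\<^sup>2 \<le> c0 * q\<^sup>2 \<and> 0 < \<bar>q\<bar> \<and> \<bar>q\<bar> < q0 \<longrightarrow>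
      (\<exists>\<sigma> \<beta> l e1 e2 R S. Im \<sigma> \<ge> c1 * q\<^sup>2 \<and> \<bar>e1 - rm\<bar> < \<epsilon>0 \<and> \<bar>e2 - rp\<bar> < \<epsilon>0 \<and>
        sep_mode M Q \<Lambda> lo hi \<sigma> (q * Q) m a \<beta> l e1 e2 R S))"
      using growing_mode_ode[OF assms L St] by (elim exE conjE)
    show ?thesis
    proof (rule exI[of _ c0], rule conjI[OF c0], intro allI impI)
      fix \<gamma> \<eta> a0 :: real and cp cm :: "real \<Rightarrow> real \<Rightarrow> real"
      assume asm: "\<gamma> > 5 / 2 \<and> eta_admissible M Q \<Lambda> rm rp \<eta> \<and> admissible_family M Q \<Lambda> rm rp \<eta> a0 cp cm"
      then have eta: "eta_admissible M Q \<Lambda> rm rp \<eta>" and fam: "admissible_family M Q \<Lambda> rm rp \<eta> a0 cp cm" by auto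
      have pos: "0 < \<eta>" "0 < a0" using eta fam unfolding eta_admissible_def admissible_family_def Let_def by auto
      have "rc < rm - \<eta>" by (rule coefficients_extend(1)[OF L(1) St eta fam, of 0]) (use pos in simp)
      \<comment> \<open>The holomorphic solution must exist beyond both ends of \<open>Y\<close>
        while its domain stays to the right of \<open>rc\<close>. Below,
        \<open>rp + \<eta> + 1\<close> is taken as right end, and \<open>\<eta>\<close> as
        \<open>\<epsilon>0\<close>, which keeps each horizon out of the interval on which the
        formula of the opposite version is used.\<close>
      then obtain lo where lo: "rc < lo" "lo < rm - \<eta>" using dense by blast
      have "rc < lo \<and> lo < rm \<and> rp < rp + \<eta> + 1 \<and> 0 < \<eta>" using lo pos by simp
      from modes[THEN spec, THEN spec, THEN spec, THEN mp, OF this] obtain q0 c1 where q0: "q0 > 0" and c1: "c1 > 0" and q0_modes: "\<forall>m q a :: real. m\<^sup>2 \<le> c0 * q\<^sup>2 \<and> a\<^sup>2 \<le> c0 * q\<^sup>2 \<and> 0 < \<bar>q\<bar> \<and> \<bar>q\<bar> < q0 \<longrightarrow>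
        (\<exists>\<sigma> \<beta> l e1 e2 R S. Im \<sigma> \<ge> c1 * q\<^sup>2 \<and> \<bar>e1 - rm\<bar> < \<eta> \<and> \<bar>e2 - rp\<bar> < \<eta> \<and>
        sep_mode M Q \<Lambda> lo (rp + \<eta> + 1) \<sigma> (q * Q) m a \<beta> l e1 e2 R S)"
        by (elim exE conjE)
      \<comment> \<open>The second bound yields \<open>\<bar>a\<bar> < a0\<close>.\<close>
      define q1 where "q1 = min q0 (a0 / sqrt c0)"
      have q1: "q1 > 0" using q0 pos c0 by (simp add: q1_def)
      show "\<exists>q0>0. \<exists>c1>0. \<forall>m q a :: real.
          m > 0 \<and> m\<^sup>2 \<le> c0 * q\<^sup>2 \<and> a\<^sup>2 \<le> c0 * q\<^sup>2 \<and> 0 < \<bar>q\<bar> \<and> \<bar>q\<bar> < q0 \<longrightarrow>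
          (\<exists>\<sigma>. Im \<sigma> \<ge> c1 * q\<^sup>2 \<and> c1 * q\<^sup>2 > 0 \<and>
             Ker \<gamma> (rm - \<eta>) (rp + \<eta>) (hatP M Q \<Lambda> rm \<eta> cp cm a \<sigma> (q * Q) m)
               \<inter> Ker \<gamma> (rm - \<eta>) (rp + \<eta>) D_phi \<noteq> {\<lambda>x. 0})"
      proof (rule exI[of _ q1], rule conjI[OF q1], rule exI[of _ c1], rule conjI[OF c1], intro allI impI)
        fix m q a :: real
        assume h: "m > 0 \<and> m\<^sup>2 \<le> c0 * q\<^sup>2 \<and> a\<^sup>2 \<le> c0 * q\<^sup>2 \<and> 0 < \<bar>q\<bar> \<and> \<bar>q\<bar> < q1"
        then have "m\<^sup>2 \<le> c0 * q\<^sup>2 \<and> a\<^sup>2 \<le> c0 * q\<^sup>2 \<and> 0 < \<bar>q\<bar> \<and> \<bar>q\<bar> < q0" by (simp add: q1_def)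
        from q0_modes[THEN spec, THEN spec, THEN spec, THEN mp, OF this] obtain \<sigma> \<beta> l e1 e2 R S where s: "Im \<sigma> \<ge> c1 * q\<^sup>2" "\<bar>e1 - rm\<bar> < \<eta>" "\<bar>e2 - rp\<bar> < \<eta>"
          "sep_mode M Q \<Lambda> lo (rp + \<eta> + 1) \<sigma> (q * Q) m a \<beta> l e1 e2 R S"
          by (elim exE conjE)
        have "\<bar>a\<bar> < a0"
        proof -
          have "\<bar>q\<bar> * sqrt c0 < a0" using h c0 by (simp add: q1_def pos_less_divide_eq)
          moreover have "\<bar>a\<bar> \<le> \<bar>q\<bar> * sqrt c0"
            using real_sqrt_le_mono[of "a\<^sup>2" "c0 * q\<^sup>2"] h by (simp add: real_sqrt_mult mult.commute)
          ultimately show ?thesis by simp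
        qed
        then interpret gauge_mode M Q \<Lambda> lo "rp + \<eta> + 1" \<sigma> "q * Q" m a \<beta> l e1 e2 R S rn rc rm rp \<eta> a0 cp cm
          by (rule gauge_mode.intro[OF s(4) gauge_mode_axioms.intro[OF St eta fam _ s(2,3)]]) (use lo in simp_all)
        obtain u where "u \<in> Ker \<gamma> (rm - \<eta>) (rp + \<eta>) (hatP M Q \<Lambda> rm \<eta> cp cm a \<sigma> (q * Q) m)"
          "u \<in> Ker \<gamma> (rm - \<eta>) (rp + \<eta>) D_phi" "u \<noteq> (\<lambda>x. 0)"
          by (rule mode_in_kernel)
        moreover have "c1 * q\<^sup>2 > 0" using c1 h by simp
        ultimately show "\<exists>\<sigma>. Im \<sigma> \<ge> c1 * q\<^sup>2 \<and> c1 * q\<^sup>2 > 0 \<and>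
             Ker \<gamma> (rm - \<eta>) (rp + \<eta>) (hatP M Q \<Lambda> rm \<eta> cp cm a \<sigma> (q * Q) m)
               \<inter> Ker \<gamma> (rm - \<eta>) (rp + \<eta>) D_phi \<noteq> {\<lambda>x. 0}"
          using s(1) by (intro exI[of _ \<sigma>] conjI) auto
      qed
    qed
  qed
  ultimately show ?thesis
    by (intro exI[of _ "1 / (1000 * M\<^sup>2)"], intro conjI allI impI) (assumption, elim conjE)
qed

end
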